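(* Let $\kappa>0$, $\gamma\in(1/2,1)$, and fix $s>5/2+(1-2\gamma)$. Assume that $\Theta_0\in H^s(\mathbb{T}^3)$ and $S\in L^\infty(0,\infty;H^{s-\gamma}(\mathbb{T}^3))$ have zero mean on $\mathbb{T}^3$. Then there exist a time $T>0$ and a unique solution $$\Theta\in L^\infty(0,T;H^s(\mathbb{T}^3))\cap L^2(0,T;H^{s+\gamma}(\mathbb{T}^3))$$ of the Cauchy problem $$\partial_t\Theta+U\cdot\nabla\Theta=S-\kappa(-\Delta)^\gamma\Theta,\qquad \nabla\cdot U=0,\quad U=M[\Theta],\qquad \Theta(0,\cdot)=\Theta_0 .$$
   Context: Setting (fractionally diffusive magneto-geostrophic equation). $\mathbb{T}^3=(\mathbb{R}/2\pi\mathbb{Z})^3$, and $\hat f(k)$, $k=(k_1,k_2,k_3)\in\mathbb{Z}^3$, denote Fourier coefficients. $\Omega,\beta,\eta,\kappa>0$ are fixed parameters. The velocity $U=M[\Theta]=(M_1\Theta,M_2\Theta,M_3\Theta)$ is given by Fourier multipliers: $\widehat{M_j\Theta}(k)=\hat M_j(k)\hat\Theta(k)$ where, for $k_3\neq0$, $$\hat M_1(k)=\frac{2\Omega k_2k_3|k|^2-(\beta^2/\eta)k_1k_2^2k_3}{4\Omega^2k_3^2|k|^2+(\beta^2/\eta)^2k_2^4},\quad \hat M_2(k)=\frac{-2\Omega k_1k_3|k|^2-(\beta^2/\eta)k_2^3k_3}{4\Omega^2k_3^2|k|^2+(\beta^2/\eta)^2k_2^4},\quad \hat M_3(k)=\frac{(\beta^2/\eta)k_2^2(k_1^2+k_2^2)}{4\Omega^2k_3^2|k|^2+(\beta^2/\eta)^2k_2^4},$$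 and $\hat M_j(k)=0$ when $k_3=0$ (so $U$ has zero vertical mean). Then $\nabla\cdot U=0$ automatically. A solution on $(0,T)$ with initial data $\Theta_0$ is a function $\Theta\in L^\infty(0,T;H^s)\cap L^2(0,T;H^{s+\gamma})$ such that for all smooth $\varphi$ on $\mathbb{T}^3$ and all $t\in(0,T)$, $$\int_{\mathbb{T}^3}(\Theta(t,\cdot)-\Theta_0)\varphi\,dx+\kappa\int_0^t\!\!\int_{\mathbb{T}^3}\Theta(-\Delta)^\gamma\varphi\,dx\,d\tau-\int_0^t\!\!\int_{\mathbb{T}^3}\Theta\,U\cdot\nabla\varphi\,dx\,d\tau=\int_0^t\!\!\int_{\mathbb{T}^3}S\varphi\,dx\,d\tau .$$ *)

theory Defs
  imports "HOL-Analysis.Analysis"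
begin

section \<open>Functions on the torus\<close>

text \<open>A function on \<open>(\<real>/2\<pi>\<int>)\<^sup>3\<close> is a function on \<open>\<real>\<^sup>3\<close> that is \<open>2\<pi>\<close>-periodic in each coordinate.
  Integrals over the torus are Lebesgue integrals over a period cell.\<close>

definition torus_fun :: "(real^3 \<Rightarrow> 'b) \<Rightarrow> bool" where
  "torus_fun f \<longleftrightarrow> (\<forall>x i. f (x + axis i (2 * pi)) = f x)"

definition torus :: "(real^3) measure" where
  "torus = lebesgue_on (cbox 0 (\<chi> i. 2 * pi))"

definition L2_torus :: "(real^3 \<Rightarrow> real) set" where
  "L2_torus = {f. torus_fun f \<and> f \<in> borel_measurable torus \<and> integrable torus (\<lambda>x. (f x)\<^sup>2)}"

definition partial_deriv :: "3 \<Rightarrow> (real^3 \<Rightarrow> real) \<Rightarrow> real^3 \<Rightarrow> real" where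
  "partial_deriv i f x = frechet_derivative f (at x) (axis i 1)"

primrec Ck :: "nat \<Rightarrow> (real^3 \<Rightarrow> real) \<Rightarrow> bool" where
  "Ck 0 f \<longleftrightarrow> continuous_on UNIV f"
| "Ck (Suc n) f \<longleftrightarrow> (\<forall>x. f differentiable (at x)) \<and> (\<forall>i. Ck n (partial_deriv i f))"

definition smooth_torus :: "(real^3 \<Rightarrow> real) set" where
  "smooth_torus = {f. torus_fun f \<and> (\<forall>n. Ck n f)}"

definition gradient :: "(real^3 \<Rightarrow> real) \<Rightarrow> real^3 \<Rightarrow> real^3" where
  "gradient f x = (\<chi> i. partial_deriv i f x)"

section \<open>Fourier coefficients, multipliers and Sobolev spaces\<close>

definition freq :: "int^3 \<Rightarrow> real^3" where
  "freq k = (\<chi> i. real_of_int (k $ i))"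

definition fourier_coeff :: "(real^3 \<Rightarrow> real) \<Rightarrow> int^3 \<Rightarrow> complex" where
  "fourier_coeff f k =
     (1 / (2 * pi) ^ 3) *\<^sub>R (LINT x|torus. complex_of_real (f x) * cis (- (freq k \<bullet> x)))"

text \<open>The operator with real, even symbol \<open>m\<close>. The result is determined up to a null set, and
  exists as soon as the coefficients \<open>m k * fourier_coeff f k\<close> are square summable.\<close>

definition fourier_multiplier :: "(int^3 \<Rightarrow> real) \<Rightarrow> (real^3 \<Rightarrow> real) \<Rightarrow> real^3 \<Rightarrow> real" where
  "fourier_multiplier m f =
     (SOME g. g \<in> L2_torus \<and>
        (\<forall>k. fourier_coeff g k = complex_of_real (m k) * fourier_coeff f k))"

definition frac_laplacian :: "real \<Rightarrow> (real^3 \<Rightarrow> real) \<Rightarrow> real^3 \<Rightarrow> real" where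
  "frac_laplacian \<gamma> = fourier_multiplier (\<lambda>k. norm (freq k) powr (2 * \<gamma>))"

text \<open>The inhomogeneous Sobolev space, for orders \<open>s \<ge> 0\<close> only: its elements are functions in
  \<open>L\<^sup>2\<close>, not general distributions. Outside the space \<open>sobolev_norm\<close> is meaningless, because
  \<open>infsum\<close> of a divergent series is \<open>0\<close>.\<close>

definition sobolev_weighted :: "real \<Rightarrow> (real^3 \<Rightarrow> real) \<Rightarrow> int^3 \<Rightarrow> real" where
  "sobolev_weighted s f k = (1 + (norm (freq k))\<^sup>2) powr s * (cmod (fourier_coeff f k))\<^sup>2"

definition sobolev :: "real \<Rightarrow> (real^3 \<Rightarrow> real) set" where
  "sobolev s = {f \<in> L2_torus. sobolev_weighted s f summable_on UNIV}"

definition sobolev_norm :: "real \<Rightarrow> (real^3 \<Rightarrow> real) \<Rightarrow> real" where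
  "sobolev_norm s f = sqrt (infsum (sobolev_weighted s f) UNIV)"

section \<open>Bochner spaces\<close>

text \<open>Strong measurability of \<open>u : I \<rightarrow> H\<^sup>s\<close>: an a.e. limit, in the norm of \<open>H\<^sup>s\<close>, of simple
  functions with values in \<open>H\<^sup>s\<close>. The value \<open>u t\<close> has to lie in \<open>H\<^sup>s\<close> for almost every \<open>t\<close> only.\<close>

definition strongly_measurable :: "real set \<Rightarrow> real \<Rightarrow> (real \<Rightarrow> real^3 \<Rightarrow> real) \<Rightarrow> bool" where
  "strongly_measurable I s u \<longleftrightarrow>
     (AE t in lebesgue_on I. u t \<in> sobolev s) \<and>
     (\<exists>\<sigma>. (\<forall>n. simple_function (lebesgue_on I) (\<sigma> n) \<and> (\<forall>t\<in>I. \<sigma> n t \<in> sobolev s)) \<and>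
          (AE t in lebesgue_on I. (\<lambda>n. sobolev_norm s (\<lambda>x. \<sigma> n t x - u t x)) \<longlonglongrightarrow> 0))"

definition Linf_sobolev :: "real set \<Rightarrow> real \<Rightarrow> (real \<Rightarrow> real^3 \<Rightarrow> real) set" where
  "Linf_sobolev I s = {u. strongly_measurable I s u \<and>
     (\<exists>C. AE t in lebesgue_on I. sobolev_norm s (u t) \<le> C)}"

definition L2_sobolev :: "real set \<Rightarrow> real \<Rightarrow> (real \<Rightarrow> real^3 \<Rightarrow> real) set" where
  "L2_sobolev I s = {u. strongly_measurable I s u \<and>
     integrable (lebesgue_on I) (\<lambda>t. (sobolev_norm s (u t))\<^sup>2)}"

section \<open>The magneto-geostrophic equation\<close>

definition mg_symbol :: "real \<Rightarrow> real \<Rightarrow> real \<Rightarrow> int^3 \<Rightarrow> real^3" where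
  "mg_symbol \<Omega> \<beta> \<eta> k =
    (if k $ 3 = 0 then 0 else
      let k1 = freq k $ 1; k2 = freq k $ 2; k3 = freq k $ 3;
          q = (norm (freq k))\<^sup>2; b = \<beta>\<^sup>2 / \<eta>;
          D = 4 * \<Omega>\<^sup>2 * k3\<^sup>2 * q + b\<^sup>2 * k2 ^ 4
      in vector [(2 * \<Omega> * k2 * k3 * q - b * k1 * k2\<^sup>2 * k3) / D,
                 (- 2 * \<Omega> * k1 * k3 * q - b * k2 ^ 3 * k3) / D,
                 (b * k2\<^sup>2 * (k1\<^sup>2 + k2\<^sup>2)) / D])"

definition mg_velocity :: "real \<Rightarrow> real \<Rightarrow> real \<Rightarrow> (real^3 \<Rightarrow> real) \<Rightarrow> real^3 \<Rightarrow> real^3" where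
  "mg_velocity \<Omega> \<beta> \<eta> \<theta> x = (\<chi> j. fourier_multiplier (\<lambda>k. mg_symbol \<Omega> \<beta> \<eta> k $ j) \<theta> x)"

text \<open>The constraint \<open>\<nabla> \<cdot> U = 0\<close> is not part of the definition of a solution below, since it holds
  for every \<open>U = M[\<Theta>]\<close>.\<close>

lemma mg_symbol_div_free: "freq k \<bullet> mg_symbol \<Omega> \<beta> \<eta> k = 0"
proof (cases "k $ 3 = 0")
  case False
  have alg: "a * ((2 * \<Omega> * b * c * q - e * a * b\<^sup>2 * c) / D)
      + b * ((- 2 * \<Omega> * a * c * q - e * b ^ 3 * c) / D)
      + c * ((e * b\<^sup>2 * (a\<^sup>2 + b\<^sup>2)) / D) = 0" for a b c q e D :: real
  proof -
    have "a * (2 * \<Omega> * b * c * q - e * a * b\<^sup>2 * c) + b * (- 2 * \<Omega> * a * c * q - e * b ^ 3 * c)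
        + c * (e * b\<^sup>2 * (a\<^sup>2 + b\<^sup>2)) = 0"
      by algebra
    then show ?thesis
      by (metis add_divide_distrib div_0 times_divide_eq_right)
  qed
  show ?thesis
    unfolding mg_symbol_def Let_def if_not_P[OF False] inner_vec_def sum_3 vector_3 inner_real_def
    by (rule alg)
qed (simp add: mg_symbol_def)

text \<open>The function \<open>\<Theta>\<close> has a value in \<open>H\<^sup>s\<close> at every time in \<open>(0,T)\<close>, so that the weak
  formulation, which is imposed at every time, is meaningful; membership in \<open>H\<^bsup>s+\<gamma>\<^esup>\<close> is only
  required at almost every time. The initial condition is contained in the weak formulation.\<close>

definition mg_solution ::
  "real \<Rightarrow> real \<Rightarrow> real \<Rightarrow> real \<Rightarrow> real \<Rightarrow> real \<Rightarrow> (real^3 \<Rightarrow> real) \<Rightarrow> (real \<Rightarrow> real^3 \<Rightarrow> real)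
    \<Rightarrow> real \<Rightarrow> (real \<Rightarrow> real^3 \<Rightarrow> real) \<Rightarrow> bool" where
  "mg_solution \<Omega> \<beta> \<eta> \<kappa> \<gamma> s \<Theta>0 S T \<Theta> \<longleftrightarrow>
     (\<forall>t\<in>{0<..<T}. \<Theta> t \<in> sobolev s) \<and>
     \<Theta> \<in> Linf_sobolev {0<..<T} s \<inter> L2_sobolev {0<..<T} (s + \<gamma>) \<and>
     (\<forall>\<phi>\<in>smooth_torus. \<forall>t\<in>{0<..<T}.
        (LINT x|torus. (\<Theta> t x - \<Theta>0 x) * \<phi> x)
        + \<kappa> * (LINT \<tau>|lebesgue_on {0<..<t}. LINT x|torus. \<Theta> \<tau> x * frac_laplacian \<gamma> \<phi> x)
        - (LINT \<tau>|lebesgue_on {0<..<t}. LINT x|torus.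
             \<Theta> \<tau> x * (mg_velocity \<Omega> \<beta> \<eta> (\<Theta> \<tau>) x \<bullet> gradient \<phi> x))
        = (LINT \<tau>|lebesgue_on {0<..<t}. LINT x|torus. S \<tau> x * \<phi> x))"

end

theory Submission
  imports Defs
begin

text \<open>On the Fourier side the equation is a system of damped scalar equations with damping
  \<open>\<kappa> |k|\<^sup>2\<^sup>\<gamma>\<close>, coupled by the quadratic term \<open>N(u,v)\<^sub>k = \<Sum>\<^sub>j \<i> (k \<cdot> M(k - j)) u\<^bsub>k-j\<^esub> v\<^sub>j\<close>. The symbol satisfies
  \<open>|M(k)| \<le> C |k|\<close> and \<open>k \<cdot> M(k - j) = j \<cdot> M(k - j)\<close>, so the coefficient is at most
  \<open>C min(|k|,|j|) |k - j|\<close>; distinguishing the largest of the three frequencies shows that \<open>N\<close> maps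
  \<open>H\<^sup>s \<times> H\<^sup>s\<close> to \<open>H\<^bsup>s-r\<^esup>\<close> whenever \<open>1 \<le> r \<le> 2\<close> and \<open>s + r > 7/2\<close>. The hypothesis on \<open>s\<close> leaves room for
  such an \<open>r < 2\<gamma>\<close>, so Duhamel's formula regains more than \<open>N\<close> loses, with a factor that is a
  positive power of the time \<open>T\<close>. Existence follows by Picard iteration, uniqueness by a contraction
  in an exponentially weighted norm. Testing with \<open>cos (k \<cdot> x)\<close> and \<open>sin (k \<cdot> x)\<close>, and expanding
  arbitrary test functions in Fourier series, identifies the weak formulation with the system for
  the modes.\<close>

text \<open>Pointwise in time \<open>N\<close> lands only in H^{s-r} with r \<ge> 1 > \<gamma>,
  while Duhamel's formula reaches L^\<infinity> H^s only from forcing in L^2 H^{s-\<gamma>}. The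
  missing r - \<gamma> derivatives come from the time integral: of the two factors at frequencies k
  - j and j, the one of higher frequency is taken in L^2 in time, where diffusion makes it small,
  and interpolation with the trivial bound T leaves a positive power of T. To do this for each pair
  (k - j, j) separately, the iteration lives in a space where every mode is dominated by a fixed
  amplitude, uniformly and in L^2 in time, and the amplitudes form a sequence in H^s; only scalar
  integrals occur. This space is smaller than the solution class, because the supremum over time
  stands inside the sum over frequencies. The fixed point argument therefore does not reach
  uniqueness among all solutions, which has its own argument in L^2(0,T;H^s). The zero mode is
  undamped; there the restriction T \<le> 1 takes the place of damping.\<close>

abbreviation nsum :: "('i \<Rightarrow> ennreal) \<Rightarrow> ennreal" where
  "nsum f \<equiv> \<integral>\<^sup>+k. f k \<partial>count_space UNIV"

section \<open>Sums as integrals over the counting measure, and their exchange with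
  integrals\<close>

lemma integrable_count_space_iff:
  fixes f :: "'i \<Rightarrow> 'b::{banach, second_countable_topology}"
  shows "integrable (count_space UNIV) f \<longleftrightarrow> (\<lambda>k. norm (f k)) summable_on UNIV"
  using abs_summable_equivalent[of f UNIV] by (simp add: Infinite_Set_Sum.abs_summable_on_def)

text \<open>No summability is assumed: for complex families summability and absolute summability
  coincide, and when they fail both sides are the default value 0. Sums depending on a parameter
  thus inherit measurability from integrals over the counting measure.\<close>

lemma infsum_eq_LINT:
  fixes f :: "'i \<Rightarrow> complex"
  shows "infsum f UNIV = (LINT k|count_space UNIV. f k)"
proof (cases "(\<lambda>k. norm (f k)) summable_on UNIV")
  case True
  then show ?thesis
    using infsetsum_infsum[of f UNIV] abs_summable_equivalent[of f UNIV]
    by (simp add: infsetsum_def)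
next
  case False
  then have "\<not> f summable_on UNIV"
    by (simp add: summable_on_iff_abs_summable_on_complex)
  then show ?thesis
    using False by (simp add: infsum_not_exists not_integrable_integral_eq integrable_count_space_iff)
qed

lemma infsum_eq_LINT_real:
  fixes f :: "'i \<Rightarrow> real"
  shows "infsum f UNIV = (LINT k|count_space UNIV. f k)"
proof (cases "(\<lambda>k. norm (f k)) summable_on UNIV")
  case True
  then show ?thesis
    using infsetsum_infsum[of f UNIV] abs_summable_equivalent[of f UNIV]
    by (simp add: infsetsum_def)
next
  case False
  then have "\<not> f summable_on UNIV"
    using summable_on_iff_abs_summable_on_real by fastforce
  then show ?thesis
    using False by (simp add: infsum_not_exists not_integrable_integral_eq integrable_count_space_iff)
qed

lemma summable_on_iff_nsum:
  fixes f :: "'i \<Rightarrow> real"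
  assumes "\<And>k. f k \<ge> 0"
  shows "f summable_on UNIV \<longleftrightarrow> nsum (\<lambda>k. ennreal (f k)) < \<infinity>"
  using integrable_count_space_iff[of f] assms
  by (simp add: integrable_iff_bounded)

lemma norm_summable_iff_nsum:
  fixes f :: "'i \<Rightarrow> 'b::{banach, second_countable_topology}"
  shows "(\<lambda>k. norm (f k)) summable_on UNIV \<longleftrightarrow> nsum (\<lambda>k. ennreal (norm (f k))) < \<infinity>"
  by (rule summable_on_iff_nsum) simp

lemma nsum_eq_infsum:
  fixes f :: "'i \<Rightarrow> real"
  assumes "\<And>k. f k \<ge> 0" "f summable_on UNIV"
  shows "nsum (\<lambda>k. ennreal (f k)) = ennreal (infsum f UNIV)"
  using assms unfolding infsum_eq_LINT_real
  by (intro nn_integral_eq_integral) (auto simp: integrable_count_space_iff)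

lemma measurable_case_prod_countable:
  fixes f :: "'i::countable \<Rightarrow> 'a \<Rightarrow> 'b::topological_space"
  assumes "\<And>k. f k \<in> borel_measurable M"
  shows "(\<lambda>(k, x). f k x) \<in> borel_measurable (count_space UNIV \<Otimes>\<^sub>M M)"
  by (rule measurable_pair_measure_countable1) (use assms in auto)

lemma pair_sigma_finite_count_space:
  assumes "sigma_finite_measure M"
  shows "pair_sigma_finite (count_space (UNIV :: 'i::countable set)) M"
  using assms by (simp add: pair_sigma_finite_def sigma_finite_measure_count_space)

lemma nsum_nn_integral_swap:
  fixes f :: "'i::countable \<Rightarrow> 'a \<Rightarrow> ennreal"
  assumes "sigma_finite_measure M" "\<And>k. f k \<in> borel_measurable M"
  shows "(\<integral>\<^sup>+x. nsum (\<lambda>k. f k x) \<partial>M) = nsum (\<lambda>k. \<integral>\<^sup>+x. f k x \<partial>M)"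
proof -
  interpret pair_sigma_finite "count_space (UNIV :: 'i set)" M
    by (rule pair_sigma_finite_count_space[OF assms(1)])
  show ?thesis
    using Fubini'[OF measurable_case_prod_countable[OF assms(2)]] by simp
qed

text \<open>Fubini on the product of the counting measure and \<open>M\<close>; \<open>fin\<close>
  is integrability on the product by Tonelli. With \<open>M\<close> the torus it integrates Fourier
  series termwise, with \<open>M\<close> a time interval it exchanges time integrals and sums over
  frequencies.\<close>

lemma infsum_integral_swap:
  fixes f :: "'i::countable \<Rightarrow> 'a \<Rightarrow> complex"
  assumes M: "sigma_finite_measure M" and meas: "\<And>k. f k \<in> borel_measurable M"
    and fin: "nsum (\<lambda>k. \<integral>\<^sup>+x. ennreal (norm (f k x)) \<partial>M) < \<infinity>"
  shows "AE x in M. (\<lambda>k. norm (f k x)) summable_on UNIV"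
    and "integrable M (\<lambda>x. infsum (\<lambda>k. f k x) UNIV)"
    and "(\<lambda>k. norm (LINT x|M. f k x)) summable_on UNIV"
    and "(LINT x|M. infsum (\<lambda>k. f k x) UNIV) = infsum (\<lambda>k. LINT x|M. f k x) UNIV"
    and "\<And>k. integrable M (f k)"
proof -
  interpret pair_sigma_finite "count_space (UNIV :: 'i set)" M
    by (rule pair_sigma_finite_count_space[OF M])
  let ?g = "\<lambda>(k, x). f k x"
  have g: "?g \<in> borel_measurable (count_space UNIV \<Otimes>\<^sub>M M)"
    by (rule measurable_case_prod_countable[OF meas])
  have int: "integrable (count_space UNIV \<Otimes>\<^sub>M M) ?g"
  proof (rule integrableI_bounded[OF g])
    have "(\<integral>\<^sup>+z. ennreal (norm (?g z)) \<partial>(count_space UNIV \<Otimes>\<^sub>M M))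
        = nsum (\<lambda>k. \<integral>\<^sup>+x. ennreal (norm (f k x)) \<partial>M)"
      using M2.nn_integral_fst[of "\<lambda>z. ennreal (norm (?g z))" "count_space UNIV"] g
      by (simp add: case_prod_beta)
    then show "(\<integral>\<^sup>+z. ennreal (norm (?g z)) \<partial>(count_space UNIV \<Otimes>\<^sub>M M)) < \<infinity>"
      using fin by simp
  qed
  show "AE x in M. (\<lambda>k. norm (f k x)) summable_on UNIV"
    using AE_integrable_snd[of f] int by (simp add: integrable_count_space_iff)
  show "integrable M (\<lambda>x. infsum (\<lambda>k. f k x) UNIV)"
    using integrable_snd[of f] int by (simp add: infsum_eq_LINT)
  have "integrable (count_space UNIV) (\<lambda>k. LINT x|M. f k x)"
    using integrable_fst[of f] int by simp
  then show "(\<lambda>k. norm (LINT x|M. f k x)) summable_on UNIV"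
    by (simp add: integrable_count_space_iff)
  show "(LINT x|M. infsum (\<lambda>k. f k x) UNIV) = infsum (\<lambda>k. LINT x|M. f k x) UNIV"
    using Fubini_integral[of f] int by (simp add: infsum_eq_LINT)
  show "integrable M (f k)" for k
    using AE_integrable_fst[of f] int by (simp add: AE_count_space)
qed

section \<open>Convolution estimates\<close>

lemma nsum_bij:
  assumes "bij h"
  shows "nsum (\<lambda>k. f (h k)) = nsum f"
  using nn_integral_bij_count_space[of h UNIV UNIV f] assms by simp

lemma nsum_shift:
  fixes f :: "'i::ab_group_add \<Rightarrow> ennreal"
  shows "nsum (\<lambda>k. f (k - j)) = nsum f" "nsum (\<lambda>j. f (k - j)) = nsum f"
proof -
  have "bij (\<lambda>k. k - j)" "bij (\<lambda>j. k - j)"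
    by (rule bij_betw_byWitness[where f' = "\<lambda>k. k + j"]; simp)
       (rule bij_betw_byWitness[where f' = "\<lambda>j. k - j"]; simp)
  then show "nsum (\<lambda>k. f (k - j)) = nsum f" "nsum (\<lambda>j. f (k - j)) = nsum f"
    by (auto intro: nsum_bij)
qed

lemma nsum_swap:
  fixes f :: "'i::countable \<Rightarrow> 'j::countable \<Rightarrow> ennreal"
  shows "nsum (\<lambda>k. nsum (\<lambda>j. f k j)) = nsum (\<lambda>j. nsum (\<lambda>k. f k j))"
  by (rule nsum_nn_integral_swap) (auto simp: sigma_finite_measure_count_space)

lemma nsum_Cauchy_Schwarz:
  "(nsum (\<lambda>j. f j * g j))\<^sup>2 \<le> nsum (\<lambda>j. (f j)\<^sup>2) * nsum (\<lambda>j. (g j)\<^sup>2)"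
  by (rule Cauchy_Schwarz_nn_integral) auto

text \<open>Cauchy-Schwarz for the functions 1 and \<open>g\<close> in the measure with density
  \<open>b\<close>, which avoids square roots of \<open>b\<close>.\<close>

lemma nsum_Cauchy_Schwarz_weight:
  "(nsum (\<lambda>j. b j * g j))\<^sup>2 \<le> nsum b * nsum (\<lambda>j. b j * (g j)\<^sup>2)"
proof -
  let ?D = "density (count_space UNIV) b"
  have "(\<integral>\<^sup>+j. 1 * g j \<partial>?D)\<^sup>2 \<le> (\<integral>\<^sup>+j. 1\<^sup>2 \<partial>?D) * (\<integral>\<^sup>+j. (g j)\<^sup>2 \<partial>?D)"
    by (rule Cauchy_Schwarz_nn_integral) auto
  then show ?thesis
    by (simp add: nn_integral_density del: nn_integral_const)
qed

text \<open>Young's inequality for l^1 * l^2: the weighted Cauchy-Schwarz inequality with weight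
  \<open>b\<close> inside, Tonelli and translation invariance outside.\<close>

lemma Young_l1_l2:
  fixes a b :: "'i::{countable, ab_group_add} \<Rightarrow> ennreal"
  shows "nsum (\<lambda>k. (nsum (\<lambda>j. b j * a (k - j)))\<^sup>2) \<le> (nsum b)\<^sup>2 * nsum (\<lambda>k. (a k)\<^sup>2)"
proof -
  have "nsum (\<lambda>k. (nsum (\<lambda>j. b j * a (k - j)))\<^sup>2)
      \<le> nsum (\<lambda>k. nsum b * nsum (\<lambda>j. b j * (a (k - j))\<^sup>2))"
    by (intro nn_integral_mono nsum_Cauchy_Schwarz_weight)
  also have "\<dots> = nsum b * nsum (\<lambda>j. nsum (\<lambda>k. b j * (a (k - j))\<^sup>2))"
    by (subst nsum_swap) (simp add: nn_integral_cmult)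
  also have "\<dots> = nsum b * nsum (\<lambda>j. b j * nsum (\<lambda>k. (a k)\<^sup>2))"
    by (simp add: nn_integral_cmult nsum_shift(1)[of "\<lambda>k. (a k)\<^sup>2"])
  also have "\<dots> = (nsum b)\<^sup>2 * nsum (\<lambda>k. (a k)\<^sup>2)"
    by (simp add: nn_integral_multc power2_eq_square mult.assoc)
  finally show ?thesis .
qed

lemma conv_flip:
  fixes a b :: "'i::ab_group_add \<Rightarrow> ennreal"
  shows "nsum (\<lambda>j. b j * a (k - j)) = nsum (\<lambda>j. a j * b (k - j))"
  using nsum_shift(2)[of "\<lambda>j. b j * a (k - j)" k] by (simp add: mult.commute)

text \<open>The weight may sit on any of the three frequencies. On \<open>j\<close> or
  \<open>k - j\<close> it is absorbed into one factor, which becomes summable by Cauchy-Schwarz, and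
  Young's inequality applies; on \<open>k\<close> the plain convolution is bounded uniformly by
  Cauchy-Schwarz and \<open>w\<close> is square summed. The 9 is a 3 for squaring a sum of three
  terms times the number of terms.\<close>

lemma conv_weighted:
  fixes a b w :: "'i::{countable, ab_group_add} \<Rightarrow> ennreal"
  shows "nsum (\<lambda>k. (nsum (\<lambda>j. (w j + w (k - j) + w k) * (a (k - j) * b j)))\<^sup>2)
     \<le> 9 * nsum (\<lambda>k. (w k)\<^sup>2) * nsum (\<lambda>k. (a k)\<^sup>2) * nsum (\<lambda>k. (b k)\<^sup>2)"
proof -
  let ?W = "nsum (\<lambda>k. (w k)\<^sup>2)" and ?A = "nsum (\<lambda>k. (a k)\<^sup>2)" and ?B = "nsum (\<lambda>k. (b k)\<^sup>2)"
  define P where "P k = nsum (\<lambda>j. (w j * b j) * a (k - j))" for k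
  define Q where "Q k = nsum (\<lambda>j. (w j * a j) * b (k - j))" for k
  define R where "R k = w k * nsum (\<lambda>j. b j * a (k - j))" for k
  have split: "nsum (\<lambda>j. (w j + w (k - j) + w k) * (a (k - j) * b j)) = P k + Q k + R k" for k
  proof -
    have "Q k = nsum (\<lambda>j. b j * (w (k - j) * a (k - j)))"
      unfolding Q_def using conv_flip[of b "\<lambda>j. w j * a j" k] by simp
    moreover have "R k = nsum (\<lambda>j. w k * (b j * a (k - j)))"
      unfolding R_def by (simp add: nn_integral_cmult)
    ultimately show ?thesis
      unfolding P_def by (simp add: nn_integral_add[symmetric] algebra_simps)
  qed
  have sq_real: "(x + y + z)\<^sup>2 \<le> 3 * (x\<^sup>2 + y\<^sup>2 + z\<^sup>2)" for x y z :: real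
  proof -
    have "0 \<le> (x - y)\<^sup>2 + (y - z)\<^sup>2 + (x - z)\<^sup>2" by simp
    also have "\<dots> = 3 * (x\<^sup>2 + y\<^sup>2 + z\<^sup>2) - (x + y + z)\<^sup>2"
      by (simp add: power2_eq_square algebra_simps)
    finally show ?thesis by simp
  qed
  have sq: "(x + y + z)\<^sup>2 \<le> 3 * (x\<^sup>2 + y\<^sup>2 + z\<^sup>2)" for x y z :: ennreal
  proof (cases "x = top \<or> y = top \<or> z = top")
    case True
    then have "x\<^sup>2 + y\<^sup>2 + z\<^sup>2 = top" by (auto simp: power2_eq_square)
    then have "3 * (x\<^sup>2 + y\<^sup>2 + z\<^sup>2) = top" by (simp only: ennreal_mult_top) simp
    then show ?thesis by (simp only: top_greatest)
  next
    case False
    then obtain x' y' z' where e: "x = ennreal x'" "y = ennreal y'" "z = ennreal z'"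
      and nn: "0 \<le> x'" "0 \<le> y'" "0 \<le> z'"
      by (metis ennreal_cases)
    have "(x + y + z)\<^sup>2 = ennreal ((x' + y' + z')\<^sup>2)"
      using nn by (simp add: e ennreal_plus[symmetric] ennreal_power del: ennreal_plus)
    moreover have "3 * (x\<^sup>2 + y\<^sup>2 + z\<^sup>2) = ennreal (3 * (x'\<^sup>2 + y'\<^sup>2 + z'\<^sup>2))"
      using nn by (simp add: e ennreal_power ennreal_mult)
    ultimately show ?thesis
      using ennreal_leI[OF sq_real[of x' y' z']] by (simp only:)
  qed
  have l1: "(nsum (\<lambda>j. w j * c j))\<^sup>2 \<le> ?W * nsum (\<lambda>k. (c k)\<^sup>2)" for c
    by (rule nsum_Cauchy_Schwarz)
  have P: "nsum (\<lambda>k. (P k)\<^sup>2) \<le> ?W * ?A * ?B"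
    unfolding P_def
    by (rule order_trans[OF Young_l1_l2 order_trans[OF mult_right_mono[OF l1]]])
       (simp_all add: mult_ac)
  have Q: "nsum (\<lambda>k. (Q k)\<^sup>2) \<le> ?W * ?A * ?B"
    unfolding Q_def
    by (rule order_trans[OF Young_l1_l2 order_trans[OF mult_right_mono[OF l1]]])
       (simp_all add: mult_ac)
  have R: "nsum (\<lambda>k. (R k)\<^sup>2) \<le> ?W * ?A * ?B"
  proof -
    have "(nsum (\<lambda>j. b j * a (k - j)))\<^sup>2 \<le> ?B * ?A" for k
      using nsum_Cauchy_Schwarz[of b "\<lambda>j. a (k - j)"] nsum_shift(2)[of "\<lambda>k. (a k)\<^sup>2" k] by simp
    then have "nsum (\<lambda>k. (R k)\<^sup>2) \<le> nsum (\<lambda>k. (w k)\<^sup>2 * (?B * ?A))"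
      unfolding R_def power_mult_distrib by (intro nn_integral_mono mult_left_mono) auto
    then show ?thesis by (simp add: nn_integral_multc mult_ac)
  qed
  have "nsum (\<lambda>k. (P k + Q k + R k)\<^sup>2) \<le> nsum (\<lambda>k. 3 * ((P k)\<^sup>2 + (Q k)\<^sup>2 + (R k)\<^sup>2))"
    by (intro nn_integral_mono sq)
  also have "\<dots> = 3 * (nsum (\<lambda>k. (P k)\<^sup>2) + nsum (\<lambda>k. (Q k)\<^sup>2) + nsum (\<lambda>k. (R k)\<^sup>2))"
    by (simp add: nn_integral_cmult nn_integral_add)
  also have "\<dots> \<le> 3 * (?W * ?A * ?B + ?W * ?A * ?B + ?W * ?A * ?B)"
    by (intro mult_left_mono add_mono P Q R) auto
  also have "\<dots> = 9 * ?W * ?A * ?B"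
  proof -
    have "3 * (x + x + x) = 9 * x" for x :: ennreal
    proof -
      have "x + x + x = 3 * x" by (metis distrib_right mult_1 numeral_Bit1 numeral_One one_add_one)
      then show ?thesis by (simp add: mult.assoc[symmetric])
    qed
    from this[of "?W * ?A * ?B"] show ?thesis by (simp only: mult.assoc)
  qed
  finally show ?thesis by (simp add: split)
qed

section \<open>The Japanese bracket of a frequency\<close>

definition jb :: "int^3 \<Rightarrow> real" where
  "jb k = sqrt (1 + (norm (freq k))\<^sup>2)"

lemma freq_nth [simp]: "freq k $ i = of_int (k $ i)"
  by (simp add: freq_def)

lemma freq_add: "freq (j + k) = freq j + freq k"
  and freq_diff: "freq (j - k) = freq j - freq k"
  and freq_minus [simp]: "freq (- k) = - freq k"
  and freq_zero [simp]: "freq 0 = 0"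
  by (simp_all add: vec_eq_iff)

lemma jb_ge_1: "jb k \<ge> 1"
  by (simp add: jb_def)

lemma jb_pos [simp]: "jb k > 0"
  using jb_ge_1[of k] by linarith

lemma jb_nonneg [simp]: "jb k \<ge> 0"
  by (simp add: less_imp_le)

lemma powr_square: "(x\<^sup>2) powr q = x powr (2 * q)" if "x > 0" for x q :: real
proof -
  have "x powr (2 * q) = (x powr 2) powr q" by (simp add: powr_powr)
  then show ?thesis using that by simp
qed

lemma jb_minus [simp]: "jb (- k) = jb k"
  by (simp add: jb_def)

lemma jb_sq: "(jb k)\<^sup>2 = 1 + (norm (freq k))\<^sup>2"
  by (simp add: jb_def add_nonneg_nonneg)

lemma norm_freq_le_jb: "norm (freq k) \<le> jb k"
  unfolding jb_def by (rule real_le_rsqrt) simp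

text \<open>\<open>jb k\<close> is the norm of (1, freq k) in R x R^3; the triangle inequality is
  applied to (1, freq j) + (0, freq k), which keeps the first component equal to 1.\<close>

lemma jb_triangle: "jb (j + k) \<le> jb j + jb k"
proof -
  have n: "norm (1::real, x) = sqrt (1 + (norm x)\<^sup>2)" for x :: "real^3"
    by (simp add: norm_Pair)
  have "norm ((1::real, freq j) + (0, freq k)) \<le> norm (1::real, freq j) + norm (0::real, freq k)"
    by (rule norm_triangle_ineq)
  then show ?thesis
    using norm_freq_le_jb[of k] by (simp add: n jb_def[symmetric] freq_add[symmetric] norm_Pair)
qed

lemma jb_le: "jb k \<le> jb (k - j) + jb j"
  using jb_triangle[of "k - j" j] by simp

lemma jb_powr_even: "(1 + (norm (freq k))\<^sup>2) powr s = jb k powr (2 * s)"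
  by (simp flip: jb_sq add: powr_square)

lemma summable_int_powr:
  assumes "q > 1/2"
  shows "(\<lambda>n::int. (1 + (of_int n)\<^sup>2 :: real) powr (- q)) summable_on UNIV"
proof -
  let ?f = "\<lambda>n::int. (1 + (of_int n)\<^sup>2 :: real) powr (- q)"
  have "summable (\<lambda>n::nat. real n powr (- 2 * q))"
    using assms by (simp add: summable_real_powr_iff)
  then have "summable (\<lambda>n::nat. ?f (int n))"
  proof (rule summable_comparison_test_ev[rotated], intro eventually_sequentiallyI[of 1])
    fix n :: nat assume "1 \<le> n"
    have "(1 + (real n)\<^sup>2) powr (- q) \<le> ((real n)\<^sup>2) powr (- q)"
      using assms \<open>1 \<le> n\<close> by (intro powr_mono2') auto
    also have "\<dots> = real n powr (- 2 * q)"
      using \<open>1 \<le> n\<close> by (simp add: powr_square)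
    finally show "norm (?f (int n)) \<le> real n powr (- 2 * q)" by simp
  qed
  then have *: "(\<lambda>n::nat. ?f (int n)) summable_on UNIV"
    by (simp add: summable_on_UNIV_nonneg_real_iff)
  have "?f summable_on (range int)"
    by (subst summable_on_reindex) (use * in \<open>auto simp: o_def\<close>)
  moreover have "?f summable_on (range (\<lambda>n. - int n))"
    by (subst summable_on_reindex) (use * in \<open>auto simp: o_def inj_on_def\<close>)
  ultimately have "?f summable_on (range int \<union> range (\<lambda>n. - int n))"
    by (rule summable_on_union)
  moreover have "x \<in> range int \<union> range (\<lambda>n. - int n)" for x
    by (cases x rule: int_cases2) auto
  then have "range int \<union> range (\<lambda>n. - int n) = UNIV" by auto
  ultimately show ?thesis by simp
qed

text \<open>The squared bracket dominates 1 + k_i^2 for each coordinate, so a third of the power is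
  given to each and the sum factors into three sums over the integers. The exponent \<open>q\<close>
  is p/6 since each factor is a power of the square; p > 3 becomes q > 1/2.\<close>

lemma nsum_jb_finite:
  assumes "p > 3"
  shows "nsum (\<lambda>k. ennreal (jb k powr (- p))) < \<infinity>"
proof -
  define q where "q = p / 6"
  have q: "q > 1/2" using assms by (simp add: q_def)
  let ?g = "\<lambda>n::int. (1 + (of_int n)\<^sup>2 :: real) powr (- q)"
  have le: "jb k powr (- p) \<le> ?g (k $ 1) * (?g (k $ 2) * ?g (k $ 3))" for k
  proof -
    have "((jb k)\<^sup>2) powr (- q) \<le> ?g (k $ i)" for i
    proof (rule powr_mono2')
      have "\<bar>freq k $ i\<bar> \<le> norm (freq k)" by (rule component_le_norm_cart)
      from power_mono[OF this, of 2] show "1 + (of_int (k $ i))\<^sup>2 \<le> (jb k)\<^sup>2" by (simp add: jb_sq)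
    qed (use q in \<open>auto simp: add_pos_nonneg\<close>)
    then have "((jb k)\<^sup>2) powr (- q) * (((jb k)\<^sup>2) powr (- q) * ((jb k)\<^sup>2) powr (- q))
        \<le> ?g (k $ 1) * (?g (k $ 2) * ?g (k $ 3))"
      by (intro mult_mono) auto
    moreover have "((jb k)\<^sup>2) powr (- q) * (((jb k)\<^sup>2) powr (- q) * ((jb k)\<^sup>2) powr (- q)) = jb k powr (- p)"
      by (simp add: powr_square powr_add[symmetric] q_def)
    ultimately show ?thesis
      by simp
  qed
  define h where "h = (\<lambda>(a, b, c). vector [a, b, c] :: int^3)"
  have "bij h"
    by (rule bij_betw_byWitness[where f' = "\<lambda>k. (k $ 1, k $ 2, k $ 3)"])
       (auto simp: h_def vector_def vec_eq_iff forall_3)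
  have "nsum (\<lambda>k. ennreal (jb k powr (- p))) \<le> nsum (\<lambda>k::int^3. ennreal (?g (k $ 1)) * (ennreal (?g (k $ 2)) * ennreal (?g (k $ 3))))"
    using le by (intro nn_integral_mono) (simp add: ennreal_mult'[symmetric] ennreal_leI)
  also have "\<dots> = nsum (\<lambda>z. ennreal (?g (h z $ 1)) * (ennreal (?g (h z $ 2)) * ennreal (?g (h z $ 3))))"
    using nsum_bij[OF \<open>bij h\<close>, of "\<lambda>k. ennreal (?g (k $ 1)) * (ennreal (?g (k $ 2)) * ennreal (?g (k $ 3)))"] by simp
  also have "\<dots> = nsum (\<lambda>(a, b, c). ennreal (?g a) * (ennreal (?g b) * ennreal (?g c)))"
    by (rule nn_integral_cong) (auto simp: h_def vector_3)
  also have "\<dots> = nsum (\<lambda>a. ennreal (?g a)) * (nsum (\<lambda>a. ennreal (?g a)) * nsum (\<lambda>a. ennreal (?g a)))"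
    by (simp add: nn_integral_fst_count_space[symmetric] nn_integral_cmult nn_integral_multc)
  also have "\<dots> < \<infinity>"
    using summable_int_powr[OF q] summable_on_iff_nsum[of ?g]
    by (simp add: ennreal_mult_less_top)
  finally show ?thesis .
qed

section \<open>Fourier series on the torus\<close>

abbreviation cell :: "(real^3) set" where
  "cell \<equiv> cbox 0 (\<chi> i. 2 * pi)"

lemma space_torus [simp]: "space torus = cell"
  by (simp add: torus_def)

lemma finite_measure_torus: "finite_measure torus"
  unfolding torus_def by (intro finite_measure_lebesgue_on) simp

lemma sigma_finite_torus: "sigma_finite_measure torus"
  using finite_measure_torus by (simp add: finite_measure_def)

lemma measure_torus: "measure torus cell = (2 * pi) ^ 3"
proof -
  have "0 \<in> cell" by (simp add: mem_box_cart)
  then have ne: "cell \<noteq> {}" by blast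
  have "measure torus cell = measure lebesgue cell"
    unfolding torus_def by (simp add: measure_restrict_space)
  also have "\<dots> = (2 * pi) ^ 3"
    using content_cbox_cart[OF ne] by (simp add: measure_completion)
  finally show ?thesis .
qed

lemma continuous_imp_integrable_torus:
  fixes f :: "real^3 \<Rightarrow> 'b::euclidean_space"
  assumes "continuous_on UNIV f"
  shows "integrable torus f"
  unfolding torus_def
  by (rule continuous_imp_integrable) (rule continuous_on_subset[OF assms], simp)

lemma continuous_imp_measurable_torus:
  fixes f :: "real^3 \<Rightarrow> 'b::euclidean_space"
  assumes "continuous_on UNIV f"
  shows "f \<in> borel_measurable torus"
  using continuous_imp_integrable_torus[OF assms] by auto

lemma LINT_torus_eq_integral:
  fixes f :: "real^3 \<Rightarrow> 'b::euclidean_space"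
  assumes "continuous_on UNIV f"
  shows "(LINT x|torus. f x) = integral cell f"
  using continuous_imp_integrable_torus[OF assms] unfolding torus_def
  by (intro lebesgue_integral_eq_integral) auto

lemma cell_split:
  fixes f :: "real^3 \<Rightarrow> 'b::euclidean_space"
  assumes f: "continuous_on UNIV f" and c: "l \<le> c" "c \<le> u"
  shows "integral (cbox (\<chi> j. if j = i then l else a j) (\<chi> j. if j = i then u else b j)) f
    = integral (cbox (\<chi> j. if j = i then l else a j) (\<chi> j. if j = i then c else b j)) f
    + integral (cbox (\<chi> j. if j = i then c else a j) (\<chi> j. if j = i then u else b j)) f"
proof -
  let ?B = "\<lambda>l u. cbox (\<chi> j. if j = i then l else a j) (\<chi> j. if j = i then u else b j)"
  have int: "f integrable_on ?B l u"
    by (rule integrable_continuous) (rule continuous_on_subset[OF f], simp)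
  have "integral (?B l u) f = integral (?B l u \<inter> {x. x \<bullet> axis i 1 \<le> c}) f
      + integral (?B l u \<inter> {x. x \<bullet> axis i 1 \<ge> c}) f"
    by (rule integral_split[OF int]) simp
  moreover have "?B l u \<inter> {x. x \<bullet> axis i 1 \<le> c} = ?B l c"
    using c by (auto simp: mem_box_cart inner_axis) (smt (verit))+
  moreover have "?B l u \<inter> {x. x \<bullet> axis i 1 \<ge> c} = ?B c u"
    using c by (auto simp: mem_box_cart inner_axis) (smt (verit))+
  ultimately show ?thesis by simp
qed

text \<open>The slab of width \<open>h\<close> is cut off one end of the cell and reattached at the
  other end by periodicity. Shifts along one axis by at most one period serve both uses, the
  orthogonality of characters and the difference quotients.\<close>

lemma torus_translation:
  fixes f :: "real^3 \<Rightarrow> 'b::euclidean_space"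
  assumes f: "continuous_on UNIV f" and per: "\<And>x. f (x + axis i (2 * pi)) = f x"
    and h: "0 \<le> h" "h \<le> 2 * pi"
  shows "(LINT x|torus. f (x + axis i h)) = (LINT x|torus. f x)"
proof -
  define B where "B l u = cbox (\<chi> j. if j = i then l else 0) (\<chi> j. if j = i then u else (2 * pi :: real))" for l u :: real
  have split: "integral (B l u) f = integral (B l c) f + integral (B c u) f" if "l \<le> c" "c \<le> u" for l c u
    unfolding B_def by (rule cell_split[OF f that])
  have cell: "cell = B 0 (2 * pi)"
    unfolding B_def by (rule arg_cong2[where f = cbox]) (auto simp: vec_eq_iff)
  have shift: "integral (B l u) (\<lambda>x. f (x + axis i c)) = integral (B (l + c) (u + c)) f" for l u c
  proof -
    have "B l u = cbox ((\<chi> j. if j = i then l + c else 0) - axis i c) ((\<chi> j. if j = i then u + c else 2 * pi) - axis i c)"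
      unfolding B_def by (rule arg_cong2[where f = cbox]) (auto simp: vec_eq_iff axis_def)
    then show ?thesis unfolding B_def by (simp only: integral_shift_cbox)
  qed
  have "integral (B 0 h) f = integral (B (2 * pi) (2 * pi + h)) f"
    using shift[of 0 h "2 * pi"] per by (simp add: add.commute)
  moreover have "integral (B 0 (2 * pi)) f = integral (B 0 h) f + integral (B h (2 * pi)) f"
    using h by (intro split) auto
  moreover have "integral (B h (2 * pi + h)) f = integral (B h (2 * pi)) f + integral (B (2 * pi) (2 * pi + h)) f"
    using h by (intro split) auto
  moreover have "integral (B 0 (2 * pi)) (\<lambda>x. f (x + axis i h)) = integral (B h (2 * pi + h)) f"
    using shift[of 0 "2 * pi" h] by simp
  moreover have "(LINT x|torus. f (x + axis i h)) = integral cell (\<lambda>x. f (x + axis i h))"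
    by (intro LINT_torus_eq_integral continuous_on_compose2[OF f] continuous_intros) auto
  ultimately show ?thesis
    using LINT_torus_eq_integral[OF f] by (simp add: cell)
qed

section \<open>Characters and absolutely convergent Fourier series\<close>

definition ek :: "int^3 \<Rightarrow> real^3 \<Rightarrow> complex" where
  "ek k x = cis (freq k \<bullet> x)"

lemma norm_ek [simp]: "norm (ek k x) = 1"
  by (simp add: ek_def)

lemma ek_0 [simp]: "ek 0 x = 1"
  by (simp add: ek_def)

lemma ek_add: "ek (j + k) x = ek j x * ek k x"
  by (simp add: ek_def freq_add inner_add_left cis_mult)

lemma cnj_ek: "cnj (ek k x) = ek (- k) x"
  by (simp add: ek_def cis_cnj inner_minus_left)

lemma continuous_ek [continuous_intros]: "continuous_on A (ek k)"
  unfolding ek_def cis_conv_exp by (intro continuous_intros)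

lemma ek_shift: "ek k (x + axis i h) = cis (of_int (k $ i) * h) * ek k x"
  by (simp add: ek_def inner_add_right inner_axis cis_mult add.commute)

lemma ek_periodic: "ek k (x + axis i (2 * pi)) = ek k x"
proof -
  have "cis (of_int (k $ i) * (2 * pi)) = 1"
    using cis_multiple_2pi[of "of_int (k $ i)"] by (simp add: mult.commute)
  then show ?thesis by (simp add: ek_shift)
qed

lemma fourier_coeff_ek:
  "fourier_coeff f k = (1 / (2 * pi) ^ 3) *\<^sub>R (LINT x|torus. complex_of_real (f x) * ek (- k) x)"
  by (simp add: fourier_coeff_def ek_def)

text \<open>Translation by half a period in a direction \<open>i\<close> with \<open>k\<^sub>i \<noteq> 0\<close> changes the sign of \<open>ek k\<close>.\<close>

lemma LINT_ek: "(LINT x|torus. ek k x) = (if k = 0 then complex_of_real ((2 * pi) ^ 3) else 0)"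
proof (cases "k = 0")
  case True
  then show ?thesis using measure_torus by (simp add: scaleR_conv_of_real)
next
  case False
  then obtain i where i: "k $ i \<noteq> 0" by (auto simp: vec_eq_iff)
  \<comment> \<open>\<open>h\<close> is half the wavelength of \<open>ek k\<close> along the axis
    \<open>i\<close>; it fits into one period because |k_i| \<ge> 1.\<close>
  define h where "h = pi / \<bar>of_int (k $ i)\<bar>"
  have h: "0 \<le> h" "h \<le> 2 * pi"
  proof -
    have "1 \<le> \<bar>of_int (k $ i) :: real\<bar>" using i by linarith
    then have "h \<le> pi" unfolding h_def by (simp add: field_simps)
    then show "h \<le> 2 * pi" using pi_gt_zero by linarith
  qed (simp add: h_def)
  have "of_int (k $ i) * h = (if k $ i > 0 then pi else - pi)"
    using i by (auto simp: h_def)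
  then have "cis (of_int (k $ i) * h) = - 1"
    by (simp add: complex_eq_iff)
  then have "(LINT x|torus. - ek k x) = (LINT x|torus. ek k x)"
    using torus_translation[OF continuous_ek ek_periodic h, of k i] by (simp add: ek_shift)
  then show ?thesis using False by simp
qed

definition fser :: "(int^3 \<Rightarrow> complex) \<Rightarrow> real^3 \<Rightarrow> complex" where
  "fser c x = infsum (\<lambda>k. c k * ek k x) UNIV"

lemma fser_summable:
  assumes "(\<lambda>k. norm (c k)) summable_on UNIV"
  shows "(\<lambda>k. norm (c k * ek k x)) summable_on UNIV" "(\<lambda>k. c k * ek k x) summable_on UNIV"
proof -
  show "(\<lambda>k. norm (c k * ek k x)) summable_on UNIV" using assms by (simp add: norm_mult)
  then show "(\<lambda>k. c k * ek k x) summable_on UNIV" by (rule abs_summable_summable)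
qed

lemma continuous_fser:
  assumes "(\<lambda>k. norm (c k)) summable_on UNIV"
  shows "continuous_on A (fser c)"
proof -
  have "uniform_limit A (\<lambda>X x. \<Sum>k\<in>X. c k * ek k x) (\<lambda>x. \<Sum>\<^sub>\<infinity>k. c k * ek k x) (finite_subsets_at_top UNIV)"
    by (rule Weierstrass_m_test_general[OF _ assms]) (simp add: norm_mult)
  then show ?thesis
    unfolding fser_def
    by (rule uniform_limit_theorem[rotated]) (auto intro!: always_eventually continuous_intros)
qed

lemma fser_periodic: "fser c (x + axis i (2 * pi)) = fser c x"
  by (simp add: fser_def ek_periodic)

lemma integrable_mult_ek:
  fixes G :: "real^3 \<Rightarrow> complex"
  assumes "integrable torus G"
  shows "integrable torus (\<lambda>x. G x * ek k x)"
proof (rule Bochner_Integration.integrable_bound[OF assms])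
  have [measurable]: "ek k \<in> borel_measurable torus"
    by (intro continuous_imp_measurable_torus continuous_ek)
  show "(\<lambda>x. G x * ek k x) \<in> borel_measurable torus"
    using assms by measurable
qed (simp add: norm_mult)

lemma fser_pairing:
  fixes G :: "real^3 \<Rightarrow> complex"
  assumes c: "(\<lambda>k. norm (c k)) summable_on UNIV" and G: "integrable torus G"
  shows "integrable torus (\<lambda>x. G x * fser c x)"
    and "(\<lambda>k. norm (c k * (LINT x|torus. G x * ek k x))) summable_on UNIV"
    and "(LINT x|torus. G x * fser c x) = infsum (\<lambda>k. c k * (LINT x|torus. G x * ek k x)) UNIV"
proof -
  let ?f = "\<lambda>k x. c k * (G x * ek k x)"
  have meas: "?f k \<in> borel_measurable torus" for k
    using integrable_mult_ek[OF G, of k] by auto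
  have "nsum (\<lambda>k. \<integral>\<^sup>+x. ennreal (norm (?f k x)) \<partial>torus)
      = nsum (\<lambda>k. ennreal (norm (c k)) * (\<integral>\<^sup>+x. ennreal (norm (G x)) \<partial>torus))"
    using G by (intro nn_integral_cong) (simp add: norm_mult ennreal_mult' nn_integral_cmult)
  also have "\<dots> < \<infinity>"
    using G norm_summable_iff_nsum[of c] c
    by (simp add: nn_integral_multc ennreal_mult_less_top integrable_iff_bounded)
  finally have fin: "nsum (\<lambda>k. \<integral>\<^sup>+x. ennreal (norm (?f k x)) \<partial>torus) < \<infinity>" .
  note sw = infsum_integral_swap[OF sigma_finite_torus meas fin]
  have eq: "G x * fser c x = infsum (\<lambda>k. ?f k x) UNIV" for x
    unfolding fser_def
    by (subst infsum_cmult_right[symmetric])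
       (use fser_summable(2)[OF c, of x] in \<open>auto simp: mult_ac\<close>)
  show "integrable torus (\<lambda>x. G x * fser c x)" using sw(2) by (simp add: eq)
  show "(\<lambda>k. norm (c k * (LINT x|torus. G x * ek k x))) summable_on UNIV"
    using sw(3) by simp
  show "(LINT x|torus. G x * fser c x) = infsum (\<lambda>k. c k * (LINT x|torus. G x * ek k x)) UNIV"
    using sw(4) by (simp add: eq)
qed

lemma fser_coeff:
  fixes c :: "int^3 \<Rightarrow> complex"
  assumes c: "(\<lambda>k. norm (c k)) summable_on UNIV"
  shows "(LINT x|torus. ek (- j) x * fser c x) = (2 * pi) ^ 3 * c j"
proof -
  have "integrable torus (ek (- j))"
    by (intro continuous_imp_integrable_torus continuous_ek)
  from fser_pairing(3)[OF c this]
  have "(LINT x|torus. ek (- j) x * fser c x) = infsum (\<lambda>k. c k * (LINT x|torus. ek (- j + k) x)) UNIV"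
    by (simp flip: ek_add)
  also have "\<dots> = infsum (\<lambda>k. if k = j then (2 * pi) ^ 3 * c j else 0) UNIV"
    by (rule infsum_cong) (auto simp: LINT_ek)
  also have "\<dots> = infsum (\<lambda>k. (2 * pi) ^ 3 * c j) {j}"
    by (rule infsum_cong_neutral) auto
  finally show ?thesis by simp
qed

definition hermitian :: "(int^3 \<Rightarrow> complex) \<Rightarrow> bool" where
  "hermitian c \<longleftrightarrow> (\<forall>k. c (- k) = cnj (c k))"

text \<open>The spaces consist of real functions, the coefficients are complex. For hermitian
  \<open>c\<close> the series is already real, and taking the real part only changes the
  type.\<close>

definition rser :: "(int^3 \<Rightarrow> complex) \<Rightarrow> real^3 \<Rightarrow> real" where
  "rser c x = Re (fser c x)"

lemma bij_uminus_int3: "bij (uminus :: int^3 \<Rightarrow> int^3)"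
  by (rule bij_betw_byWitness[where f' = uminus]) auto

lemma fser_hermitian:
  assumes "hermitian c"
  shows "complex_of_real (rser c x) = fser c x"
proof -
  have "cnj (fser c x) = infsum (\<lambda>k. c (- k) * ek (- k) x) UNIV"
    unfolding fser_def infsum_cnj[symmetric] using assms
    by (simp add: hermitian_def cnj_ek)
  also have "\<dots> = fser c x"
    unfolding fser_def using infsum_reindex_bij_betw[OF bij_uminus_int3, of "\<lambda>k. c k * ek k x"] by simp
  finally show ?thesis
    by (simp add: rser_def complex_eq_iff)
qed

lemma fourier_coeff_rser:
  assumes "(\<lambda>k. norm (c k)) summable_on UNIV" "hermitian c"
  shows "fourier_coeff (rser c) k = c k"
  using fser_coeff[OF assms(1), of k]
  by (simp add: fourier_coeff_ek fser_hermitian[OF assms(2)] mult.commute scaleR_conv_of_real)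

lemma continuous_rser:
  assumes "(\<lambda>k. norm (c k)) summable_on UNIV"
  shows "continuous_on A (rser c)"
  unfolding rser_def by (intro continuous_intros continuous_fser assms)

lemma continuous_torus_L2:
  assumes "continuous_on UNIV f" "torus_fun f"
  shows "f \<in> L2_torus"
  using assms unfolding L2_torus_def
  by (auto intro!: continuous_imp_measurable_torus continuous_imp_integrable_torus continuous_intros)

lemma rser_L2:
  assumes "(\<lambda>k. norm (c k)) summable_on UNIV"
  shows "rser c \<in> L2_torus"
  by (rule continuous_torus_L2[OF continuous_rser[OF assms]])
     (simp add: torus_fun_def rser_def fser_periodic)

lemma L2_torus_integrable:
  assumes "f \<in> L2_torus"
  shows "integrable torus f"
proof -
  interpret finite_measure torus by (rule finite_measure_torus)
  have "integrable torus (\<lambda>x. 1 + (f x)\<^sup>2)"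
    using assms by (intro Bochner_Integration.integrable_add) (auto simp: L2_torus_def)
  then show ?thesis
  proof (rule Bochner_Integration.integrable_bound)
    show "AE x in torus. norm (f x) \<le> norm (1 + (f x)\<^sup>2)"
    proof (intro AE_I2)
      fix x
      have "0 \<le> (\<bar>f x\<bar> - 1)\<^sup>2" by simp
      then have "\<bar>f x\<bar> \<le> 1 + (f x)\<^sup>2" by (simp add: power2_diff)
      then show "norm (f x) \<le> norm (1 + (f x)\<^sup>2)" by simp
    qed
  qed (use assms in \<open>simp add: L2_torus_def\<close>)
qed

lemma hermitian_fourier_coeff: "hermitian (fourier_coeff f)"
proof -
  have "cnj (LINT x|torus. complex_of_real (f x) * ek (- k) x)
      = (LINT x|torus. cnj (complex_of_real (f x) * ek (- k) x))" for k
    by (simp only: Bochner_Integration.integral_cnj)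
  then show ?thesis
    by (auto simp: hermitian_def fourier_coeff_ek cnj_ek)
qed

lemma fourier_coeff_diff:
  assumes "integrable torus f" "integrable torus g"
  shows "fourier_coeff (\<lambda>x. f x - g x) k = fourier_coeff f k - fourier_coeff g k"
  using integrable_mult_ek[of "\<lambda>x. complex_of_real (f x)" "- k"]
    integrable_mult_ek[of "\<lambda>x. complex_of_real (g x)" "- k"] assms
  by (simp add: fourier_coeff_ek left_diff_distrib scaleR_diff_right)

lemma L2_torus_diff:
  assumes "f \<in> L2_torus" "g \<in> L2_torus"
  shows "(\<lambda>x. f x - g x) \<in> L2_torus"
proof -
  have "integrable torus (\<lambda>x. 2 * (f x)\<^sup>2 + 2 * (g x)\<^sup>2)"
    using assms by (auto simp: L2_torus_def)
  then have "integrable torus (\<lambda>x. (f x - g x)\<^sup>2)"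
  proof (rule Bochner_Integration.integrable_bound)
    show "AE x in torus. norm ((f x - g x)\<^sup>2) \<le> norm (2 * (f x)\<^sup>2 + 2 * (g x)\<^sup>2)"
    proof (intro AE_I2)
      fix x
      have "0 \<le> (f x + g x)\<^sup>2" by simp
      then have "(f x - g x)\<^sup>2 \<le> 2 * (f x)\<^sup>2 + 2 * (g x)\<^sup>2"
        by (simp add: power2_diff power2_sum)
      then show "norm ((f x - g x)\<^sup>2) \<le> norm (2 * (f x)\<^sup>2 + 2 * (g x)\<^sup>2)"
        by simp
    qed
  qed (use assms in \<open>auto simp: L2_torus_def\<close>)
  then show ?thesis
    using assms by (auto simp: L2_torus_def torus_fun_def)
qed

section \<open>Completeness of the trigonometric system\<close>

inductive trig_poly :: "(real^3 \<Rightarrow> complex) \<Rightarrow> bool" where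
  monomial: "trig_poly (\<lambda>x. c * ek k x)"
| add: "trig_poly p \<Longrightarrow> trig_poly q \<Longrightarrow> trig_poly (\<lambda>x. p x + q x)"

lemma trig_poly_mult:
  assumes "trig_poly p" "trig_poly q"
  shows "trig_poly (\<lambda>x. p x * q x)"
  using assms(1)
proof induction
  case (monomial c k)
  show ?case using assms(2)
  proof induction
    case (monomial d j)
    have "(\<lambda>x. c * ek k x * (d * ek j x)) = (\<lambda>x. (c * d) * ek (k + j) x)"
      by (simp add: ek_add fun_eq_iff mult_ac)
    then show ?case by (metis trig_poly.monomial)
  next
    case (add p q)
    then show ?case using trig_poly.add[OF add.IH] by (simp add: distrib_left)
  qed
next
  case (add p1 p2)
  then show ?case using trig_poly.add[OF add.IH] by (simp add: distrib_right)
qed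

lemma trig_poly_const: "trig_poly (\<lambda>x. c)"
  using trig_poly.monomial[of c 0] by simp

lemma trig_poly_sum:
  assumes "finite A" "\<And>i. i \<in> A \<Longrightarrow> trig_poly (p i)"
  shows "trig_poly (\<lambda>x. \<Sum>i\<in>A. p i x)"
  using assms
  by (induction A rule: finite_induct) (auto intro: trig_poly_const[of 0] trig_poly.add)

lemma ek_axis: "ek (axis i 1) x = cis (x $ i)"
proof -
  have "freq (axis i 1) = axis i 1" by (simp add: vec_eq_iff axis_def)
  then show ?thesis by (simp add: ek_def inner_axis')
qed

lemma trig_poly_cos: "trig_poly (\<lambda>x. complex_of_real (cos (x $ i)))"
  and trig_poly_sin: "trig_poly (\<lambda>x. complex_of_real (sin (x $ i)))"
proof -
  have "(\<lambda>x. complex_of_real (cos (x $ i))) = (\<lambda>x. 1/2 * ek (axis i 1) x + 1/2 * ek (- axis i 1) x)"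
    by (simp add: ek_axis cnj_ek[symmetric] complex_eq_iff fun_eq_iff)
  then show "trig_poly (\<lambda>x. complex_of_real (cos (x $ i)))"
    by (simp only: trig_poly.intros)
  have "(\<lambda>x. complex_of_real (sin (x $ i))) = (\<lambda>x. (- \<i>/2) * ek (axis i 1) x + (\<i>/2) * ek (- axis i 1) x)"
    by (simp add: ek_axis cnj_ek[symmetric] complex_eq_iff fun_eq_iff)
  then show "trig_poly (\<lambda>x. complex_of_real (sin (x $ i)))"
    by (simp only: trig_poly.intros)
qed

definition torus_embed :: "real^3 \<Rightarrow> (real^3) \<times> (real^3)" where
  "torus_embed x = (\<chi> i. cos (x $ i), \<chi> i. sin (x $ i))"

lemma continuous_torus_embed: "continuous_on A torus_embed"
  unfolding torus_embed_def by (intro continuous_intros)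

text \<open>On the image of \<open>torus_embed\<close> the coordinates of R^6 are the functions cos
  x_i and sin x_i, and products of characters are characters. Hence the polynomials of the
  Stone-Weierstrass theorem pull back to trigonometric polynomials.\<close>

lemma trig_poly_embed:
  assumes "real_polynomial_function q"
  shows "trig_poly (\<lambda>x. complex_of_real (q (torus_embed x)))"
  using assms
proof induction
  case (linear f)
  interpret f: bounded_linear f by fact
  have "f (torus_embed x) = (\<Sum>i\<in>UNIV. f (axis i 1, 0) * cos (x $ i)) + (\<Sum>i\<in>UNIV. f (0, axis i 1) * sin (x $ i))" for x
  proof -
    have dec: "v = (\<Sum>i\<in>UNIV. (v $ i) *\<^sub>R axis i 1)" for v :: "real^3"
      using basis_expansion[of v] by (simp add: scalar_mult_eq_scaleR)
    let ?u = "\<chi> i. cos (x $ i)" and ?v = "\<chi> i. sin (x $ i)"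
    have "torus_embed x = (\<Sum>i\<in>UNIV. (cos (x $ i)) *\<^sub>R (axis i 1, 0)) + (\<Sum>i\<in>UNIV. (sin (x $ i)) *\<^sub>R (0, axis i 1))"
      unfolding torus_embed_def using dec[of ?u] dec[of ?v]
      by (simp add: prod_eq_iff fst_sum snd_sum)
    then show ?thesis
      by (simp only: f.add f.sum f.scaleR) (simp add: mult.commute)
  qed
  then have eq: "(\<lambda>x. complex_of_real (f (torus_embed x)))
     = (\<lambda>x. (\<Sum>i\<in>UNIV. complex_of_real (f (axis i 1, 0)) * complex_of_real (cos (x $ i)))
          + (\<Sum>i\<in>UNIV. complex_of_real (f (0, axis i 1)) * complex_of_real (sin (x $ i))))"
    by simp
  show ?case unfolding eq
    by (intro trig_poly.add trig_poly_sum trig_poly_mult trig_poly_const trig_poly_cos trig_poly_sin) auto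
next
  case (const c)
  then show ?case by (rule trig_poly_const)
next
  case (add f g)
  then show ?case using trig_poly.add[OF add.IH] by simp
next
  case (mult f g)
  then show ?case using trig_poly_mult[OF mult.IH] by simp
qed

lemma LINT_trig_poly_zero:
  assumes f: "integrable torus f" and zero: "\<And>k. fourier_coeff f k = 0" and "trig_poly p"
  shows "(LINT x|torus. complex_of_real (f x) * p x) = 0 \<and> integrable torus (\<lambda>x. complex_of_real (f x) * p x)"
  using assms(3)
proof induction
  case (monomial c k)
  have "(LINT x|torus. complex_of_real (f x) * ek k x) = 0"
    using zero[of "- k"] by (simp add: fourier_coeff_ek)
  moreover have "integrable torus (\<lambda>x. complex_of_real (f x) * ek k x)"
    using f by (intro integrable_mult_ek) auto
  ultimately show ?case
    using integral_mult_right_zero[of torus c "\<lambda>x. complex_of_real (f x) * ek k x"]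
    by (simp add: mult.left_commute)
next
  case (add p q)
  then show ?case by (simp add: distrib_left)
qed

text \<open>The embedding identifies only points on the faces: equal cosines and sines mean that
  coordinates differ by a multiple of 2 pi, and an interior coordinate of one point leaves only the
  multiple 0.\<close>

lemma torus_embed_eq_interior:
  assumes "x \<in> cell" "y \<in> cell" "torus_embed x = torus_embed y" "x \<in> interior cell"
  shows "x = y"
proof -
  have "x $ i = y $ i" for i
  proof -
    have "cos (x $ i) = cos (y $ i)" "sin (x $ i) = sin (y $ i)"
      using assms(3) by (auto simp: torus_embed_def vec_eq_iff)
    then obtain n :: int where n: "x $ i = y $ i + 2 * pi * n"
      using sin_cos_eq_iff[of "x $ i" "y $ i"] by auto
    have b: "0 < x $ i" "x $ i < 2 * pi" "0 \<le> y $ i" "y $ i \<le> 2 * pi"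
      using assms by (auto simp: mem_box_cart interior_cbox)
    have "\<not> n \<ge> 1"
    proof
      assume "n \<ge> 1"
      then have "2 * pi * 1 \<le> 2 * pi * n" by (intro mult_left_mono) auto
      then show False using n b by linarith
    qed
    moreover have "\<not> n \<le> -1"
    proof
      assume "n \<le> -1"
      then have "2 * pi * n \<le> 2 * pi * (-1)" by (intro mult_left_mono) auto
      then show False using n b by linarith
    qed
    ultimately have "n = 0" by linarith
    then show ?thesis using n by simp
  qed
  then show ?thesis by (simp add: vec_eq_iff)
qed

lemma trig_approx:
  fixes h :: "real^3 \<Rightarrow> real"
  assumes h: "continuous_on UNIV h" and bd: "\<And>x. x \<in> cell - interior cell \<Longrightarrow> h x = 0" and "e > 0"
  obtains p where "trig_poly p" "\<And>x. x \<in> cell \<Longrightarrow> norm (complex_of_real (h x) - p x) < e"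
proof -
  \<comment> \<open>\<open>H\<close> transports \<open>h\<close> to the image. The choice is
    harmless: two points of the cell with the same image are equal or both on the boundary, where
    \<open>h\<close> vanishes.\<close>
  define H where "H z = h (SOME x. x \<in> cell \<and> torus_embed x = z)" for z
  have H: "H (torus_embed x) = h x" if "x \<in> cell" for x
  proof -
    define y where "y = (SOME y. y \<in> cell \<and> torus_embed y = torus_embed x)"
    have "y \<in> cell \<and> torus_embed y = torus_embed x"
      unfolding y_def by (rule someI[of _ x]) (use that in auto)
    then have y: "y \<in> cell" "torus_embed y = torus_embed x" by auto
    have "h y = h x"
    proof (cases "x \<in> interior cell \<or> y \<in> interior cell")
      case True
      then show ?thesis using torus_embed_eq_interior[of x y] torus_embed_eq_interior[of y x] that y by auto
    next
      case False
      then show ?thesis using bd that y by simp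
    qed
    then show ?thesis by (simp add: H_def y_def)
  qed
  have comp: "compact (torus_embed ` cell)"
    by (intro compact_continuous_image continuous_torus_embed compact_cbox)
  \<comment> \<open>On the compact cell \<open>torus_embed\<close> maps closed sets to closed sets,
    so it is a quotient map onto its image, and continuity of \<open>H\<close> follows from that of
    \<open>h\<close>.\<close>
  have "continuous_on (torus_embed ` cell) H"
    unfolding continuous_on_closed_invariant
  proof (intro allI impI)
    fix B :: "real set" assume "closed B"
    have "closed (h -` B)"
      using continuous_closed_vimage[OF \<open>closed B\<close>, of h] h by (simp add: continuous_on_eq_continuous_at)
    then have "compact (cell \<inter> h -` B)"
      by (intro compact_Int_closed compact_cbox)
    then have "closed (torus_embed ` (cell \<inter> h -` B))"
      by (intro compact_imp_closed compact_continuous_image continuous_torus_embed)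
    moreover have "torus_embed ` (cell \<inter> h -` B) \<inter> torus_embed ` cell = H -` B \<inter> torus_embed ` cell"
      using H by (auto simp: image_iff)
    ultimately show "\<exists>A. closed A \<and> A \<inter> torus_embed ` cell = H -` B \<inter> torus_embed ` cell"
      by blast
  qed
  from Stone_Weierstrass_real_polynomial_function[OF comp this \<open>e > 0\<close>]
  obtain q where q: "real_polynomial_function q" "\<And>z. z \<in> torus_embed ` cell \<Longrightarrow> \<bar>H z - q z\<bar> < e"
    by blast
  show thesis
  proof (rule that[OF trig_poly_embed[OF q(1)]])
    fix x assume x: "x \<in> cell"
    then show "norm (complex_of_real (h x) - complex_of_real (q (torus_embed x))) < e"
      using q(2)[of "torus_embed x"] H[OF x] by (simp flip: of_real_diff)
  qed
qed

text \<open>Against a trigonometric polynomial the integral vanishes, and uniform approximation of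
  \<open>h\<close> within \<open>e\<close> leaves an error of at most \<open>e\<close> times the L^1
  norm of \<open>f\<close>.\<close>

lemma fourier_coeff_zero_continuous:
  fixes h :: "real^3 \<Rightarrow> real"
  assumes f: "integrable torus f" and zero: "\<And>k. fourier_coeff f k = 0"
    and h: "continuous_on UNIV h" and bd: "\<And>x. x \<in> cell - interior cell \<Longrightarrow> h x = 0"
    and int: "integrable torus (\<lambda>x. f x * h x)"
  shows "(LINT x|torus. f x * h x) = 0"
proof -
  let ?I = "LINT x|torus. \<bar>f x\<bar>"
  have "\<bar>LINT x|torus. f x * h x\<bar> \<le> e * ?I" if "e > 0" for e
  proof -
    obtain p where p: "trig_poly p" "\<And>x. x \<in> cell \<Longrightarrow> norm (complex_of_real (h x) - p x) < e"
      using trig_approx[OF h bd \<open>e > 0\<close>] by blast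
    note P = LINT_trig_poly_zero[OF f zero p(1)]
    have "complex_of_real (LINT x|torus. f x * h x) = (LINT x|torus. complex_of_real (f x * h x))"
      by (rule integral_complex_of_real[symmetric])
    also have "\<dots> = (LINT x|torus. complex_of_real (f x * h x) - complex_of_real (f x) * p x)"
      using int P by (subst Bochner_Integration.integral_diff) (auto simp del: of_real_mult)
    also have "norm \<dots> \<le> (LINT x|torus. e * \<bar>f x\<bar>)"
    proof (rule Bochner_Integration.integral_norm_bound_integral)
      show "norm (complex_of_real (f x * h x) - complex_of_real (f x) * p x) \<le> e * \<bar>f x\<bar>"
        if "x \<in> space torus" for x
      proof -
        have "norm (complex_of_real (f x * h x) - complex_of_real (f x) * p x) = \<bar>f x\<bar> * norm (complex_of_real (h x) - p x)"
          by (simp add: right_diff_distrib[symmetric] norm_mult)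
        also have "\<dots> \<le> \<bar>f x\<bar> * e"
          using p(2)[of x] that by (intro mult_left_mono) auto
        finally show ?thesis by (simp add: mult.commute)
      qed
    qed (use f int P in \<open>auto simp del: of_real_mult\<close>)
    finally show ?thesis by simp
  qed
  note le = this
  show ?thesis
  proof (rule ccontr)
    assume "(LINT x|torus. f x * h x) \<noteq> 0"
    then have pos: "\<bar>LINT x|torus. f x * h x\<bar> > 0" by simp
    have I: "?I \<ge> 0" by simp
    define e where "e = \<bar>LINT x|torus. f x * h x\<bar> / (2 * (?I + 1))"
    have "e > 0" unfolding e_def by (intro divide_pos_pos mult_pos_pos add_nonneg_pos pos I) auto
    have "e * ?I \<le> e * (?I + 1)" using \<open>e > 0\<close> by simp
    also have "\<dots> = \<bar>LINT x|torus. f x * h x\<bar> / 2" unfolding e_def using add_nonneg_pos[OF I zero_less_one] by (simp add: field_simps)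
    finally show False using le[OF \<open>e > 0\<close>] pos by linarith
  qed
qed

text \<open>Stone--Weierstrass on the image of the torus under \<open>torus_embed\<close> lets us test \<open>f\<close> with continuous
  functions vanishing on the faces of the cell. Choosing cut-off approximations of \<open>sgn f\<close> gives
  \<open>\<integral>|f| = 0\<close>.\<close>

theorem fourier_coeff_zero_imp_AE_zero:
  assumes f: "integrable torus f" and zero: "\<And>k. fourier_coeff f k = 0"
  shows "AE x in torus. f x = 0"
proof -
  have fm [measurable]: "f \<in> borel_measurable torus" using f by auto
  have "(\<lambda>x. sgn (f x)) \<in> borel_measurable torus" by measurable
  then have "(\<lambda>x. if x \<in> cell then sgn (f x) else 0) \<in> borel_measurable lebesgue"
    unfolding torus_def by (intro borel_measurable_if_I) auto
  then have "(\<lambda>x. if x \<in> cell then sgn (f x) else 0) measurable_on UNIV"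
    by (intro lebesgue_measurable_imp_measurable_on) auto
  \<comment> \<open>The sign of \<open>f\<close>, extended by 0, is almost everywhere a limit of
    functions continuous on the whole space; they are the raw material for the test
    functions.\<close>
  then obtain N g where N: "negligible N" and g: "\<And>n. continuous_on UNIV (g n)"
    and lim: "\<And>x. x \<notin> N \<Longrightarrow> (\<lambda>n. g n x) \<longlonglongrightarrow> (if x \<in> cell then sgn (f x) else 0)"
    unfolding measurable_on_def by auto
  \<comment> \<open>Clamping to [-1,1] does not change the limit and makes |f| a dominating
    function. The cut-off \<open>chi n\<close> vanishes on the faces, as
    \<open>fourier_coeff_zero_continuous\<close> requires, and is eventually 1 at each point off
    them.\<close>
  define clamp where "clamp y = max (-1) (min 1 y)" for y :: real
  define chi where "chi n x = min 1 (real n * infdist x (frontier cell))" for n and x :: "real^3"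
  define h where "h n x = clamp (g n x) * chi n x" for n x
  have h_cont: "continuous_on UNIV (h n)" for n
    unfolding h_def clamp_def chi_def by (intro continuous_intros g)
  have chi01: "0 \<le> chi n x" "chi n x \<le> 1" for n x
    unfolding chi_def by (auto simp: infdist_nonneg)
  have h1: "\<bar>h n x\<bar> \<le> 1" for n x
  proof -
    have "\<bar>clamp (g n x)\<bar> \<le> 1" by (auto simp: clamp_def)
    then show ?thesis unfolding h_def abs_mult using chi01[of n x] by (intro mult_le_one) auto
  qed
  have h_meas: "h n \<in> borel_measurable torus" for n
    by (intro continuous_imp_measurable_torus h_cont)
  have h_int: "integrable torus (\<lambda>x. f x * h n x)" for n
  proof (rule Bochner_Integration.integrable_bound[OF f])
    show "AE x in torus. norm (f x * h n x) \<le> norm (f x)"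
      using h1[of n] by (auto simp: abs_mult intro!: AE_I2 mult_left_le)
  qed (use h_meas[of n] in measurable)
  have zero_n: "(LINT x|torus. f x * h n x) = 0" for n
  proof (rule fourier_coeff_zero_continuous[OF f zero h_cont _ h_int])
    fix x assume "x \<in> cell - interior cell"
    then have "x \<in> frontier cell" by (simp add: frontier_def)
    then show "h n x = 0" by (simp add: h_def chi_def)
  qed
  have "frontier cell = cell - box 0 (\<chi> i. 2 * pi)"
    by (simp add: frontier_def interior_cbox)
  then have neg: "negligible (N \<union> frontier cell)"
    using negligible_frontier_interval[of "0 :: real^3" "\<chi> i. 2 * pi"] N by (simp add: negligible_Un)
  then have "AE x in lebesgue. x \<notin> N \<union> frontier cell"
    using AE_not_in negligible_iff_null_sets by blast
  then have "AE x in lebesgue. x \<in> cell \<longrightarrow> x \<notin> N \<union> frontier cell"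
    by (rule AE_mp) (simp add: AE_I2)
  then have ae: "AE x in torus. x \<notin> N \<union> frontier cell"
    unfolding torus_def by (subst AE_restrict_space_iff) auto
  have "AE x in torus. (\<lambda>n. f x * h n x) \<longlonglongrightarrow> \<bar>f x\<bar>"
    using ae
  proof (rule AE_mp, intro AE_I2 impI)
    fix x assume "x \<in> space torus" and x: "x \<notin> N \<union> frontier cell"
    then have "x \<in> cell" by simp
    have "(\<lambda>n. clamp (g n x)) \<longlonglongrightarrow> clamp (sgn (f x))"
      unfolding clamp_def using lim[of x] x \<open>x \<in> cell\<close> by (intro tendsto_intros) auto
    moreover have "clamp (sgn (f x)) = sgn (f x)" by (auto simp: clamp_def sgn_if)
    moreover have "(\<lambda>n. chi n x) \<longlonglongrightarrow> 1"
    proof (rule tendsto_eventually)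
      have fr: "frontier cell \<noteq> {}"
        using frontier_not_empty[of cell] \<open>x \<in> cell\<close> bounded_cbox[of 0 "\<chi> i. 2 * pi"] not_bounded_UNIV
        by (metis empty_iff)
      have "infdist x (frontier cell) > 0"
        using x fr by (simp add: infdist_pos_not_in_closed)
      then obtain m :: nat where m: "1 < real m * infdist x (frontier cell)"
        using reals_Archimedean3 by blast
      show "eventually (\<lambda>n. chi n x = 1) sequentially"
      proof (rule eventually_sequentiallyI[of m])
        fix n assume "m \<le> n"
        then have "real m * infdist x (frontier cell) \<le> real n * infdist x (frontier cell)"
          by (intro mult_right_mono) (auto simp: infdist_nonneg)
        then show "chi n x = 1" using m by (simp add: chi_def)
      qed
    qed
    ultimately have "(\<lambda>n. f x * h n x) \<longlonglongrightarrow> f x * (sgn (f x) * 1)"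
      unfolding h_def by (intro tendsto_intros) auto
    then show "(\<lambda>n. f x * h n x) \<longlonglongrightarrow> \<bar>f x\<bar>" by (simp add: abs_sgn)
  qed
  then have "(\<lambda>n. LINT x|torus. f x * h n x) \<longlonglongrightarrow> (LINT x|torus. \<bar>f x\<bar>)"
  proof (rule integral_dominated_convergence[where w = "\<lambda>x. \<bar>f x\<bar>", rotated 3])
    show "AE x in torus. norm (f x * h n x) \<le> \<bar>f x\<bar>" for n
      using h1[of n] by (auto simp: abs_mult intro!: AE_I2 mult_left_le)
  qed (use f h_int in auto)
  then have "(LINT x|torus. \<bar>f x\<bar>) = 0"
    by (simp add: zero_n LIMSEQ_const_iff)
  then have "AE x in torus. \<bar>f x\<bar> = 0"
    using integral_nonneg_eq_0_iff_AE[of torus "\<lambda>x. \<bar>f x\<bar>"] f by simp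
  then show ?thesis by simp
qed

text \<open>An integrable function with summable coefficients has a continuous representative;
  through it the termwise formulas for \<open>fser\<close> apply to test functions and to
  solutions.\<close>

lemma AE_eq_rser:
  assumes f: "integrable torus f" and c: "(\<lambda>k. norm (fourier_coeff f k)) summable_on UNIV"
  shows "AE x in torus. f x = rser (fourier_coeff f) x"
proof -
  have r: "integrable torus (rser (fourier_coeff f))"
    by (intro L2_torus_integrable rser_L2 c)
  have "AE x in torus. f x - rser (fourier_coeff f) x = 0"
    using f r by (intro fourier_coeff_zero_imp_AE_zero)
      (auto simp: fourier_coeff_diff fourier_coeff_rser c hermitian_fourier_coeff)
  then show ?thesis by simp
qed

lemma AE_eq_of_fourier_coeff_eq:
  assumes f: "integrable torus f" and g: "integrable torus g"
    and eq: "\<And>k. fourier_coeff f k = fourier_coeff g k"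
  shows "AE x in torus. f x = g x"
proof -
  have "AE x in torus. f x - g x = 0"
    using f g by (intro fourier_coeff_zero_imp_AE_zero) (auto simp: fourier_coeff_diff eq)
  then show ?thesis by simp
qed

section \<open>Smooth functions on the torus\<close>

lemma torus_fun_partial_deriv:
  assumes "torus_fun f" "\<And>x. f differentiable (at x)"
  shows "torus_fun (partial_deriv i f)"
  unfolding torus_fun_def
proof (intro allI)
  fix x :: "real^3" and j :: 3
  let ?c = "axis j (2 * pi) :: real^3"
  have "(f has_derivative frechet_derivative f (at (x + ?c))) (at (x + ?c))"
    using assms(2) frechet_derivative_works by blast
  moreover have "((\<lambda>y. y + ?c) has_derivative (\<lambda>h. h)) (at x)"
    by (auto intro!: derivative_eq_intros)
  ultimately have "((\<lambda>y. f (y + ?c)) has_derivative frechet_derivative f (at (x + ?c))) (at x)"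
    using has_derivative_compose by blast
  then have "(f has_derivative frechet_derivative f (at (x + ?c))) (at x)"
    using assms(1) by (simp add: torus_fun_def)
  then have "frechet_derivative f (at (x + ?c)) = frechet_derivative f (at x)"
    by (rule frechet_derivative_at)
  then show "partial_deriv i f (x + ?c) = partial_deriv i f x"
    by (simp add: partial_deriv_def)
qed

lemma partial_deriv_line:
  assumes "\<And>x. f differentiable (at x)"
  shows "((\<lambda>t. f (x + axis i t)) has_real_derivative partial_deriv i f (x + axis i t)) (at t)"
proof -
  let ?D = "frechet_derivative f (at (x + axis i t))"
  have D: "(f has_derivative ?D) (at (x + axis i t))"
    using assms frechet_derivative_works by blast
  have ax: "axis i r = r *\<^sub>R (axis i 1 :: real^3)" for r :: real
    by (simp add: vec_eq_iff axis_def)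
  have "((\<lambda>t. x + t *\<^sub>R axis i 1) has_derivative (\<lambda>h. h *\<^sub>R axis i 1)) (at t)"
    by (auto intro!: derivative_eq_intros)
  from has_derivative_compose[OF this, of f ?D] D
  have "((\<lambda>t. f (x + t *\<^sub>R axis i 1)) has_derivative (\<lambda>h. ?D (h *\<^sub>R axis i 1))) (at t)"
    by (simp add: ax[of t])
  moreover have "?D (h *\<^sub>R axis i 1) = h * partial_deriv i f (x + axis i t)" for h
    using linear_scale[OF has_derivative_linear[OF D]] by (simp add: partial_deriv_def)
  ultimately have "((\<lambda>t. f (x + t *\<^sub>R axis i 1)) has_derivative (\<lambda>h. h * partial_deriv i f (x + axis i t))) (at t)"
    by simp
  moreover have "(\<lambda>h. h * P) = (*) P" for P :: real by (simp add: fun_eq_iff mult.commute)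
  ultimately show ?thesis
    unfolding has_field_derivative_def by (simp add: ax[symmetric])
qed

lemma cis_quotient_limit:
  "(\<lambda>n. (cis (a * (1 / real (Suc n))) - 1) * of_nat (Suc n)) \<longlonglongrightarrow> \<i> * complex_of_real a"
proof -
  have "((\<lambda>z. exp (\<i> * complex_of_real a * z)) has_field_derivative \<i> * complex_of_real a) (at 0)"
    by (auto intro!: derivative_eq_intros)
  then have lim: "((\<lambda>z. (exp (\<i> * complex_of_real a * z) - 1) / z) \<longlongrightarrow> \<i> * complex_of_real a) (at 0)"
    by (simp add: has_field_derivative_iff)
  have l0: "(\<lambda>n. complex_of_real (1 / real (Suc n))) \<longlonglongrightarrow> 0"
    using tendsto_of_real[OF LIMSEQ_inverse_real_of_nat, where ?'a = complex]
    by (simp add: inverse_eq_divide del: of_nat_Suc)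
  have ne: "complex_of_real (1 / real (Suc n)) \<noteq> 0" for n by (simp del: of_nat_Suc)
  have "filterlim (\<lambda>n. complex_of_real (1 / real (Suc n))) (at 0) sequentially"
    unfolding filterlim_at by (intro conjI always_eventually allI l0) (use ne in blast)+
  from filterlim_compose[OF lim this]
  show ?thesis
    by (simp add: cis_conv_exp mult_ac)
qed

lemma norm_fourier_coeff_le:
  assumes "integrable torus f"
  shows "norm (fourier_coeff f k) \<le> (LINT x|torus. \<bar>f x\<bar>)"
proof -
  have pi1: "(2 * pi) ^ 3 \<ge> 1"
    using pi_gt3 by (intro one_le_power) auto
  have "norm (LINT x|torus. complex_of_real (f x) * ek (- k) x) \<le> (LINT x|torus. \<bar>f x\<bar>)"
    using assms integrable_mult_ek[of "\<lambda>x. complex_of_real (f x)" "- k"]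
    by (intro Bochner_Integration.integral_norm_bound_integral) (auto simp: norm_mult)
  moreover have "norm (fourier_coeff f k) = norm (LINT x|torus. complex_of_real (f x) * ek (- k) x) / (2 * pi) ^ 3"
    unfolding fourier_coeff_ek by simp
  moreover have "y / (2 * pi) ^ 3 \<le> y" if "y \<ge> 0" for y :: real
    using mult_left_mono[OF pi1 that] pi1 by (simp add: field_simps)
  ultimately show ?thesis
    by (smt (verit) norm_ge_zero)
qed

text \<open>Difference quotients replace integration by parts: translation invariance moves the
  shift onto the character, which produces the factor (cis (k_i h) - 1) / h, and h tends to 0 on
  both sides. The mean value theorem supplies the pointwise limit and the bound for dominated
  convergence.\<close>

lemma fourier_coeff_partial_deriv:
  assumes per: "torus_fun f" and d: "\<And>x. f differentiable (at x)"
    and c: "continuous_on UNIV (partial_deriv i f)"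
  shows "fourier_coeff (partial_deriv i f) k = \<i> * of_int (k $ i) * fourier_coeff f k"
proof -
  let ?D = "partial_deriv i f"
  have fc: "continuous_on UNIV f"
    using d by (simp add: continuous_on_eq_continuous_at differentiable_imp_continuous_within)
  have shift_c: "continuous_on UNIV (\<lambda>x. f (x + axis i h))" for h
    by (intro continuous_on_compose2[OF fc] continuous_intros) auto
  define h where "h n = 1 / real (Suc n)" for n
  have h: "0 < h n" "h n \<le> 1" for n
    unfolding h_def by auto
  have h2: "h n \<le> 2 * pi" for n
    using h(2)[of n] pi_gt3 by linarith
  define q where "q n x = (f (x + axis i (h n)) - f x) * real (Suc n)" for n x
  define A where "A = (LINT x|torus. complex_of_real (f x) * ek (- k) x)"
  have int_f: "integrable torus (\<lambda>x. complex_of_real (f x) * ek (- k) x)"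
    by (intro continuous_imp_integrable_torus continuous_intros fc)
  have int_sh: "integrable torus (\<lambda>x. complex_of_real (f (x + axis i h)) * ek (- k) x)" for h
    by (intro continuous_imp_integrable_torus continuous_intros shift_c)
  have sh: "(LINT x|torus. complex_of_real (f (x + axis i (h n))) * ek (- k) x) = cis (of_int (k $ i) * h n) * A" for n
  proof -
    have "(LINT x|torus. complex_of_real (f (x + axis i (h n))) * ek (- k) (x + axis i (h n))) = A"
      unfolding A_def
    proof (rule torus_translation[where f = "\<lambda>x. complex_of_real (f x) * ek (- k) x"])
      show "continuous_on UNIV (\<lambda>x. complex_of_real (f x) * ek (- k) x)"
        by (intro continuous_intros fc)
    qed (use per h[of n] h2[of n] in \<open>auto simp: torus_fun_def ek_periodic less_imp_le\<close>)
    moreover have "complex_of_real (f (x + axis i (h n))) * ek (- k) x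
      = cis (of_int (k $ i) * h n) * (complex_of_real (f (x + axis i (h n))) * ek (- k) (x + axis i (h n)))" for x
    proof -
      have "cis (of_int (k $ i) * h n) * cis (- (of_int (k $ i) * h n)) = 1" by (simp add: cis_mult)
      then show ?thesis by (simp add: ek_shift mult_ac)
    qed
    ultimately show ?thesis by (simp only: integral_mult_right_zero)
  qed
  have q_int: "(LINT x|torus. complex_of_real (q n x) * ek (- k) x)
      = (cis (of_int (k $ i) * h n) - 1) * of_nat (Suc n) * A" for n
  proof -
    have "complex_of_real (q n x) * ek (- k) x = (complex_of_real (f (x + axis i (h n))) * ek (- k) x
        - complex_of_real (f x) * ek (- k) x) * of_nat (Suc n)" for x
      by (simp add: q_def algebra_simps)
    then have "(LINT x|torus. complex_of_real (q n x) * ek (- k) x)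
      = (LINT x|torus. complex_of_real (f (x + axis i (h n))) * ek (- k) x
        - complex_of_real (f x) * ek (- k) x) * of_nat (Suc n)"
      by (simp only: integral_mult_left_zero)
    also have "\<dots> = (cis (of_int (k $ i) * h n) * A - A) * of_nat (Suc n)"
      by (simp only: Bochner_Integration.integral_diff[OF int_sh int_f] sh A_def[symmetric])
    finally show ?thesis by (simp add: algebra_simps)
  qed
  have q_mv: "\<exists>z. 0 < z \<and> z < h n \<and> q n x = ?D (x + axis i z)" for n x
  proof -
    have "\<exists>z. 0 < z \<and> z < h n \<and> f (x + axis i (h n)) - f (x + axis i 0) = (h n - 0) * ?D (x + axis i z)"
      by (rule MVT2[OF h(1)]) (rule partial_deriv_line[OF d])
    moreover have "axis i 0 = (0 :: real^3)" by (simp add: vec_eq_iff axis_def)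
    ultimately obtain z where z: "0 < z" "z < h n" "f (x + axis i (h n)) - f x = h n * ?D (x + axis i z)"
      by auto
    have "h n * real (Suc n) = 1" by (simp add: h_def)
    then have "q n x = ?D (x + axis i z)"
      unfolding q_def z(3) by (simp add: mult_ac del: of_nat_Suc)
    then show ?thesis using z by blast
  qed
  \<comment> \<open>The intermediate point of the mean value theorem may leave the cell by less than
    1, so the derivative is bounded on a box enlarged by 1.\<close>
  have "compact (cbox (0::real^3) (\<chi> i. 2 * pi + 1))" by (rule compact_cbox)
  then have "compact (?D ` cbox (0::real^3) (\<chi> i. 2 * pi + 1))"
    by (intro compact_continuous_image continuous_on_subset[OF c]) auto
  then obtain B where B: "\<And>y. y \<in> cbox (0::real^3) (\<chi> i. 2 * pi + 1) \<Longrightarrow> \<bar>?D y\<bar> \<le> B"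
    using compact_imp_bounded bounded_iff by (metis image_eqI real_norm_def)
  have q_bd: "\<bar>q n x\<bar> \<le> B" if "x \<in> cell" for n x
  proof -
    obtain z where z: "0 < z" "z < h n" "q n x = ?D (x + axis i z)" using q_mv by blast
    have "x + axis i z \<in> cbox (0::real^3) (\<chi> i. 2 * pi + 1)"
      using that z h(2)[of n] by (auto simp: mem_box_cart axis_def) (smt (verit))+
    then show ?thesis using B z(3) by simp
  qed
  have q_lim: "(\<lambda>n. q n x) \<longlonglongrightarrow> ?D x" for x
  proof -
    obtain z where z: "\<And>n. 0 < z n \<and> z n < h n \<and> q n x = ?D (x + axis i (z n))"
      using choice[of "\<lambda>n z. 0 < z \<and> z < h n \<and> q n x = ?D (x + axis i z)"] q_mv by blast
    have "(\<lambda>n. h n) \<longlonglongrightarrow> 0"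
      unfolding h_def using LIMSEQ_inverse_real_of_nat by (simp add: inverse_eq_divide)
    then have "(\<lambda>n. z n) \<longlonglongrightarrow> 0"
      by (rule tendsto_sandwich[OF _ _ tendsto_const, rotated 2]) (use z in \<open>auto simp: less_imp_le\<close>)
    then have "(\<lambda>n. x + z n *\<^sub>R axis i 1) \<longlonglongrightarrow> x + 0 *\<^sub>R axis i 1"
      by (intro tendsto_intros)
    moreover have "x + axis i (z n) = x + z n *\<^sub>R axis i 1" for n
      by (simp add: vec_eq_iff axis_def)
    ultimately have "(\<lambda>n. x + axis i (z n)) \<longlonglongrightarrow> x" by simp
    moreover have "isCont ?D x" using c by (simp add: continuous_on_eq_continuous_at)
    ultimately have "(\<lambda>n. ?D (x + axis i (z n))) \<longlonglongrightarrow> ?D x" by (rule isCont_tendsto_compose[rotated])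
    then show ?thesis using z by simp
  qed
  have fin: "integrable torus (\<lambda>x::real^3. B)"
    by (intro continuous_imp_integrable_torus continuous_intros)
  have "(\<lambda>n. LINT x|torus. complex_of_real (q n x) * ek (- k) x) \<longlonglongrightarrow> (LINT x|torus. complex_of_real (?D x) * ek (- k) x)"
  proof (rule integral_dominated_convergence[where w = "\<lambda>x. B"])
    show "(\<lambda>x. complex_of_real (?D x) * ek (- k) x) \<in> borel_measurable torus"
      by (intro continuous_imp_measurable_torus continuous_intros c)
    show "(\<lambda>x. complex_of_real (q n x) * ek (- k) x) \<in> borel_measurable torus" for n
      unfolding q_def by (intro continuous_imp_measurable_torus continuous_intros fc shift_c)
    show "AE x in torus. (\<lambda>n. complex_of_real (q n x) * ek (- k) x) \<longlonglongrightarrow> complex_of_real (?D x) * ek (- k) x"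
      by (intro AE_I2 tendsto_intros q_lim)
    show "AE x in torus. norm (complex_of_real (q n x) * ek (- k) x) \<le> B" for n
      using q_bd[of _ n] by (intro AE_I2) (simp add: norm_mult)
  qed (rule fin)
  moreover have "(\<lambda>n. LINT x|torus. complex_of_real (q n x) * ek (- k) x) \<longlonglongrightarrow> \<i> * complex_of_real (of_int (k $ i)) * A"
    unfolding q_int h_def by (intro tendsto_intros cis_quotient_limit)
  ultimately have "(LINT x|torus. complex_of_real (?D x) * ek (- k) x) = \<i> * of_int (k $ i) * A"
    using LIMSEQ_unique by fastforce
  then show ?thesis by (simp add: fourier_coeff_ek A_def scaleR_conv_of_real mult_ac)
qed

lemma smooth_torusD:
  assumes "\<phi> \<in> smooth_torus"
  shows "torus_fun \<phi>" "\<phi> differentiable (at x)" "partial_deriv i \<phi> \<in> smooth_torus" "continuous_on UNIV \<phi>"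
proof -
  have "Ck (Suc n) \<phi>" for n using assms unfolding smooth_torus_def by blast
  then have d: "\<phi> differentiable (at x)" and c: "Ck n (partial_deriv i \<phi>)" for x n i by auto
  show "torus_fun \<phi>" "\<phi> differentiable (at x)" using assms d by (auto simp: smooth_torus_def)
  show "partial_deriv i \<phi> \<in> smooth_torus"
    unfolding smooth_torus_def using c torus_fun_partial_deriv[OF \<open>torus_fun \<phi>\<close> d] by simp
  have "Ck 0 \<phi>" using assms unfolding smooth_torus_def by blast
  then show "continuous_on UNIV \<phi>" by simp
qed

lemma smooth_torus_partial_coeff:
  assumes "\<phi> \<in> smooth_torus"
  shows "fourier_coeff (partial_deriv i \<phi>) k = \<i> * of_int (k $ i) * fourier_coeff \<phi> k"
  using assms smooth_torusD by (intro fourier_coeff_partial_deriv) blast+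

lemma smooth_torus_iterated_coeff:
  assumes "\<phi> \<in> smooth_torus"
  shows "(partial_deriv i ^^ n) \<phi> \<in> smooth_torus \<and>
    fourier_coeff ((partial_deriv i ^^ n) \<phi>) k = (\<i> * of_int (k $ i)) ^ n * fourier_coeff \<phi> k"
proof (induction n)
  case (Suc n)
  then show ?case
    using smooth_torusD(3)[of "(partial_deriv i ^^ n) \<phi>" i] smooth_torus_partial_coeff[of "(partial_deriv i ^^ n) \<phi>" i k]
    by (simp add: mult_ac)
qed (use assms in simp)

text \<open>Six derivatives along each axis bound m^6 times the coefficient, where m is the largest
  of 1 and the |k_i|. The squared bracket is at most 4 m^2, whence 64 = 4^3. Of the six powers two
  are spent in \<open>smooth_torus_summable\<close>; the other four make the sum over the lattice
  converge.\<close>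

lemma smooth_torus_decay:
  assumes "\<phi> \<in> smooth_torus"
  obtains C where "\<And>k. (jb k) ^ 6 * norm (fourier_coeff \<phi> k) \<le> C"
proof -
  define C where "C i = (LINT x|torus. \<bar>(partial_deriv i ^^ 6) \<phi> x\<bar>)" for i
  have smooth_int: "integrable torus \<psi>" if "\<psi> \<in> smooth_torus" for \<psi>
    using smooth_torusD(4)[OF that] by (rule continuous_imp_integrable_torus)
  have C: "\<bar>of_int (k $ i)\<bar> ^ 6 * norm (fourier_coeff \<phi> k) \<le> C i" for k i
  proof -
    have "norm (fourier_coeff ((partial_deriv i ^^ 6) \<phi>) k) \<le> C i"
      unfolding C_def by (intro norm_fourier_coeff_le smooth_int) (use smooth_torus_iterated_coeff[OF assms] in blast)
    then show ?thesis
      using smooth_torus_iterated_coeff[OF assms, where i = i and n = 6 and k = k] by (simp add: norm_mult norm_power power_mult_distrib)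
  qed
  define C0 where "C0 = (LINT x|torus. \<bar>\<phi> x\<bar>)"
  have C0: "norm (fourier_coeff \<phi> k) \<le> C0" for k
    unfolding C0_def by (intro norm_fourier_coeff_le smooth_int assms)
  have nn: "0 \<le> C0" "0 \<le> C i" for i unfolding C0_def C_def by (rule Bochner_Integration.integral_nonneg, simp)+
  define K where "K = C0 + (\<Sum>i\<in>UNIV. C i)"
  have K0: "C0 \<le> K" unfolding K_def using nn(2) by (simp add: sum_nonneg)
  have Ki: "C i \<le> K" for i
    unfolding K_def using member_le_sum[of i UNIV C] nn by simp
  show thesis
  proof (rule that[of "64 * K"])
    fix k
    define y where "y = norm (fourier_coeff \<phi> k)"
    have y: "y \<ge> 0" by (simp add: y_def)
    define m where "m = Max {1, \<bar>of_int (k $ 1)\<bar>, \<bar>of_int (k $ 2)\<bar>, \<bar>of_int (k $ 3)\<bar> :: real}"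
    have m: "1 \<le> m" "\<bar>of_int (k $ 1)\<bar> \<le> m" "\<bar>of_int (k $ 2)\<bar> \<le> m" "\<bar>of_int (k $ 3)\<bar> \<le> m"
      unfolding m_def by (rule Max_ge; simp)+
    have sqm: "(of_int (k $ i))\<^sup>2 \<le> m\<^sup>2" if "\<bar>of_int (k $ i)\<bar> \<le> m" for i
      using power_mono[OF that, of 2] by simp
    have "(jb k)\<^sup>2 = 1 + ((of_int (k $ 1))\<^sup>2 + (of_int (k $ 2))\<^sup>2 + (of_int (k $ 3))\<^sup>2)"
      unfolding jb_sq by (simp add: norm_eq_sqrt_inner inner_vec_def sum_3 power2_eq_square)
    also have "\<dots> \<le> m\<^sup>2 + (m\<^sup>2 + m\<^sup>2 + m\<^sup>2)"
      using m(1) by (intro add_mono sqm m(2-4)) simp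
    finally have "((jb k)\<^sup>2) ^ 3 \<le> (4 * m\<^sup>2) ^ 3" by (intro power_mono) auto
    then have le: "(jb k) ^ 6 \<le> 64 * m ^ 6" by (simp add: power_mult_distrib flip: power_mult)
    have m6: "m ^ 6 * y \<le> K"
    proof -
      have "m \<in> {1, \<bar>of_int (k $ 1)\<bar>, \<bar>of_int (k $ 2)\<bar>, \<bar>of_int (k $ 3)\<bar> :: real}"
        unfolding m_def by (rule Max_in) auto
      then consider "m = 1" | i where "m = \<bar>of_int (k $ i)\<bar>"
        by blast
      then show ?thesis
      proof cases
        case 1
        then show ?thesis using order_trans[OF C0[of k] K0] by (simp add: y_def)
      next
        case (2 i)
        then show ?thesis using order_trans[OF C[of k i] Ki[of i]] by (simp only: y_def)
      qed
    qed
    have "(jb k) ^ 6 * y \<le> (64 * m ^ 6) * y" using le y by (rule mult_right_mono)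
    then show "(jb k) ^ 6 * norm (fourier_coeff \<phi> k) \<le> 64 * K"
      using m6 by (simp add: y_def)
  qed
qed

text \<open>Two powers of the bracket pay for every term of the weak formulation: the diffusion
  symbol has order 2 \<gamma> < 2, and the modes of the quadratic term and of the forcing grow at
  most like \<open>(jb k)\<^sup>2\<close>.\<close>

lemma smooth_torus_summable:
  assumes "\<phi> \<in> smooth_torus"
  shows "(\<lambda>k. (jb k)\<^sup>2 * norm (fourier_coeff \<phi> k)) summable_on UNIV"
proof -
  obtain C where C: "\<And>k. (jb k) ^ 6 * norm (fourier_coeff \<phi> k) \<le> C"
    using smooth_torus_decay[OF assms] by blast
  have "(\<lambda>k. jb k powr (- 4)) summable_on UNIV"
    using nsum_jb_finite[of 4] by (subst summable_on_iff_nsum) auto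
  then have "(\<lambda>k. C * jb k powr (- 4)) summable_on UNIV"
    by (rule summable_on_cmult_right)
  then show ?thesis
  proof (rule summable_on_comparison_test)
    fix k
    have "jb k powr (- 4) = 1 / (jb k) ^ 4" by (simp add: powr_minus divide_simps)
    then have e: "C * jb k powr (- 4) = C / (jb k) ^ 4" by simp
    have "(jb k)\<^sup>2 * norm (fourier_coeff \<phi> k) * (jb k) ^ 4 = (jb k) ^ 6 * norm (fourier_coeff \<phi> k)"
      by (simp add: power_add[symmetric] mult_ac)
    then show "(jb k)\<^sup>2 * norm (fourier_coeff \<phi> k) \<le> C * jb k powr (- 4)"
      unfolding e by (intro pos_le_divide_eq[THEN iffD2] zero_less_power jb_pos) (simp only: C)
  qed (auto simp: mult_nonneg_nonneg)
qed

lemma smooth_torus_abs_summable: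
  assumes "\<phi> \<in> smooth_torus"
  shows "(\<lambda>k. norm (fourier_coeff \<phi> k)) summable_on UNIV"
  by (rule summable_on_comparison_test[OF smooth_torus_summable[OF assms]])
     (auto intro: mult_le_cancel_right1[THEN iffD2] simp: one_le_power jb_ge_1)

text \<open>The family is closed under partial derivatives, which exchange sine and cosine with new
  coefficients; therefore the induction generalises over \<open>a\<close> and
  \<open>b\<close>.\<close>

lemma Ck_trig: "Ck n (\<lambda>x. a * cos (freq k \<bullet> x) + b * sin (freq k \<bullet> x))"
proof (induction n arbitrary: a b)
  case (Suc n)
  let ?f = "\<lambda>a b x. a * cos (freq k \<bullet> x) + b * sin (freq k \<bullet> x)"
  have D: "(?f a b has_derivative (\<lambda>h. (- a * sin (freq k \<bullet> x) + b * cos (freq k \<bullet> x)) * (freq k \<bullet> h))) (at x)" for x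
    by (auto intro!: derivative_eq_intros simp: algebra_simps)
  have pd: "partial_deriv i (?f a b) = ?f (of_int (k $ i) * b) (- of_int (k $ i) * a)" for i
    unfolding partial_deriv_def frechet_derivative_at[OF D, symmetric]
    by (simp add: fun_eq_iff inner_axis algebra_simps)
  show ?case unfolding Ck.simps
  proof (intro conjI allI)
    show "?f a b differentiable (at x)" for x
      using D differentiable_def by blast
    show "Ck n (partial_deriv i (?f a b))" for i
      unfolding pd by (rule Suc.IH)
  qed
qed (auto intro!: continuous_intros)

lemma smooth_torus_trig: "(\<lambda>x. a * cos (freq k \<bullet> x) + b * sin (freq k \<bullet> x)) \<in> smooth_torus"
proof -
  have "cos (freq k \<bullet> (x + axis i (2 * pi))) = cos (freq k \<bullet> x)"
    "sin (freq k \<bullet> (x + axis i (2 * pi))) = sin (freq k \<bullet> x)" for x i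
    using ek_periodic[of k x i] by (simp_all add: ek_def complex_eq_iff)
  then show ?thesis
    using Ck_trig by (simp add: smooth_torus_def torus_fun_def)
qed

lemma fourier_coeff_trig:
  "fourier_coeff (\<lambda>x. a * cos (freq k \<bullet> x) + b * sin (freq k \<bullet> x)) m
    = (if m = k then Complex (a/2) (-b/2) else 0) + (if m = - k then Complex (a/2) (b/2) else 0)"
proof -
  have eq: "complex_of_real (a * cos (freq k \<bullet> x) + b * sin (freq k \<bullet> x)) * ek (- m) x
     = Complex (a/2) (-b/2) * ek (k - m) x + Complex (a/2) (b/2) * ek (- k - m) x" for x
  proof -
    have "complex_of_real (a * cos (freq k \<bullet> x) + b * sin (freq k \<bullet> x)) = Complex (a/2) (-b/2) * ek k x + Complex (a/2) (b/2) * ek (- k) x"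
      by (simp add: ek_def complex_eq_iff)
    then show ?thesis using ek_add[of k "- m" x] ek_add[of "- k" "- m" x] by (simp add: algebra_simps)
  qed
  have "integrable torus (ek j)" for j by (intro continuous_imp_integrable_torus continuous_ek)
  then have "(LINT x|torus. complex_of_real (a * cos (freq k \<bullet> x) + b * sin (freq k \<bullet> x)) * ek (- m) x)
     = Complex (a/2) (-b/2) * (LINT x|torus. ek (k - m) x) + Complex (a/2) (b/2) * (LINT x|torus. ek (- k - m) x)"
    unfolding eq by simp
  moreover have "- k - m = 0 \<longleftrightarrow> m = - k" "k - m = 0 \<longleftrightarrow> m = k"
    by (auto simp: algebra_simps)
  ultimately show ?thesis
    unfolding fourier_coeff_ek by (simp add: LINT_ek scaleR_conv_of_real algebra_simps)
qed

section \<open>Weighted sequence spaces\<close>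

text \<open>Sobolev regularity read off the coefficients alone. The value type is a parameter
  because the same norms measure complex coefficients and the nonnegative real amplitudes that
  dominate them.\<close>

definition hs :: "real \<Rightarrow> (int^3 \<Rightarrow> 'a::real_normed_vector) \<Rightarrow> bool" where
  "hs s c \<longleftrightarrow> (\<lambda>k. jb k powr (2 * s) * (norm (c k))\<^sup>2) summable_on UNIV"

definition hnorm :: "real \<Rightarrow> (int^3 \<Rightarrow> 'a::real_normed_vector) \<Rightarrow> real" where
  "hnorm s c = sqrt (infsum (\<lambda>k. jb k powr (2 * s) * (norm (c k))\<^sup>2) UNIV)"

text \<open>The squared norm as an extended number has no default value for divergent sums, so
  Tonelli and comparison apply before finiteness is known.\<close>

definition hsum :: "real \<Rightarrow> (int^3 \<Rightarrow> 'a::real_normed_vector) \<Rightarrow> ennreal" where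
  "hsum s c = nsum (\<lambda>k. ennreal (jb k powr (2 * s) * (norm (c k))\<^sup>2))"

lemma jb_neq_0 [simp]: "jb k \<noteq> 0"
  using jb_pos[of k] by linarith

lemma jb_powr_sq: "(jb k powr s)\<^sup>2 = jb k powr (2 * s)"
  by (simp add: powr_power mult.commute)

lemma sobolev_weighted_eq: "sobolev_weighted s f = (\<lambda>k. jb k powr (2 * s) * (norm (fourier_coeff f k))\<^sup>2)"
  by (simp add: sobolev_weighted_def jb_powr_even fun_eq_iff)

lemma sobolev_iff: "f \<in> sobolev s \<longleftrightarrow> f \<in> L2_torus \<and> hs s (fourier_coeff f)"
  by (simp add: sobolev_def hs_def sobolev_weighted_eq)

lemma sobolev_norm_eq: "sobolev_norm s f = hnorm s (fourier_coeff f)"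
  by (simp add: sobolev_norm_def hnorm_def sobolev_weighted_eq)

lemma hs_iff_hsum: "hs s c \<longleftrightarrow> hsum s c < \<infinity>"
  unfolding hs_def hsum_def by (rule summable_on_iff_nsum) simp

lemma hnorm_nonneg [simp]: "0 \<le> hnorm s c"
  unfolding hnorm_def by (simp add: infsum_nonneg)

lemma hnorm_sq: "(hnorm s c)\<^sup>2 = infsum (\<lambda>k. jb k powr (2 * s) * (norm (c k))\<^sup>2) UNIV"
  unfolding hnorm_def by (simp add: infsum_nonneg)

lemma hsum_eq: "hs s c \<Longrightarrow> hsum s c = ennreal ((hnorm s c)\<^sup>2)"
  unfolding hs_def hsum_def hnorm_sq by (rule nsum_eq_infsum) simp

lemma hs_hnorm_leI:
  assumes "B \<ge> 0" "\<And>F. finite F \<Longrightarrow> (\<Sum>k\<in>F. jb k powr (2 * s) * (norm (c k))\<^sup>2) \<le> B\<^sup>2"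
  shows "hs s c" "hnorm s c \<le> B"
proof -
  show h: "hs s c"
    unfolding hs_def
    by (rule nonneg_bdd_above_summable_on) (use assms(2) in \<open>auto intro!: bdd_aboveI2\<close>)
  have "(hnorm s c)\<^sup>2 \<le> B\<^sup>2"
    unfolding hnorm_sq using h assms(2) by (intro infsum_le_finite_sums) (auto simp: hs_def)
  then show "hnorm s c \<le> B" using assms(1) by (rule power2_le_imp_le)
qed

lemma hs_finite_sum_le:
  assumes "hs s c" "finite F"
  shows "(\<Sum>k\<in>F. jb k powr (2 * s) * (norm (c k))\<^sup>2) \<le> (hnorm s c)\<^sup>2"
  unfolding hnorm_sq by (rule finite_sum_le_infsum) (use assms in \<open>auto simp: hs_def\<close>)

lemma hsum_le_imp:
  assumes "B \<ge> 0" "hsum s c \<le> ennreal (B\<^sup>2)"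
  shows "hs s c" "hnorm s c \<le> B"
proof -
  show h: "hs s c" using assms(2) by (simp add: hs_iff_hsum order_le_less_trans)
  then have "(hnorm s c)\<^sup>2 \<le> B\<^sup>2"
    using assms(2) by (simp add: hsum_eq)
  then show "hnorm s c \<le> B" using assms(1) by (rule power2_le_imp_le)
qed

lemma hs_bound:
  assumes "hs s c"
  shows "norm (c k) \<le> jb k powr (- s) * hnorm s c"
proof -
  have "(jb k powr s * norm (c k))\<^sup>2 \<le> (hnorm s c)\<^sup>2"
    using hs_finite_sum_le[OF assms, of "{k}"]
    by (simp add: power_mult_distrib jb_powr_sq mult.commute)
  then have "jb k powr s * norm (c k) \<le> hnorm s c"
    by (rule power2_le_imp_le) simp
  then have "jb k powr (- s) * (jb k powr s * norm (c k)) \<le> jb k powr (- s) * hnorm s c"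
    by (intro mult_left_mono) auto
  moreover have "jb k powr (- s) * (jb k powr s * norm (c k)) = norm (c k)"
    by (simp add: mult.assoc[symmetric] powr_add[symmetric])
  ultimately show ?thesis by simp
qed

text \<open>Multipliers of order \<open>a\<close> map H^s to H^{s-a}, in the form of a pointwise
  domination. For a = 0 this is comparison of sequences; negative \<open>a\<close> expresses the
  smoothing by Duhamel's formula.\<close>

lemma hs_weight:
  fixes c :: "int^3 \<Rightarrow> 'a::real_normed_vector" and d :: "int^3 \<Rightarrow> 'b::real_normed_vector"
  assumes c: "hs s c" and M: "M \<ge> 0" and le: "\<And>k. norm (d k) \<le> M * jb k powr a * norm (c k)" and s': "s' \<le> s - a"
  shows "hs s' d" "hnorm s' d \<le> M * hnorm s c"
proof -
  have "(\<Sum>k\<in>F. jb k powr (2 * s') * (norm (d k))\<^sup>2) \<le> (M * hnorm s c)\<^sup>2" if F: "finite F" for F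
  proof -
    have "(\<Sum>k\<in>F. jb k powr (2 * s') * (norm (d k))\<^sup>2) \<le> (\<Sum>k\<in>F. M\<^sup>2 * (jb k powr (2 * s) * (norm (c k))\<^sup>2))"
    proof (intro sum_mono)
      fix k
      have "jb k powr s' \<le> jb k powr (s - a)" using s' jb_ge_1 by (intro powr_mono) auto
      then have "jb k powr s' * norm (d k) \<le> jb k powr (s - a) * (M * jb k powr a * norm (c k))"
        by (intro mult_mono le) auto
      also have "\<dots> = M * (jb k powr s * norm (c k))"
        by (simp add: mult_ac powr_add[symmetric])
      finally have "(jb k powr s' * norm (d k))\<^sup>2 \<le> (M * (jb k powr s * norm (c k)))\<^sup>2"
        by (intro power_mono) auto
      then show "jb k powr (2 * s') * (norm (d k))\<^sup>2 \<le> M\<^sup>2 * (jb k powr (2 * s) * (norm (c k))\<^sup>2)"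
        by (simp add: power_mult_distrib jb_powr_sq)
    qed
    also have "\<dots> \<le> M\<^sup>2 * (hnorm s c)\<^sup>2"
      unfolding sum_distrib_left[symmetric] by (intro mult_left_mono hs_finite_sum_le c F) auto
    finally show ?thesis by (simp add: power_mult_distrib)
  qed
  then show "hs s' d" "hnorm s' d \<le> M * hnorm s c"
    using hs_hnorm_leI[of "M * hnorm s c" s' d] M by auto
qed

lemma hs_mono:
  assumes "hs s c" "s' \<le> s" "\<And>k. norm (d k) \<le> norm (c k)"
  shows "hs s' d" "hnorm s' d \<le> hnorm s c"
  using hs_weight[of s c 1 d 0 s'] assms by auto

lemma hs_add:
  assumes c: "hs s c" and d: "hs s d"
  shows "hs s (\<lambda>k. c k + d k)" "hnorm s (\<lambda>k. c k + d k) \<le> hnorm s c + hnorm s d"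
proof -
  have "(\<Sum>k\<in>F. jb k powr (2 * s) * (norm (c k + d k))\<^sup>2) \<le> (hnorm s c + hnorm s d)\<^sup>2" if F: "finite F" for F
  proof -
    have L: "L2_set (\<lambda>k. jb k powr s * norm (e k)) F \<le> hnorm s e" if "hs s e" for e :: "int^3 \<Rightarrow> 'a"
    proof -
      have "(L2_set (\<lambda>k. jb k powr s * norm (e k)) F)\<^sup>2 \<le> (hnorm s e)\<^sup>2"
        using hs_finite_sum_le[OF that F]
        by (simp add: L2_set_def sum_nonneg power_mult_distrib jb_powr_sq)
      then show ?thesis by (rule power2_le_imp_le) simp
    qed
    have "(\<Sum>k\<in>F. jb k powr (2 * s) * (norm (c k + d k))\<^sup>2) = (L2_set (\<lambda>k. jb k powr s * norm (c k + d k)) F)\<^sup>2"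
      by (simp add: L2_set_def sum_nonneg power_mult_distrib jb_powr_sq)
    also have "\<dots> \<le> (L2_set (\<lambda>k. jb k powr s * norm (c k) + jb k powr s * norm (d k)) F)\<^sup>2"
      by (intro power_mono L2_set_mono)
         (auto simp: distrib_left[symmetric] norm_triangle_ineq L2_set_nonneg intro!: mult_left_mono)
    also have "\<dots> \<le> (hnorm s c + hnorm s d)\<^sup>2"
      by (intro power_mono order_trans[OF L2_set_triangle_ineq add_mono] L c d L2_set_nonneg)
    finally show ?thesis .
  qed
  then show "hs s (\<lambda>k. c k + d k)" "hnorm s (\<lambda>k. c k + d k) \<le> hnorm s c + hnorm s d"
    using hs_hnorm_leI[of "hnorm s c + hnorm s d" s "\<lambda>k. c k + d k"] by (auto intro: add_nonneg_nonneg)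
qed

lemma hs_diff:
  assumes "hs s c" "hs s d"
  shows "hs s (\<lambda>k. c k - d k)" "hnorm s (\<lambda>k. c k - d k) \<le> hnorm s c + hnorm s d"
proof -
  have "hs s (\<lambda>k. - d k)" "hnorm s (\<lambda>k. - d k) \<le> hnorm s d"
    using hs_mono[OF assms(2), of s "\<lambda>k. - d k"] by auto
  then show "hs s (\<lambda>k. c k - d k)" "hnorm s (\<lambda>k. c k - d k) \<le> hnorm s c + hnorm s d"
    using hs_add[OF assms(1), of "\<lambda>k. - d k"] by auto
qed

text \<open>Cauchy-Schwarz against \<open>jb k powr (a - s)\<close>, which is square summable over
  the three-dimensional lattice since 2 (s - a) > 3.\<close>

lemma hs_abs_summable:
  assumes c: "hs s c" and a: "s - a > 3/2"
  shows "(\<lambda>k. jb k powr a * norm (c k)) summable_on UNIV"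
proof -
  have "(nsum (\<lambda>k. ennreal (jb k powr (a - s)) * ennreal (jb k powr s * norm (c k))))\<^sup>2
     \<le> nsum (\<lambda>k. (ennreal (jb k powr (a - s)))\<^sup>2) * nsum (\<lambda>k. (ennreal (jb k powr s * norm (c k)))\<^sup>2)"
    by (rule nsum_Cauchy_Schwarz)
  also have "\<dots> = nsum (\<lambda>k. ennreal (jb k powr (- (2 * (s - a))))) * hsum s c"
    by (simp add: hsum_def ennreal_power power_mult_distrib jb_powr_sq algebra_simps)
  also have "\<dots> < \<infinity>"
    using nsum_jb_finite[of "2 * (s - a)"] a c by (simp add: hs_iff_hsum ennreal_mult_less_top)
  finally have "nsum (\<lambda>k. ennreal (jb k powr (a - s)) * ennreal (jb k powr s * norm (c k))) < \<infinity>"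
    by (simp add: power_less_top_ennreal)
  moreover have "ennreal (jb k powr (a - s)) * ennreal (jb k powr s * norm (c k)) = ennreal (jb k powr a * norm (c k))" for k
    by (simp add: ennreal_mult'[symmetric] mult.assoc[symmetric] powr_add[symmetric])
  ultimately show ?thesis
    by (subst summable_on_iff_nsum) auto
qed

lemma hs_abs_summable0:
  assumes "hs s c" "s > 3/2"
  shows "(\<lambda>k. norm (c k)) summable_on UNIV"
  using hs_abs_summable[OF assms(1), of 0] assms(2) by simp

lemma sobolev_diff:
  assumes "f \<in> sobolev s" "g \<in> sobolev s"
  shows "(\<lambda>x. f x - g x) \<in> sobolev s"
    "fourier_coeff (\<lambda>x. f x - g x) = (\<lambda>k. fourier_coeff f k - fourier_coeff g k)"
proof -
  have L: "f \<in> L2_torus" "g \<in> L2_torus" using assms by (auto simp: sobolev_iff)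
  show e: "fourier_coeff (\<lambda>x. f x - g x) = (\<lambda>k. fourier_coeff f k - fourier_coeff g k)"
    using L by (simp add: fun_eq_iff fourier_coeff_diff L2_torus_integrable)
  show "(\<lambda>x. f x - g x) \<in> sobolev s"
    using assms hs_diff L2_torus_diff[OF L] by (auto simp: sobolev_iff e)
qed

section \<open>Measurability in time\<close>

text \<open>Lebesgue measure is complete, so changing a function on a null set keeps it measurable;
  extension by 0 transfers this to the subset.\<close>

lemma borel_measurable_lebesgue_on_AE:
  fixes f g :: "real \<Rightarrow> 'b::euclidean_space"
  assumes S: "S \<in> sets lebesgue" and f: "f \<in> borel_measurable (lebesgue_on S)"
    and ae: "AE t in lebesgue_on S. f t = g t"
  shows "g \<in> borel_measurable (lebesgue_on S)"
proof -
  have "(\<lambda>t. if t \<in> S then f t else 0) \<in> borel_measurable lebesgue"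
    by (rule borel_measurable_if_I[OF f S])
  moreover have "AE t in lebesgue. (if t \<in> S then f t else 0) = (if t \<in> S then g t else 0)"
    using ae S by (subst (asm) AE_restrict_space_iff) (auto elim!: eventually_mono)
  ultimately have "(\<lambda>t. if t \<in> S then g t else 0) \<in> borel_measurable lebesgue"
    by (rule borel_measurable_AE)
  then show ?thesis by (rule borel_measurable_if_D)
qed

lemma borel_measurable_lebesgue_on_LIMSEQ:
  fixes f :: "nat \<Rightarrow> real \<Rightarrow> 'b::euclidean_space"
  assumes S: "S \<in> sets lebesgue" and f: "\<And>n. f n \<in> borel_measurable (lebesgue_on S)"
    and lim: "AE t in lebesgue_on S. (\<lambda>n. f n t) \<longlonglongrightarrow> g t"
  shows "g \<in> borel_measurable (lebesgue_on S)"
proof -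
  obtain N where N: "N \<in> null_sets (lebesgue_on S)" "{t \<in> space (lebesgue_on S). \<not> ((\<lambda>n. f n t) \<longlonglongrightarrow> g t)} \<subseteq> N"
    using lim by (auto simp: eventually_ae_filter)
  have N': "AE t in lebesgue_on S. t \<notin> N" by (rule AE_not_in[OF N(1)])
  have [measurable]: "N \<in> sets (lebesgue_on S)" using N by auto
  note f[measurable]
  have "(\<lambda>t. if t \<in> N then 0 else g t) \<in> borel_measurable (lebesgue_on S)"
  proof (rule borel_measurable_LIMSEQ_metric)
    show "(\<lambda>t. if t \<in> N then 0 else f n t) \<in> borel_measurable (lebesgue_on S)" for n
      by measurable
    show "(\<lambda>n. if t \<in> N then 0 else f n t) \<longlonglongrightarrow> (if t \<in> N then 0 else g t)" if "t \<in> space (lebesgue_on S)" for t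
      using N(2) that by auto
  qed
  moreover have "AE t in lebesgue_on S. (if t \<in> N then 0 else g t) = g t"
    using N' by eventually_elim auto
  ultimately show ?thesis by (rule borel_measurable_lebesgue_on_AE[OF S])
qed

text \<open>For s \<ge> 0 a single coefficient is bounded by the H^s norm, hence the coefficients of
  the approximating simple functions converge almost everywhere.\<close>

lemma strongly_measurable_coeff:
  assumes I: "I \<in> sets lebesgue" and s: "s \<ge> 0" and u: "strongly_measurable I s u"
  shows "(\<lambda>t. fourier_coeff (u t) k) \<in> borel_measurable (lebesgue_on I)"
proof -
  obtain \<sigma> where \<sigma>: "\<And>n. simple_function (lebesgue_on I) (\<sigma> n)" "\<And>n t. t \<in> I \<Longrightarrow> \<sigma> n t \<in> sobolev s"
    and lim: "AE t in lebesgue_on I. (\<lambda>n. sobolev_norm s (\<lambda>x. \<sigma> n t x - u t x)) \<longlonglongrightarrow> 0"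
    and us: "AE t in lebesgue_on I. u t \<in> sobolev s"
    using u by (auto simp: strongly_measurable_def)
  show ?thesis
  proof (rule borel_measurable_lebesgue_on_LIMSEQ[OF I])
    show "(\<lambda>t. fourier_coeff (\<sigma> n t) k) \<in> borel_measurable (lebesgue_on I)" for n
      using simple_function_compose[OF \<sigma>(1)[of n], where g = "\<lambda>f. fourier_coeff f k"]
      by (simp add: o_def borel_measurable_simple_function)
    show "AE t in lebesgue_on I. (\<lambda>n. fourier_coeff (\<sigma> n t) k) \<longlonglongrightarrow> fourier_coeff (u t) k"
      using lim us AE_space
    proof eventually_elim
      case (elim t)
      have t: "t \<in> I" using elim(3) by simp
      note d = sobolev_diff[OF \<sigma>(2)[OF t] elim(2)]
      have "norm (fourier_coeff (\<sigma> n t) k - fourier_coeff (u t) k) \<le> sobolev_norm s (\<lambda>x. \<sigma> n t x - u t x)" for n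
      proof -
        have "jb k powr (- s) \<le> 1"
          using s jb_ge_1[of k] by (metis neg_le_0_iff_le powr_mono powr_zero_eq_one jb_pos less_irrefl)
        then have "jb k powr (- s) * hnorm s (fourier_coeff (\<lambda>x. \<sigma> n t x - u t x)) \<le> hnorm s (fourier_coeff (\<lambda>x. \<sigma> n t x - u t x))"
          by (simp add: mult_left_le_one_le)
        then show ?thesis
          using hs_bound[of s "fourier_coeff (\<lambda>x. \<sigma> n t x - u t x)" k] d(1)[of n] unfolding sobolev_norm_eq sobolev_iff d(2)
          by auto
      qed
      then have "(\<lambda>n. fourier_coeff (\<sigma> n t) k - fourier_coeff (u t) k) \<longlonglongrightarrow> 0"
        by (intro Lim_null_comparison[OF _ elim(1)] always_eventually allI)
      then show ?case by (rule LIM_zero_cancel)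
    qed
  qed
qed

text \<open>For a divergent sum both sides are 0, as \<open>enn2real\<close> sends infinity to 0.
  Measurability of norms in time can thus be read off that of the extended sums.\<close>

lemma infsum_eq_enn2real:
  fixes f :: "'i \<Rightarrow> real"
  assumes "\<And>k. f k \<ge> 0"
  shows "infsum f UNIV = enn2real (nsum (\<lambda>k. ennreal (f k)))"
proof (cases "f summable_on UNIV")
  case True
  then show ?thesis using nsum_eq_infsum[of f] assms by (simp add: infsum_nonneg)
next
  case False
  then have "nsum (\<lambda>k. ennreal (f k)) = top"
    using summable_on_iff_nsum[of f] assms by (metis infinity_ennreal_def less_top)
  then show ?thesis using False by (simp add: infsum_not_exists)
qed

lemma borel_measurable_nsum:
  fixes f :: "'i::countable \<Rightarrow> 'a \<Rightarrow> ennreal"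
  assumes "\<And>k. f k \<in> borel_measurable M"
  shows "(\<lambda>x. nsum (\<lambda>k. f k x)) \<in> borel_measurable M"
proof -
  have "(\<lambda>(x, k). f k x) \<in> borel_measurable (M \<Otimes>\<^sub>M count_space UNIV)"
    using measurable_pair_swap[OF measurable_case_prod_countable[OF assms]] by (simp add: case_prod_beta')
  then show ?thesis
    using sigma_finite_measure.borel_measurable_nn_integral[OF sigma_finite_measure_count_space]
    by (simp add: case_prod_beta')
qed

lemma borel_measurable_hsum:
  fixes c :: "real \<Rightarrow> int^3 \<Rightarrow> complex"
  assumes "\<And>k. (\<lambda>t. c t k) \<in> borel_measurable M"
  shows "(\<lambda>t. hsum s (c t)) \<in> borel_measurable M"
  unfolding hsum_def using assms by (intro borel_measurable_nsum) measurable

lemma borel_measurable_hnorm: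
  fixes c :: "real \<Rightarrow> int^3 \<Rightarrow> complex"
  assumes "\<And>k. (\<lambda>t. c t k) \<in> borel_measurable M"
  shows "(\<lambda>t. hnorm s (c t)) \<in> borel_measurable M"
proof -
  have "hnorm s (c t) = sqrt (enn2real (hsum s (c t)))" for t
    unfolding hnorm_def hsum_def by (subst infsum_eq_enn2real) auto
  then show ?thesis using borel_measurable_hsum[OF assms, of s] by simp
qed

lemma integrable_hnorm_sq:
  fixes c :: "real \<Rightarrow> int^3 \<Rightarrow> complex"
  assumes c: "\<And>k. (\<lambda>t. c t k) \<in> borel_measurable M" and fin: "(\<integral>\<^sup>+t. hsum s (c t) \<partial>M) < \<infinity>"
  shows "AE t in M. hs s (c t)" "integrable M (\<lambda>t. (hnorm s (c t))\<^sup>2)"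
proof -
  have "AE t in M. hsum s (c t) \<noteq> \<infinity>"
    using fin by (intro nn_integral_PInf_AE borel_measurable_hsum c) auto
  then show "AE t in M. hs s (c t)" by (simp add: hs_iff_hsum less_top)
  have le: "ennreal ((hnorm s (c t))\<^sup>2) \<le> hsum s (c t)" for t
    by (cases "hs s (c t)") (auto simp: hsum_eq hs_iff_hsum less_top[symmetric])
  show "integrable M (\<lambda>t. (hnorm s (c t))\<^sup>2)"
  proof (rule integrableI_bounded)
    show "(\<lambda>t. (hnorm s (c t))\<^sup>2) \<in> borel_measurable M"
      using borel_measurable_hnorm[OF c, of s] by measurable
    have "(\<integral>\<^sup>+t. ennreal (norm ((hnorm s (c t))\<^sup>2)) \<partial>M) \<le> (\<integral>\<^sup>+t. hsum s (c t) \<partial>M)"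
      using le by (intro nn_integral_mono) simp
    then show "(\<integral>\<^sup>+t. ennreal (norm ((hnorm s (c t))\<^sup>2)) \<partial>M) < \<infinity>"
      using fin by (rule order_le_less_trans)
  qed
qed

text \<open>By Tonelli the squared norm in L^2 of time with values in H^s is a weighted sum of the
  L^2 norms of the modes; estimates of single modes are summed through this identity.\<close>

lemma nn_integral_hsum:
  fixes c :: "real \<Rightarrow> int^3 \<Rightarrow> complex"
  assumes "sigma_finite_measure M" "\<And>k. (\<lambda>t. c t k) \<in> borel_measurable M"
  shows "(\<integral>\<^sup>+t. hsum s (c t) \<partial>M) = nsum (\<lambda>k. ennreal (jb k powr (2 * s)) * (\<integral>\<^sup>+t. ennreal ((norm (c t k))\<^sup>2) \<partial>M))"
proof -
  note assms(2)[measurable]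
  have "(\<integral>\<^sup>+t. hsum s (c t) \<partial>M) = nsum (\<lambda>k. \<integral>\<^sup>+t. ennreal (jb k powr (2 * s) * (norm (c t k))\<^sup>2) \<partial>M)"
    unfolding hsum_def by (rule nsum_nn_integral_swap[OF assms(1)]) measurable
  also have "\<dots> = nsum (\<lambda>k. ennreal (jb k powr (2 * s)) * (\<integral>\<^sup>+t. ennreal ((norm (c t k))\<^sup>2) \<partial>M))"
    by (intro nn_integral_cong) (simp add: ennreal_mult' nn_integral_cmult)
  finally show ?thesis .
qed

text \<open>The projection onto hermitian sequences, applied to truncated coefficients so that they
  belong to real functions.\<close>

definition symm :: "(int^3 \<Rightarrow> complex) \<Rightarrow> int^3 \<Rightarrow> complex" where
  "symm c k = (c k + cnj (c (- k))) / 2"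

lemma hermitian_symm: "hermitian (symm c)"
  by (simp add: hermitian_def symm_def add.commute)

lemma hs_finite_support:
  fixes c :: "int^3 \<Rightarrow> complex"
  assumes "finite {k. c k \<noteq> 0}"
  shows "hs s c" "(\<lambda>k. norm (c k)) summable_on UNIV"
proof -
  have "finite {k \<in> UNIV. jb k powr (2 * s) * (norm (c k))\<^sup>2 \<noteq> 0}" "finite {k \<in> UNIV. norm (c k) \<noteq> 0}"
    using assms by (auto elim: finite_subset[rotated])
  then show "hs s c" "(\<lambda>k. norm (c k)) summable_on UNIV"
    unfolding hs_def by (auto intro: finite_nonzero_values_imp_summable_on)
qed

lemma simple_function_restrict_finite:
  assumes "finite F" "\<And>k. simple_function M (a k)"
  shows "simple_function M (\<lambda>t k. if k \<in> F then a k t else (0::complex))"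
  using assms(1)
proof induction
  case empty
  show ?case by simp
next
  case (insert j F)
  have "simple_function M (\<lambda>t. (\<lambda>g z. g(j := z)) (\<lambda>k. if k \<in> F then a k t else 0) (a j t))"
    by (rule simple_function_compose2[OF insert.IH assms(2)])
  moreover have "(\<lambda>t. (\<lambda>g z. g(j := z)) (\<lambda>k. if k \<in> F then a k t else 0) (a j t)) = (\<lambda>t k. if k \<in> insert j F then a k t else 0)"
    by (auto simp: fun_eq_iff)
  ultimately show ?case by simp
qed

text \<open>Converse of \<open>strongly_measurable_coeff\<close>. Each coordinate is approximated by
  simple functions of at most twice its modulus, cut off to finitely many frequencies and
  symmetrised; convergence in H^s is dominated convergence over the frequencies.\<close>

lemma strongly_measurableI:
  fixes c :: "real \<Rightarrow> int^3 \<Rightarrow> complex"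
  assumes c: "\<And>k. (\<lambda>t. c t k) \<in> borel_measurable (lebesgue_on I)"
    and u: "\<And>t. t \<in> I \<Longrightarrow> u t \<in> L2_torus" "\<And>t. t \<in> I \<Longrightarrow> fourier_coeff (u t) = c t"
    and hs: "AE t in lebesgue_on I. hs s (c t)"
  shows "strongly_measurable I s u"
proof -
  let ?M = "lebesgue_on I"
  have "\<exists>F. (\<forall>i. simple_function ?M (F i)) \<and> (\<forall>t\<in>I. (\<lambda>i. F i t) \<longlonglongrightarrow> c t k) \<and> (\<forall>i. \<forall>t\<in>I. norm (F i t) \<le> 2 * norm (c t k))" for k
    using borel_measurable_implies_sequence_metric[OF c, of k 0] by (auto simp: dist_norm)
  then obtain a where a: "\<And>k i. simple_function ?M (a k i)" "\<And>k t. t \<in> I \<Longrightarrow> (\<lambda>i. a k i t) \<longlonglongrightarrow> c t k"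
    "\<And>k i t. t \<in> I \<Longrightarrow> norm (a k i t) \<le> 2 * norm (c t k)"
    by metis
  define F where "F n = {k :: int^3. to_nat k \<le> n}" for n
  have F: "finite (F n)" for n
    unfolding F_def using finite_vimageI[of "{..n}" to_nat] by (simp add: vimage_def inj_to_nat)
  define b where "b n t = (\<lambda>k. if k \<in> F n then a k n t else 0)" for n t
  have b_simple: "simple_function ?M (b n)" for n
    unfolding b_def by (rule simple_function_restrict_finite[OF F a(1)])
  define d where "d n t = symm (b n t)" for n t
  define \<sigma> where "\<sigma> n t = rser (d n t)" for n t
  have d_fin: "finite {k. d n t k \<noteq> 0}" for n t
  proof (rule finite_subset)
    show "{k. d n t k \<noteq> 0} \<subseteq> F n \<union> uminus ` F n"
    proof
      fix k assume "k \<in> {k. d n t k \<noteq> 0}"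
      then have "k \<in> F n \<or> - k \<in> F n" by (auto simp: d_def symm_def b_def split: if_splits)
      then show "k \<in> F n \<union> uminus ` F n" by (auto intro: image_eqI[of _ _ "- k"])
    qed
  qed (use F in auto)
  note d_hs = hs_finite_support[OF d_fin]
  have coeff_\<sigma>: "fourier_coeff (\<sigma> n t) = d n t" for n t
    unfolding \<sigma>_def by (intro ext fourier_coeff_rser d_hs) (simp add: d_def hermitian_symm)
  have \<sigma>_sob: "\<sigma> n t \<in> sobolev s" for n t
    unfolding sobolev_iff coeff_\<sigma> by (auto simp: \<sigma>_def intro: rser_L2 d_hs)
  have \<sigma>_simple: "simple_function ?M (\<sigma> n)" for n
    using simple_function_compose[OF b_simple[of n], where g = "\<lambda>c. rser (symm c)"]
    by (simp add: \<sigma>_def[abs_def] d_def o_def)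
  have herm: "c t (- k) = cnj (c t k)" if "t \<in> I" for t k
    using hermitian_fourier_coeff[of "u t"] u(2)[OF that] by (simp add: hermitian_def)
  have lim: "(\<lambda>n. sobolev_norm s (\<lambda>x. \<sigma> n t x - u t x)) \<longlonglongrightarrow> 0" if t: "t \<in> I" and hs: "hs s (c t)" for t
  proof -
    have us: "u t \<in> sobolev s" using u[OF t] hs by (simp add: sobolev_iff)
    have eq: "sobolev_norm s (\<lambda>x. \<sigma> n t x - u t x) = hnorm s (\<lambda>k. d n t k - c t k)" for n
      unfolding sobolev_norm_eq sobolev_diff(2)[OF \<sigma>_sob us] coeff_\<sigma> u(2)[OF t] ..
    have b_lim: "(\<lambda>n. b n t k) \<longlonglongrightarrow> c t k" for k
    proof (rule Lim_transform_eventually[OF a(2)[OF t]])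
      show "\<forall>\<^sub>F n in sequentially. a k n t = b n t k"
        by (rule eventually_sequentiallyI[of "to_nat k"]) (simp add: b_def F_def)
    qed
    have d_lim: "(\<lambda>n. d n t k) \<longlonglongrightarrow> c t k" for k
    proof -
      have "(\<lambda>n. (b n t k + cnj (b n t (- k))) / 2) \<longlonglongrightarrow> (c t k + cnj (c t (- k))) / 2"
        by (intro tendsto_intros b_lim) simp
      then show ?thesis by (simp add: d_def symm_def[abs_def] herm[OF t])
    qed
    have d_bd: "norm (d n t k) \<le> 2 * norm (c t k)" for n k
    proof -
      have bb: "norm (b n t k) \<le> 2 * norm (c t k)" for k using a(3)[OF t] by (simp add: b_def)
      have "norm (d n t k) \<le> (norm (b n t k) + norm (b n t (- k))) / 2"
        unfolding d_def symm_def using norm_triangle_ineq[of "b n t k" "cnj (b n t (- k))"] by (simp add: norm_divide)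
      also have "\<dots> \<le> 2 * norm (c t k)"
        using bb[of k] bb[of "- k"] by (simp add: herm[OF t])
      finally show ?thesis .
    qed
    \<comment> \<open>The difference is at most 3 times the limit in modulus, 2 for the
      approximation and 1 for the limit itself; squaring gives the dominating factor 9.\<close>
    have "(\<lambda>n. LINT k|count_space UNIV. jb k powr (2 * s) * (norm (d n t k - c t k))\<^sup>2) \<longlonglongrightarrow> (LINT k|count_space (UNIV :: (int^3) set). (0::real))"
    proof (rule integral_dominated_convergence[where w = "\<lambda>k. 9 * (jb k powr (2 * s) * (norm (c t k))\<^sup>2)"])
      show "integrable (count_space UNIV) (\<lambda>k. 9 * (jb k powr (2 * s) * (norm (c t k))\<^sup>2))"
        using hs unfolding hs_def integrable_count_space_iff
        by (auto simp: summable_on_cmult_right abs_mult)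
      show "AE k in count_space UNIV. (\<lambda>n. jb k powr (2 * s) * (norm (d n t k - c t k))\<^sup>2) \<longlonglongrightarrow> 0"
      proof (rule AE_I2)
        fix k
        have "(\<lambda>n. jb k powr (2 * s) * (norm (d n t k - c t k))\<^sup>2) \<longlonglongrightarrow> jb k powr (2 * s) * (norm (c t k - c t k))\<^sup>2"
          by (intro tendsto_intros d_lim)
        then show "(\<lambda>n. jb k powr (2 * s) * (norm (d n t k - c t k))\<^sup>2) \<longlonglongrightarrow> 0" by simp
      qed
      show "AE k in count_space UNIV. norm (jb k powr (2 * s) * (norm (d n t k - c t k))\<^sup>2) \<le> 9 * (jb k powr (2 * s) * (norm (c t k))\<^sup>2)" for n
      proof (rule AE_I2)
        fix k
        have "norm (d n t k - c t k) \<le> 3 * norm (c t k)"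
          using norm_triangle_ineq4[of "d n t k" "c t k"] d_bd[of n k] by simp
        then have "(norm (d n t k - c t k))\<^sup>2 \<le> (3 * norm (c t k))\<^sup>2" by (intro power_mono) auto
        then show "norm (jb k powr (2 * s) * (norm (d n t k - c t k))\<^sup>2) \<le> 9 * (jb k powr (2 * s) * (norm (c t k))\<^sup>2)"
          using mult_left_mono[of _ _ "jb k powr (2 * s)"] by (fastforce simp: power_mult_distrib)
      qed
    qed auto
    then have "(\<lambda>n. sqrt (LINT k|count_space UNIV. jb k powr (2 * s) * (norm (d n t k - c t k))\<^sup>2)) \<longlonglongrightarrow> sqrt 0"
      by (intro tendsto_real_sqrt) simp
    then show ?thesis unfolding eq hnorm_def infsum_eq_LINT_real by simp
  qed
  show ?thesis
    unfolding strongly_measurable_def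
  proof (intro conjI exI[of _ \<sigma>] allI ballI \<sigma>_simple \<sigma>_sob)
    show "AE t in ?M. u t \<in> sobolev s"
      using hs AE_space by eventually_elim (use u in \<open>auto simp: sobolev_iff\<close>)
    show "AE t in ?M. (\<lambda>n. sobolev_norm s (\<lambda>x. \<sigma> n t x - u t x)) \<longlonglongrightarrow> 0"
      using hs AE_space by eventually_elim (use lim in auto)
  qed
qed

section \<open>The quadratic term\<close>

text \<open>Here \<open>x\<close>, \<open>y\<close>, \<open>z\<close> stand for the brackets of \<open>k\<close>, \<open>k - j\<close>, \<open>j\<close>.\<close>

lemma trilinear_weight:
  fixes x y z r s :: real
  assumes r: "1 \<le> r" "r \<le> 2" and s: "s + r > 7/2"
    and x: "1 \<le> x" and y: "1 \<le> y" and z: "1 \<le> z"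
    and xyz: "x \<le> y + z" "y \<le> x + z"
  defines "p \<equiv> r + s - 2"
  shows "x powr (s - r) * (min x z * y)
    \<le> 2 powr (s + 2) * ((z powr (- p) + y powr (- p) + x powr (- p)) * (y powr s * z powr s))"
proof -
  \<comment> \<open>One constant for all cases: \<open>?C\<close> majorises the factors 2^(s-r+1),
    1, 2^(s-r) and 2^(r-s) that arise below.\<close>
  let ?C = "2 powr (s + 2) :: real"
  have s1: "s \<ge> 1" using r s by linarith
  have C1: "?C \<ge> 1" using s1 by (intro ge_one_powr_ge_zero) auto
  have pw: "w powr a * w = w powr (a + 1)" if "1 \<le> w" for w a :: real
    using that by (simp add: powr_add)
  have main: "?C * (q powr (- p) * (y powr s * z powr s)) \<le> ?C * ((z powr (- p) + y powr (- p) + x powr (- p)) * (y powr s * z powr s))"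
    if "q \<in> {x, y, z}" for q
    using that by (intro mult_left_mono mult_right_mono) auto
  have pos: "0 < x" "0 < y" "0 < z" using x y z by auto
  \<comment> \<open>The surplus power -p is put on \<open>y\<close>, \<open>x\<close>,
    \<open>z\<close> in the three cases respectively. In the first x \<le> 2 z, in the second
    \<open>x\<close> is the smallest, in the third \<open>x\<close> and \<open>y\<close> are
    comparable.\<close>
  consider "y \<le> z" | "z \<le> y" "x \<le> z" | "z \<le> y" "z \<le> x" by linarith
  then show ?thesis
  proof cases
    case 1
    have "x powr (s - r) * (min x z * y) \<le> x powr (s - r) * (x * y)"
      using y by (intro mult_left_mono mult_right_mono) auto
    also have "\<dots> = x powr (s - r + 1) * y" using pw[OF x, of "s - r"] by (simp add: mult.assoc)
    also have "\<dots> \<le> (2 * z) powr (s - r + 1) * y"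
      using 1 xyz x y r s by (intro mult_right_mono powr_mono2) auto
    also have "\<dots> = 2 powr (s - r + 1) * (z powr s * z powr (1 - r) * y)"
      using pos by (simp add: powr_mult powr_add[symmetric] algebra_simps)
    also have "\<dots> \<le> ?C * (z powr s * y powr (1 - r) * y)"
      using 1 r y pos by (intro mult_mono mult_left_mono mult_right_mono powr_mono powr_mono2') auto
    also have "\<dots> = ?C * (y powr (- p) * (y powr s * z powr s))"
      using pw[OF y, of "1 - r"] by (simp add: p_def mult_ac powr_add[symmetric])
    also have "\<dots> \<le> ?C * ((z powr (- p) + y powr (- p) + x powr (- p)) * (y powr s * z powr s))"
      by (rule main) simp
    finally show ?thesis .
  next
    case 2
    have "x powr (s - r) * (min x z * y) = x powr (s - r) * (x * y)"
      using 2 by simp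
    also have "\<dots> = x powr (- p) * (x powr (s - 1) * x powr s * y)"
      using pw[OF x, of "s - r"] by (simp add: p_def mult.assoc powr_add[symmetric]) (simp add: mult.assoc[symmetric] powr_add[symmetric] algebra_simps)
    also have "\<dots> \<le> x powr (- p) * (y powr (s - 1) * z powr s * y)"
      using 2 x y s1 by (intro mult_left_mono mult_right_mono mult_mono powr_mono2) auto
    also have "\<dots> = 1 * (x powr (- p) * (y powr s * z powr s))"
      using pw[OF y, of "s - 1"] by (simp add: mult_ac)
    also have "\<dots> \<le> ?C * (x powr (- p) * (y powr s * z powr s))"
      using C1 by (intro mult_right_mono) auto
    also have "\<dots> \<le> ?C * ((z powr (- p) + y powr (- p) + x powr (- p)) * (y powr s * z powr s))"
      by (rule main) simp
    finally show ?thesis .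
  next
    case 3
    \<comment> \<open>The exponent s - r may have either sign, so comparability is used in both
      directions: x \<le> 2 y for s \<ge> r and y \<le> 2 x for s < r.\<close>
    have xy: "x powr (s - r) \<le> ?C * y powr (s - r)"
    proof (cases "s \<ge> r")
      case True
      then have "x powr (s - r) \<le> (2 * y) powr (s - r)"
        using 3 xyz x by (intro powr_mono2) auto
      also have "\<dots> = 2 powr (s - r) * y powr (s - r)" using pos by (simp add: powr_mult)
      also have "\<dots> \<le> ?C * y powr (s - r)" using r by (intro mult_right_mono powr_mono) auto
      finally show ?thesis .
    next
      case False
      then have "x powr (s - r) \<le> (y / 2) powr (s - r)"
        using 3 xyz x y by (intro powr_mono2') auto
      also have "\<dots> = 2 powr (r - s) * y powr (s - r)"
        using pos by (simp add: powr_divide) (simp add: powr_diff field_simps)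
      also have "\<dots> \<le> ?C * y powr (s - r)" using r s1 by (intro mult_right_mono powr_mono) auto
      finally show ?thesis .
    qed
    have "x powr (s - r) * (min x z * y) \<le> (?C * y powr (s - r)) * (z * y)"
      using 3 y z by (intro mult_mono xy) auto
    also have "\<dots> = ?C * (y powr s * y powr (1 - r) * z)"
    proof -
      have "s - r + 1 = s + (1 - r)" by simp
      then have "y powr (s - r) * y = y powr s * y powr (1 - r)"
        using pw[OF y, of "s - r"] by (simp only: powr_add)
      then show ?thesis by (simp add: mult_ac)
    qed
    also have "\<dots> \<le> ?C * (y powr s * z powr (1 - r) * z)"
      using 3 r z pos by (intro mult_left_mono mult_right_mono powr_mono2') auto
    also have "\<dots> = ?C * (z powr (- p) * (y powr s * z powr s))"
      using pw[OF z, of "1 - r"] by (simp add: p_def mult_ac powr_add[symmetric])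
    also have "\<dots> \<le> ?C * ((z powr (- p) + y powr (- p) + x powr (- p)) * (y powr s * z powr s))"
      by (rule main) simp
    finally show ?thesis .
  qed
qed

definition mk :: "int^3 \<Rightarrow> int^3 \<Rightarrow> real" where
  "mk k j = min (norm (freq k)) (norm (freq j)) * norm (freq (k - j))"

lemma mk_nonneg [simp]: "0 \<le> mk k j"
  by (simp add: mk_def)

text \<open>A scalar majorant of the quadratic term. It is kept apart from \<open>Nl\<close> because
  it is also evaluated at amplitudes that dominate the modes for all times at once.\<close>

definition Kc :: "(int^3 \<Rightarrow> real) \<Rightarrow> (int^3 \<Rightarrow> real) \<Rightarrow> int^3 \<Rightarrow> real" where
  "Kc A B k = infsum (\<lambda>j. mk k j * (A (k - j) * B j)) UNIV"

text \<open>The factor \<open>2 powr (s + 2)\<close> comes from \<open>trilinear_weight\<close>, the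
  3 is the square root of the 9 in \<open>conv_weighted\<close>, and the last root is the l^2 norm
  of the weights \<open>jb k powr (- (r + s - 2))\<close>.\<close>

definition bil_const :: "real \<Rightarrow> real \<Rightarrow> real" where
  "bil_const s r = 3 * 2 powr (s + 2) * sqrt (enn2real (nsum (\<lambda>k. ennreal (jb k powr (- (2 * (r + s - 2)))))))"

lemma bil_const_nonneg: "bil_const s r \<ge> 0"
  by (simp add: bil_const_def)

text \<open>Multiplication by the weight of H^{s-r} turns the kernel into the three-term weight of
  \<open>conv_weighted\<close>, by the pointwise inequality \<open>trilinear_weight\<close>. The
  hypothesis s + r > 7/2 makes p = r + s - 2 exceed 3/2, so the weights are square summable.\<close>

lemma Kc_estimate:
  assumes r: "1 \<le> r" "r \<le> 2" and s: "s + r > 7/2"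
    and A: "\<And>k. A k \<ge> 0" "hs s A" and B: "\<And>k. B k \<ge> 0" "hs s B"
  shows "(\<lambda>j. mk k j * (A (k - j) * B j)) summable_on UNIV"
    and "Kc A B k \<ge> 0"
    and "hs (s - r) (Kc A B)"
    and "hnorm (s - r) (Kc A B) \<le> bil_const s r * (hnorm s A * hnorm s B)"
proof -
  define p where "p = r + s - 2"
  define W where "W = nsum (\<lambda>k. ennreal (jb k powr (- (2 * p))))"
  have W: "W < \<infinity>" unfolding W_def using nsum_jb_finite[of "2 * p"] s by (simp add: p_def)
  define w where "w k = ennreal (jb k powr (- p))" for k
  define a where "a k = ennreal (jb k powr s * A k)" for k
  define b where "b k = ennreal (jb k powr s * B k)" for k
  define g where "g k = nsum (\<lambda>j. ennreal (mk k j * (A (k - j) * B j)))" for k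
  define C where "C = (2 powr (s + 2) :: real)"
  have pt: "ennreal (jb k powr (s - r)) * ennreal (mk k j * (A (k - j) * B j))
      \<le> ennreal C * ((w j + w (k - j) + w k) * (a (k - j) * b j))" for k j
  proof -
    have "mk k j \<le> min (jb k) (jb j) * jb (k - j)"
      unfolding mk_def by (intro mult_mono min.mono norm_freq_le_jb) auto
    then have "jb k powr (s - r) * mk k j \<le> jb k powr (s - r) * (min (jb k) (jb j) * jb (k - j))"
      by (intro mult_left_mono) auto
    also have "\<dots> \<le> C * ((jb j powr (- p) + jb (k - j) powr (- p) + jb k powr (- p)) * (jb (k - j) powr s * jb j powr s))"
      unfolding C_def p_def
    proof (rule trilinear_weight[OF r s jb_ge_1 jb_ge_1 jb_ge_1 jb_le])
      show "jb (k - j) \<le> jb k + jb j" using jb_triangle[of k "- j"] by simp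
    qed
    finally have "jb k powr (s - r) * mk k j * (A (k - j) * B j)
      \<le> C * ((jb j powr (- p) + jb (k - j) powr (- p) + jb k powr (- p)) * (jb (k - j) powr s * jb j powr s)) * (A (k - j) * B j)"
      using A(1) B(1) by (intro mult_right_mono) auto
    then have le: "jb k powr (s - r) * (mk k j * (A (k - j) * B j))
      \<le> C * ((jb j powr (- p) + jb (k - j) powr (- p) + jb k powr (- p)) * ((jb (k - j) powr s * A (k - j)) * (jb j powr s * B j)))"
      by (simp only: mult_ac)
    have "ennreal (jb k powr (s - r)) * ennreal (mk k j * (A (k - j) * B j)) = ennreal (jb k powr (s - r) * (mk k j * (A (k - j) * B j)))"
      by (simp add: ennreal_mult')
    also have "\<dots> \<le> ennreal (C * ((jb j powr (- p) + jb (k - j) powr (- p) + jb k powr (- p)) * ((jb (k - j) powr s * A (k - j)) * (jb j powr s * B j))))"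
      by (rule ennreal_leI[OF le])
    also have "\<dots> = ennreal C * ((w j + w (k - j) + w k) * (a (k - j) * b j))"
      unfolding w_def a_def b_def C_def using A(1) B(1)
      by (simp add: ennreal_mult' ennreal_mult'' ennreal_plus)
    finally show ?thesis .
  qed
  have HA: "nsum (\<lambda>k. (a k)\<^sup>2) = hsum s A" and HB: "nsum (\<lambda>k. (b k)\<^sup>2) = hsum s B" and HW: "nsum (\<lambda>k. (w k)\<^sup>2) = W"
    unfolding a_def b_def w_def W_def hsum_def using A(1) B(1)
    by (simp_all add: ennreal_power power_mult_distrib jb_powr_sq)
  have tot: "nsum (\<lambda>k. (ennreal (jb k powr (s - r)) * g k)\<^sup>2) \<le> ennreal (C\<^sup>2) * (9 * W * hsum s A * hsum s B)"
  proof -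
    have "nsum (\<lambda>k. (ennreal (jb k powr (s - r)) * g k)\<^sup>2)
      \<le> nsum (\<lambda>k. (ennreal C * nsum (\<lambda>j. (w j + w (k - j) + w k) * (a (k - j) * b j)))\<^sup>2)"
      unfolding g_def using pt
      by (intro nn_integral_mono power_mono) (auto simp: nn_integral_cmult[symmetric] intro!: nn_integral_mono)
    also have "\<dots> = ennreal (C\<^sup>2) * nsum (\<lambda>k. (nsum (\<lambda>j. (w j + w (k - j) + w k) * (a (k - j) * b j)))\<^sup>2)"
      by (simp add: power_mult_distrib nn_integral_cmult ennreal_power C_def)
    also have "\<dots> \<le> ennreal (C\<^sup>2) * (9 * nsum (\<lambda>k. (w k)\<^sup>2) * nsum (\<lambda>k. (a k)\<^sup>2) * nsum (\<lambda>k. (b k)\<^sup>2))"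
      by (intro mult_left_mono conv_weighted) auto
    finally show ?thesis by (simp only: HA HB HW)
  qed
  have fin: "hsum s A < \<infinity>" "hsum s B < \<infinity>" using A(2) B(2) by (auto simp: hs_iff_hsum)
  have tot_eq: "ennreal (C\<^sup>2) * (9 * W * hsum s A * hsum s B) = ennreal ((bil_const s r * (hnorm s A * hnorm s B))\<^sup>2)"
  proof -
    have W': "W = ennreal (enn2real W)" using W by simp
    have "(bil_const s r * (hnorm s A * hnorm s B))\<^sup>2 = C\<^sup>2 * (9 * enn2real W * (hnorm s A)\<^sup>2 * (hnorm s B)\<^sup>2)"
      unfolding bil_const_def C_def W_def p_def by (simp add: power_mult_distrib mult_ac)
    also have "ennreal \<dots> = ennreal (C\<^sup>2) * (9 * ennreal (enn2real W) * ennreal ((hnorm s A)\<^sup>2) * ennreal ((hnorm s B)\<^sup>2))"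
      by (simp add: ennreal_mult' ennreal_mult'')
    finally show ?thesis using W' by (simp add: hsum_eq[OF A(2)] hsum_eq[OF B(2)])
  qed
  \<comment> \<open>Convergence of the individual convolution sums is a consequence, not an input:
    one weighted term is at most the finite total over all \<open>k\<close>.\<close>
  have g_fin: "g k < \<infinity>" for k
  proof -
    have "(ennreal (jb k powr (s - r)) * g k)\<^sup>2 \<le> nsum (\<lambda>k. (ennreal (jb k powr (s - r)) * g k)\<^sup>2)"
      by (rule nn_integral_ge_point) simp
    also have "\<dots> \<le> ennreal ((bil_const s r * (hnorm s A * hnorm s B))\<^sup>2)"
      using tot by (simp only: tot_eq)
    also have "\<dots> < \<infinity>" by simp
    finally have "ennreal (jb k powr (s - r)) * g k < \<infinity>" by (simp add: power_less_top_ennreal)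
    then show ?thesis by (auto simp: ennreal_mult_less_top)
  qed
  have nn: "mk k j * (A (k - j) * B j) \<ge> 0" for k j using A(1) B(1) by simp
  show summ: "(\<lambda>j. mk k j * (A (k - j) * B j)) summable_on UNIV" for k
    using g_fin[of k] nn unfolding g_def by (subst summable_on_iff_nsum) auto
  show K0: "Kc A B k \<ge> 0" for k unfolding Kc_def using nn by (intro infsum_nonneg) auto
  have "g k = ennreal (Kc A B k)" for k
    unfolding g_def Kc_def by (rule nsum_eq_infsum[OF nn summ])
  then have "hsum (s - r) (Kc A B) = nsum (\<lambda>k. (ennreal (jb k powr (s - r)) * g k)\<^sup>2)"
    unfolding hsum_def using K0
    by (intro nn_integral_cong) (simp add: ennreal_mult'[symmetric] ennreal_power power_mult_distrib jb_powr_sq)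
  then have "hsum (s - r) (Kc A B) \<le> ennreal ((bil_const s r * (hnorm s A * hnorm s B))\<^sup>2)"
    using tot by (simp only: tot_eq)
  then show "hs (s - r) (Kc A B)" "hnorm (s - r) (Kc A B) \<le> bil_const s r * (hnorm s A * hnorm s B)"
    using bil_const_nonneg by (auto intro!: hsum_le_imp[of "bil_const s r * (hnorm s A * hnorm s B)"])
qed

section \<open>The symbol of the velocity operator and the bilinear form of the modes\<close>

lemma mg_symbol_minus: "mg_symbol \<Omega> \<beta> \<eta> (- k) = mg_symbol \<Omega> \<beta> \<eta> k"
  by (simp add: mg_symbol_def Let_def)

text \<open>With q = |k_3| |k| the denominator is a sum of two squares,
  \<open>(2 * \<Omega> * q)\<^sup>2 + (b * k2\<^sup>2)\<^sup>2\<close>. The terms with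
  \<open>\<Omega>\<close> are compared with the first square, the terms with \<open>b\<close> with
  twice the product of the two bases, so \<open>b\<close> cancels and the constant depends on
  \<open>\<Omega>\<close> only.\<close>

lemma norm_mg_symbol_le:
  assumes "\<Omega> > 0" "\<beta> > 0" "\<eta> > 0"
  shows "norm (mg_symbol \<Omega> \<beta> \<eta> k) \<le> 3 / \<Omega> * norm (freq k)"
proof (cases "k $ 3 = 0")
  case True
  then show ?thesis using assms by (simp add: mg_symbol_def)
next
  case False
  define k1 k2 k3 n b where "k1 = freq k $ 1" and "k2 = freq k $ 2" and "k3 = freq k $ 3" and "n = norm (freq k)" and "b = \<beta>\<^sup>2 / \<eta>"
  define D where "D = 4 * \<Omega>\<^sup>2 * k3\<^sup>2 * n\<^sup>2 + b\<^sup>2 * k2 ^ 4"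
  have b: "b > 0" using assms by (simp add: b_def)
  have k3: "1 \<le> \<bar>k3\<bar>" using False by (simp add: k3_def)
  have kn: "\<bar>k1\<bar> \<le> n" "\<bar>k2\<bar> \<le> n" "\<bar>k3\<bar> \<le> n"
    unfolding k1_def k2_def k3_def n_def by (rule component_le_norm_cart)+
  have n: "n \<ge> 1" using k3 kn by linarith
  have n2: "n\<^sup>2 = k1\<^sup>2 + k2\<^sup>2 + k3\<^sup>2"
    unfolding n_def k1_def k2_def k3_def by (simp add: norm_eq_sqrt_inner inner_vec_def sum_3 power2_eq_square)
  define q where "q = \<bar>k3\<bar> * n"
  have q: "q > 0" unfolding q_def using k3 n by (intro mult_pos_pos) auto
  have Dq: "D = (2 * \<Omega> * q)\<^sup>2 + (b * k2\<^sup>2)\<^sup>2"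
    by (simp add: D_def q_def power_mult_distrib power2_abs flip: power_mult)
  have D1: "D \<ge> (2 * \<Omega> * q)\<^sup>2" unfolding Dq by simp
  have D2: "D \<ge> 2 * (2 * \<Omega> * q) * (b * k2\<^sup>2)" unfolding Dq by (rule sum_squares_bound)
  have Dpos: "D > 0" using D1 q assms by (intro less_le_trans[OF _ D1]) auto
  have t1: "\<bar>2 * \<Omega> * a * k3 * n\<^sup>2 / D\<bar> \<le> n / (2 * \<Omega>)" if "\<bar>a\<bar> \<le> n" for a
  proof -
    have "\<bar>2 * \<Omega> * a * k3 * n\<^sup>2\<bar> = 2 * \<Omega> * \<bar>a\<bar> * (q * n)"
      using assms n by (simp add: abs_mult q_def power2_eq_square mult_ac)
    also have "\<dots> \<le> 2 * \<Omega> * n * (q * n)"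
      using that assms q n by (intro mult_right_mono mult_left_mono) auto
    also have "\<dots> \<le> 2 * \<Omega> * n * (q * q)"
    proof -
      \<comment> \<open>The third frequency is a nonzero integer, so |k_3| \<ge> 1 and
        \<open>q\<close> is at least \<open>n\<close>.\<close>
      have "n \<le> q" unfolding q_def using k3 n by (intro mult_le_cancel_right1[THEN iffD2]) auto
      then show ?thesis using assms q n by (intro mult_left_mono) auto
    qed
    also have "\<dots> = n / (2 * \<Omega>) * (2 * \<Omega> * q)\<^sup>2"
      using assms by (simp add: power2_eq_square field_simps)
    also have "\<dots> \<le> n / (2 * \<Omega>) * D"
      using assms n D1 by (intro mult_left_mono) auto
    finally show ?thesis using Dpos by (simp add: abs_divide pos_divide_le_eq)
  qed
  have t2: "\<bar>b * k2\<^sup>2 * a / D\<bar> \<le> n / (4 * \<Omega>)" if "\<bar>a\<bar> \<le> q * n" for a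
  proof -
    have "\<bar>b * k2\<^sup>2 * a\<bar> = b * k2\<^sup>2 * \<bar>a\<bar>"
      using b by (simp add: abs_mult)
    also have "\<dots> \<le> b * k2\<^sup>2 * (q * n)"
      using that b by (intro mult_left_mono) auto
    also have "\<dots> = n / (4 * \<Omega>) * (2 * (2 * \<Omega> * q) * (b * k2\<^sup>2))"
      using assms by (simp add: field_simps)
    also have "\<dots> \<le> n / (4 * \<Omega>) * D"
      using assms n D2 by (intro mult_left_mono) auto
    finally show ?thesis using Dpos by (simp add: abs_divide pos_divide_le_eq)
  qed
  have c13: "\<bar>c * k3\<bar> \<le> q * n" if "\<bar>c\<bar> \<le> n" for c
  proof -
    have "\<bar>c\<bar> * \<bar>k3\<bar> \<le> n * n * \<bar>k3\<bar>"
      using that n by (intro mult_right_mono) (auto intro: order_trans[OF that] mult_le_cancel_left1[THEN iffD2])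
    then show ?thesis by (simp add: q_def abs_mult mult_ac)
  qed
  have c3: "\<bar>k1\<^sup>2 + k2\<^sup>2\<bar> \<le> q * n"
  proof -
    have "n * n * 1 \<le> n * n * \<bar>k3\<bar>" using k3 n by (intro mult_left_mono) auto
    then have "n\<^sup>2 \<le> q * n" by (simp add: q_def power2_eq_square mult_ac)
    moreover have "\<bar>k1\<^sup>2 + k2\<^sup>2\<bar> \<le> n\<^sup>2" unfolding n2 by simp
    ultimately show ?thesis by linarith
  qed
  have sym: "mg_symbol \<Omega> \<beta> \<eta> k = vector [(2 * \<Omega> * k2 * k3 * n\<^sup>2 - b * k1 * k2\<^sup>2 * k3) / D,
                 (- 2 * \<Omega> * k1 * k3 * n\<^sup>2 - b * k2 ^ 3 * k3) / D,
                 (b * k2\<^sup>2 * (k1\<^sup>2 + k2\<^sup>2)) / D]"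
    unfolding mg_symbol_def Let_def if_not_P[OF False] D_def k1_def k2_def k3_def n_def b_def ..
  have n4: "n / (4 * \<Omega>) \<le> n / (2 * \<Omega>)" using assms n by (intro divide_left_mono) auto
  have half: "n / (2 * \<Omega>) + n / (2 * \<Omega>) = 1 / \<Omega> * n" using assms by (simp add: field_simps)
  have m1: "\<bar>mg_symbol \<Omega> \<beta> \<eta> k $ 1\<bar> \<le> 1 / \<Omega> * n"
  proof -
    have "mg_symbol \<Omega> \<beta> \<eta> k $ 1 = 2 * \<Omega> * k2 * k3 * n\<^sup>2 / D - b * k2\<^sup>2 * (k1 * k3) / D"
      unfolding sym vector_3 by (simp add: diff_divide_distrib mult_ac)
    then show ?thesis using t1[OF kn(2)] t2[OF c13[OF kn(1)]] n4 half by linarith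
  qed
  have m2: "\<bar>mg_symbol \<Omega> \<beta> \<eta> k $ 2\<bar> \<le> 1 / \<Omega> * n"
  proof -
    have "mg_symbol \<Omega> \<beta> \<eta> k $ 2 = - (2 * \<Omega> * k1 * k3 * n\<^sup>2 / D) - b * k2\<^sup>2 * (k2 * k3) / D"
      unfolding sym vector_3 by (simp add: diff_divide_distrib mult_ac power2_eq_square power3_eq_cube)
    then show ?thesis using t1[OF kn(1)] t2[OF c13[OF kn(2)]] n4 half by linarith
  qed
  have m3: "\<bar>mg_symbol \<Omega> \<beta> \<eta> k $ 3\<bar> \<le> 1 / \<Omega> * n"
  proof -
    have "n / (2 * \<Omega>) \<ge> 0" using assms n by simp
    then show ?thesis using t2[OF c3] n4 half unfolding sym vector_3 by linarith
  qed
  have "norm (mg_symbol \<Omega> \<beta> \<eta> k) \<le> (\<Sum>i\<in>UNIV. \<bar>mg_symbol \<Omega> \<beta> \<eta> k $ i\<bar>)"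
    by (rule norm_le_l1_cart)
  also have "\<dots> \<le> 1 / \<Omega> * n + 1 / \<Omega> * n + 1 / \<Omega> * n"
    unfolding sum_3 by (intro add_mono m1 m2 m3)
  finally show ?thesis unfolding n_def by (simp add: field_simps)
qed

lemma abs_freq_mg_symbol_le:
  assumes "\<Omega> > 0" "\<beta> > 0" "\<eta> > 0"
  shows "\<bar>freq k \<bullet> mg_symbol \<Omega> \<beta> \<eta> (k - j)\<bar> \<le> 3 / \<Omega> * mk k j"
proof -
  have eq: "freq k \<bullet> mg_symbol \<Omega> \<beta> \<eta> (k - j) = freq j \<bullet> mg_symbol \<Omega> \<beta> \<eta> (k - j)"
    using mg_symbol_div_free[of "k - j" \<Omega> \<beta> \<eta>] by (simp add: freq_diff inner_diff_left)
  have M: "norm (mg_symbol \<Omega> \<beta> \<eta> (k - j)) \<le> 3 / \<Omega> * norm (freq (k - j))"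
    by (rule norm_mg_symbol_le[OF assms])
  have "\<bar>freq k \<bullet> mg_symbol \<Omega> \<beta> \<eta> (k - j)\<bar> \<le> norm (freq k) * norm (mg_symbol \<Omega> \<beta> \<eta> (k - j))"
    by (rule Cauchy_Schwarz_ineq2)
  moreover have "\<bar>freq k \<bullet> mg_symbol \<Omega> \<beta> \<eta> (k - j)\<bar> \<le> norm (freq j) * norm (mg_symbol \<Omega> \<beta> \<eta> (k - j))"
    unfolding eq by (rule Cauchy_Schwarz_ineq2)
  ultimately have "\<bar>freq k \<bullet> mg_symbol \<Omega> \<beta> \<eta> (k - j)\<bar> \<le> min (norm (freq k)) (norm (freq j)) * norm (mg_symbol \<Omega> \<beta> \<eta> (k - j))"
    by (simp add: min_def)
  also have "\<dots> \<le> min (norm (freq k)) (norm (freq j)) * (3 / \<Omega> * norm (freq (k - j)))"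
    using M by (intro mult_left_mono) auto
  finally show ?thesis by (simp add: mk_def mult_ac)
qed

text \<open>The contribution of frequency \<open>j\<close> of \<open>v\<close> to the coefficient at
  \<open>k\<close> of div (v M[u]): \<open>u\<close> generates the velocity, \<open>v\<close> is
  transported, and \<open>freq k\<close> comes from the divergence.\<close>

definition Nl_term :: "real \<Rightarrow> real \<Rightarrow> real \<Rightarrow> (int^3 \<Rightarrow> complex) \<Rightarrow> (int^3 \<Rightarrow> complex) \<Rightarrow> int^3 \<Rightarrow> int^3 \<Rightarrow> complex" where
  "Nl_term \<Omega> \<beta> \<eta> u v k j = \<i> * complex_of_real (freq k \<bullet> mg_symbol \<Omega> \<beta> \<eta> (k - j)) * (u (k - j) * v j)"

definition Nl :: "real \<Rightarrow> real \<Rightarrow> real \<Rightarrow> (int^3 \<Rightarrow> complex) \<Rightarrow> (int^3 \<Rightarrow> complex) \<Rightarrow> int^3 \<Rightarrow> complex" where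
  "Nl \<Omega> \<beta> \<eta> u v k = infsum (Nl_term \<Omega> \<beta> \<eta> u v k) UNIV"

lemma norm_Nl_term_le:
  assumes "\<Omega> > 0" "\<beta> > 0" "\<eta> > 0" "\<And>k. norm (u k) \<le> A k" "\<And>k. norm (v k) \<le> B k"
  shows "norm (Nl_term \<Omega> \<beta> \<eta> u v k j) \<le> 3 / \<Omega> * (mk k j * (A (k - j) * B j))"
proof -
  have "norm (Nl_term \<Omega> \<beta> \<eta> u v k j) = \<bar>freq k \<bullet> mg_symbol \<Omega> \<beta> \<eta> (k - j)\<bar> * (norm (u (k - j)) * norm (v j))"
    by (simp add: Nl_term_def norm_mult)
  also have "\<dots> \<le> (3 / \<Omega> * mk k j) * (A (k - j) * B j)"
    using assms order_trans[OF norm_ge_zero assms(4)] by (intro mult_mono abs_freq_mg_symbol_le) auto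
  finally show ?thesis by (simp add: mult_ac)
qed

lemma Nl_estimate:
  assumes pos: "\<Omega> > 0" "\<beta> > 0" "\<eta> > 0" and r: "1 \<le> r" "r \<le> 2" and s: "s + r > 7/2"
    and u: "hs s u" and v: "hs s v"
  shows "(\<lambda>j. norm (Nl_term \<Omega> \<beta> \<eta> u v k j)) summable_on UNIV"
    and "infsum (\<lambda>j. norm (Nl_term \<Omega> \<beta> \<eta> u v k j)) UNIV \<le> 3 / \<Omega> * Kc (\<lambda>k. norm (u k)) (\<lambda>k. norm (v k)) k"
    and "norm (Nl \<Omega> \<beta> \<eta> u v k) \<le> 3 / \<Omega> * Kc (\<lambda>k. norm (u k)) (\<lambda>k. norm (v k)) k"
    and "hs (s - r) (Nl \<Omega> \<beta> \<eta> u v)"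
    and "hnorm (s - r) (Nl \<Omega> \<beta> \<eta> u v) \<le> 3 / \<Omega> * bil_const s r * (hnorm s u * hnorm s v)"
proof -
  have nu: "hs s (\<lambda>k. norm (u k))" "hnorm s (\<lambda>k. norm (u k)) = hnorm s u"
    and nv: "hs s (\<lambda>k. norm (v k))" "hnorm s (\<lambda>k. norm (v k)) = hnorm s v"
    using u v by (simp_all add: hs_def hnorm_def)
  note K = Kc_estimate[OF r s _ nu(1) _ nv(1), simplified]
  have le: "norm (Nl_term \<Omega> \<beta> \<eta> u v k j) \<le> 3 / \<Omega> * (mk k j * (norm (u (k - j)) * norm (v j)))" for k j
    by (rule norm_Nl_term_le[OF pos]) auto
  have sm: "(\<lambda>j. 3 / \<Omega> * (mk k j * (norm (u (k - j)) * norm (v j)))) summable_on UNIV" for k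
    by (intro summable_on_cmult_right K(1))
  show summ: "(\<lambda>j. norm (Nl_term \<Omega> \<beta> \<eta> u v k j)) summable_on UNIV" for k
    by (rule summable_on_comparison_test[OF sm]) (use le in auto)
  show inf: "infsum (\<lambda>j. norm (Nl_term \<Omega> \<beta> \<eta> u v k j)) UNIV \<le> 3 / \<Omega> * Kc (\<lambda>k. norm (u k)) (\<lambda>k. norm (v k)) k" for k
  proof -
    have "infsum (\<lambda>j. norm (Nl_term \<Omega> \<beta> \<eta> u v k j)) UNIV \<le> infsum (\<lambda>j. 3 / \<Omega> * (mk k j * (norm (u (k - j)) * norm (v j)))) UNIV"
      by (rule infsum_mono[OF summ sm le])
    then show ?thesis by (simp only: Kc_def infsum_cmult_right')
  qed
  show nl: "norm (Nl \<Omega> \<beta> \<eta> u v k) \<le> 3 / \<Omega> * Kc (\<lambda>k. norm (u k)) (\<lambda>k. norm (v k)) k" for k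
    unfolding Nl_def by (rule order_trans[OF norm_infsum_bound[OF summ] inf])
  have *: "norm (Nl \<Omega> \<beta> \<eta> u v k) \<le> 3 / \<Omega> * jb k powr 0 * norm (Kc (\<lambda>k. norm (u k)) (\<lambda>k. norm (v k)) k)" for k
    using nl[of k] K(2)[of k] by simp
  show "hs (s - r) (Nl \<Omega> \<beta> \<eta> u v)"
    by (rule hs_weight(1)[OF K(3) _ *]) (use pos in auto)
  have "hnorm (s - r) (Nl \<Omega> \<beta> \<eta> u v) \<le> 3 / \<Omega> * hnorm (s - r) (Kc (\<lambda>k. norm (u k)) (\<lambda>k. norm (v k)))"
    by (rule hs_weight(2)[OF K(3) _ *]) (use pos in auto)
  also have "\<dots> \<le> 3 / \<Omega> * (bil_const s r * (hnorm s u * hnorm s v))"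
    using K(4) pos by (intro mult_left_mono) (auto simp: nu(2) nv(2))
  finally show "hnorm (s - r) (Nl \<Omega> \<beta> \<eta> u v) \<le> 3 / \<Omega> * bil_const s r * (hnorm s u * hnorm s v)"
    by (simp add: mult.assoc)
qed

lemma infsum_diff_complex:
  fixes f g :: "'i \<Rightarrow> complex"
  assumes "f summable_on A" "g summable_on A"
  shows "infsum (\<lambda>k. f k - g k) A = infsum f A - infsum g A"
  using infsum_add[OF assms(1), of "\<lambda>k. - g k"] assms(2)
  by (simp add: infsum_uminus summable_on_uminus)

lemma Nl_diff:
  assumes pos: "\<Omega> > 0" "\<beta> > 0" "\<eta> > 0" and r: "1 \<le> r" "r \<le> 2" and s: "s + r > 7/2"
    and u: "hs s u" and u': "hs s u'" and v: "hs s v" and v': "hs s v'"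
  shows "Nl \<Omega> \<beta> \<eta> u v k - Nl \<Omega> \<beta> \<eta> u' v' k
    = Nl \<Omega> \<beta> \<eta> u (\<lambda>k. v k - v' k) k + Nl \<Omega> \<beta> \<eta> (\<lambda>k. u k - u' k) v' k"
proof -
  have sm: "Nl_term \<Omega> \<beta> \<eta> a b k summable_on UNIV" if "hs s a" "hs s b" for a b
    using Nl_estimate(1)[OF pos r s that] by (rule abs_summable_summable)
  have "Nl \<Omega> \<beta> \<eta> u v k - Nl \<Omega> \<beta> \<eta> u' v' k = infsum (\<lambda>j. Nl_term \<Omega> \<beta> \<eta> u v k j - Nl_term \<Omega> \<beta> \<eta> u' v' k j) UNIV"
    unfolding Nl_def by (rule infsum_diff_complex[symmetric]) (intro sm u v u' v')+
  also have "\<dots> = infsum (\<lambda>j. Nl_term \<Omega> \<beta> \<eta> u (\<lambda>k. v k - v' k) k j + Nl_term \<Omega> \<beta> \<eta> (\<lambda>k. u k - u' k) v' k j) UNIV"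
    by (rule infsum_cong) (simp add: Nl_term_def algebra_simps)
  also have "\<dots> = Nl \<Omega> \<beta> \<eta> u (\<lambda>k. v k - v' k) k + Nl \<Omega> \<beta> \<eta> (\<lambda>k. u k - u' k) v' k"
    unfolding Nl_def by (rule infsum_add) (intro sm u v v' hs_diff u')+
  finally show ?thesis .
qed

text \<open>Conjugation flips the sign of the imaginary unit, and passing from (k, j) to (-k, -j)
  flips the sign of \<open>freq k\<close> while the symbol is even.\<close>

lemma Nl_hermitian:
  assumes "hermitian u" "hermitian v"
  shows "hermitian (Nl \<Omega> \<beta> \<eta> u v)"
  unfolding hermitian_def
proof
  fix k
  have "cnj (Nl_term \<Omega> \<beta> \<eta> u v k j) = Nl_term \<Omega> \<beta> \<eta> u v (- k) (- j)" for j
  proof -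
    have "- k - - j = - (k - j)" by simp
    then show ?thesis
      using assms unfolding Nl_term_def hermitian_def
      by (simp only: mg_symbol_minus freq_minus inner_minus_left) simp
  qed
  then have "cnj (Nl \<Omega> \<beta> \<eta> u v k) = infsum (\<lambda>j. Nl_term \<Omega> \<beta> \<eta> u v (- k) (- j)) UNIV"
    unfolding Nl_def infsum_cnj[symmetric] by simp
  also have "\<dots> = Nl \<Omega> \<beta> \<eta> u v (- k)"
    unfolding Nl_def using infsum_reindex_bij_betw[OF bij_uminus_int3, of "Nl_term \<Omega> \<beta> \<eta> u v (- k)"] by simp
  finally show "Nl \<Omega> \<beta> \<eta> u v (- k) = cnj (Nl \<Omega> \<beta> \<eta> u v k)" by simp
qed

section \<open>Damped scalar equations\<close>

abbreviation TI :: "real \<Rightarrow> real measure" where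
  "TI t \<equiv> lebesgue_on {0<..<t}"

lemma finite_measure_TI: "finite_measure (TI t)"
  by (rule finite_measure_lebesgue_on) simp

lemma sigma_finite_TI: "sigma_finite_measure (TI t)"
  using finite_measure_TI by (simp add: finite_measure_def)

lemma TI_restrict:
  assumes "t \<le> T"
  shows "TI t = restrict_space (TI T) {0<..<t}"
proof -
  have "{0<..<T} \<inter> {0<..<t} = {0<..<t}" using assms by auto
  then show ?thesis by (subst restrict_restrict_space) auto
qed

lemma TI_sub_sets: "t \<le> T \<Longrightarrow> {0<..<t} \<inter> space (TI T) \<in> sets (TI T)"
  by (auto simp: sets_restrict_space)

lemma LINT_TI:
  fixes f :: "real \<Rightarrow> 'b::euclidean_space"
  assumes "t \<le> T"
  shows "(LINT \<tau>|TI t. f \<tau>) = (LINT \<tau>|TI T. indicator {0<..<t} \<tau> *\<^sub>R f \<tau>)"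
  unfolding TI_restrict[OF assms] by (rule integral_restrict_space) (rule TI_sub_sets[OF assms])

lemma integrable_lebesgue_on_subset:
  fixes f :: "real \<Rightarrow> 'b::euclidean_space"
  assumes f: "integrable (lebesgue_on S) f" and sub: "R \<subseteq> S" and meas: "R \<in> sets lebesgue" "S \<in> sets lebesgue"
  shows "integrable (lebesgue_on R) f"
proof -
  have R: "R \<in> sets (lebesgue_on S)" using sub meas by (simp add: sets_restrict_space_iff)
  have "S \<inter> R = R" using sub by auto
  then have eq: "lebesgue_on R = restrict_space (lebesgue_on S) R"
    using meas by (subst restrict_restrict_space) auto
  have "integrable (lebesgue_on S) (\<lambda>\<tau>. indicator R \<tau> *\<^sub>R f \<tau>)"
    by (rule integrable_mult_indicator[OF R f])
  then show ?thesis
    unfolding eq using R sub by (subst integrable_restrict_space) (auto simp: Int_absorb2)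
qed

lemma integrable_TI:
  fixes f :: "real \<Rightarrow> 'b::euclidean_space"
  assumes "integrable (TI T) f" "t \<le> T"
  shows "integrable (TI t) f"
  by (rule integrable_lebesgue_on_subset[OF assms(1)]) (use assms(2) in auto)

lemma measurable_TI:
  fixes f :: "real \<Rightarrow> 'b::euclidean_space"
  assumes "f \<in> borel_measurable (TI T)" "t \<le> T"
  shows "f \<in> borel_measurable (TI t)"
  unfolding TI_restrict[OF assms(2)] by (rule measurable_restrict_space1[OF assms(1)])

lemma AE_TI:
  assumes "AE \<tau> in TI T. P \<tau>" "t \<le> T"
  shows "AE \<tau> in TI t. P \<tau>"
  using assms(1) unfolding TI_restrict[OF assms(2)]
  by (subst AE_restrict_space_iff[OF TI_sub_sets[OF assms(2)]]) (auto elim: eventually_mono)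

lemma LINT_TI_integral:
  fixes f :: "real \<Rightarrow> 'b::euclidean_space"
  assumes "integrable (TI T) f" "t \<le> T"
  shows "(LINT \<tau>|TI t. f \<tau>) = integral {0..t} f"
  using lebesgue_integral_eq_integral[OF integrable_TI[OF assms]]
  by (simp add: integral_open_interval_real)

lemma continuous_LINT_TI:
  fixes f :: "real \<Rightarrow> 'b::euclidean_space"
  assumes "integrable (TI T) f"
  shows "continuous_on {0..T} (\<lambda>t. LINT \<tau>|TI t. f \<tau>)"
proof -
  have "f integrable_on {0<..<T}" by (rule integrable_on_lebesgue_on[OF assms]) simp
  then have "f integrable_on {0..T}"
    using integrable_on_open_interval_real by blast
  then have "continuous_on {0..T} (\<lambda>t. integral {0..t} f)" by (rule indefinite_integral_continuous_1)
  then show ?thesis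
    by (rule continuous_on_eq) (use LINT_TI_integral[OF assms] in auto)
qed

lemma ident_measurable_TI [measurable]: "(\<lambda>x. x) \<in> borel_measurable (lebesgue_on (S :: real set))"
  using id_borel_measurable_lebesgue_on[of S] by (simp add: id_def)

lemma continuous_measurable_TI:
  fixes f :: "real \<Rightarrow> 'b::euclidean_space"
  assumes "continuous_on {0..T} f"
  shows "f \<in> borel_measurable (TI T)"
  by (rule continuous_imp_measurable_on_sets_lebesgue) (rule continuous_on_subset[OF assms], auto)

lemma continuous_integrable_TI:
  fixes f :: "real \<Rightarrow> 'b::euclidean_space"
  assumes "continuous_on {0..T} f"
  shows "integrable (TI T) f"
proof -
  have "compact (f ` {0..T})" by (intro compact_continuous_image assms) simp
  then obtain B where B: "\<And>t. t \<in> {0..T} \<Longrightarrow> norm (f t) \<le> B"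
    using compact_imp_bounded bounded_iff by (metis image_eqI)
  show ?thesis
    by (rule finite_measure.integrable_const_bound[OF finite_measure_TI, where B = B])
       (use B continuous_measurable_TI[OF assms] in \<open>auto intro!: AE_I2\<close>)
qed

lemma integrable_exp_mult_TI:
  fixes f :: "real \<Rightarrow> 'b::euclidean_space"
  assumes "integrable (TI T) f"
  shows "integrable (TI T) (\<lambda>\<tau>. exp (c * \<tau>) *\<^sub>R f \<tau>)"
proof (rule Bochner_Integration.integrable_bound)
  show "integrable (TI T) (\<lambda>\<tau>. exp (\<bar>c\<bar> * T) *\<^sub>R f \<tau>)" using assms by simp
  have [measurable]: "f \<in> borel_measurable (TI T)" using assms by auto
  show "(\<lambda>\<tau>. exp (c * \<tau>) *\<^sub>R f \<tau>) \<in> borel_measurable (TI T)" by measurable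
  show "AE \<tau> in TI T. norm (exp (c * \<tau>) *\<^sub>R f \<tau>) \<le> norm (exp (\<bar>c\<bar> * T) *\<^sub>R f \<tau>)"
  proof (intro AE_I2)
    fix \<tau> assume "\<tau> \<in> space (TI T)"
    then have "c * \<tau> \<le> \<bar>c\<bar> * T" by (intro mult_mono) auto
    then show "norm (exp (c * \<tau>) *\<^sub>R f \<tau>) \<le> norm (exp (\<bar>c\<bar> * T) *\<^sub>R f \<tau>)"
      by (auto intro!: mult_right_mono)
  qed
qed

lemma LINT_exp_TI:
  assumes "0 \<le> \<sigma>" "\<sigma> \<le> t"
  shows "(LINT \<tau>|TI t. indicator {\<sigma><..<t} \<tau> * (c * exp (c * \<tau>))) = exp (c * t) - exp (c * \<sigma>)"
proof -
  have e: "{0<..<t} \<inter> {\<sigma><..<t} = {\<sigma><..<t}" using assms by auto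
  have "(LINT \<tau>|TI t. indicator {\<sigma><..<t} \<tau> * (c * exp (c * \<tau>))) = (LINT \<tau>|lebesgue_on {\<sigma><..<t}. c * exp (c * \<tau>))"
  proof -
    have S: "{\<sigma><..<t} \<inter> space (TI t) \<in> sets (TI t)"
      using assms by (auto simp: sets_restrict_space_iff)
    have "restrict_space (TI t) {\<sigma><..<t} = lebesgue_on {\<sigma><..<t}"
      using assms by (subst restrict_restrict_space) (simp_all add: max_absorb2)
    then show ?thesis
      using integral_restrict_space[OF S, of "\<lambda>\<tau>. c * exp (c * \<tau>)"] by simp
  qed
  also have "\<dots> = integral {\<sigma><..<t} (\<lambda>\<tau>. c * exp (c * \<tau>))"
  proof (rule lebesgue_integral_eq_integral)
    have "integrable (lebesgue_on {\<sigma>..t}) (\<lambda>\<tau>. c * exp (c * \<tau>))"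
      by (intro continuous_imp_integrable_real continuous_intros)
    then show "integrable (lebesgue_on {\<sigma><..<t}) (\<lambda>\<tau>. c * exp (c * \<tau>))"
      by (rule integrable_lebesgue_on_subset) auto
  qed simp
  also have "\<dots> = integral {\<sigma>..t} (\<lambda>\<tau>. c * exp (c * \<tau>))"
    by (rule integral_open_interval_real[symmetric])
  also have "\<dots> = exp (c * t) - exp (c * \<sigma>)"
  proof (rule integral_unique, rule fundamental_theorem_of_calculus[OF assms(2)])
    show "((\<lambda>\<tau>. exp (c * \<tau>)) has_vector_derivative c * exp (c * \<tau>)) (at \<tau> within {\<sigma>..t})" for \<tau>
      by (auto intro!: derivative_eq_intros simp: has_real_derivative_iff_has_vector_derivative[symmetric])
  qed
  finally show ?thesis .
qed

lemma integrable_indicator_exp: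
  "integrable (TI t) (\<lambda>\<tau>. indicator {\<sigma><..<t} \<tau> * (c * exp (c * \<tau>)) :: real)"
proof -
  have "integrable (TI t) (\<lambda>\<tau>. c * exp (c * \<tau>))"
    by (intro continuous_integrable_TI continuous_intros)
  moreover have "{\<sigma><..<t} \<inter> {0<..<t} \<in> sets (TI t)"
    unfolding sets_restrict_space by (rule image_eqI[of _ _ "{\<sigma><..<t}"]) auto
  ultimately have "integrable (TI t) (\<lambda>\<tau>. indicator ({\<sigma><..<t} \<inter> {0<..<t}) \<tau> *\<^sub>R (c * exp (c * \<tau>)))"
    by (intro integrable_mult_indicator)
  then show ?thesis
    by (rule Bochner_Integration.integrable_cong[THEN iffD1, rotated 2]) (auto simp: indicator_def)
qed

text \<open>Integration by parts against an exponential for a merely integrable \<open>g\<close>: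
  Fubini on the triangle \<sigma> < \<tau>, with the inner integral of the exponential computed
  explicitly.\<close>

lemma iterated_integral_exp:
  fixes g :: "real \<Rightarrow> 'b::euclidean_space"
  assumes g: "integrable (TI t) g"
  shows "(LINT \<tau>|TI t. (c * exp (c * \<tau>)) *\<^sub>R (LINT \<sigma>|TI \<tau>. g \<sigma>))
    = (LINT \<sigma>|TI t. (exp (c * t) - exp (c * \<sigma>)) *\<^sub>R g \<sigma>)"
proof -
  let ?M = "TI t"
  interpret pair_sigma_finite ?M ?M
    by (simp add: pair_sigma_finite_def sigma_finite_TI)
  interpret finite_measure ?M by (rule finite_measure_TI)
  define h where "h \<tau> \<sigma> = (if \<sigma> < \<tau> then (c * exp (c * \<tau>)) *\<^sub>R g \<sigma> else 0)" for \<tau> \<sigma>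
  have [measurable]: "g \<in> borel_measurable ?M" using g by auto
  have hm: "case_prod h \<in> borel_measurable (?M \<Otimes>\<^sub>M ?M)"
    unfolding h_def by measurable
  define C where "C = \<bar>c\<bar> * exp (\<bar>c\<bar> * t)"
  have hb: "norm (h \<tau> \<sigma>) \<le> C * norm (g \<sigma>)" if "\<tau> \<in> {0<..<t}" for \<tau> \<sigma>
  proof -
    have "c * \<tau> \<le> \<bar>c\<bar> * t" using that by (intro mult_mono) auto
    then have "\<bar>c\<bar> * exp (c * \<tau>) \<le> C" unfolding C_def by (intro mult_left_mono) auto
    then have "\<bar>c\<bar> * exp (c * \<tau>) * norm (g \<sigma>) \<le> C * norm (g \<sigma>)" by (rule mult_right_mono) simp
    moreover have "0 \<le> C * norm (g \<sigma>)" by (simp add: C_def)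
    ultimately show ?thesis by (simp add: h_def abs_mult)
  qed
  have C0: "C \<ge> 0" by (simp add: C_def)
  have int: "integrable (?M \<Otimes>\<^sub>M ?M) (case_prod h)"
  proof (rule integrableI_bounded[OF hm])
    have "(\<integral>\<^sup>+z. ennreal (norm (case_prod h z)) \<partial>(?M \<Otimes>\<^sub>M ?M)) = (\<integral>\<^sup>+\<tau>. \<integral>\<^sup>+\<sigma>. ennreal (norm (h \<tau> \<sigma>)) \<partial>?M \<partial>?M)"
      using sigma_finite_measure.nn_integral_fst[OF sigma_finite_TI, where f = "\<lambda>z. ennreal (norm (case_prod h z))"] hm by simp
    also have "\<dots> \<le> (\<integral>\<^sup>+\<tau>. \<integral>\<^sup>+\<sigma>. ennreal (C * norm (g \<sigma>)) \<partial>?M \<partial>?M)"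
      using hb by (intro nn_integral_mono ennreal_leI) auto
    also have "\<dots> = ennreal C * (\<integral>\<^sup>+\<sigma>. ennreal (norm (g \<sigma>)) \<partial>?M) * emeasure ?M (space ?M)"
      using C0 by (simp add: ennreal_mult' nn_integral_cmult)
    also have "\<dots> < \<infinity>"
    proof -
      have "emeasure ?M {0<..<t} < top"
        using finite_measure.emeasure_finite[OF finite_measure_TI, of t "{0<..<t}"]
        by (simp only: top.not_eq_extremum)
      then show ?thesis using g by (auto simp: ennreal_mult_less_top integrable_iff_bounded)
    qed
    finally show "(\<integral>\<^sup>+z. ennreal (norm (case_prod h z)) \<partial>(?M \<Otimes>\<^sub>M ?M)) < \<infinity>" .
  qed
  have "(LINT \<tau>|?M. (c * exp (c * \<tau>)) *\<^sub>R (LINT \<sigma>|TI \<tau>. g \<sigma>)) = (LINT \<tau>|?M. LINT \<sigma>|?M. h \<tau> \<sigma>)"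
  proof (rule Bochner_Integration.integral_cong[OF refl])
    fix \<tau> assume "\<tau> \<in> space ?M"
    then have \<tau>: "0 < \<tau>" "\<tau> < t" by auto
    have "(c * exp (c * \<tau>)) *\<^sub>R (LINT \<sigma>|TI \<tau>. g \<sigma>) = (LINT \<sigma>|?M. (c * exp (c * \<tau>)) *\<^sub>R (indicator {0<..<\<tau>} \<sigma> *\<^sub>R g \<sigma>))"
      by (simp only: LINT_TI[OF less_imp_le[OF \<tau>(2)]] Bochner_Integration.integral_scaleR_right)
    also have "\<dots> = (LINT \<sigma>|?M. h \<tau> \<sigma>)"
      by (rule Bochner_Integration.integral_cong[OF refl]) (auto simp: h_def indicator_def)
    finally show "(c * exp (c * \<tau>)) *\<^sub>R (LINT \<sigma>|TI \<tau>. g \<sigma>) = (LINT \<sigma>|?M. h \<tau> \<sigma>)" .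
  qed
  also have "\<dots> = (LINT \<sigma>|?M. LINT \<tau>|?M. h \<tau> \<sigma>)"
    by (rule Fubini_integral[OF int, symmetric])
  also have "\<dots> = (LINT \<sigma>|?M. (exp (c * t) - exp (c * \<sigma>)) *\<^sub>R g \<sigma>)"
  proof (rule Bochner_Integration.integral_cong[OF refl])
    fix \<sigma> assume "\<sigma> \<in> space ?M"
    then have \<sigma>: "0 < \<sigma>" "\<sigma> < t" by auto
    have "(LINT \<tau>|?M. h \<tau> \<sigma>) = (LINT \<tau>|?M. (indicator {\<sigma><..<t} \<tau> * (c * exp (c * \<tau>))) *\<^sub>R g \<sigma>)"
      by (rule Bochner_Integration.integral_cong[OF refl]) (auto simp: h_def indicator_def)
    also have "\<dots> = (LINT \<tau>|?M. indicator {\<sigma><..<t} \<tau> * (c * exp (c * \<tau>))) *\<^sub>R g \<sigma>"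
      by (rule Bochner_Integration.integral_scaleR_left) (rule integrable_indicator_exp)
    finally show "(LINT \<tau>|?M. h \<tau> \<sigma>) = (exp (c * t) - exp (c * \<sigma>)) *\<^sub>R g \<sigma>"
      using \<sigma> by (simp add: LINT_exp_TI)
  qed
  finally show ?thesis .
qed

section \<open>Duhamel's formula for y' + \<mu> y = f and its estimates in L^2\<close>

definition duh :: "real \<Rightarrow> (real \<Rightarrow> 'b::euclidean_space) \<Rightarrow> real \<Rightarrow> 'b" where
  "duh \<mu> f t = (LINT \<sigma>|TI t. exp (- (\<mu> * (t - \<sigma>))) *\<^sub>R f \<sigma>)"

lemma duh_eq: "duh \<mu> f t = exp (- (\<mu> * t)) *\<^sub>R (LINT \<sigma>|TI t. exp (\<mu> * \<sigma>) *\<^sub>R f \<sigma>)"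
proof -
  have "exp (- (\<mu> * (t - \<sigma>))) *\<^sub>R f \<sigma> = exp (- (\<mu> * t)) *\<^sub>R (exp (\<mu> * \<sigma>) *\<^sub>R f \<sigma>)" for \<sigma>
    by (simp add: exp_add[symmetric] algebra_simps)
  then show ?thesis unfolding duh_def by (simp only: Bochner_Integration.integral_scaleR_right)
qed

lemma continuous_duh:
  assumes "integrable (TI T) f"
  shows "continuous_on {0..T} (duh \<mu> f)"
  unfolding duh_eq[abs_def]
  by (intro continuous_intros continuous_LINT_TI integrable_exp_mult_TI assms)

lemma LINT_exp_const:
  fixes y :: "'b::euclidean_space"
  assumes "0 \<le> t"
  shows "(LINT \<tau>|TI t. (c * exp (c * \<tau>)) *\<^sub>R y) = (exp (c * t) - 1) *\<^sub>R y"
proof -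
  have "(LINT \<tau>|TI t. (c * exp (c * \<tau>)) *\<^sub>R y) = (LINT \<tau>|TI t. (indicator {0<..<t} \<tau> * (c * exp (c * \<tau>))) *\<^sub>R y)"
    by (rule Bochner_Integration.integral_cong) auto
  also have "\<dots> = (LINT \<tau>|TI t. indicator {0<..<t} \<tau> * (c * exp (c * \<tau>))) *\<^sub>R y"
    by (rule Bochner_Integration.integral_scaleR_left) (rule integrable_indicator_exp)
  finally show ?thesis using LINT_exp_TI[of 0 t c] assms by simp
qed

text \<open>The integrated form of z' = f - \<mu> z. The time integral of \<open>z\<close> contains
  a primitive multiplied by a decaying exponential, which \<open>iterated_integral_exp\<close> with
  c = -\<mu> resolves.\<close>

lemma duhamel_solves:
  fixes f :: "real \<Rightarrow> 'b::euclidean_space" and \<mu> :: real and y0 :: 'b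
  assumes f: "integrable (TI T) f" and t: "0 < t" "t \<le> T"
  defines "z \<equiv> \<lambda>t. exp (- (\<mu> * t)) *\<^sub>R y0 + duh \<mu> f t"
  shows "z t = y0 + (LINT \<tau>|TI t. f \<tau>) - \<mu> *\<^sub>R (LINT \<tau>|TI t. z \<tau>)"
proof -
  define h where "h \<sigma> = exp (\<mu> * \<sigma>) *\<^sub>R f \<sigma>" for \<sigma>
  define H where "H t = (LINT \<sigma>|TI t. h \<sigma>)" for t
  have hT: "integrable (TI T) h" unfolding h_def by (rule integrable_exp_mult_TI[OF f])
  have ht: "integrable (TI t) h" by (rule integrable_TI[OF hT t(2)])
  have ft: "integrable (TI t) f" by (rule integrable_TI[OF f t(2)])
  have z: "z = (\<lambda>t. exp (- \<mu> * t) *\<^sub>R y0 + exp (- \<mu> * t) *\<^sub>R H t)"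
    unfolding z_def duh_eq H_def h_def by simp
  have Hc: "continuous_on {0..t} H"
    unfolding H_def by (rule continuous_LINT_TI[OF ht])
  have i1: "integrable (TI t) (\<lambda>\<tau>. (- \<mu> * exp (- \<mu> * \<tau>)) *\<^sub>R y0)" "integrable (TI t) (\<lambda>\<tau>. (- \<mu> * exp (- \<mu> * \<tau>)) *\<^sub>R H \<tau>)"
    by (intro continuous_integrable_TI continuous_intros Hc)+
  have "- (\<mu> *\<^sub>R (LINT \<tau>|TI t. z \<tau>)) = (LINT \<tau>|TI t. (- \<mu>) *\<^sub>R z \<tau>)" by simp
  also have "\<dots> = (LINT \<tau>|TI t. (- \<mu> * exp (- \<mu> * \<tau>)) *\<^sub>R y0 + (- \<mu> * exp (- \<mu> * \<tau>)) *\<^sub>R H \<tau>)"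
    unfolding z by (simp add: scaleR_right_distrib)
  also have "\<dots> = (exp (- \<mu> * t) - 1) *\<^sub>R y0 + (LINT \<sigma>|TI t. (exp (- \<mu> * t) - exp (- \<mu> * \<sigma>)) *\<^sub>R h \<sigma>)"
    using LINT_exp_const[of t "- \<mu>" y0] iterated_integral_exp[OF ht, of "- \<mu>"] t
    by (subst Bochner_Integration.integral_add[OF i1]) (simp add: H_def)
  also have "(LINT \<sigma>|TI t. (exp (- \<mu> * t) - exp (- \<mu> * \<sigma>)) *\<^sub>R h \<sigma>) = (LINT \<sigma>|TI t. exp (- \<mu> * t) *\<^sub>R h \<sigma> - f \<sigma>)"
  proof -
    have "exp (- \<mu> * \<sigma>) *\<^sub>R h \<sigma> = f \<sigma>" for \<sigma> by (simp add: h_def exp_minus)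
    then show ?thesis by (simp only: scaleR_diff_left)
  qed
  also have "\<dots> = exp (- \<mu> * t) *\<^sub>R H t - (LINT \<tau>|TI t. f \<tau>)"
    using ht ft by (simp add: H_def)
  finally show ?thesis unfolding z by (simp add: algebra_simps)
qed

text \<open>The integrating factor argument without differentiation: f - \<mu> y has the primitive y
  - y0, and inserting it into \<open>iterated_integral_exp\<close> with c = \<mu> makes the
  integrals of \<open>y\<close> cancel. It applies to solutions of which only integrability is known
  beforehand.\<close>

lemma integral_eq_duhamel:
  fixes f y :: "real \<Rightarrow> 'b::euclidean_space"
  assumes f: "integrable (TI T) f" and y: "integrable (TI T) y"
    and eq: "\<And>t. t \<in> {0<..<T} \<Longrightarrow> y t = y0 + (LINT \<tau>|TI t. f \<tau>) - \<mu> *\<^sub>R (LINT \<tau>|TI t. y \<tau>)"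
    and t: "t \<in> {0<..<T}"
  shows "y t = exp (- (\<mu> * t)) *\<^sub>R y0 + duh \<mu> f t"
proof -
  have tT: "0 < t" "t \<le> T" using t by auto
  have ft: "integrable (TI t) f" and yt: "integrable (TI t) y"
    using integrable_TI[OF f tT(2)] integrable_TI[OF y tT(2)] by auto
  define g where "g \<sigma> = f \<sigma> - \<mu> *\<^sub>R y \<sigma>" for \<sigma>
  have g: "integrable (TI t) g" unfolding g_def using ft yt by auto
  have G: "(LINT \<sigma>|TI \<tau>. g \<sigma>) = y \<tau> - y0" if "0 < \<tau>" "\<tau> \<le> t" for \<tau>
  proof -
    have "\<tau> \<in> {0<..<T}" using that t by auto
    moreover have "integrable (TI \<tau>) f" "integrable (TI \<tau>) y" using integrable_TI[OF ft] integrable_TI[OF yt] that by auto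
    ultimately show ?thesis using eq[of \<tau>] by (simp add: g_def)
  qed
  define E where "E = (LINT \<sigma>|TI t. exp (\<mu> * \<sigma>) *\<^sub>R f \<sigma>)"
  define Y where "Y = (LINT \<sigma>|TI t. (\<mu> * exp (\<mu> * \<sigma>)) *\<^sub>R y \<sigma>)"
  have Yint: "integrable (TI t) (\<lambda>\<sigma>. (\<mu> * exp (\<mu> * \<sigma>)) *\<^sub>R y \<sigma>)"
  proof -
    have "integrable (TI t) (\<lambda>\<sigma>. \<mu> *\<^sub>R (exp (\<mu> * \<sigma>) *\<^sub>R y \<sigma>))"
      by (intro integrable_scaleR_right integrable_exp_mult_TI yt)
    then show ?thesis by simp
  qed
  have cint: "integrable (TI t) (\<lambda>\<sigma>. (\<mu> * exp (\<mu> * \<sigma>)) *\<^sub>R y0)"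
    by (intro continuous_integrable_TI continuous_intros)
  have "(LINT \<tau>|TI t. (\<mu> * exp (\<mu> * \<tau>)) *\<^sub>R (LINT \<sigma>|TI \<tau>. g \<sigma>)) = (LINT \<tau>|TI t. (\<mu> * exp (\<mu> * \<tau>)) *\<^sub>R y \<tau> - (\<mu> * exp (\<mu> * \<tau>)) *\<^sub>R y0)"
    by (rule Bochner_Integration.integral_cong) (auto simp: G scaleR_diff_right)
  also have "\<dots> = Y - (exp (\<mu> * t) - 1) *\<^sub>R y0"
    using Yint cint LINT_exp_const[of t \<mu> y0] tT by (simp add: Y_def)
  finally have 1: "(LINT \<sigma>|TI t. (exp (\<mu> * t) - exp (\<mu> * \<sigma>)) *\<^sub>R g \<sigma>) = Y - (exp (\<mu> * t) - 1) *\<^sub>R y0"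
    by (simp only: iterated_integral_exp[OF g])
  have "(LINT \<sigma>|TI t. (exp (\<mu> * t) - exp (\<mu> * \<sigma>)) *\<^sub>R g \<sigma>)
      = (LINT \<sigma>|TI t. exp (\<mu> * t) *\<^sub>R g \<sigma> - (exp (\<mu> * \<sigma>) *\<^sub>R f \<sigma> - (\<mu> * exp (\<mu> * \<sigma>)) *\<^sub>R y \<sigma>))"
    by (rule Bochner_Integration.integral_cong) (auto simp: g_def algebra_simps)
  also have "\<dots> = exp (\<mu> * t) *\<^sub>R (y t - y0) - (E - Y)"
    using g Yint integrable_exp_mult_TI[OF ft, of \<mu>] G[of t] tT by (simp add: E_def Y_def)
  finally have "exp (\<mu> * t) *\<^sub>R (y t - y0) - (E - Y) = Y - (exp (\<mu> * t) - 1) *\<^sub>R y0"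
    using 1 by simp
  then have "exp (\<mu> * t) *\<^sub>R y t = y0 + E" by (simp add: algebra_simps)
  then have "exp (- (\<mu> * t)) *\<^sub>R (exp (\<mu> * t) *\<^sub>R y t) = exp (- (\<mu> * t)) *\<^sub>R (y0 + E)" by simp
  then show ?thesis by (simp add: duh_eq E_def exp_minus scaleR_right_distrib)
qed

lemma LINT_Cauchy_Schwarz:
  fixes w f :: "'a \<Rightarrow> real"
  assumes w: "integrable M w" "\<And>x. w x \<ge> 0" and f: "f \<in> borel_measurable M" "\<And>x. f x \<ge> 0"
    and wf: "integrable M (\<lambda>x. w x * (f x)\<^sup>2)"
  shows "integrable M (\<lambda>x. w x * f x)" "(LINT x|M. w x * f x)\<^sup>2 \<le> (LINT x|M. w x) * (LINT x|M. w x * (f x)\<^sup>2)"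
proof -
  have [measurable]: "w \<in> borel_measurable M" using w by auto
  note f(1)[measurable]
  show int: "integrable M (\<lambda>x. w x * f x)"
  proof (rule Bochner_Integration.integrable_bound)
    show "integrable M (\<lambda>x. w x + w x * (f x)\<^sup>2)" using w wf by auto
    show "AE x in M. norm (w x * f x) \<le> norm (w x + w x * (f x)\<^sup>2)"
    proof (intro AE_I2)
      fix x
      have "0 \<le> (f x - 1)\<^sup>2" by simp
      then have "f x \<le> 1 + (f x)\<^sup>2" using f(2)[of x] by (simp add: power2_diff)
      then have "w x * f x \<le> w x * (1 + (f x)\<^sup>2)" using w(2)[of x] by (rule mult_left_mono)
      then show "norm (w x * f x) \<le> norm (w x + w x * (f x)\<^sup>2)"
        using w(2)[of x] f(2)[of x] by (simp add: distrib_left)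
    qed
  qed measurable
  let ?D = "density M (\<lambda>x. ennreal (w x))"
  have "(\<integral>\<^sup>+x. 1 * ennreal (f x) \<partial>?D)\<^sup>2 \<le> (\<integral>\<^sup>+x. 1\<^sup>2 \<partial>?D) * (\<integral>\<^sup>+x. (ennreal (f x))\<^sup>2 \<partial>?D)"
    by (rule Cauchy_Schwarz_nn_integral) auto
  then have "(\<integral>\<^sup>+x. ennreal (w x * f x) \<partial>M)\<^sup>2 \<le> (\<integral>\<^sup>+x. ennreal (w x) \<partial>M) * (\<integral>\<^sup>+x. ennreal (w x * (f x)\<^sup>2) \<partial>M)"
    using w(2) f(2) by (simp add: nn_integral_density ennreal_mult' ennreal_power del: nn_integral_const)
  moreover have "(\<integral>\<^sup>+x. ennreal (w x * f x) \<partial>M) = ennreal (LINT x|M. w x * f x)"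
    by (rule nn_integral_eq_integral[OF int]) (simp add: w(2) f(2))
  moreover have "(\<integral>\<^sup>+x. ennreal (w x) \<partial>M) = ennreal (LINT x|M. w x)"
    by (rule nn_integral_eq_integral[OF w(1)]) (simp add: w(2))
  moreover have "(\<integral>\<^sup>+x. ennreal (w x * (f x)\<^sup>2) \<partial>M) = ennreal (LINT x|M. w x * (f x)\<^sup>2)"
    by (rule nn_integral_eq_integral[OF wf]) (simp add: w(2))
  moreover have nn: "0 \<le> (LINT x|M. w x * f x)" "0 \<le> (LINT x|M. w x)" "0 \<le> (LINT x|M. w x * (f x)\<^sup>2)"
    using w(2) f(2) by (auto intro!: Bochner_Integration.integral_nonneg)
  ultimately have "ennreal ((LINT x|M. w x * f x)\<^sup>2) \<le> ennreal ((LINT x|M. w x) * (LINT x|M. w x * (f x)\<^sup>2))"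
    by (simp add: ennreal_power ennreal_mult')
  then show "(LINT x|M. w x * f x)\<^sup>2 \<le> (LINT x|M. w x) * (LINT x|M. w x * (f x)\<^sup>2)"
    using nn by simp
qed

lemma L2_TI_integrable:
  fixes f :: "real \<Rightarrow> 'b::euclidean_space"
  assumes f: "f \<in> borel_measurable (TI T)" and f2: "integrable (TI T) (\<lambda>t. (norm (f t))\<^sup>2)"
  shows "integrable (TI T) f"
proof -
  have "integrable (TI T) (\<lambda>t. (1::real) * norm (f t))"
    by (rule LINT_Cauchy_Schwarz(1))
       (use f f2 finite_measure.integrable_const[OF finite_measure_TI] in auto)
  then show ?thesis using f by (simp add: integrable_norm_iff)
qed

text \<open>\<open>\<iota>\<close> bounds the total mass of the kernel, by T or by 1/\<mu>.
  Cauchy-Schwarz with the kernel as weight bounds the square of the Duhamel integral by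
  \<open>\<iota>\<close> times \<open>Z\<close>, the Duhamel integral of |f|^2, so that both
  estimates reduce to a nonnegative scalar function.\<close>

lemma duh_L2_estimate:
  fixes f :: "real \<Rightarrow> 'b::euclidean_space"
  assumes f: "f \<in> borel_measurable (TI T)" and f2: "integrable (TI T) (\<lambda>t. (norm (f t))\<^sup>2)"
    and \<mu>: "\<mu> \<ge> 0" and T: "0 < T" and \<iota>: "\<iota> = T \<or> (\<mu> > 0 \<and> \<iota> = 1 / \<mu>)"
  shows "t \<in> {0<..<T} \<Longrightarrow> (norm (duh \<mu> f t))\<^sup>2 \<le> \<iota> * (LINT t|TI T. (norm (f t))\<^sup>2)"
    and "integrable (TI T) (\<lambda>t. (norm (duh \<mu> f t))\<^sup>2)"
    and "(LINT t|TI T. (norm (duh \<mu> f t))\<^sup>2) \<le> \<iota>\<^sup>2 * (LINT t|TI T. (norm (f t))\<^sup>2)"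
proof -
  have fi: "integrable (TI T) f" by (rule L2_TI_integrable[OF f f2])
  define F where "F = (LINT t|TI T. (norm (f t))\<^sup>2)"
  define Z where "Z = duh \<mu> (\<lambda>t. (norm (f t))\<^sup>2)"
  have F0: "F \<ge> 0" unfolding F_def by simp
  have \<iota>0: "\<iota> > 0" using \<iota> T by auto
  have w1: "exp (- (\<mu> * (t - \<sigma>))) \<le> 1" if "\<sigma> \<le> t" for t \<sigma> using \<mu> that by simp
  have wint: "integrable (TI t) (\<lambda>\<sigma>. exp (- (\<mu> * (t - \<sigma>))))" for t
    by (intro continuous_integrable_TI continuous_intros)
  have kern: "(LINT \<sigma>|TI t. exp (- (\<mu> * (t - \<sigma>)))) \<le> \<iota>" if t: "0 < t" "t \<le> T" for t
    using \<iota>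
  proof
    assume "\<iota> = T"
    have "(LINT \<sigma>|TI t. exp (- (\<mu> * (t - \<sigma>)))) \<le> (LINT \<sigma>|TI t. 1)"
      by (rule integral_mono[OF wint finite_measure.integrable_const[OF finite_measure_TI]]) (use w1 in auto)
    also have "\<dots> = t" using t by (simp add: measure_restrict_space)
    finally show ?thesis using \<open>\<iota> = T\<close> t by simp
  next
    assume a: "\<mu> > 0 \<and> \<iota> = 1 / \<mu>"
    have "(LINT \<sigma>|TI t. exp (- (\<mu> * (t - \<sigma>)))) = (LINT \<sigma>|TI t. (\<mu> * exp (\<mu> * \<sigma>)) *\<^sub>R (exp (- (\<mu> * t)) / \<mu>))"
      using a by (intro Bochner_Integration.integral_cong) (auto simp: exp_add[symmetric] algebra_simps)
    also have "\<dots> = (1 - exp (- (\<mu> * t))) / \<mu>"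
      using LINT_exp_const[of t \<mu> "exp (- (\<mu> * t)) / \<mu>"] t by (simp add: left_diff_distrib exp_add[symmetric] diff_divide_distrib)
    also have "\<dots> \<le> \<iota>" using a by (simp add: divide_right_mono)
    finally show ?thesis .
  qed
  have pt: "(norm (duh \<mu> f t))\<^sup>2 \<le> \<iota> * Z t" if t: "0 < t" "t \<le> T" for t
  proof -
    have f2t: "integrable (TI t) (\<lambda>\<sigma>. (norm (f \<sigma>))\<^sup>2)" by (rule integrable_TI[OF f2 t(2)])
    have wf2: "integrable (TI t) (\<lambda>\<sigma>. exp (- (\<mu> * (t - \<sigma>))) * (norm (f \<sigma>))\<^sup>2)"
    proof -
      have "integrable (TI t) (\<lambda>\<sigma>. exp (- (\<mu> * t)) *\<^sub>R (exp (\<mu> * \<sigma>) *\<^sub>R (norm (f \<sigma>))\<^sup>2))"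
        by (intro integrable_scaleR_right integrable_exp_mult_TI f2t)
      then show ?thesis by (simp add: mult.assoc[symmetric] exp_add[symmetric] algebra_simps)
    qed
    have ft: "(\<lambda>\<sigma>. norm (f \<sigma>)) \<in> borel_measurable (TI t)" using measurable_TI[OF f t(2)] by simp
    have "norm (duh \<mu> f t) \<le> (LINT \<sigma>|TI t. norm (exp (- (\<mu> * (t - \<sigma>))) *\<^sub>R f \<sigma>))"
      unfolding duh_def by (rule integral_norm_bound)
    also have "\<dots> = (LINT \<sigma>|TI t. exp (- (\<mu> * (t - \<sigma>))) * norm (f \<sigma>))" by simp
    finally have "(norm (duh \<mu> f t))\<^sup>2 \<le> (LINT \<sigma>|TI t. exp (- (\<mu> * (t - \<sigma>))) * norm (f \<sigma>))\<^sup>2"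
      by (intro power_mono) auto
    also have "\<dots> \<le> (LINT \<sigma>|TI t. exp (- (\<mu> * (t - \<sigma>)))) * (LINT \<sigma>|TI t. exp (- (\<mu> * (t - \<sigma>))) * (norm (f \<sigma>))\<^sup>2)"
      by (rule LINT_Cauchy_Schwarz(2)[OF wint _ ft _ wf2]) auto
    also have "\<dots> \<le> \<iota> * Z t"
      unfolding Z_def duh_def using kern[OF t] by (auto intro!: mult_right_mono Bochner_Integration.integral_nonneg)
    finally show ?thesis .
  qed
  have Z0: "0 \<le> Z t" for t unfolding Z_def duh_def by (simp add: Bochner_Integration.integral_nonneg)
  have Zc: "continuous_on {0..T} Z" unfolding Z_def by (rule continuous_duh[OF f2])
  have Zint: "integrable (TI T) Z" by (rule continuous_integrable_TI[OF Zc])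
  \<comment> \<open>\<open>Z\<close> itself solves a damped equation. As all terms are nonnegative,
    this one identity bounds both \<open>Z\<close> and \<mu> times its time integral by
    \<open>F\<close>.\<close>
  have Zeq: "Z t = (LINT \<tau>|TI t. (norm (f \<tau>))\<^sup>2) - \<mu> * (LINT \<tau>|TI t. Z \<tau>)" if "0 < t" "t \<le> T" for t
    using duhamel_solves[OF f2 that, of \<mu> 0] by (simp add: Z_def)
  have ZF: "Z t \<le> F" if t: "0 < t" "t \<le> T" for t
  proof -
    have "0 \<le> \<mu> * (LINT \<tau>|TI t. Z \<tau>)" using \<mu> Z0 by (simp add: Bochner_Integration.integral_nonneg)
    moreover have "(LINT \<tau>|TI t. (norm (f \<tau>))\<^sup>2) \<le> F"
      unfolding F_def LINT_TI[OF t(2)] using f2 t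
      by (intro integral_mono integrable_mult_indicator) (auto simp: sets_restrict_space indicator_def)
    ultimately show ?thesis using Zeq[OF t] by linarith
  qed
  show "(norm (duh \<mu> f t))\<^sup>2 \<le> \<iota> * (LINT t|TI T. (norm (f t))\<^sup>2)" if "t \<in> {0<..<T}"
  proof -
    have "(norm (duh \<mu> f t))\<^sup>2 \<le> \<iota> * Z t" using pt that by auto
    also have "\<dots> \<le> \<iota> * F" using ZF[of t] that \<iota>0 by (intro mult_left_mono) auto
    finally show ?thesis by (simp add: F_def)
  qed
  have dc: "continuous_on {0..T} (duh \<mu> f)" by (rule continuous_duh[OF fi])
  show d2: "integrable (TI T) (\<lambda>t. (norm (duh \<mu> f t))\<^sup>2)"
    by (intro continuous_integrable_TI continuous_intros dc)
  have ZI: "(LINT t|TI T. Z t) \<le> \<iota> * F"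
    using \<iota>
  proof
    assume "\<iota> = T"
    have "(LINT t|TI T. Z t) \<le> (LINT t|TI T. F)"
      by (rule integral_mono[OF Zint finite_measure.integrable_const[OF finite_measure_TI]]) (use ZF in auto)
    then show ?thesis using T \<open>\<iota> = T\<close> by (simp add: measure_restrict_space mult.commute)
  next
    assume a: "\<mu> > 0 \<and> \<iota> = 1 / \<mu>"
    have "\<mu> * (LINT t|TI T. Z t) \<le> F" using Zeq[of T] Z0[of T] T by (simp add: F_def)
    then show ?thesis using a by (simp add: field_simps)
  qed
  have "(LINT t|TI T. (norm (duh \<mu> f t))\<^sup>2) \<le> (LINT t|TI T. \<iota> * Z t)"
    by (rule integral_mono[OF d2]) (use Zint pt in auto)
  also have "\<dots> \<le> \<iota> * (\<iota> * F)" using ZI \<iota>0 by simp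
  finally show "(LINT t|TI T. (norm (duh \<mu> f t))\<^sup>2) \<le> \<iota>\<^sup>2 * (LINT t|TI T. (norm (f t))\<^sup>2)"
    by (simp add: F_def power2_eq_square mult.assoc)
qed

section \<open>Mode-wise controlled functions\<close>

lemma borel_measurable_infsum_complex:
  fixes e :: "'i::countable \<Rightarrow> 'a \<Rightarrow> complex"
  assumes "\<And>i. e i \<in> borel_measurable M"
  shows "(\<lambda>x. infsum (\<lambda>i. e i x) UNIV) \<in> borel_measurable M"
proof -
  have "(\<lambda>(x, i). e i x) \<in> borel_measurable (M \<Otimes>\<^sub>M count_space UNIV)"
    using measurable_pair_swap[OF measurable_case_prod_countable[OF assms]] by (simp add: case_prod_beta')
  then show ?thesis
    unfolding infsum_eq_LINT
    by (rule sigma_finite_measure.borel_measurable_lebesgue_integral[OF sigma_finite_measure_count_space])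
qed

text \<open>Minkowski's inequality for countable sums: Cauchy--Schwarz with the weights \<open>w i\<close> reduces it to the
  bounds on the single terms.\<close>

lemma L2_infsum:
  fixes e :: "'i::countable \<Rightarrow> 'a \<Rightarrow> complex"
  assumes M: "sigma_finite_measure M" and meas: "\<And>i. e i \<in> borel_measurable M"
    and bd: "\<And>i x. x \<in> space M \<Longrightarrow> norm (e i x) \<le> w i" and w0: "\<And>i. 0 \<le> w i" and w: "w summable_on UNIV"
    and q: "q \<ge> 0" and int: "\<And>i. integrable M (\<lambda>x. (norm (e i x))\<^sup>2)"
    and L2: "\<And>i. (LINT x|M. (norm (e i x))\<^sup>2) \<le> (q * w i)\<^sup>2"
  shows "(\<lambda>x. infsum (\<lambda>i. e i x) UNIV) \<in> borel_measurable M"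
    and "\<And>x. x \<in> space M \<Longrightarrow> norm (infsum (\<lambda>i. e i x) UNIV) \<le> infsum w UNIV"
    and "integrable M (\<lambda>x. (norm (infsum (\<lambda>i. e i x) UNIV))\<^sup>2)"
    and "(LINT x|M. (norm (infsum (\<lambda>i. e i x) UNIV))\<^sup>2) \<le> (q * infsum w UNIV)\<^sup>2"
proof -
  note meas[measurable]
  let ?G = "\<lambda>x. infsum (\<lambda>i. e i x) UNIV"
  show Gm: "?G \<in> borel_measurable M"
    by (rule borel_measurable_infsum_complex[OF meas])
  have summ: "(\<lambda>i. norm (e i x)) summable_on UNIV" if "x \<in> space M" for x
    by (rule summable_on_comparison_test[OF w]) (use bd[OF that] in auto)
  have norm_G: "norm (?G x) \<le> infsum (\<lambda>i. norm (e i x)) UNIV" if "x \<in> space M" for x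
    by (rule norm_infsum_bound[OF summ[OF that]])
  show "norm (?G x) \<le> infsum w UNIV" if "x \<in> space M" for x
    by (rule order_trans[OF norm_G[OF that] infsum_mono[OF summ[OF that] w bd[OF that]]])
  let ?W = "nsum (\<lambda>i. ennreal (w i))"
  have W: "?W = ennreal (infsum w UNIV)" by (rule nsum_eq_infsum[OF w0 w])
  have pt: "ennreal ((norm (?G x))\<^sup>2) \<le> ?W * nsum (\<lambda>i. ennreal (w i * (norm (e i x) / w i)\<^sup>2))" if x: "x \<in> space M" for x
  proof -
    have "ennreal (norm (?G x)) \<le> ennreal (infsum (\<lambda>i. norm (e i x)) UNIV)"
      by (rule ennreal_leI[OF norm_G[OF x]])
    also have "\<dots> = nsum (\<lambda>i. ennreal (norm (e i x)))"
      by (rule nsum_eq_infsum[symmetric]) (use summ[OF x] in auto)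
    also have "\<dots> = nsum (\<lambda>i. ennreal (w i) * ennreal (norm (e i x) / w i))"
    proof (intro nn_integral_cong)
      fix i
      \<comment> \<open>A vanishing weight forces the term to vanish by \<open>bd\<close>, so the
        quotient with denominator 0 does no harm.\<close>
      have "norm (e i x) = w i * (norm (e i x) / w i)" using bd[OF x, of i] by (cases "w i = 0") auto
      then show "ennreal (norm (e i x)) = ennreal (w i) * ennreal (norm (e i x) / w i)"
        using w0[of i] by (metis ennreal_mult')
    qed
    finally have "(ennreal (norm (?G x)))\<^sup>2 \<le> (nsum (\<lambda>i. ennreal (w i) * ennreal (norm (e i x) / w i)))\<^sup>2"
      by (rule power_mono) simp
    also have "\<dots> \<le> ?W * nsum (\<lambda>i. ennreal (w i) * (ennreal (norm (e i x) / w i))\<^sup>2)"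
      by (rule nsum_Cauchy_Schwarz_weight)
    also have "(\<lambda>i. ennreal (w i) * (ennreal (norm (e i x) / w i))\<^sup>2) = (\<lambda>i. ennreal (w i * (norm (e i x) / w i)\<^sup>2))"
      using w0 by (simp add: fun_eq_iff ennreal_mult' ennreal_power)
    finally show ?thesis by (simp add: ennreal_power)
  qed
  have trm: "(\<integral>\<^sup>+x. ennreal (w i * (norm (e i x) / w i)\<^sup>2) \<partial>M) \<le> ennreal (q\<^sup>2) * ennreal (w i)" for i
  proof (cases "w i = 0")
    case False
    then have wi: "w i > 0" using w0[of i] by simp
    have "w i * (norm (e i x) / w i)\<^sup>2 = 1 / w i * (norm (e i x))\<^sup>2" for x
      using wi by (simp add: power2_eq_square field_simps)
    then have "(\<integral>\<^sup>+x. ennreal (w i * (norm (e i x) / w i)\<^sup>2) \<partial>M) = (\<integral>\<^sup>+x. ennreal (1 / w i * (norm (e i x))\<^sup>2) \<partial>M)"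
      by simp
    also have "\<dots> = ennreal (LINT x|M. 1 / w i * (norm (e i x))\<^sup>2)"
      by (rule nn_integral_eq_integral) (use int wi in auto)
    also have "\<dots> = ennreal (1 / w i * (LINT x|M. (norm (e i x))\<^sup>2))" by simp
    also have "\<dots> \<le> ennreal (1 / w i * (q * w i)\<^sup>2)"
      using wi by (intro ennreal_leI mult_left_mono L2) auto
    also have "1 / w i * (q * w i)\<^sup>2 = q\<^sup>2 * w i" using wi by (simp add: power2_eq_square field_simps)
    finally show ?thesis using w0[of i] by (simp add: ennreal_mult')
  qed simp
  have fin: "(\<integral>\<^sup>+x. ennreal ((norm (?G x))\<^sup>2) \<partial>M) \<le> ennreal ((q * infsum w UNIV)\<^sup>2)"
  proof -
    have "(\<integral>\<^sup>+x. ennreal ((norm (?G x))\<^sup>2) \<partial>M) \<le> (\<integral>\<^sup>+x. ?W * nsum (\<lambda>i. ennreal (w i * (norm (e i x) / w i)\<^sup>2)) \<partial>M)"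
      by (intro nn_integral_mono pt)
    also have "\<dots> = ?W * (\<integral>\<^sup>+x. nsum (\<lambda>i. ennreal (w i * (norm (e i x) / w i)\<^sup>2)) \<partial>M)"
      by (intro nn_integral_cmult borel_measurable_nsum) measurable
    also have "\<dots> = ?W * nsum (\<lambda>i. \<integral>\<^sup>+x. ennreal (w i * (norm (e i x) / w i)\<^sup>2) \<partial>M)"
      by (subst nsum_nn_integral_swap[OF M]) auto
    also have "\<dots> \<le> ?W * nsum (\<lambda>i. ennreal (q\<^sup>2) * ennreal (w i))"
      by (intro mult_left_mono nn_integral_mono trm) auto
    also have "\<dots> = ?W * (ennreal (q\<^sup>2) * ?W)"
      by (simp add: nn_integral_cmult)
    also have "\<dots> = ennreal (infsum w UNIV * (q\<^sup>2 * infsum w UNIV))"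
      using infsum_nonneg[of UNIV w] w0 unfolding W by (simp add: ennreal_mult')
    also have "infsum w UNIV * (q\<^sup>2 * infsum w UNIV) = (q * infsum w UNIV)\<^sup>2"
      by (simp add: power2_eq_square mult_ac)
    finally show ?thesis .
  qed
  show Gint: "integrable M (\<lambda>x. (norm (?G x))\<^sup>2)"
  proof (rule integrableI_bounded)
    show "(\<lambda>x. (norm (?G x))\<^sup>2) \<in> borel_measurable M" using Gm by measurable
    show "(\<integral>\<^sup>+x. ennreal (norm ((norm (?G x))\<^sup>2)) \<partial>M) < \<infinity>"
      using order_le_less_trans[OF fin] by simp
  qed
  have "ennreal (LINT x|M. (norm (?G x))\<^sup>2) \<le> ennreal ((q * infsum w UNIV)\<^sup>2)"
    using fin by (subst nn_integral_eq_integral[OF Gint, symmetric]) auto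
  then show "(LINT x|M. (norm (?G x))\<^sup>2) \<le> (q * infsum w UNIV)\<^sup>2" by simp
qed

text \<open>The auxiliary exponent \<open>r\<close> is the number of derivatives that the quadratic
  term loses. The hypothesis on \<open>s\<close> is represented by the existence of such an
  \<open>r\<close> below 2 \<gamma>.\<close>

locale mg_params =
  fixes \<Omega> \<beta> \<eta> \<kappa> \<gamma> s r :: real
  assumes pos: "\<Omega> > 0" "\<beta> > 0" "\<eta> > 0" "\<kappa> > 0"
    and \<gamma>: "1/2 < \<gamma>" "\<gamma> < 1"
    and r: "1 \<le> r" "r < 2 * \<gamma>" and sr: "s + r > 7/2"
begin

lemma r2: "r \<le> 2" using \<gamma> r by linarith
lemma s32: "s > 3/2" using sr r \<gamma> by linarith
lemma r\<gamma>: "\<gamma> \<le> r" using \<gamma> r by linarith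

abbreviation N :: "(int^3 \<Rightarrow> complex) \<Rightarrow> (int^3 \<Rightarrow> complex) \<Rightarrow> int^3 \<Rightarrow> complex" where
  "N \<equiv> Nl \<Omega> \<beta> \<eta>"

definition \<mu> :: "int^3 \<Rightarrow> real" where
  "\<mu> k = \<kappa> * norm (freq k) powr (2 * \<gamma>)"

lemma \<mu>_nonneg: "\<mu> k \<ge> 0" using pos by (simp add: \<mu>_def)

lemma norm_freq_ge_1:
  assumes "k \<noteq> 0"
  shows "norm (freq k) \<ge> 1"
proof -
  obtain i where "k $ i \<noteq> 0" using assms by (auto simp: vec_eq_iff)
  then have "1 \<le> \<bar>freq k $ i\<bar>" by simp
  then show ?thesis using component_le_norm_cart[of "freq k" i] by linarith
qed

lemma jb_powr_le:
  assumes "k \<noteq> 0"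
  shows "jb k powr (2 * \<gamma>) \<le> 2 * norm (freq k) powr (2 * \<gamma>)"
proof -
  have n: "norm (freq k) \<ge> 1" by (rule norm_freq_ge_1[OF assms])
  then have "1 \<le> (norm (freq k))\<^sup>2" by (rule one_le_power)
  then have "(jb k)\<^sup>2 \<le> 2 * (norm (freq k))\<^sup>2" by (simp add: jb_sq)
  then have "((jb k)\<^sup>2) powr \<gamma> \<le> (2 * (norm (freq k))\<^sup>2) powr \<gamma>"
    using \<gamma> by (intro powr_mono2) auto
  also have "\<dots> = 2 powr \<gamma> * norm (freq k) powr (2 * \<gamma>)"
  proof -
    have "norm (freq k) > 0" using n by linarith
    then show ?thesis by (simp only: powr_mult powr_square)
  qed
  also have "\<dots> \<le> 2 powr 1 * norm (freq k) powr (2 * \<gamma>)"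
    using \<gamma> by (intro mult_right_mono powr_mono) auto
  finally show ?thesis by (simp add: powr_square)
qed

text \<open>The value 2 / \<kappa> serves the damped modes, with the 2 of \<open>jb_powr_le\<close>;
  the value 1 serves the zero mode.\<close>

definition C\<kappa> :: real where "C\<kappa> = max 1 (2 / \<kappa>)"

lemma C\<kappa>_ge_1: "C\<kappa> \<ge> 1" by (simp add: C\<kappa>_def)

text \<open>For the zero mode the bracket is 1 and T \<le> 1 replaces the damping; otherwise 1 /
  \<open>\<mu> k\<close> is chosen, which is controlled by the bracket to the power -2 \<gamma>. One
  gain is thus valid for all modes.\<close>

lemma iota_exists:
  assumes "0 < T" "T \<le> 1"
  obtains \<iota> where "\<iota> = T \<or> (\<mu> k > 0 \<and> \<iota> = 1 / \<mu> k)" "0 < \<iota>" "\<iota> \<le> C\<kappa> * jb k powr (- 2 * \<gamma>)"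
proof (cases "k = 0")
  case True
  then have "jb k = 1" by (simp add: jb_def)
  then show ?thesis using that[of T] assms C\<kappa>_ge_1 by simp
next
  case False
  have n: "norm (freq k) \<ge> 1" by (rule norm_freq_ge_1[OF False])
  have m: "\<mu> k > 0" unfolding \<mu>_def by (intro mult_pos_pos pos) (use n in auto)
  have "1 / \<mu> k \<le> 2 / \<kappa> * jb k powr (- 2 * \<gamma>)"
  proof -
    have "jb k powr (2 * \<gamma>) * \<kappa> \<le> 2 * \<mu> k"
      using mult_right_mono[OF jb_powr_le[OF False], of \<kappa>] pos by (simp add: \<mu>_def mult_ac)
    then have "1 / \<mu> k \<le> 2 / (jb k powr (2 * \<gamma>) * \<kappa>)"
      using m pos by (simp add: field_simps)
    also have "\<dots> = 2 / \<kappa> * jb k powr (- 2 * \<gamma>)"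
      by (simp add: powr_minus field_simps)
    finally show ?thesis .
  qed
  also have "\<dots> \<le> C\<kappa> * jb k powr (- 2 * \<gamma>)"
    by (intro mult_right_mono) (auto simp: C\<kappa>_def)
  finally show ?thesis using that[of "1 / \<mu> k"] m by simp
qed

text \<open>Control of every Fourier mode by one number, simultaneously in \<open>L\<^sup>\<infinity>\<close> and, with the gain of
  the diffusion, in \<open>L\<^sup>2\<close> in time. This decouples the time dependence from the sums over frequencies.\<close>

definition ctrl :: "real \<Rightarrow> (int^3 \<Rightarrow> real) \<Rightarrow> (real \<Rightarrow> int^3 \<Rightarrow> complex) \<Rightarrow> bool" where
  "ctrl T A u \<longleftrightarrow> (\<forall>k. 0 \<le> A k \<and> (\<lambda>t. u t k) \<in> borel_measurable (TI T) \<and>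
     (\<forall>t\<in>{0<..<T}. norm (u t k) \<le> A k) \<and>
     (LINT t|TI T. (norm (u t k))\<^sup>2) \<le> (jb k powr (- \<gamma>) * A k)\<^sup>2)"

lemma ctrlD:
  assumes "ctrl T A u"
  shows "0 \<le> A k" "(\<lambda>t. u t k) \<in> borel_measurable (TI T)" "t \<in> {0<..<T} \<Longrightarrow> norm (u t k) \<le> A k"
    "(LINT t|TI T. (norm (u t k))\<^sup>2) \<le> (jb k powr (- \<gamma>) * A k)\<^sup>2"
    "integrable (TI T) (\<lambda>t. (norm (u t k))\<^sup>2)"
proof -
  show 1: "0 \<le> A k" "(\<lambda>t. u t k) \<in> borel_measurable (TI T)"
    "(LINT t|TI T. (norm (u t k))\<^sup>2) \<le> (jb k powr (- \<gamma>) * A k)\<^sup>2"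
    using assms by (auto simp: ctrl_def)
  show 2: "t \<in> {0<..<T} \<Longrightarrow> norm (u t k) \<le> A k" for t using assms by (auto simp: ctrl_def)
  note 1(2)[measurable]
  show "integrable (TI T) (\<lambda>t. (norm (u t k))\<^sup>2)"
    by (rule finite_measure.integrable_const_bound[OF finite_measure_TI, where B = "(A k)\<^sup>2"])
       (use 2 in \<open>auto intro!: AE_I2 power_mono\<close>)
qed

lemma ctrl_infsum:
  fixes d :: "'i::countable \<Rightarrow> real \<Rightarrow> int^3 \<Rightarrow> complex"
  assumes d: "\<And>i. ctrl T (A i) (d i)" and summ: "\<And>k. (\<lambda>i. A i k) summable_on UNIV"
  shows "ctrl T (\<lambda>k. infsum (\<lambda>i. A i k) UNIV) (\<lambda>t k. infsum (\<lambda>i. d i t k) UNIV)"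
  unfolding ctrl_def
proof (intro allI)
  fix k
  note L = L2_infsum[OF sigma_finite_TI, of "\<lambda>i t. d i t k" T "\<lambda>i. A i k" "jb k powr (- \<gamma>)"]
  have "0 \<le> infsum (\<lambda>i. A i k) UNIV" using ctrlD(1)[OF d] by (intro infsum_nonneg) auto
  then show "0 \<le> infsum (\<lambda>i. A i k) UNIV \<and>
         (\<lambda>t. infsum (\<lambda>i. d i t k) UNIV) \<in> borel_measurable (TI T) \<and>
         (\<forall>t\<in>{0<..<T}. norm (infsum (\<lambda>i. d i t k) UNIV) \<le> infsum (\<lambda>i. A i k) UNIV) \<and>
         (LINT t|TI T. (norm (infsum (\<lambda>i. d i t k) UNIV))\<^sup>2) \<le> (jb k powr (- \<gamma>) * infsum (\<lambda>i. A i k) UNIV)\<^sup>2"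
    using L(1,2,4) ctrlD[OF d] summ by auto
qed

text \<open>A sum of two terms is a sum over the type \<open>bool\<close>, so Minkowski's inequality
  is reused from \<open>ctrl_infsum\<close>.\<close>

lemma ctrl_add:
  assumes "ctrl T A u" "ctrl T B v"
  shows "ctrl T (\<lambda>k. A k + B k) (\<lambda>t k. u t k + v t k)"
proof -
  have "ctrl T (\<lambda>k. infsum (\<lambda>b. if b then A k else B k) UNIV) (\<lambda>t k. infsum (\<lambda>b. (if b then u else v) t k) UNIV)"
    using ctrl_infsum[of T "\<lambda>b k. if b then A k else B k" "\<lambda>b. if b then u else v"] assms by simp
  then show ?thesis by (simp add: UNIV_bool add.commute)
qed

lemma ctrl_cong:
  assumes "ctrl T A u" "\<And>t k. t \<in> {0<..<T} \<Longrightarrow> v t k = u t k"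
  shows "ctrl T A v"
proof -
  have "(\<lambda>t. v t k) \<in> borel_measurable (TI T) \<longleftrightarrow> (\<lambda>t. u t k) \<in> borel_measurable (TI T)" for k
    by (rule measurable_cong) (use assms(2) in auto)
  moreover have "(LINT t|TI T. (norm (v t k))\<^sup>2) = (LINT t|TI T. (norm (u t k))\<^sup>2)" for k
    by (rule Bochner_Integration.integral_cong) (use assms(2) in auto)
  ultimately show ?thesis using assms by (simp add: ctrl_def)
qed

lemma ctrl_uminus:
  assumes "ctrl T A u"
  shows "ctrl T A (\<lambda>t k. - u t k)"
  using assms by (auto simp: ctrl_def)

text \<open>In effect a norm, the least H^s norm of a dominating amplitude. The amplitude itself is
  hidden, so that sums and limits may choose a new one.\<close>

definition bnd :: "real \<Rightarrow> real \<Rightarrow> (real \<Rightarrow> int^3 \<Rightarrow> complex) \<Rightarrow> bool" where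
  "bnd T a u \<longleftrightarrow> (\<exists>A. ctrl T A u \<and> hs s A \<and> hnorm s A \<le> a)"

lemma bnd_add: "bnd T a u \<Longrightarrow> bnd T b v \<Longrightarrow> bnd T (a + b) (\<lambda>t k. u t k + v t k)"
proof -
  assume "bnd T a u" "bnd T b v"
  then obtain A B where "ctrl T A u" "hs s A" "hnorm s A \<le> a" "ctrl T B v" "hs s B" "hnorm s B \<le> b"
    by (auto simp: bnd_def)
  then show ?thesis
    unfolding bnd_def using ctrl_add[of T A u B v] hs_add[of s A B]
    by (intro exI[of _ "\<lambda>k. A k + B k"]) auto
qed

lemma bnd_uminus: "bnd T a u \<Longrightarrow> bnd T a (\<lambda>t k. - u t k)"
  unfolding bnd_def using ctrl_uminus by blast

lemma bnd_diff: "bnd T a u \<Longrightarrow> bnd T b v \<Longrightarrow> bnd T (a + b) (\<lambda>t k. u t k - v t k)"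
  using bnd_add[of T a u b "\<lambda>t k. - v t k"] bnd_uminus by simp

lemma bnd_mono: "bnd T a u \<Longrightarrow> a \<le> b \<Longrightarrow> bnd T b u"
  unfolding bnd_def by (meson order_trans)

lemma bnd_cong: "bnd T a u \<Longrightarrow> (\<And>t k. t \<in> {0<..<T} \<Longrightarrow> v t k = u t k) \<Longrightarrow> bnd T a v"
  unfolding bnd_def using ctrl_cong by blast

lemma bnd_nonneg: "bnd T a u \<Longrightarrow> 0 \<le> a"
  unfolding bnd_def using hnorm_nonneg order_trans by blast

lemma bndD:
  assumes "bnd T a u" "t \<in> {0<..<T}"
  shows "hs s (u t)" "hnorm s (u t) \<le> a" "norm (u t k) \<le> jb k powr (- s) * a"
proof -
  obtain A where A: "ctrl T A u" "hs s A" "hnorm s A \<le> a" using assms by (auto simp: bnd_def)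
  have le: "norm (u t k) \<le> norm (A k)" for k using ctrlD(1,3)[OF A(1)] assms(2) by fastforce
  show h: "hs s (u t)" by (rule hs_mono(1)[OF A(2) order_refl le])
  have "hnorm s (u t) \<le> hnorm s A" by (rule hs_mono(2)[OF A(2) order_refl le])
  then show n: "hnorm s (u t) \<le> a" using A(3) by simp
  show "norm (u t k) \<le> jb k powr (- s) * a"
    by (rule order_trans[OF hs_bound[OF h] mult_left_mono[OF n]]) simp
qed

lemma bnd_measurable: "bnd T a u \<Longrightarrow> (\<lambda>t. u t k) \<in> borel_measurable (TI T)"
  unfolding bnd_def using ctrlD(2) by blast

text \<open>The factor \<open>jb k powr (- \<gamma>)\<close> in the last clause of
  \<open>ctrl\<close> is exactly the gain from H^s to H^{s+\<gamma>}; Tonelli sums it over the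
  modes.\<close>

lemma bnd_hsum:
  assumes "bnd T a u"
  shows "(\<integral>\<^sup>+t. hsum (s + \<gamma>) (u t) \<partial>TI T) < \<infinity>"
proof -
  obtain A where A: "ctrl T A u" "hs s A" using assms by (auto simp: bnd_def)
  have "(\<integral>\<^sup>+t. hsum (s + \<gamma>) (u t) \<partial>TI T) = nsum (\<lambda>k. ennreal (jb k powr (2 * (s + \<gamma>))) * (\<integral>\<^sup>+t. ennreal ((norm (u t k))\<^sup>2) \<partial>TI T))"
    by (rule nn_integral_hsum[OF sigma_finite_TI ctrlD(2)[OF A(1)]])
  also have "\<dots> \<le> nsum (\<lambda>k. ennreal (jb k powr (2 * s) * (norm (A k))\<^sup>2))"
  proof (intro nn_integral_mono)
    fix k
    have "(\<integral>\<^sup>+t. ennreal ((norm (u t k))\<^sup>2) \<partial>TI T) = ennreal (LINT t|TI T. (norm (u t k))\<^sup>2)"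
      by (rule nn_integral_eq_integral[OF ctrlD(5)[OF A(1)]]) simp
    also have "\<dots> \<le> ennreal ((jb k powr (- \<gamma>) * A k)\<^sup>2)"
      by (rule ennreal_leI[OF ctrlD(4)[OF A(1)]])
    finally have "ennreal (jb k powr (2 * (s + \<gamma>))) * (\<integral>\<^sup>+t. ennreal ((norm (u t k))\<^sup>2) \<partial>TI T)
       \<le> ennreal (jb k powr (2 * (s + \<gamma>))) * ennreal ((jb k powr (- \<gamma>) * A k)\<^sup>2)"
      by (rule mult_left_mono) simp
    also have "\<dots> = ennreal (jb k powr (2 * s) * (norm (A k))\<^sup>2)"
      by (simp add: ennreal_mult'[symmetric] power_mult_distrib jb_powr_sq mult.assoc[symmetric] powr_add[symmetric])
    finally show "ennreal (jb k powr (2 * (s + \<gamma>))) * (\<integral>\<^sup>+t. ennreal ((norm (u t k))\<^sup>2) \<partial>TI T)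
       \<le> ennreal (jb k powr (2 * s) * (norm (A k))\<^sup>2)" .
  qed
  also have "\<dots> < \<infinity>" using A(2) by (simp add: hs_iff_hsum hsum_def)
  finally show ?thesis .
qed

text \<open>Completeness of the iteration space in the form of absolutely convergent series; the
  amplitude that dominates the sum is the sum of the amplitudes.\<close>

lemma bnd_suminf:
  fixes d :: "nat \<Rightarrow> real \<Rightarrow> int^3 \<Rightarrow> complex"
  assumes d: "\<And>n. bnd T (a n) (d n)" and a: "a sums b"
  shows "bnd T b (\<lambda>t k. infsum (\<lambda>n. d n t k) UNIV)"
    and "t \<in> {0<..<T} \<Longrightarrow> ((\<lambda>n. d n t k) has_sum infsum (\<lambda>n. d n t k) UNIV) UNIV"
proof -
  have "\<forall>n. \<exists>A. ctrl T A (d n) \<and> hs s A \<and> hnorm s A \<le> a n" using d by (auto simp: bnd_def)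
  then obtain A where A: "\<And>n. ctrl T (A n) (d n)" "\<And>n. hs s (A n)" "\<And>n. hnorm s (A n) \<le> a n"
    by metis
  have a0: "a n \<ge> 0" for n using bnd_nonneg[OF d] .
  have a_sum: "a summable_on UNIV"
    using a a0 by (simp add: summable_on_UNIV_nonneg_real_iff sums_iff)
  have A0: "A n k \<ge> 0" for n k by (rule ctrlD(1)[OF A(1)])
  have Ab: "A n k \<le> jb k powr (- s) * a n" for n k
    using order_trans[OF hs_bound[OF A(2)[of n], of k] mult_left_mono[OF A(3)[of n], of "jb k powr (- s)"]] A0[of n k] by auto
  have summ: "(\<lambda>n. A n k) summable_on UNIV" for k
    by (rule summable_on_comparison_test[OF summable_on_cmult_right[OF a_sum, of "jb k powr (- s)"]]) (use Ab A0 in auto)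
  have c: "ctrl T (\<lambda>k. infsum (\<lambda>n. A n k) UNIV) (\<lambda>t k. infsum (\<lambda>n. d n t k) UNIV)"
    by (rule ctrl_infsum[OF A(1) summ])
  have "b \<ge> 0" using a a0 sums_le[OF _ sums_zero a] by auto
  have part: "hs s (\<lambda>k. \<Sum>n<m. A n k) \<and> hnorm s (\<lambda>k. \<Sum>n<m. A n k) \<le> (\<Sum>n<m. a n)" for m
  proof (induction m)
    case 0
    have "hs s (\<lambda>k. 0 :: real)" "hnorm s (\<lambda>k. 0 :: real) \<le> 0" by (simp_all add: hs_def hnorm_def)
    then show ?case by simp
  next
    case (Suc m)
    then show ?case using hs_add[of s "\<lambda>k. \<Sum>n<m. A n k" "A m"] A(2)[of m] A(3)[of m] by auto
  qed
  \<comment> \<open>The bound passes to the limit as in Fatou's lemma: it holds for the partial sums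
    on each finite set of frequencies, where only convergence of single modes enters.\<close>
  have fs: "(\<Sum>k\<in>F. jb k powr (2 * s) * (norm (infsum (\<lambda>n. A n k) UNIV))\<^sup>2) \<le> b\<^sup>2" if F: "finite F" for F
  proof (rule LIMSEQ_le_const2)
    have "(\<lambda>m. \<Sum>n<m. A n k) \<longlonglongrightarrow> infsum (\<lambda>n. A n k) UNIV" for k
      using has_sum_imp_sums[OF has_sum_infsum[OF summ]] by (simp add: sums_def)
    then show "(\<lambda>m. \<Sum>k\<in>F. jb k powr (2 * s) * (norm (\<Sum>n<m. A n k))\<^sup>2) \<longlonglongrightarrow> (\<Sum>k\<in>F. jb k powr (2 * s) * (norm (infsum (\<lambda>n. A n k) UNIV))\<^sup>2)"
      by (intro tendsto_intros)
    have "(\<Sum>k\<in>F. jb k powr (2 * s) * (norm (\<Sum>n<m. A n k))\<^sup>2) \<le> b\<^sup>2" for m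
    proof -
      have "(\<Sum>k\<in>F. jb k powr (2 * s) * (norm (\<Sum>n<m. A n k))\<^sup>2) \<le> (hnorm s (\<lambda>k. \<Sum>n<m. A n k))\<^sup>2"
        using hs_finite_sum_le[of s "\<lambda>k. \<Sum>n<m. A n k" F] part F by blast
      also have "\<dots> \<le> (\<Sum>n<m. a n)\<^sup>2" using part by (intro power_mono) auto
      also have "\<dots> \<le> b\<^sup>2"
        using sum_le_suminf[of a "{..<m}"] a a0 by (intro power_mono) (auto simp: sums_iff sum_nonneg)
      finally show ?thesis .
    qed
    then show "\<exists>N. \<forall>m\<ge>N. (\<Sum>k\<in>F. jb k powr (2 * s) * (norm (\<Sum>n<m. A n k))\<^sup>2) \<le> b\<^sup>2" by blast
  qed
  show "bnd T b (\<lambda>t k. infsum (\<lambda>n. d n t k) UNIV)"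
    unfolding bnd_def using c hs_hnorm_leI[OF \<open>b \<ge> 0\<close> fs] by blast
  show "((\<lambda>n. d n t k) has_sum infsum (\<lambda>n. d n t k) UNIV) UNIV" if "t \<in> {0<..<T}"
  proof (rule has_sum_infsum, rule abs_summable_summable)
    show "(\<lambda>n. norm (d n t k)) summable_on UNIV"
      by (rule summable_on_comparison_test[OF summ]) (use ctrlD(3)[OF A(1) that] in auto)
  qed
qed

section \<open>The Duhamel operator of the quadratic term\<close>

definition Dop :: "(real \<Rightarrow> int^3 \<Rightarrow> complex) \<Rightarrow> (real \<Rightarrow> int^3 \<Rightarrow> complex) \<Rightarrow> real \<Rightarrow> int^3 \<Rightarrow> complex" where
  "Dop u v t k = duh (\<mu> k) (\<lambda>\<tau>. N (u \<tau>) (v \<tau>) k) t"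

text \<open>The interpolation exponent determined by \<gamma> (1 - \<epsilon>) = r - \<gamma>: this
  much of the smoothing is spent on derivatives, the rest becomes a power of T. It is positive
  because r < 2 \<gamma>.\<close>

definition \<epsilon> :: real where "\<epsilon> = (2 * \<gamma> - r) / \<gamma>"

lemma \<epsilon>_pos: "0 < \<epsilon>" "\<epsilon> \<le> 1"
  using \<gamma> r by (auto simp: \<epsilon>_def)

text \<open>x is split into its powers \<epsilon> and 1 - \<epsilon>; the first is bounded through
  T, the second through the smoothing bound.\<close>

lemma min_interpolate:
  assumes "0 \<le> x" "x \<le> T" "x \<le> m powr (- 2 * \<gamma>)" "0 < T" "0 < m"
  shows "x \<le> T powr \<epsilon> * m powr (- 2 * (r - \<gamma>))"
proof (cases "x = 0")
  case False
  then have x: "x > 0" using assms by simp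
  have "x = x powr \<epsilon> * x powr (1 - \<epsilon>)" using x by (simp add: powr_add[symmetric])
  also have "\<dots> \<le> T powr \<epsilon> * (m powr (- 2 * \<gamma>)) powr (1 - \<epsilon>)"
    using assms x \<epsilon>_pos by (intro mult_mono powr_mono2) auto
  also have "(m powr (- 2 * \<gamma>)) powr (1 - \<epsilon>) = m powr (- 2 * (r - \<gamma>))"
  proof -
    have "\<gamma> * \<epsilon> = 2 * \<gamma> - r" using \<gamma> by (simp add: \<epsilon>_def)
    then have "(- 2 * \<gamma>) * (1 - \<epsilon>) = - 2 * (r - \<gamma>)" by (simp add: right_diff_distrib)
    then show ?thesis by (simp only: powr_powr)
  qed
  finally show ?thesis .
qed (use assms in simp)

text \<open>The gain in L^2 of time for a product with output frequency \<open>k\<close>. The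
  division by 2 reflects that the larger of the brackets of k - j and j is at least half that of
  \<open>k\<close>.\<close>

definition qk :: "real \<Rightarrow> int^3 \<Rightarrow> real" where
  "qk T k = T powr (\<epsilon> / 2) * (jb k / 2) powr (- (r - \<gamma>))"

lemma qk_nonneg: "qk T k \<ge> 0" by (simp add: qk_def)

text \<open>Either factor can be taken in L^2 of time with the other bounded uniformly, or both can
  be bounded uniformly at the price of T. The first two bounds together involve the larger bracket
  \<open>m\<close>, and \<open>min_interpolate\<close> balances it against T.\<close>

lemma product_L2:
  assumes u: "ctrl T A u" and v: "ctrl T B v" and T: "0 < T"
  shows "(LINT t|TI T. (norm (u t (k - j) * v t j))\<^sup>2) \<le> (qk T k * (A (k - j) * B j))\<^sup>2"
proof -
  let ?I = "LINT t|TI T. (norm (u t (k - j) * v t j))\<^sup>2"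
  let ?a = "A (k - j)" and ?b = "B j"
  note um[measurable] = ctrlD(2)[OF u] and vm[measurable] = ctrlD(2)[OF v]
  have A0: "?a \<ge> 0" "?b \<ge> 0" using ctrlD(1)[OF u] ctrlD(1)[OF v] by auto
  have pw: "norm (u t (k - j)) \<le> ?a" "norm (v t j) \<le> ?b" if "t \<in> {0<..<T}" for t
    using ctrlD(3)[OF u that] ctrlD(3)[OF v that] by auto
  have int: "integrable (TI T) (\<lambda>t. (norm (u t (k - j) * v t j))\<^sup>2)"
    by (rule finite_measure.integrable_const_bound[OF finite_measure_TI, where B = "(?a * ?b)\<^sup>2"])
       (use pw A0 in \<open>auto intro!: AE_I2 power_mono mult_mono simp: norm_mult\<close>)
  have I1: "?I \<le> T * (?a * ?b)\<^sup>2"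
  proof -
    have "?I \<le> (LINT t|TI T. (?a * ?b)\<^sup>2)"
      by (rule integral_mono[OF int finite_measure.integrable_const[OF finite_measure_TI]])
         (use pw A0 in \<open>auto intro!: power_mono mult_mono simp: norm_mult\<close>)
    then show ?thesis using T by (simp add: measure_restrict_space mult.commute)
  qed
  have I2: "?I \<le> jb (k - j) powr (- 2 * \<gamma>) * (?a * ?b)\<^sup>2"
  proof -
    have "?I \<le> (LINT t|TI T. ?b\<^sup>2 * (norm (u t (k - j)))\<^sup>2)"
    proof (rule integral_mono[OF int])
      show "integrable (TI T) (\<lambda>t. ?b\<^sup>2 * (norm (u t (k - j)))\<^sup>2)" using ctrlD(5)[OF u] by simp
      show "(norm (u t (k - j) * v t j))\<^sup>2 \<le> ?b\<^sup>2 * (norm (u t (k - j)))\<^sup>2" if "t \<in> space (TI T)" for t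
        using pw(2)[of t] that by (auto simp: norm_mult power_mult_distrib mult.commute[of "?b\<^sup>2"] intro!: mult_left_mono power_mono)
    qed
    also have "\<dots> \<le> ?b\<^sup>2 * (jb (k - j) powr (- \<gamma>) * ?a)\<^sup>2"
      using ctrlD(4)[OF u, of "k - j"] by (simp add: mult_left_mono)
    finally show ?thesis by (simp add: power_mult_distrib jb_powr_sq mult_ac)
  qed
  have I3: "?I \<le> jb j powr (- 2 * \<gamma>) * (?a * ?b)\<^sup>2"
  proof -
    have "?I \<le> (LINT t|TI T. ?a\<^sup>2 * (norm (v t j))\<^sup>2)"
    proof (rule integral_mono[OF int])
      show "integrable (TI T) (\<lambda>t. ?a\<^sup>2 * (norm (v t j))\<^sup>2)" using ctrlD(5)[OF v] by simp
      show "(norm (u t (k - j) * v t j))\<^sup>2 \<le> ?a\<^sup>2 * (norm (v t j))\<^sup>2" if "t \<in> space (TI T)" for t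
        using pw(1)[of t] that by (auto simp: norm_mult power_mult_distrib intro!: mult_right_mono power_mono)
    qed
    also have "\<dots> \<le> ?a\<^sup>2 * (jb j powr (- \<gamma>) * ?b)\<^sup>2"
      using ctrlD(4)[OF v, of j] by (simp add: mult_left_mono)
    finally show ?thesis by (simp add: power_mult_distrib jb_powr_sq mult_ac)
  qed
  define m where "m = max (jb (k - j)) (jb j)"
  have m: "m \<ge> jb k / 2" "m > 0" unfolding m_def using jb_le[of k j] by (auto simp: less_max_iff_disj)
  show ?thesis
  proof (cases "?a * ?b = 0")
    case True
    show ?thesis using I1 unfolding True by simp
  next
    case False
    then have ab: "(?a * ?b)\<^sup>2 > 0" by simp
    define x where "x = ?I / (?a * ?b)\<^sup>2"
    have "0 \<le> ?I" by simp
    then have x: "0 \<le> x" "x \<le> T" "x \<le> m powr (- 2 * \<gamma>)"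
      using I1 I2 I3 ab unfolding x_def m_def by (auto simp: pos_divide_le_eq max_def)
    have "x \<le> T powr \<epsilon> * m powr (- 2 * (r - \<gamma>))"
      by (rule min_interpolate[OF x T m(2)])
    also have "\<dots> \<le> T powr \<epsilon> * (jb k / 2) powr (- 2 * (r - \<gamma>))"
      using m(1) r\<gamma> by (intro mult_left_mono powr_mono2') auto
    also have "\<dots> = (qk T k)\<^sup>2"
    proof -
      have "(y powr a)\<^sup>2 = y powr (2 * a)" for y a :: real
        by (simp add: power2_eq_square powr_add[symmetric])
      then show ?thesis unfolding qk_def by (simp add: power_mult_distrib)
    qed
    finally have "x * (?a * ?b)\<^sup>2 \<le> (qk T k)\<^sup>2 * (?a * ?b)\<^sup>2"
      using ab by (intro mult_right_mono) auto
    moreover have "(y / w) * w = y" if "w > 0" for y w :: real using that by simp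
    ultimately show ?thesis using ab by (simp only: x_def power_mult_distrib)
  qed
qed

text \<open>Minkowski's inequality over \<open>j\<close>. The factor \<open>qk T k\<close> of
  \<open>product_L2\<close> depends on the output frequency only, so it comes out of the sum and the
  majorant \<open>Kc\<close> remains.\<close>

lemma N_L2:
  assumes u: "ctrl T A u" and v: "ctrl T B v" and A: "hs s A" and B: "hs s B" and T: "0 < T"
  shows "(\<lambda>t. N (u t) (v t) k) \<in> borel_measurable (TI T)"
    and "integrable (TI T) (\<lambda>t. (norm (N (u t) (v t) k))\<^sup>2)"
    and "(LINT t|TI T. (norm (N (u t) (v t) k))\<^sup>2) \<le> (qk T k * (3 / \<Omega> * Kc A B k))\<^sup>2"
proof -
  let ?e = "\<lambda>j t. Nl_term \<Omega> \<beta> \<eta> (u t) (v t) k j"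
  let ?w = "\<lambda>j. 3 / \<Omega> * (mk k j * (A (k - j) * B j))"
  have A0: "A k \<ge> 0" "B k \<ge> 0" for k using ctrlD(1)[OF u] ctrlD(1)[OF v] by auto
  note K = Kc_estimate[OF r(1) r2 sr A0(1) A A0(2) B]
  note um[measurable] = ctrlD(2)[OF u] and vm[measurable] = ctrlD(2)[OF v]
  have meas: "?e j \<in> borel_measurable (TI T)" for j unfolding Nl_term_def by measurable
  have bd: "norm (?e j t) \<le> ?w j" if "t \<in> space (TI T)" for j t
    using that by (intro norm_Nl_term_le pos ctrlD(3)[OF u] ctrlD(3)[OF v]) auto
  have w0: "0 \<le> ?w j" for j using A0 pos by simp
  have w: "?w summable_on UNIV" by (intro summable_on_cmult_right K(1))
  have int: "integrable (TI T) (\<lambda>t. (norm (?e j t))\<^sup>2)" for j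
    by (rule finite_measure.integrable_const_bound[OF finite_measure_TI, where B = "(?w j)\<^sup>2"])
       (use bd meas in \<open>auto intro!: AE_I2 power_mono\<close>)
  have L2: "(LINT t|TI T. (norm (?e j t))\<^sup>2) \<le> (qk T k * ?w j)\<^sup>2" for j
  proof -
    let ?c = "freq k \<bullet> mg_symbol \<Omega> \<beta> \<eta> (k - j)"
    have "(LINT t|TI T. (norm (?e j t))\<^sup>2) = ?c\<^sup>2 * (LINT t|TI T. (norm (u t (k - j) * v t j))\<^sup>2)"
      by (simp add: Nl_term_def norm_mult power_mult_distrib)
    also have "\<dots> \<le> (3 / \<Omega> * mk k j)\<^sup>2 * (qk T k * (A (k - j) * B j))\<^sup>2"
    proof (rule mult_mono)
      show "?c\<^sup>2 \<le> (3 / \<Omega> * mk k j)\<^sup>2"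
        using power_mono[OF abs_freq_mg_symbol_le[OF pos(1-3), of k j], of 2] by simp
    qed (use product_L2[OF u v T] in auto)
    also have "\<dots> = (qk T k * ?w j)\<^sup>2" by (simp add: power_mult_distrib power_divide mult_ac)
    finally show ?thesis .
  qed
  note L = L2_infsum[OF sigma_finite_TI meas bd w0 w qk_nonneg[of T k] int L2]
  have inf: "infsum ?w UNIV = 3 / \<Omega> * Kc A B k" by (simp only: Kc_def infsum_cmult_right')
  show "(\<lambda>t. N (u t) (v t) k) \<in> borel_measurable (TI T)"
    "integrable (TI T) (\<lambda>t. (norm (N (u t) (v t) k))\<^sup>2)"
    "(LINT t|TI T. (norm (N (u t) (v t) k))\<^sup>2) \<le> (qk T k * (3 / \<Omega> * Kc A B k))\<^sup>2"
    using L(1,3,4) unfolding inf Nl_def by auto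
qed

text \<open>With \<iota> at most a multiple of the bracket to the power -2 \<gamma>, the uniform
  bound gains the square root of this and the L^2 bound gains all of it. The two differ by the
  factor \<open>jb k powr (- \<gamma>)\<close> built into \<open>ctrl\<close>, so one amplitude
  serves both.\<close>

lemma ctrl_duh:
  assumes T: "0 < T" "T \<le> 1"
    and F: "\<And>k. 0 \<le> F k" "\<And>k. (\<lambda>t. f t k) \<in> borel_measurable (TI T)" "\<And>k. integrable (TI T) (\<lambda>t. (norm (f t k))\<^sup>2)"
      "\<And>k. (LINT t|TI T. (norm (f t k))\<^sup>2) \<le> (F k)\<^sup>2"
  shows "ctrl T (\<lambda>k. C\<kappa> * jb k powr (- \<gamma>) * F k) (\<lambda>t k. duh (\<mu> k) (\<lambda>\<tau>. f \<tau> k) t)"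
  unfolding ctrl_def
proof (intro allI conjI ballI)
  fix k
  obtain \<iota> where \<iota>: "\<iota> = T \<or> (\<mu> k > 0 \<and> \<iota> = 1 / \<mu> k)" "0 < \<iota>" "\<iota> \<le> C\<kappa> * jb k powr (- 2 * \<gamma>)"
    using iota_exists[OF T] by blast
  note E = duh_L2_estimate[OF F(2,3) \<mu>_nonneg T(1) \<iota>(1)]
  show "0 \<le> C\<kappa> * jb k powr (- \<gamma>) * F k" using C\<kappa>_ge_1 F(1) by simp
  have "continuous_on {0..T} (duh (\<mu> k) (\<lambda>\<tau>. f \<tau> k))"
    by (rule continuous_duh[OF L2_TI_integrable[OF F(2,3)]])
  then show "duh (\<mu> k) (\<lambda>\<tau>. f \<tau> k) \<in> borel_measurable (TI T)" by (rule continuous_measurable_TI)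
  show "norm (duh (\<mu> k) (\<lambda>\<tau>. f \<tau> k) t) \<le> C\<kappa> * jb k powr (- \<gamma>) * F k" if t: "t \<in> {0<..<T}" for t
  proof (rule power2_le_imp_le)
    have "(norm (duh (\<mu> k) (\<lambda>\<tau>. f \<tau> k) t))\<^sup>2 \<le> \<iota> * (LINT t|TI T. (norm (f t k))\<^sup>2)" by (rule E(1)[OF t])
    also have "\<dots> \<le> (C\<kappa> * jb k powr (- 2 * \<gamma>)) * (F k)\<^sup>2"
      using \<iota> F(4)[of k] C\<kappa>_ge_1 by (intro mult_mono) auto
    \<comment> \<open>\<open>C\<kappa>\<close> is enlarged to its square, which is possible because
      it is at least 1, so that the root of the bound contains \<open>C\<kappa>\<close>
      itself.\<close>
    also have "\<dots> \<le> (C\<kappa>\<^sup>2 * jb k powr (- 2 * \<gamma>)) * (F k)\<^sup>2"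
      using C\<kappa>_ge_1 by (intro mult_right_mono) (auto simp: power2_eq_square)
    finally show "(norm (duh (\<mu> k) (\<lambda>\<tau>. f \<tau> k) t))\<^sup>2 \<le> (C\<kappa> * jb k powr (- \<gamma>) * F k)\<^sup>2"
      by (simp add: power_mult_distrib jb_powr_sq)
  qed (use C\<kappa>_ge_1 F(1) in simp)
  have "(LINT t|TI T. (norm (duh (\<mu> k) (\<lambda>\<tau>. f \<tau> k) t))\<^sup>2) \<le> \<iota>\<^sup>2 * (LINT t|TI T. (norm (f t k))\<^sup>2)" by (rule E(3))
  also have "\<dots> \<le> (C\<kappa> * jb k powr (- 2 * \<gamma>))\<^sup>2 * (F k)\<^sup>2"
    using \<iota> F(4)[of k] by (intro mult_mono power_mono) auto
  also have "\<dots> = (jb k powr (- \<gamma>) * (C\<kappa> * jb k powr (- \<gamma>) * F k))\<^sup>2"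
  proof -
    have "jb k powr (- 2 * \<gamma>) = jb k powr (- \<gamma>) * jb k powr (- \<gamma>)" by (simp add: powr_add[symmetric])
    then show ?thesis by (simp add: power_mult_distrib mult_ac)
  qed
  finally show "(LINT t|TI T. (norm (duh (\<mu> k) (\<lambda>\<tau>. f \<tau> k) t))\<^sup>2) \<le> (jb k powr (- \<gamma>) * (C\<kappa> * jb k powr (- \<gamma>) * F k))\<^sup>2" .
qed

text \<open>The product of the constants of Duhamel's formula, of the halved bracket in
  \<open>qk\<close>, of the symbol and of the bilinear estimate.\<close>

definition \<Gamma> :: real where "\<Gamma> = C\<kappa> * 2 powr (r - \<gamma>) * (3 / \<Omega>) * bil_const s r"

lemma \<Gamma>_nonneg: "\<Gamma> \<ge> 0"
  unfolding \<Gamma>_def using C\<kappa>_ge_1 pos bil_const_nonneg by simp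

text \<open>The balance of derivatives: Duhamel's formula gains \<gamma>, the product in time gains
  r - \<gamma>, together the \<open>r\<close> lost in \<open>Kc_estimate\<close>. What remains is
  the power \<open>\<epsilon> / 2\<close> of T.\<close>

lemma bnd_Dop:
  assumes u: "bnd T a u" and v: "bnd T b v" and T: "0 < T" "T \<le> 1"
  shows "bnd T (\<Gamma> * T powr (\<epsilon> / 2) * (a * b)) (Dop u v)"
proof -
  obtain A where A: "ctrl T A u" "hs s A" "hnorm s A \<le> a" using u by (auto simp: bnd_def)
  obtain B where B: "ctrl T B v" "hs s B" "hnorm s B \<le> b" using v by (auto simp: bnd_def)
  have A0: "A k \<ge> 0" "B k \<ge> 0" for k using ctrlD(1)[OF A(1)] ctrlD(1)[OF B(1)] by auto
  note K = Kc_estimate[OF r(1) r2 sr A0(1) A(2) A0(2) B(2)]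
  define F where "F k = qk T k * (3 / \<Omega> * Kc A B k)" for k
  define C where "C k = C\<kappa> * jb k powr (- \<gamma>) * F k" for k
  define M where "M = C\<kappa> * 2 powr (r - \<gamma>) * (3 / \<Omega>) * T powr (\<epsilon> / 2)"
  have M0: "M \<ge> 0" unfolding M_def using C\<kappa>_ge_1 pos by simp
  have c: "ctrl T C (Dop u v)"
    unfolding C_def Dop_def[abs_def]
    by (rule ctrl_duh[OF T]) (use N_L2[OF A(1) B(1) A(2) B(2) T(1)] K(2) pos qk_nonneg in \<open>auto simp: F_def\<close>)
  have eq: "norm (C k) \<le> M * jb k powr (- r) * norm (Kc A B k)" for k
  proof -
    have "(jb k / 2) powr (- (r - \<gamma>)) = 2 powr (r - \<gamma>) * jb k powr (- (r - \<gamma>))"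
      by (simp add: powr_divide powr_minus powr_diff field_simps)
    then have "C k = M * (jb k powr (- \<gamma>) * jb k powr (- (r - \<gamma>))) * Kc A B k"
      unfolding C_def F_def qk_def M_def by (simp add: mult_ac)
    also have "jb k powr (- \<gamma>) * jb k powr (- (r - \<gamma>)) = jb k powr (- r)" by (simp add: powr_add[symmetric])
    finally show ?thesis using M0 K(2) by simp
  qed
  have h: "hs s C" "hnorm s C \<le> M * hnorm (s - r) (Kc A B)"
    using hs_weight[OF K(3) M0 eq, of s] by auto
  have "M * hnorm (s - r) (Kc A B) \<le> M * (bil_const s r * (a * b))"
    using M0 bil_const_nonneg A(3) B(3) bnd_nonneg[OF u] bnd_nonneg[OF v]
    by (intro mult_left_mono order_trans[OF K(4)] mult_mono) auto
  also have "\<dots> = \<Gamma> * T powr (\<epsilon> / 2) * (a * b)" by (simp add: M_def \<Gamma>_def mult_ac)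
  finally show ?thesis unfolding bnd_def using c h by (meson order_trans)
qed

lemma N_integrable:
  assumes u: "bnd T a u" and v: "bnd T b v" and T: "0 < T"
  shows "integrable (TI T) (\<lambda>t. N (u t) (v t) k)"
proof -
  obtain A where A: "ctrl T A u" "hs s A" using u by (auto simp: bnd_def)
  obtain B where B: "ctrl T B v" "hs s B" using v by (auto simp: bnd_def)
  show ?thesis by (rule L2_TI_integrable[OF N_L2(1,2)[OF A(1) B(1) A(2) B(2) T]])
qed

lemma duh_add:
  assumes "integrable (TI T) f" "integrable (TI T) g" "t \<le> T"
  shows "duh m (\<lambda>\<tau>. f \<tau> + g \<tau>) t = duh m f t + duh m g t"
  using integrable_exp_mult_TI[OF integrable_TI[OF assms(1,3)], of m] integrable_exp_mult_TI[OF integrable_TI[OF assms(2,3)], of m]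
  by (simp add: duh_eq scaleR_right_distrib)

lemma duh_cong:
  assumes "\<And>\<tau>. \<tau> \<in> {0<..<t} \<Longrightarrow> f \<tau> = g \<tau>"
  shows "duh m f t = duh m g t"
  unfolding duh_def by (rule Bochner_Integration.integral_cong) (use assms in auto)

lemma Dop_diff:
  assumes u: "bnd T a u" and u': "bnd T a' u'" and v: "bnd T b v" and v': "bnd T b' v'" and T: "0 < T" and t: "t \<in> {0<..<T}"
  shows "Dop u v t k - Dop u' v' t k = Dop u (\<lambda>t k. v t k - v' t k) t k + Dop (\<lambda>t k. u t k - u' t k) v' t k"
proof -
  have tT: "t \<le> T" using t by simp
  have "N (u \<tau>) (v \<tau>) k = N (u' \<tau>) (v' \<tau>) k + (N (u \<tau>) (\<lambda>k. v \<tau> k - v' \<tau> k) k + N (\<lambda>k. u \<tau> k - u' \<tau> k) (v' \<tau>) k)" if "\<tau> \<in> {0<..<t}" for \<tau>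
  proof -
    have \<tau>: "\<tau> \<in> {0<..<T}" using that t by auto
    show ?thesis
      using Nl_diff[OF pos(1-3) r(1) r2 sr bndD(1)[OF u \<tau>] bndD(1)[OF u' \<tau>] bndD(1)[OF v \<tau>] bndD(1)[OF v' \<tau>], of k]
      by (simp add: algebra_simps)
  qed
  then have "Dop u v t k = duh (\<mu> k) (\<lambda>\<tau>. N (u' \<tau>) (v' \<tau>) k + (N (u \<tau>) (\<lambda>k. v \<tau> k - v' \<tau> k) k + N (\<lambda>k. u \<tau> k - u' \<tau> k) (v' \<tau>) k)) t"
    unfolding Dop_def by (rule duh_cong)
  also have "\<dots> = Dop u' v' t k + (Dop u (\<lambda>t k. v t k - v' t k) t k + Dop (\<lambda>t k. u t k - u' t k) v' t k)"
    unfolding Dop_def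
    using N_integrable[OF u' v' T] N_integrable[OF u bnd_diff[OF v v'] T] N_integrable[OF bnd_diff[OF u u'] v' T]
    by (subst duh_add[OF _ _ tT] duh_add[OF _ _ tT], auto)+
  finally show ?thesis by simp
qed

end

section \<open>Picard iteration\<close>

lemma duh_cnj: "duh m (\<lambda>\<tau>. cnj (f \<tau>)) t = cnj (duh m f t)"
proof -
  have "duh m (\<lambda>\<tau>. cnj (f \<tau>)) t = (LINT \<sigma>|TI t. cnj (exp (- (m * (t - \<sigma>))) *\<^sub>R f \<sigma>))"
    unfolding duh_def by (simp add: scaleR_conv_of_real)
  also have "\<dots> = cnj (duh m f t)"
    unfolding duh_def by (rule Bochner_Integration.integral_cnj)
  finally show ?thesis .
qed

lemma LINT_exp_decay_le:
  assumes m: "m \<ge> 0" and T: "0 < T" and \<iota>: "\<iota> = T \<or> (m > 0 \<and> \<iota> = 1 / m)"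
  shows "(LINT t|TI T. exp (- (m * t))) \<le> \<iota>"
  using \<iota>
proof
  assume "\<iota> = T"
  have "(LINT t|TI T. exp (- (m * t))) \<le> (LINT t|TI T. 1)"
    by (rule integral_mono[OF continuous_integrable_TI finite_measure.integrable_const[OF finite_measure_TI]])
       (use m in \<open>auto intro!: continuous_intros\<close>)
  then show ?thesis using T \<open>\<iota> = T\<close> by (simp add: measure_restrict_space)
next
  assume a: "m > 0 \<and> \<iota> = 1 / m"
  have "(LINT t|TI T. exp (- (m * t))) = (LINT t|TI T. (- m * exp (- m * t)) *\<^sub>R (- 1 / m))"
    using a by (intro Bochner_Integration.integral_cong) auto
  also have "\<dots> = (exp (- m * T) - 1) *\<^sub>R (- 1 / m)"
    using T by (intro LINT_exp_const) simp
  also have "\<dots> = (1 - exp (- m * T)) / m" by (simp add: diff_divide_distrib)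
  also have "\<dots> \<le> \<iota>" using a by (simp add: divide_right_mono)
  finally show ?thesis .
qed

context mg_params
begin

definition Lin :: "(int^3 \<Rightarrow> complex) \<Rightarrow> (real \<Rightarrow> int^3 \<Rightarrow> complex) \<Rightarrow> real \<Rightarrow> int^3 \<Rightarrow> complex" where
  "Lin c S t k = exp (- (\<mu> k * t)) *\<^sub>R c k + duh (\<mu> k) (\<lambda>\<tau>. S \<tau> k) t"

text \<open>Squaring the exponential only makes it smaller, so the L^2 norm in time is controlled by
  the same kernel mass \<open>\<iota>\<close> as in Duhamel's formula.\<close>

lemma bnd_heat:
  assumes c: "hs s c" and T: "0 < T" "T \<le> 1"
  shows "bnd T (C\<kappa> * hnorm s c) (\<lambda>t k. exp (- (\<mu> k * t)) *\<^sub>R c k)"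
proof -
  define A where "A k = C\<kappa> * norm (c k)" for k
  have le: "norm (A k) \<le> C\<kappa> * jb k powr 0 * norm (c k)" for k using C\<kappa>_ge_1 by (simp add: A_def)
  have h: "hs s A" "hnorm s A \<le> C\<kappa> * hnorm s c"
    using hs_weight[OF c _ le, of s] C\<kappa>_ge_1 by auto
  have "ctrl T A (\<lambda>t k. exp (- (\<mu> k * t)) *\<^sub>R c k)"
    unfolding ctrl_def
  proof (intro allI conjI ballI)
    fix k
    obtain \<iota> where \<iota>: "\<iota> = T \<or> (\<mu> k > 0 \<and> \<iota> = 1 / \<mu> k)" "0 < \<iota>" "\<iota> \<le> C\<kappa> * jb k powr (- 2 * \<gamma>)"
      using iota_exists[OF T] by blast
    show "0 \<le> A k" using C\<kappa>_ge_1 by (simp add: A_def)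
    have cont: "continuous_on {0..T} (\<lambda>t. exp (- (\<mu> k * t)) *\<^sub>R c k)" by (intro continuous_intros)
    then show "(\<lambda>t. exp (- (\<mu> k * t)) *\<^sub>R c k) \<in> borel_measurable (TI T)" by (rule continuous_measurable_TI)
    have e1: "exp (- (\<mu> k * t)) \<le> 1" if "t \<in> {0<..<T}" for t using that \<mu>_nonneg[of k] by simp
    show "norm (exp (- (\<mu> k * t)) *\<^sub>R c k) \<le> A k" if "t \<in> {0<..<T}" for t
    proof -
      have "exp (- (\<mu> k * t)) * norm (c k) \<le> C\<kappa> * norm (c k)"
        using order_trans[OF e1[OF that] C\<kappa>_ge_1] by (intro mult_right_mono) auto
      then show ?thesis by (simp add: A_def)
    qed
    have i: "integrable (TI T) (\<lambda>t. (norm (c k))\<^sup>2 * exp (- (\<mu> k * t)))" 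
      by (intro continuous_integrable_TI continuous_intros)
    have "(LINT t|TI T. (norm (exp (- (\<mu> k * t)) *\<^sub>R c k))\<^sup>2) \<le> (LINT t|TI T. (norm (c k))\<^sup>2 * exp (- (\<mu> k * t)))"
    proof (rule integral_mono[OF continuous_integrable_TI i])
      show "continuous_on {0..T} (\<lambda>t. (norm (exp (- (\<mu> k * t)) *\<^sub>R c k))\<^sup>2)" by (intro continuous_intros)
      fix t assume "t \<in> space (TI T)"
      then have "exp (- (\<mu> k * t)) * exp (- (\<mu> k * t)) \<le> 1 * exp (- (\<mu> k * t))" using e1[of t] by (intro mult_right_mono) auto
      then have "(norm (c k))\<^sup>2 * (exp (- (\<mu> k * t)) * exp (- (\<mu> k * t))) \<le> (norm (c k))\<^sup>2 * exp (- (\<mu> k * t))"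
        by (intro mult_left_mono) auto
      then show "(norm (exp (- (\<mu> k * t)) *\<^sub>R c k))\<^sup>2 \<le> (norm (c k))\<^sup>2 * exp (- (\<mu> k * t))"
        by (simp add: power_mult_distrib power2_eq_square mult_ac)
    qed
    also have "\<dots> = (norm (c k))\<^sup>2 * (LINT t|TI T. exp (- (\<mu> k * t)))" by simp
    also have "\<dots> \<le> (norm (c k))\<^sup>2 * (C\<kappa> * jb k powr (- 2 * \<gamma>))"
      using LINT_exp_decay_le[OF \<mu>_nonneg T(1) \<iota>(1)] \<iota>(3) by (intro mult_left_mono) auto
    also have "\<dots> \<le> (norm (c k))\<^sup>2 * (C\<kappa>\<^sup>2 * jb k powr (- 2 * \<gamma>))"
      using C\<kappa>_ge_1 by (intro mult_left_mono mult_right_mono) (auto simp: power2_eq_square)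
    also have "\<dots> = (jb k powr (- \<gamma>) * A k)\<^sup>2"
      unfolding A_def by (simp add: power_mult_distrib jb_powr_sq)
    finally show "(LINT t|TI T. (norm (exp (- (\<mu> k * t)) *\<^sub>R c k))\<^sup>2) \<le> (jb k powr (- \<gamma>) * A k)\<^sup>2" .
  qed
  then show ?thesis unfolding bnd_def using h by blast
qed

text \<open>On a bounded time interval a bound in L^\<infinity> gives one in L^2, and by Tonelli the
  time norms of the modes form a sequence in H^{s-\<gamma>}, the order that \<open>ctrl_duh\<close>
  lifts to \<open>s\<close>.\<close>

lemma forcing_L2:
  fixes S :: "real \<Rightarrow> int^3 \<Rightarrow> complex"
  assumes meas: "\<And>k. (\<lambda>t. S t k) \<in> borel_measurable (TI 1)"
    and hs: "AE t in TI 1. hs (s - \<gamma>) (S t) \<and> hnorm (s - \<gamma>) (S t) \<le> CS"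
  defines "F \<equiv> \<lambda>k. sqrt (LINT t|TI 1. (norm (S t k))\<^sup>2)"
  shows "integrable (TI 1) (\<lambda>t. (norm (S t k))\<^sup>2)" "hs (s - \<gamma>) F"
proof -
  interpret finite_measure "TI 1" by (rule finite_measure_TI)
  have "(\<integral>\<^sup>+t. hsum (s - \<gamma>) (S t) \<partial>TI 1) \<le> (\<integral>\<^sup>+t. ennreal (CS\<^sup>2) \<partial>TI 1)"
  proof (rule nn_integral_mono_AE)
    show "AE t in TI 1. hsum (s - \<gamma>) (S t) \<le> ennreal (CS\<^sup>2)"
      using hs by eventually_elim (simp add: hsum_eq ennreal_leI power_mono)
  qed
  also have "\<dots> < \<infinity>" using emeasure_finite by (simp add: ennreal_mult_eq_top_iff top.not_eq_extremum[symmetric])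
  finally have fin: "nsum (\<lambda>k. ennreal (jb k powr (2 * (s - \<gamma>))) * (\<integral>\<^sup>+t. ennreal ((norm (S t k))\<^sup>2) \<partial>TI 1)) < \<infinity>"
    by (simp only: nn_integral_hsum[OF sigma_finite_TI meas])
  note meas[measurable]
  show int: "integrable (TI 1) (\<lambda>t. (norm (S t k))\<^sup>2)" for k
  proof (rule integrableI_bounded)
    have "ennreal (jb k powr (2 * (s - \<gamma>))) * (\<integral>\<^sup>+t. ennreal ((norm (S t k))\<^sup>2) \<partial>TI 1) < \<infinity>"
      by (rule order_le_less_trans[OF nn_integral_ge_point fin]) simp
    then show "(\<integral>\<^sup>+t. ennreal (norm ((norm (S t k))\<^sup>2)) \<partial>TI 1) < \<infinity>"
      by (auto simp: ennreal_mult_less_top)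
  qed measurable
  have "(\<integral>\<^sup>+t. ennreal ((norm (S t k))\<^sup>2) \<partial>TI 1) = ennreal ((norm (F k))\<^sup>2)" for k
    unfolding F_def by (subst nn_integral_eq_integral[OF int]) auto
  then have "hsum (s - \<gamma>) F < \<infinity>"
    using fin by (simp add: hsum_def ennreal_mult')
  then show "hs (s - \<gamma>) F" by (simp add: hs_iff_hsum)
qed

text \<open>\<open>\<rho>\<close> has to be independent of T, because T is chosen from it
  afterwards. The forcing is therefore measured on the whole unit interval.\<close>

lemma bnd_Lin:
  assumes c: "hs s c" and meas: "\<And>k. (\<lambda>t. S t k) \<in> borel_measurable (TI 1)"
    and hs: "AE t in TI 1. hs (s - \<gamma>) (S t) \<and> hnorm (s - \<gamma>) (S t) \<le> CS"
  obtains \<rho> where "\<And>T. 0 < T \<Longrightarrow> T \<le> 1 \<Longrightarrow> bnd T \<rho> (Lin c S)"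
proof -
  define F where "F = (\<lambda>k. sqrt (LINT t|TI 1. (norm (S t k))\<^sup>2))"
  note FL = forcing_L2[OF meas hs, folded F_def]
  define B where "B k = C\<kappa> * jb k powr (- \<gamma>) * F k" for k
  have F0: "0 \<le> F k" for k by (simp add: F_def)
  have "norm (B k) \<le> C\<kappa> * jb k powr (- \<gamma>) * norm (F k)" for k
    unfolding B_def using C\<kappa>_ge_1 F0[of k] by (simp add: abs_mult)
  from hs_weight(1)[OF FL(2) _ this, of s] have B: "hs s B" using C\<kappa>_ge_1 by simp
  show thesis
  proof (rule that)
    fix T :: real assume T: "0 < T" "T \<le> 1"
    have "ctrl T B (\<lambda>t k. duh (\<mu> k) (\<lambda>\<tau>. S \<tau> k) t)"
      unfolding B_def
    proof (rule ctrl_duh[OF T F0])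
      show "(\<lambda>t. S t k) \<in> borel_measurable (TI T)" for k by (rule measurable_TI[OF meas T(2)])
      show "integrable (TI T) (\<lambda>t. (norm (S t k))\<^sup>2)" for k by (rule integrable_TI[OF FL(1) T(2)])
      show "(LINT t|TI T. (norm (S t k))\<^sup>2) \<le> (F k)\<^sup>2" for k
      proof -
        have "(LINT t|TI T. (norm (S t k))\<^sup>2) \<le> (LINT t|TI 1. (norm (S t k))\<^sup>2)"
          unfolding LINT_TI[OF T(2)] using FL(1) T
          by (intro integral_mono integrable_mult_indicator) (auto simp: sets_restrict_space indicator_def)
        then show ?thesis by (simp add: F_def)
      qed
    qed
    then have "bnd T (hnorm s B) (\<lambda>t k. duh (\<mu> k) (\<lambda>\<tau>. S \<tau> k) t)"
      unfolding bnd_def using B by blast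
    from bnd_add[OF bnd_heat[OF c T] this]
    show "bnd T (C\<kappa> * hnorm s c + hnorm s B) (Lin c S)"
      unfolding Lin_def[abs_def] .
  qed
qed

primrec pic :: "(real \<Rightarrow> int^3 \<Rightarrow> complex) \<Rightarrow> nat \<Rightarrow> real \<Rightarrow> int^3 \<Rightarrow> complex" where
  "pic L 0 = L"
| "pic L (Suc n) = (\<lambda>t k. L t k - Dop (pic L n) (pic L n) t k)"

lemma Dop_hermitian:
  assumes "\<And>t. t \<in> {0<..<T} \<Longrightarrow> hermitian (u t)" "\<And>t. t \<in> {0<..<T} \<Longrightarrow> hermitian (v t)" "t \<in> {0<..<T}"
  shows "hermitian (Dop u v t)"
  unfolding hermitian_def
proof
  fix k
  have "\<mu> (- k) = \<mu> k" by (simp add: \<mu>_def)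
  have "N (u \<tau>) (v \<tau>) (- k) = cnj (N (u \<tau>) (v \<tau>) k)" if "\<tau> \<in> {0<..<t}" for \<tau>
  proof -
    have "\<tau> \<in> {0<..<T}" using that assms(3) by auto
    then show ?thesis using Nl_hermitian[of "u \<tau>" "v \<tau>"] assms by (simp add: hermitian_def)
  qed
  then have "Dop u v t (- k) = duh (\<mu> k) (\<lambda>\<tau>. cnj (N (u \<tau>) (v \<tau>) k)) t"
    unfolding Dop_def \<open>\<mu> (- k) = \<mu> k\<close> by (rule duh_cong)
  then show "Dop u v t (- k) = cnj (Dop u v t k)" by (simp add: duh_cnj Dop_def)
qed

lemma pic_hermitian:
  assumes "\<And>t. t \<in> {0<..<T} \<Longrightarrow> hermitian (L t)" "t \<in> {0<..<T}"
  shows "hermitian (pic L n t)"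
  using assms(2)
proof (induction n arbitrary: t)
  case (Suc n)
  then have "hermitian (Dop (pic L n) (pic L n) t)" by (intro Dop_hermitian[of T])
  then show ?case using assms(1)[OF Suc.prems] by (simp add: hermitian_def)
qed (use assms in simp)

text \<open>Let q be the factor of T and \<Gamma> in \<open>bnd_Dop\<close>. The 8 leaves a margin
  in every step: iterates stay below 2 \<rho> since 4 q \<rho>^2 \<le> \<rho>, and successive
  differences are at least halved since 4 q \<rho> \<le> 1/2.\<close>

theorem picard:
  assumes L: "bnd T \<rho> L" and T: "0 < T" "T \<le> 1" and small: "8 * (\<Gamma> * T powr (\<epsilon> / 2)) * \<rho> \<le> 1"
    and herm: "\<And>t. t \<in> {0<..<T} \<Longrightarrow> hermitian (L t)"
  obtains X R where "bnd T R X" "\<And>t k. t \<in> {0<..<T} \<Longrightarrow> X t k = L t k - Dop X X t k"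
    "\<And>t. t \<in> {0<..<T} \<Longrightarrow> hermitian (X t)"
proof -
  define q where "q = \<Gamma> * T powr (\<epsilon> / 2)"
  have q0: "q \<ge> 0" using \<Gamma>_nonneg by (simp add: q_def)
  have \<rho>0: "\<rho> \<ge> 0" by (rule bnd_nonneg[OF L])
  have small': "8 * q * \<rho> \<le> 1" using small by (simp add: q_def)
  have D: "bnd T (q * (a * b)) (Dop u v)" if "bnd T a u" "bnd T b v" for a b u v
    unfolding q_def by (rule bnd_Dop[OF that T])
  have P: "bnd T (2 * \<rho>) (pic L n)" for n
  proof (induction n)
    case 0
    show ?case using bnd_mono[OF L] \<rho>0 by simp
  next
    case (Suc n)
    have "bnd T (\<rho> + q * (2 * \<rho> * (2 * \<rho>))) (pic L (Suc n))"
      using bnd_diff[OF L D[OF Suc Suc]] by simp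
    moreover have "\<rho> + q * (2 * \<rho> * (2 * \<rho>)) \<le> 2 * \<rho>"
      using mult_right_mono[OF small' \<rho>0] \<rho>0 by (simp add: algebra_simps)
    ultimately show ?case by (rule bnd_mono)
  qed
  define d where "d n t k = pic L (Suc n) t k - pic L n t k" for n t k
  have dn: "bnd T (\<rho> * (1/2) ^ Suc n) (d n)" for n
  proof (induction n)
    case 0
    have "bnd T (q * (\<rho> * \<rho>)) (\<lambda>t k. - Dop L L t k)" by (rule bnd_uminus[OF D[OF L L]])
    then have "bnd T (q * (\<rho> * \<rho>)) (d 0)" by (rule bnd_cong) (simp add: d_def)
    moreover have "q * (\<rho> * \<rho>) \<le> \<rho> * (1/2) ^ Suc 0"
      using mult_right_mono[OF small' \<rho>0] \<rho>0 by (simp add: algebra_simps)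
    ultimately show ?case by (rule bnd_mono)
  next
    case (Suc n)
    let ?b = "\<rho> * (1/2) ^ Suc n"
    have dS: "bnd T ?b (\<lambda>t k. pic L (Suc n) t k - pic L n t k)" using Suc by (simp add: d_def[abs_def])
    have "bnd T (q * (2 * \<rho> * ?b) + q * (?b * (2 * \<rho>)))
       (\<lambda>t k. - (Dop (pic L (Suc n)) (\<lambda>t k. pic L (Suc n) t k - pic L n t k) t k + Dop (\<lambda>t k. pic L (Suc n) t k - pic L n t k) (pic L n) t k))"
      by (intro bnd_uminus bnd_add D P dS)
    then have "bnd T (q * (2 * \<rho> * ?b) + q * (?b * (2 * \<rho>))) (d (Suc n))"
    proof (rule bnd_cong)
      fix t k assume t: "t \<in> {0<..<T}"
      have "d (Suc n) t k = - (Dop (pic L (Suc n)) (pic L (Suc n)) t k - Dop (pic L n) (pic L n) t k)"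
        by (simp add: d_def)
      then show "d (Suc n) t k = - (Dop (pic L (Suc n)) (\<lambda>t k. pic L (Suc n) t k - pic L n t k) t k + Dop (\<lambda>t k. pic L (Suc n) t k - pic L n t k) (pic L n) t k)"
        by (simp only: Dop_diff[OF P P P P T(1) t])
    qed
    moreover have "q * (2 * \<rho> * ?b) + q * (?b * (2 * \<rho>)) \<le> \<rho> * (1/2) ^ Suc (Suc n)"
      using mult_right_mono[OF small', of ?b] \<rho>0 by (simp add: algebra_simps)
    ultimately show ?case by (rule bnd_mono)
  qed
  have geo: "(\<lambda>m. \<rho> * (1/2) ^ Suc (m + n)) sums (\<rho> * (1/2) ^ n)" for n
  proof -
    have "(\<lambda>m. (\<rho> * (1/2) ^ Suc n) * (1/2) ^ m) sums ((\<rho> * (1/2) ^ Suc n) * (1 / (1 - 1/2)))"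
      by (intro sums_mult geometric_sums) simp
    then show ?thesis by (simp add: power_add mult_ac)
  qed
  have d_sums: "(\<lambda>m. d m t k) sums infsum (\<lambda>m. d m t k) UNIV" if "t \<in> {0<..<T}" for t k
    using bnd_suminf(2)[of T "\<lambda>n. \<rho> * (1/2) ^ Suc n" d "\<rho>" t k] dn geo[of 0] that has_sum_imp_sums by auto
  define X where "X t k = L t k + infsum (\<lambda>m. d m t k) UNIV" for t k
  have tele: "(\<Sum>m<n. d m t k) = pic L n t k - L t k" for n t k
    by (induction n) (simp_all add: d_def)
  have tail: "bnd T (\<rho> * (1/2) ^ n) (\<lambda>t k. X t k - pic L n t k)" for n
  proof -
    note B = bnd_suminf[of T "\<lambda>m. \<rho> * (1/2) ^ Suc (m + n)" "\<lambda>m. d (m + n)", OF dn geo]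
    show ?thesis
    proof (rule bnd_cong[OF B(1)])
      fix t k assume t: "t \<in> {0<..<T}"
      have 1: "(\<lambda>m. d (m + n) t k) sums infsum (\<lambda>m. d (m + n) t k) UNIV"
        by (rule has_sum_imp_sums[OF B(2)[OF t]])
      have "(\<lambda>m. d (m + n) t k) sums (infsum (\<lambda>m. d m t k) UNIV - (\<Sum>m<n. d m t k))"
        by (rule sums_split_initial_segment[OF d_sums[OF t]])
      then show "X t k - pic L n t k = infsum (\<lambda>m. d (m + n) t k) UNIV"
        using sums_unique2[OF 1] by (simp add: tele X_def)
    qed
  qed
  have X: "bnd T (3 * \<rho>) X"
  proof -
    have "bnd T (\<rho> * (1/2) ^ 0 + 2 * \<rho>) (\<lambda>t k. (X t k - pic L 0 t k) + pic L 0 t k)"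
      by (intro bnd_add tail P)
    then show ?thesis by simp
  qed
  have lim0: "(\<lambda>n. C * (1/2) ^ n) \<longlonglongrightarrow> (0::real)" for C :: real
    using tendsto_mult_right_zero[OF LIMSEQ_realpow_zero, of "1/2" C] by simp
  \<comment> \<open>The defect of \<open>X\<close> is split by means of an iterate, as
    \<open>pic L (Suc n)\<close> equals \<open>L\<close> minus the quadratic term of
    \<open>pic L n\<close> exactly; both resulting differences are of order 2^(-n).\<close>
  have fix_eq: "X t k = L t k - Dop X X t k" if t: "t \<in> {0<..<T}" for t k
  proof -
    define C where "C = jb k powr (- s) * (\<rho> * (1/2) + (q * (3 * \<rho> * \<rho>) + q * (\<rho> * (2 * \<rho>))))"
    have "norm (X t k - (L t k - Dop X X t k)) \<le> C * (1/2) ^ n" for n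
    proof -
      have "bnd T (\<rho> * (1/2) ^ Suc n + (q * (3 * \<rho> * (\<rho> * (1/2) ^ n)) + q * (\<rho> * (1/2) ^ n * (2 * \<rho>))))
         (\<lambda>t k. (X t k - pic L (Suc n) t k) + (Dop X (\<lambda>t k. X t k - pic L n t k) t k + Dop (\<lambda>t k. X t k - pic L n t k) (pic L n) t k))"
        by (intro bnd_add D tail X P)
      from bndD(3)[OF this t, of k]
      have "norm ((X t k - pic L (Suc n) t k) + (Dop X X t k - Dop (pic L n) (pic L n) t k)) \<le> C * (1/2) ^ n"
        unfolding Dop_diff[OF X P X P T(1) t, symmetric] C_def by (simp add: algebra_simps)
      then show ?thesis by (simp add: algebra_simps)
    qed
    then have "norm (X t k - (L t k - Dop X X t k)) \<le> 0"
      by (intro LIMSEQ_le_const[OF lim0[of C]]) auto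
    then show ?thesis by simp
  qed
  have "hermitian (X t)" if t: "t \<in> {0<..<T}" for t
    unfolding hermitian_def
  proof
    fix k
    have lim: "(\<lambda>n. pic L n t k) \<longlonglongrightarrow> X t k" for k
    proof -
      have "(\<lambda>n. \<Sum>m<n. d m t k) \<longlonglongrightarrow> infsum (\<lambda>m. d m t k) UNIV"
        using d_sums[OF t] by (simp add: sums_def)
      then have "(\<lambda>n. L t k + (\<Sum>m<n. d m t k)) \<longlonglongrightarrow> X t k"
        unfolding X_def by (intro tendsto_intros)
      then show ?thesis by (simp add: tele)
    qed
    have "(\<lambda>n. cnj (pic L n t k)) \<longlonglongrightarrow> cnj (X t k)" by (intro tendsto_intros lim)
    moreover have "cnj (pic L n t k) = pic L n t (- k)" for n
      using pic_hermitian[OF herm t] by (simp add: hermitian_def)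
    ultimately show "X t (- k) = cnj (X t k)" using LIMSEQ_unique lim[of "- k"] by auto
  qed
  then show thesis using that[OF X fix_eq] by blast
qed

end

section \<open>The weak formulation in Fourier variables\<close>

lemma LINT_mult_ek:
  "(LINT x|torus. complex_of_real (F x) * ek k x) = (2 * pi) ^ 3 * fourier_coeff F (- k)"
  by (simp add: fourier_coeff_ek scaleR_conv_of_real)

text \<open>Asymmetric on purpose: only \<open>\<phi>\<close> is expanded, so \<open>F\<close> may
  be any integrable function, in particular the product of the solution with its velocity.\<close>

lemma parseval:
  fixes F \<phi> :: "real^3 \<Rightarrow> real"
  assumes F: "integrable torus F" and \<phi>: "integrable torus \<phi>" and p: "(\<lambda>k. norm (fourier_coeff \<phi> k)) summable_on UNIV"
  shows "complex_of_real (LINT x|torus. F x * \<phi> x) = (2 * pi) ^ 3 * infsum (\<lambda>k. cnj (fourier_coeff \<phi> k) * fourier_coeff F k) UNIV"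
    and "integrable torus (\<lambda>x. F x * \<phi> x)"
    and "(\<lambda>k. norm (cnj (fourier_coeff \<phi> k) * fourier_coeff F k)) summable_on UNIV"
proof -
  let ?p = "fourier_coeff \<phi>"
  have herm: "?p (- k) = cnj (?p k)" for k using hermitian_fourier_coeff[of \<phi>] by (simp add: hermitian_def)
  have ae: "AE x in torus. \<phi> x = rser ?p x" by (rule AE_eq_rser[OF \<phi> p])
  have FC: "integrable torus (\<lambda>x. complex_of_real (F x))" using F by simp
  note pair = fser_pairing[OF p FC]
  have meas: "(\<lambda>x. complex_of_real (F x * \<phi> x)) \<in> borel_measurable torus" using F \<phi> by auto
  have ae': "AE x in torus. complex_of_real (F x) * fser ?p x = complex_of_real (F x * \<phi> x)"
    using ae by eventually_elim (simp add: fser_hermitian[OF hermitian_fourier_coeff, symmetric])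
  have int: "integrable torus (\<lambda>x. complex_of_real (F x * \<phi> x))"
    by (rule integrable_cong_AE_imp[OF pair(1) meas ae'])
  then show "integrable torus (\<lambda>x. F x * \<phi> x)" by (simp only: complex_of_real_integrable_eq)
  have "complex_of_real (LINT x|torus. F x * \<phi> x) = (LINT x|torus. complex_of_real (F x * \<phi> x))"
    by (rule integral_complex_of_real[symmetric])
  also have "\<dots> = (LINT x|torus. complex_of_real (F x) * fser ?p x)"
    using ae' meas pair(1) by (intro integral_cong_AE) (auto elim: eventually_mono)
  also have "\<dots> = infsum (\<lambda>k. ?p k * ((2 * pi) ^ 3 * fourier_coeff F (- k))) UNIV"
    unfolding pair(3) LINT_mult_ek ..
  also have "\<dots> = infsum (\<lambda>k. ?p (- k) * ((2 * pi) ^ 3 * fourier_coeff F (- (- k)))) UNIV"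
    using infsum_reindex_bij_betw[OF bij_uminus_int3, of "\<lambda>k. ?p k * ((2 * pi) ^ 3 * fourier_coeff F (- k))"] by simp
  also have "\<dots> = infsum (\<lambda>k. (2 * pi) ^ 3 * (cnj (?p k) * fourier_coeff F k)) UNIV"
    by (simp add: herm mult_ac)
  also have "\<dots> = (2 * pi) ^ 3 * infsum (\<lambda>k. cnj (?p k) * fourier_coeff F k) UNIV"
    by (rule infsum_cmult_right')
  finally show "complex_of_real (LINT x|torus. F x * \<phi> x) = (2 * pi) ^ 3 * infsum (\<lambda>k. cnj (?p k) * fourier_coeff F k) UNIV" .
  have "(\<lambda>k. norm (?p k) * (LINT x|torus. \<bar>F x\<bar>)) summable_on UNIV"
    by (rule summable_on_cmult_left[OF p])
  then show "(\<lambda>k. norm (cnj (?p k) * fourier_coeff F k)) summable_on UNIV"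
    by (rule summable_on_comparison_test) (auto simp: norm_mult intro!: mult_left_mono norm_fourier_coeff_le F)
qed

text \<open>The series with the prescribed coefficients witnesses the choice in
  \<open>fourier_multiplier\<close>, and evenness of \<open>m\<close> keeps it real. These two
  properties are all that is known of the chosen function.\<close>

lemma fourier_multiplier_spec:
  assumes even: "\<And>k. m (- k) = m k" and summ: "(\<lambda>k. norm (complex_of_real (m k) * fourier_coeff f k)) summable_on UNIV"
  shows "fourier_multiplier m f \<in> L2_torus"
    "fourier_coeff (fourier_multiplier m f) k = complex_of_real (m k) * fourier_coeff f k"
proof -
  let ?c = "\<lambda>k. complex_of_real (m k) * fourier_coeff f k"
  have "hermitian ?c" using hermitian_fourier_coeff[of f] by (simp add: hermitian_def even)
  define P where "P g \<longleftrightarrow> g \<in> L2_torus \<and> (\<forall>k. fourier_coeff g k = ?c k)" for g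
  have "P (rser ?c)"
    using rser_L2[OF summ] fourier_coeff_rser[OF summ \<open>hermitian ?c\<close>] by (simp add: P_def)
  then have "P (SOME g. P g)" by (rule someI[of P])
  moreover have "fourier_multiplier m f = (SOME g. P g)" by (simp add: fourier_multiplier_def P_def)
  ultimately have "fourier_multiplier m f \<in> L2_torus \<and> (\<forall>k. fourier_coeff (fourier_multiplier m f) k = ?c k)"
    by (simp add: P_def)
  then show "fourier_multiplier m f \<in> L2_torus" "fourier_coeff (fourier_multiplier m f) k = ?c k" by auto
qed

lemma L2_torus_mult_integrable:
  assumes "f \<in> L2_torus" "g \<in> L2_torus"
  shows "integrable torus (\<lambda>x. f x * g x)"
proof (rule Bochner_Integration.integrable_bound)
  show "integrable torus (\<lambda>x. (f x)\<^sup>2 + (g x)\<^sup>2)" using assms by (auto simp: L2_torus_def)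
  show "(\<lambda>x. f x * g x) \<in> borel_measurable torus" using assms by (auto simp: L2_torus_def)
  show "AE x in torus. norm (f x * g x) \<le> norm ((f x)\<^sup>2 + (g x)\<^sup>2)"
  proof (intro AE_I2)
    fix x
    have "2 * (\<bar>f x\<bar> * \<bar>g x\<bar>) \<le> (f x)\<^sup>2 + (g x)\<^sup>2" using sum_squares_bound[of "\<bar>f x\<bar>" "\<bar>g x\<bar>"] by simp
    moreover have "0 \<le> \<bar>f x\<bar> * \<bar>g x\<bar>" by simp
    ultimately have "\<bar>f x\<bar> * \<bar>g x\<bar> \<le> (f x)\<^sup>2 + (g x)\<^sup>2" by linarith
    then show "norm (f x * g x) \<le> norm ((f x)\<^sup>2 + (g x)\<^sup>2)" by (simp add: abs_mult)
  qed
qed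

text \<open>The convolution theorem with one factor expanded: \<open>fser_pairing\<close> is applied
  to \<open>g\<close> times \<open>ek (- k)\<close>, and the shifted characters produce the
  coefficients of \<open>g\<close> at k - j.\<close>

lemma fourier_coeff_product:
  assumes f: "integrable torus f" "(\<lambda>k. norm (fourier_coeff f k)) summable_on UNIV" and g: "g \<in> L2_torus"
  shows "fourier_coeff (\<lambda>x. f x * g x) k = infsum (\<lambda>j. fourier_coeff f j * fourier_coeff g (k - j)) UNIV"
    "(\<lambda>j. norm (fourier_coeff f j * fourier_coeff g (k - j))) summable_on UNIV"
proof -
  have gi: "integrable torus g" by (rule L2_torus_integrable[OF g])
  have G: "integrable torus (\<lambda>x. complex_of_real (g x) * ek (- k) x)"
    using gi by (intro integrable_mult_ek) simp
  note pair = fser_pairing[OF f(2) G]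
  have c: "(LINT x|torus. complex_of_real (g x) * ek (- k) x * ek j x) = (2 * pi) ^ 3 * fourier_coeff g (k - j)" for j
  proof -
    have m: "- (- k + j) = k - j" by simp
    show ?thesis using LINT_mult_ek[of g "- k + j"] unfolding ek_add m by (simp only: mult.assoc)
  qed
  have e: "fourier_coeff f j * ((2 * pi) ^ 3 * fourier_coeff g (k - j)) = (2 * pi) ^ 3 * (fourier_coeff f j * fourier_coeff g (k - j))" for j
    by (simp add: mult_ac)
  have ae: "AE x in torus. complex_of_real (f x * g x) * ek (- k) x = complex_of_real (g x) * ek (- k) x * fser (fourier_coeff f) x"
    using AE_eq_rser[OF f] by eventually_elim (simp add: fser_hermitian[OF hermitian_fourier_coeff, symmetric])
  have [measurable]: "ek (- k) \<in> borel_measurable torus"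
    by (intro continuous_imp_measurable_torus continuous_ek)
  have [measurable]: "f \<in> borel_measurable torus" "g \<in> borel_measurable torus" using f gi by auto
  have "(LINT x|torus. complex_of_real (f x * g x) * ek (- k) x) = (LINT x|torus. complex_of_real (g x) * ek (- k) x * fser (fourier_coeff f) x)"
    using pair(1) by (intro integral_cong_AE ae) auto
  also have "\<dots> = (2 * pi) ^ 3 * infsum (\<lambda>j. fourier_coeff f j * fourier_coeff g (k - j)) UNIV"
    unfolding pair(3) c e by (rule infsum_cmult_right')
  finally show "fourier_coeff (\<lambda>x. f x * g x) k = infsum (\<lambda>j. fourier_coeff f j * fourier_coeff g (k - j)) UNIV"
    by (simp add: fourier_coeff_ek scaleR_conv_of_real)
  have "(\<lambda>j. norm ((2 * pi) ^ 3 * (fourier_coeff f j * fourier_coeff g (k - j)))) summable_on UNIV"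
    using pair(2) unfolding c e .
  then have "(\<lambda>j. (2 * pi) ^ 3 * norm (fourier_coeff f j * fourier_coeff g (k - j))) summable_on UNIV"
    by (simp add: norm_mult norm_power)
  then show "(\<lambda>j. norm (fourier_coeff f j * fourier_coeff g (k - j))) summable_on UNIV"
    using summable_on_cmult_right'[of "(2 * pi) ^ 3" "\<lambda>j. norm (fourier_coeff f j * fourier_coeff g (k - j))" UNIV] by simp
qed

lemma infsum_sum_complex:
  fixes f :: "'l \<Rightarrow> 'i \<Rightarrow> complex"
  assumes "finite A" "\<And>l. l \<in> A \<Longrightarrow> f l summable_on B"
  shows "infsum (\<lambda>k. \<Sum>l\<in>A. f l k) B = (\<Sum>l\<in>A. infsum (f l) B)"
proof -
  have "(\<lambda>k. \<Sum>l\<in>A. f l k) summable_on B \<and> infsum (\<lambda>k. \<Sum>l\<in>A. f l k) B = (\<Sum>l\<in>A. infsum (f l) B)"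
    using assms
  proof (induction A rule: finite_induct)
    case (insert l A)
    then show ?case
      using infsum_add[of "f l" B "\<lambda>k. \<Sum>l\<in>A. f l k"] summable_on_add[of "f l" B "\<lambda>k. \<Sum>l\<in>A. f l k"]
      by simp
  qed simp
  then show ?thesis ..
qed

text \<open>Common to all time integrals of the weak formulation: growth of the modes like
  \<open>(jb k)\<^sup>2\<close> is absorbed by the decay of the test function. The integrand
  \<open>h\<close> is tied to its series only almost everywhere, and its measurability follows by
  completeness.\<close>

lemma time_swap:
  fixes a :: "int^3 \<Rightarrow> real \<Rightarrow> complex"
  assumes t: "0 < t" and a: "\<And>k. a k \<in> borel_measurable (TI t)" and bd: "AE \<tau> in TI t. \<forall>k. norm (a k \<tau>) \<le> C * (jb k)\<^sup>2"
    and p: "(\<lambda>k. (jb k)\<^sup>2 * norm (p k)) summable_on UNIV"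
    and h: "AE \<tau> in TI t. complex_of_real (h \<tau>) = V * infsum (\<lambda>k. cnj (p k) * a k \<tau>) UNIV"
  shows "complex_of_real (LINT \<tau>|TI t. h \<tau>) = V * infsum (\<lambda>k. cnj (p k) * (LINT \<tau>|TI t. a k \<tau>)) UNIV"
    "(\<lambda>k. norm (cnj (p k) * (LINT \<tau>|TI t. a k \<tau>))) summable_on UNIV"
    "integrable (TI t) (a k)"
proof -
  interpret finite_measure "TI t" by (rule finite_measure_TI)
  have bd': "AE \<tau> in TI t. norm (a k \<tau>) \<le> C * (jb k)\<^sup>2" for k using bd by eventually_elim blast
  have int_a: "integrable (TI t) (a k)" for k
    by (rule integrable_const_bound[OF bd' a])
  then show "integrable (TI t) (a k)" .
  let ?f = "\<lambda>k \<tau>. cnj (p k) * a k \<tau>"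
  have f: "?f k \<in> borel_measurable (TI t)" for k using a by measurable
  have le: "(\<integral>\<^sup>+\<tau>. ennreal (norm (?f k \<tau>)) \<partial>TI t) \<le> ennreal (t * \<bar>C\<bar>) * ennreal ((jb k)\<^sup>2 * norm (p k))" for k
  proof -
    have "(\<integral>\<^sup>+\<tau>. ennreal (norm (?f k \<tau>)) \<partial>TI t) \<le> (\<integral>\<^sup>+\<tau>. ennreal (\<bar>C\<bar> * ((jb k)\<^sup>2 * norm (p k))) \<partial>TI t)"
    proof (rule nn_integral_mono_AE)
      show "AE \<tau> in TI t. ennreal (norm (?f k \<tau>)) \<le> ennreal (\<bar>C\<bar> * ((jb k)\<^sup>2 * norm (p k)))"
        using bd'[of k]
      proof eventually_elim
        case (elim \<tau>)
        also have "C * (jb k)\<^sup>2 \<le> \<bar>C\<bar> * (jb k)\<^sup>2" by (intro mult_right_mono) auto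
        finally have "norm (p k) * norm (a k \<tau>) \<le> norm (p k) * (\<bar>C\<bar> * (jb k)\<^sup>2)" by (rule mult_left_mono) simp
        then show ?case by (intro ennreal_leI) (simp add: norm_mult mult_ac)
      qed
    qed
    also have "\<dots> = ennreal (\<bar>C\<bar> * ((jb k)\<^sup>2 * norm (p k))) * ennreal t"
      using t by (simp add: emeasure_restrict_space)
    also have "\<dots> = ennreal (t * \<bar>C\<bar>) * ennreal ((jb k)\<^sup>2 * norm (p k))"
      using t by (simp add: ennreal_mult'[symmetric] mult_ac)
    finally show ?thesis .
  qed
  have "nsum (\<lambda>k. \<integral>\<^sup>+\<tau>. ennreal (norm (?f k \<tau>)) \<partial>TI t) \<le> nsum (\<lambda>k. ennreal (t * \<bar>C\<bar>) * ennreal ((jb k)\<^sup>2 * norm (p k)))"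
    by (rule nn_integral_mono[OF le])
  also have "\<dots> = ennreal (t * \<bar>C\<bar>) * nsum (\<lambda>k. ennreal ((jb k)\<^sup>2 * norm (p k)))"
    by (rule nn_integral_cmult) simp
  also have "\<dots> < \<infinity>"
    using p summable_on_iff_nsum[of "\<lambda>k. (jb k)\<^sup>2 * norm (p k)"] by (simp add: ennreal_mult_less_top)
  finally have fin: "nsum (\<lambda>k. \<integral>\<^sup>+\<tau>. ennreal (norm (?f k \<tau>)) \<partial>TI t) < \<infinity>" .
  note sw = infsum_integral_swap[OF sigma_finite_TI f fin]
  have eqk: "(LINT \<tau>|TI t. ?f k \<tau>) = cnj (p k) * (LINT \<tau>|TI t. a k \<tau>)" for k by simp
  show "(\<lambda>k. norm (cnj (p k) * (LINT \<tau>|TI t. a k \<tau>))) summable_on UNIV"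
    using sw(3) by simp
  have Gm: "(\<lambda>\<tau>. V * infsum (\<lambda>k. ?f k \<tau>) UNIV) \<in> borel_measurable (TI t)" using sw(2) by auto
  have hm: "(\<lambda>\<tau>. complex_of_real (h \<tau>)) \<in> borel_measurable (TI t)"
    by (rule borel_measurable_lebesgue_on_AE[OF _ Gm]) (use h in \<open>auto elim: eventually_mono\<close>)
  have "complex_of_real (LINT \<tau>|TI t. h \<tau>) = (LINT \<tau>|TI t. complex_of_real (h \<tau>))"
    by (rule integral_complex_of_real[symmetric])
  also have "\<dots> = (LINT \<tau>|TI t. V * infsum (\<lambda>k. ?f k \<tau>) UNIV)"
    by (rule integral_cong_AE[OF hm Gm h])
  also have "\<dots> = V * infsum (\<lambda>k. LINT \<tau>|TI t. ?f k \<tau>) UNIV"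
    by (simp only: integral_mult_right_zero sw(4))
  finally show "complex_of_real (LINT \<tau>|TI t. h \<tau>) = V * infsum (\<lambda>k. cnj (p k) * (LINT \<tau>|TI t. a k \<tau>)) UNIV"
    by (simp only: eqk)
qed

context mg_params
begin

text \<open>The velocity costs one derivative, so its coefficients are summable because s + \<gamma>
  - 1 > 3/2; this is where H^{s+\<gamma>} enters rather than H^s. The minus sign comes from
  conjugating the imaginary unit in the coefficients of the derivatives of
  \<open>\<phi>\<close>.\<close>

lemma nonlinear_term:
  assumes f: "f \<in> sobolev (s + \<gamma>)" and \<phi>: "\<phi> \<in> smooth_torus"
  shows "complex_of_real (LINT x|torus. f x * (mg_velocity \<Omega> \<beta> \<eta> f x \<bullet> gradient \<phi> x))
    = (2 * pi) ^ 3 * infsum (\<lambda>k. cnj (fourier_coeff \<phi> k) * (- N (fourier_coeff f) (fourier_coeff f) k)) UNIV"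
proof -
  let ?c = "fourier_coeff f" and ?p = "fourier_coeff \<phi>"
  have fL: "f \<in> L2_torus" and hsg: "hs (s + \<gamma>) ?c" using f by (auto simp: sobolev_iff)
  have hs_s: "hs s ?c" by (rule hs_mono[OF hsg]) (use \<gamma> in auto)
  have fi: "integrable torus f" by (rule L2_torus_integrable[OF fL])
  have fsum: "(\<lambda>k. norm (?c k)) summable_on UNIV" by (rule hs_abs_summable0[OF hs_s s32])
  have jsum: "(\<lambda>k. jb k powr 1 * norm (?c k)) summable_on UNIV"
    using sr r \<gamma> by (intro hs_abs_summable[OF hsg]) simp
  define U where "U l = fourier_multiplier (\<lambda>k. mg_symbol \<Omega> \<beta> \<eta> k $ l) f" for l :: 3
  have Usum: "(\<lambda>k. norm (complex_of_real (mg_symbol \<Omega> \<beta> \<eta> k $ l) * ?c k)) summable_on UNIV" for l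
  proof (rule summable_on_comparison_test[OF summable_on_cmult_right[OF jsum, of "3 / \<Omega>"]])
    fix k
    have "\<bar>mg_symbol \<Omega> \<beta> \<eta> k $ l\<bar> \<le> norm (mg_symbol \<Omega> \<beta> \<eta> k)" by (rule component_le_norm_cart)
    also have "\<dots> \<le> 3 / \<Omega> * norm (freq k)" by (rule norm_mg_symbol_le[OF pos(1-3)])
    also have "\<dots> \<le> 3 / \<Omega> * jb k" using pos norm_freq_le_jb by (intro mult_left_mono) auto
    finally have "\<bar>mg_symbol \<Omega> \<beta> \<eta> k $ l\<bar> * norm (?c k) \<le> 3 / \<Omega> * jb k * norm (?c k)" by (rule mult_right_mono) simp
    then show "norm (complex_of_real (mg_symbol \<Omega> \<beta> \<eta> k $ l) * ?c k) \<le> 3 / \<Omega> * (jb k powr 1 * norm (?c k))"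
      by (simp add: norm_mult mult.assoc)
  qed simp
  note Uspec = fourier_multiplier_spec[OF _ Usum, folded U_def, unfolded mg_symbol_minus, OF refl]
  have UL: "U l \<in> L2_torus" for l by (rule Uspec)
  have Uc: "fourier_coeff (U l) k = complex_of_real (mg_symbol \<Omega> \<beta> \<eta> k $ l) * ?c k" for l k
    by (rule Uspec)
  have FI: "integrable torus (\<lambda>x. f x * U l x)" for l by (rule L2_torus_mult_integrable[OF fL UL])
  define F where "F l k = fourier_coeff (\<lambda>x. f x * U l x) k" for l k
  have Fk: "F l k = infsum (\<lambda>j. ?c j * fourier_coeff (U l) (k - j)) UNIV" for l k
    unfolding F_def by (rule fourier_coeff_product[OF fi fsum UL])
  have Fks: "(\<lambda>j. norm (?c j * fourier_coeff (U l) (k - j))) summable_on UNIV" for l k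
    unfolding F_def by (rule fourier_coeff_product[OF fi fsum UL])
  have d: "partial_deriv l \<phi> \<in> smooth_torus" for l by (rule smooth_torusD(3)[OF \<phi>])
  have dI: "integrable torus (partial_deriv l \<phi>)" for l
    by (rule continuous_imp_integrable_torus[OF smooth_torusD(4)[OF d]])
  note par = parseval[OF FI dI smooth_torus_abs_summable[OF d]]
  have dc: "fourier_coeff (partial_deriv l \<phi>) k = \<i> * of_int (k $ l) * ?p k" for l k
    by (rule smooth_torus_partial_coeff[OF \<phi>])
  have "(LINT x|torus. f x * (mg_velocity \<Omega> \<beta> \<eta> f x \<bullet> gradient \<phi> x))
     = (LINT x|torus. (\<Sum>l\<in>UNIV. f x * U l x * partial_deriv l \<phi> x))"
    by (simp add: mg_velocity_def gradient_def inner_vec_def U_def sum_distrib_left mult.assoc)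
  also have "\<dots> = (\<Sum>l\<in>UNIV. (LINT x|torus. f x * U l x * partial_deriv l \<phi> x))"
    by (rule Bochner_Integration.integral_sum) (rule par(2))
  also have "complex_of_real \<dots> = (\<Sum>l\<in>UNIV. complex_of_real (LINT x|torus. f x * U l x * partial_deriv l \<phi> x))"
    by simp
  also have "\<dots> = (\<Sum>l\<in>UNIV. (2 * pi) ^ 3 * infsum (\<lambda>k. cnj (fourier_coeff (partial_deriv l \<phi>) k) * F l k) UNIV)"
    unfolding F_def by (intro sum.cong refl par(1))
  also have "\<dots> = (2 * pi) ^ 3 * (\<Sum>l\<in>UNIV. infsum (\<lambda>k. cnj (fourier_coeff (partial_deriv l \<phi>) k) * F l k) UNIV)"
    by (rule sum_distrib_left[symmetric])
  also have "(\<Sum>l\<in>UNIV. infsum (\<lambda>k. cnj (fourier_coeff (partial_deriv l \<phi>) k) * F l k) UNIV)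
      = infsum (\<lambda>k. \<Sum>l\<in>UNIV. cnj (fourier_coeff (partial_deriv l \<phi>) k) * F l k) UNIV"
    unfolding F_def by (intro infsum_sum_complex[symmetric] finite abs_summable_summable[OF par(3)])
  also have "(\<lambda>k. \<Sum>l\<in>UNIV. cnj (fourier_coeff (partial_deriv l \<phi>) k) * F l k) = (\<lambda>k. cnj (?p k) * (- N ?c ?c k))"
  proof
    fix k
    have "N ?c ?c k = infsum (\<lambda>j. \<Sum>l\<in>UNIV. \<i> * of_int (k $ l) * (?c j * fourier_coeff (U l) (k - j))) UNIV"
      unfolding Nl_def
    proof (rule infsum_cong)
      fix j
      have "freq k \<bullet> mg_symbol \<Omega> \<beta> \<eta> (k - j) = (\<Sum>l\<in>UNIV. of_int (k $ l) * mg_symbol \<Omega> \<beta> \<eta> (k - j) $ l)"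
        by (simp add: inner_vec_def)
      then show "Nl_term \<Omega> \<beta> \<eta> ?c ?c k j = (\<Sum>l\<in>UNIV. \<i> * of_int (k $ l) * (?c j * fourier_coeff (U l) (k - j)))"
        unfolding Nl_term_def Uc by (simp add: sum_distrib_left sum_distrib_right mult_ac)
    qed
    also have "\<dots> = (\<Sum>l\<in>UNIV. infsum (\<lambda>j. \<i> * of_int (k $ l) * (?c j * fourier_coeff (U l) (k - j))) UNIV)"
      by (intro infsum_sum_complex finite summable_on_cmult_right abs_summable_summable[OF Fks])
    also have "\<dots> = (\<Sum>l\<in>UNIV. \<i> * of_int (k $ l) * F l k)"
      unfolding Fk by (intro sum.cong refl infsum_cmult_right')
    finally have "N ?c ?c k = (\<Sum>l\<in>UNIV. \<i> * of_int (k $ l) * F l k)" .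
    then show "(\<Sum>l\<in>UNIV. cnj (fourier_coeff (partial_deriv l \<phi>) k) * F l k) = cnj (?p k) * (- N ?c ?c k)"
      unfolding dc by (simp add: sum_distrib_left sum_negf[symmetric] mult_ac)
  qed
  finally show ?thesis .
qed

lemma freq_powr_le: "norm (freq k) powr (2 * \<gamma>) \<le> (jb k)\<^sup>2"
proof -
  have "norm (freq k) powr (2 * \<gamma>) \<le> jb k powr (2 * \<gamma>)"
    using \<gamma> norm_freq_le_jb by (intro powr_mono2) auto
  also have "\<dots> \<le> jb k powr 2" using \<gamma> jb_ge_1 by (intro powr_mono) auto
  finally show ?thesis by simp
qed

lemma diffusion_term:
  assumes f: "f \<in> sobolev s" and \<phi>: "\<phi> \<in> smooth_torus"
  shows "complex_of_real (LINT x|torus. f x * frac_laplacian \<gamma> \<phi> x)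
    = (2 * pi) ^ 3 * infsum (\<lambda>k. cnj (fourier_coeff \<phi> k) * (complex_of_real (norm (freq k) powr (2 * \<gamma>)) * fourier_coeff f k)) UNIV"
proof -
  let ?c = "fourier_coeff f" and ?p = "fourier_coeff \<phi>"
  have fL: "f \<in> L2_torus" and hs_s: "hs s ?c" using f by (auto simp: sobolev_iff)
  have fi: "integrable torus f" by (rule L2_torus_integrable[OF fL])
  have fsum: "(\<lambda>k. norm (?c k)) summable_on UNIV" by (rule hs_abs_summable0[OF hs_s s32])
  have summ: "(\<lambda>k. norm (complex_of_real (norm (freq k) powr (2 * \<gamma>)) * ?p k)) summable_on UNIV"
  proof (rule summable_on_comparison_test[OF smooth_torus_summable[OF \<phi>]])
    fix k
    have "norm (freq k) powr (2 * \<gamma>) \<le> (jb k)\<^sup>2" by (rule freq_powr_le)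
    then show "norm (complex_of_real (norm (freq k) powr (2 * \<gamma>)) * ?p k) \<le> (jb k)\<^sup>2 * norm (?p k)"
      by (simp add: norm_mult mult_right_mono)
  qed simp
  note G = fourier_multiplier_spec[OF _ summ, folded frac_laplacian_def, simplified]
  have gi: "integrable torus (frac_laplacian \<gamma> \<phi>)" by (rule L2_torus_integrable[OF G(1)])
  have "complex_of_real (LINT x|torus. f x * frac_laplacian \<gamma> \<phi> x) = cnj (complex_of_real (LINT x|torus. frac_laplacian \<gamma> \<phi> x * f x))"
    by (simp add: mult.commute)
  also have "\<dots> = cnj ((2 * pi) ^ 3 * infsum (\<lambda>k. cnj (?c k) * fourier_coeff (frac_laplacian \<gamma> \<phi>) k) UNIV)"
    by (simp only: parseval(1)[OF gi fi fsum])
  also have "\<dots> = (2 * pi) ^ 3 * infsum (\<lambda>k. cnj (cnj (?c k) * fourier_coeff (frac_laplacian \<gamma> \<phi>) k)) UNIV"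
  proof -
    have "cnj ((2 * pi) ^ 3 * z) = (2 * pi) ^ 3 * cnj z" for z :: complex by simp
    then show ?thesis by (simp only: infsum_cnj)
  qed
  also have "\<dots> = (2 * pi) ^ 3 * infsum (\<lambda>k. cnj (?p k) * (complex_of_real (norm (freq k) powr (2 * \<gamma>)) * ?c k)) UNIV"
    by (simp add: G(2) mult_ac)
  finally show ?thesis .
qed

end

lemma AE_lebesgue_on_subset:
  assumes "AE t in lebesgue_on A. P t" "B \<subseteq> A" "A \<in> sets lebesgue" "B \<in> sets lebesgue"
  shows "AE t in lebesgue_on B. P t"
proof -
  have "AE t in lebesgue. t \<in> A \<longrightarrow> P t"
    using assms(1,3) by (subst (asm) AE_restrict_space_iff) auto
  then have "AE t in lebesgue. t \<in> B \<longrightarrow> P t"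
    by eventually_elim (use assms(2) in auto)
  then show ?thesis using assms(4) by (subst AE_restrict_space_iff) auto
qed

section \<open>Weak solutions as solutions of the mode equations\<close>

context mg_params
begin

definition regular :: "real \<Rightarrow> (real \<Rightarrow> real^3 \<Rightarrow> real) \<Rightarrow> bool" where
  "regular T \<Theta> \<longleftrightarrow> (\<forall>t\<in>{0<..<T}. \<Theta> t \<in> sobolev s) \<and>
     \<Theta> \<in> Linf_sobolev {0<..<T} s \<inter> L2_sobolev {0<..<T} (s + \<gamma>)"

lemma regularD:
  assumes "regular T \<Theta>"
  shows "(\<lambda>t. fourier_coeff (\<Theta> t) k) \<in> borel_measurable (TI T)"
    "t \<in> {0<..<T} \<Longrightarrow> \<Theta> t \<in> sobolev s"
    "t \<in> {0<..<T} \<Longrightarrow> hs s (fourier_coeff (\<Theta> t))"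
    "\<exists>R\<ge>0. AE t in TI T. hnorm s (fourier_coeff (\<Theta> t)) \<le> R"
    "AE t in TI T. \<Theta> t \<in> sobolev (s + \<gamma>)"
proof -
  show "(\<lambda>t. fourier_coeff (\<Theta> t) k) \<in> borel_measurable (TI T)"
    using assms s32 by (intro strongly_measurable_coeff[of _ s]) (auto simp: regular_def Linf_sobolev_def)
  show sob: "t \<in> {0<..<T} \<Longrightarrow> \<Theta> t \<in> sobolev s" for t using assms by (auto simp: regular_def)
  then show "t \<in> {0<..<T} \<Longrightarrow> hs s (fourier_coeff (\<Theta> t))" by (simp add: sobolev_iff)
  obtain C where "AE t in TI T. sobolev_norm s (\<Theta> t) \<le> C"
    using assms by (auto simp: regular_def Linf_sobolev_def)
  then have "AE t in TI T. hnorm s (fourier_coeff (\<Theta> t)) \<le> \<bar>C\<bar>"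
    by eventually_elim (simp add: sobolev_norm_eq)
  then show "\<exists>R\<ge>0. AE t in TI T. hnorm s (fourier_coeff (\<Theta> t)) \<le> R" by (intro exI[of _ "\<bar>C\<bar>"]) simp
  show "AE t in TI T. \<Theta> t \<in> sobolev (s + \<gamma>)"
    using assms by (auto simp: regular_def L2_sobolev_def strongly_measurable_def)
qed

lemma forcingD:
  assumes "S \<in> Linf_sobolev {0<..} (s - \<gamma>)"
  shows "(\<lambda>t. fourier_coeff (S t) k) \<in> borel_measurable (TI T)"
    "\<exists>C\<ge>0. AE t in TI T. S t \<in> sobolev (s - \<gamma>) \<and> hnorm (s - \<gamma>) (fourier_coeff (S t)) \<le> C"
proof -
  have "(\<lambda>t. fourier_coeff (S t) k) \<in> borel_measurable (lebesgue_on {0<..})"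
    using assms s32 \<gamma> by (intro strongly_measurable_coeff[of _ "s - \<gamma>"]) (auto simp: Linf_sobolev_def)
  then show "(\<lambda>t. fourier_coeff (S t) k) \<in> borel_measurable (TI T)"
    by (rule measurable_restrict_mono) auto
  obtain C where C: "AE t in lebesgue_on {0<..}. sobolev_norm (s - \<gamma>) (S t) \<le> C"
    and m: "AE t in lebesgue_on {0<..}. S t \<in> sobolev (s - \<gamma>)"
    using assms by (auto simp: Linf_sobolev_def strongly_measurable_def)
  have "AE t in lebesgue_on {0<..}. S t \<in> sobolev (s - \<gamma>) \<and> hnorm (s - \<gamma>) (fourier_coeff (S t)) \<le> \<bar>C\<bar>"
    using C m by eventually_elim (simp add: sobolev_norm_eq)
  then have "AE t in TI T. S t \<in> sobolev (s - \<gamma>) \<and> hnorm (s - \<gamma>) (fourier_coeff (S t)) \<le> \<bar>C\<bar>"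
    by (rule AE_lebesgue_on_subset) auto
  then show "\<exists>C\<ge>0. AE t in TI T. S t \<in> sobolev (s - \<gamma>) \<and> hnorm (s - \<gamma>) (fourier_coeff (S t)) \<le> C"
    by (intro exI[of _ "\<bar>C\<bar>"]) simp
qed

lemma N_measurable:
  assumes "\<And>k. (\<lambda>t. u t k) \<in> borel_measurable M" "\<And>k. (\<lambda>t. v t k) \<in> borel_measurable M"
  shows "(\<lambda>t. N (u t) (v t) k) \<in> borel_measurable M"
proof -
  note assms[measurable]
  show ?thesis
    unfolding Nl_def by (rule borel_measurable_infsum_complex) (simp add: Nl_term_def, measurable)
qed

definition KN :: real where "KN = 3 / \<Omega> * bil_const s r"

lemma KN_nonneg: "KN \<ge> 0"
  unfolding KN_def using pos bil_const_nonneg by simp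

lemma hnorm_N_le:
  assumes "hs s u" "hs s v"
  shows "hs (s - r) (N u v)" "hnorm (s - r) (N u v) \<le> KN * (hnorm s u * hnorm s v)"
  using Nl_estimate(4,5)[OF pos(1-3) r(1) r2 sr assms] by (auto simp: KN_def)

text \<open>A crude growth bound for single modes; the orders s, s - r and s - \<gamma> at which it
  is applied all lie above -2.\<close>

lemma hs_norm_le_jb2:
  assumes "hs q c" "q \<ge> -2"
  shows "norm (c k) \<le> hnorm q c * (jb k)\<^sup>2"
proof -
  have "norm (c k) \<le> jb k powr (- q) * hnorm q c" by (rule hs_bound[OF assms(1)])
  also have "\<dots> \<le> jb k powr 2 * hnorm q c"
    using assms(2) jb_ge_1 by (intro mult_right_mono powr_mono) auto
  finally show ?thesis by (simp add: mult.commute)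
qed

text \<open>The equation of the k-th mode integrated over (0,t), left side minus right side. The
  integrated form matches the weak formulation and contains the initial condition.\<close>

definition resid :: "(int^3 \<Rightarrow> complex) \<Rightarrow> (real \<Rightarrow> int^3 \<Rightarrow> complex) \<Rightarrow> (real \<Rightarrow> int^3 \<Rightarrow> complex) \<Rightarrow> real \<Rightarrow> int^3 \<Rightarrow> complex" where
  "resid c f u t k = u t k - c k + complex_of_real (\<mu> k) * (LINT \<tau>|TI t. u \<tau> k)
     + (LINT \<tau>|TI t. N (u \<tau>) (u \<tau>) k) - (LINT \<tau>|TI t. f \<tau> k)"

text \<open>Each term of the weak formulation is a sum over frequencies against the conjugated
  coefficients of \<open>\<phi>\<close>. The data term is expanded at the fixed time
  \<open>t\<close>; the other three are expanded at almost every earlier time and then integrated by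
  \<open>time_swap\<close>.\<close>

lemma weak_residual:
  assumes reg: "regular T \<Theta>" and \<Theta>0: "\<Theta>0 \<in> sobolev s" and S: "S \<in> Linf_sobolev {0<..} (s - \<gamma>)"
    and \<phi>: "\<phi> \<in> smooth_torus" and t: "t \<in> {0<..<T}"
  shows "complex_of_real ((LINT x|torus. (\<Theta> t x - \<Theta>0 x) * \<phi> x)
        + \<kappa> * (LINT \<tau>|TI t. LINT x|torus. \<Theta> \<tau> x * frac_laplacian \<gamma> \<phi> x)
        - (LINT \<tau>|TI t. LINT x|torus. \<Theta> \<tau> x * (mg_velocity \<Omega> \<beta> \<eta> (\<Theta> \<tau>) x \<bullet> gradient \<phi> x))
        - (LINT \<tau>|TI t. LINT x|torus. S \<tau> x * \<phi> x))
     = (2 * pi) ^ 3 * infsum (\<lambda>k. cnj (fourier_coeff \<phi> k)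
          * resid (fourier_coeff \<Theta>0) (\<lambda>t. fourier_coeff (S t)) (\<lambda>t. fourier_coeff (\<Theta> t)) t k) UNIV"
proof -
  have tT: "0 < t" "t \<le> T" using t by auto
  let ?V = "(2 * pi) ^ 3 :: complex"
  define p where "p = fourier_coeff \<phi>"
  define u where "u t = fourier_coeff (\<Theta> t)" for t
  define c where "c = fourier_coeff \<Theta>0"
  define f where "f t = fourier_coeff (S t)" for t
  have pj: "(\<lambda>k. (jb k)\<^sup>2 * norm (p k)) summable_on UNIV" unfolding p_def by (rule smooth_torus_summable[OF \<phi>])
  have ps: "(\<lambda>k. norm (p k)) summable_on UNIV" unfolding p_def by (rule smooth_torus_abs_summable[OF \<phi>])
  have \<phi>i: "integrable torus \<phi>" by (rule continuous_imp_integrable_torus[OF smooth_torusD(4)[OF \<phi>]])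
  obtain R where R: "R \<ge> 0" "AE t in TI T. hnorm s (u t) \<le> R" using regularD(4)[OF reg] by (auto simp: u_def)
  obtain CS where CS: "CS \<ge> 0" "AE \<tau> in TI t. S \<tau> \<in> sobolev (s - \<gamma>) \<and> hnorm (s - \<gamma>) (f \<tau>) \<le> CS"
    using forcingD(2)[OF S, of t] by (auto simp: f_def)
  have um: "(\<lambda>t. u t k) \<in> borel_measurable (TI t)" for k
    unfolding u_def by (rule measurable_TI[OF regularD(1)[OF reg] tT(2)])
  have fm: "(\<lambda>t. f t k) \<in> borel_measurable (TI t)" for k unfolding f_def by (rule forcingD(1)[OF S])
  have uR: "AE \<tau> in TI t. \<tau> \<in> {0<..<T} \<and> hnorm s (u \<tau>) \<le> R"
    using AE_TI[OF R(2) tT(2)] AE_space by eventually_elim (use tT in auto)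
  have usg: "AE \<tau> in TI t. \<Theta> \<tau> \<in> sobolev (s + \<gamma>)" by (rule AE_TI[OF regularD(5)[OF reg] tT(2)])
  have hsu: "hs s (u \<tau>)" if "\<tau> \<in> {0<..<T}" for \<tau> unfolding u_def by (rule regularD(3)[OF reg that])
  have s1: "((\<lambda>k. cnj (p k) * (u t k - c k)) has_sum infsum (\<lambda>k. cnj (p k) * (u t k - c k)) UNIV) UNIV"
    and e1: "complex_of_real (LINT x|torus. (\<Theta> t x - \<Theta>0 x) * \<phi> x) = ?V * infsum (\<lambda>k. cnj (p k) * (u t k - c k)) UNIV"
  proof -
    note d = sobolev_diff[OF regularD(2)[OF reg t] \<Theta>0]
    have "integrable torus (\<lambda>x. \<Theta> t x - \<Theta>0 x)"
      using d(1) by (intro L2_torus_integrable) (simp add: sobolev_iff)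
    note P = parseval[OF this \<phi>i ps[unfolded p_def]]
    show "((\<lambda>k. cnj (p k) * (u t k - c k)) has_sum infsum (\<lambda>k. cnj (p k) * (u t k - c k)) UNIV) UNIV"
      using abs_summable_summable[OF P(3)] unfolding d(2) p_def u_def c_def by (rule has_sum_infsum)
    show "complex_of_real (LINT x|torus. (\<Theta> t x - \<Theta>0 x) * \<phi> x) = ?V * infsum (\<lambda>k. cnj (p k) * (u t k - c k)) UNIV"
      using P(1) unfolding d(2) p_def u_def c_def .
  qed
  define a2 where "a2 k \<tau> = complex_of_real (norm (freq k) powr (2 * \<gamma>)) * u \<tau> k" for k \<tau>
  have a2m: "a2 k \<in> borel_measurable (TI t)" for k unfolding a2_def using um by measurable
  have a2b: "AE \<tau> in TI t. \<forall>k. norm (a2 k \<tau>) \<le> R * (jb k)\<^sup>2"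
    using uR
  proof eventually_elim
    case (elim \<tau>)
    show ?case
    proof
      fix k
      have "norm (u \<tau> k) \<le> jb k powr (- s) * hnorm s (u \<tau>)" using elim by (intro hs_bound hsu) auto
      also have "\<dots> \<le> 1 * R"
        using elim s32 jb_ge_1[of k] powr_mono[of "- s" 0 "jb k"] by (intro mult_mono) auto
      finally have "norm (freq k) powr (2 * \<gamma>) * norm (u \<tau> k) \<le> (jb k)\<^sup>2 * R"
        using freq_powr_le by (intro mult_mono) auto
      then show "norm (a2 k \<tau>) \<le> R * (jb k)\<^sup>2" by (simp add: a2_def norm_mult mult.commute)
    qed
  qed
  have a2h: "AE \<tau> in TI t. complex_of_real (LINT x|torus. \<Theta> \<tau> x * frac_laplacian \<gamma> \<phi> x) = ?V * infsum (\<lambda>k. cnj (p k) * a2 k \<tau>) UNIV"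
    using uR by eventually_elim (simp only: a2_def p_def u_def diffusion_term[OF regularD(2)[OF reg] \<phi>])
  note T2 = time_swap[OF tT(1) a2m a2b pj a2h]
  define a3 where "a3 k \<tau> = - N (u \<tau>) (u \<tau>) k" for k \<tau>
  have a3m: "a3 k \<in> borel_measurable (TI t)" for k unfolding a3_def using N_measurable[OF um um] by measurable
  have a3b: "AE \<tau> in TI t. \<forall>k. norm (a3 k \<tau>) \<le> (KN * (R * R)) * (jb k)\<^sup>2"
    using uR
  proof eventually_elim
    case (elim \<tau>)
    note H = hnorm_N_le[OF hsu hsu, of \<tau> \<tau>]
    show ?case
    proof
      fix k
      have "norm (a3 k \<tau>) \<le> hnorm (s - r) (N (u \<tau>) (u \<tau>)) * (jb k)\<^sup>2"
        unfolding a3_def norm_minus_cancel using H(1) elim s32 r2 by (intro hs_norm_le_jb2) auto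
      also have "\<dots> \<le> (KN * (R * R)) * (jb k)\<^sup>2"
      proof (rule mult_right_mono)
        have "hnorm (s - r) (N (u \<tau>) (u \<tau>)) \<le> KN * (hnorm s (u \<tau>) * hnorm s (u \<tau>))" using H(2) elim by auto
        also have "\<dots> \<le> KN * (R * R)" using elim KN_nonneg R(1) by (intro mult_left_mono mult_mono) auto
        finally show "hnorm (s - r) (N (u \<tau>) (u \<tau>)) \<le> KN * (R * R)" .
      qed simp
      finally show "norm (a3 k \<tau>) \<le> (KN * (R * R)) * (jb k)\<^sup>2" .
    qed
  qed
  \<comment> \<open>The expansion of the advection term uses a value of the solution in
    H^{s+\<gamma>}, which is available at almost every time only.\<close>
  have a3h: "AE \<tau> in TI t. complex_of_real (LINT x|torus. \<Theta> \<tau> x * (mg_velocity \<Omega> \<beta> \<eta> (\<Theta> \<tau>) x \<bullet> gradient \<phi> x)) = ?V * infsum (\<lambda>k. cnj (p k) * a3 k \<tau>) UNIV"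
    using usg by eventually_elim (simp only: a3_def p_def u_def nonlinear_term[OF _ \<phi>])
  note T3 = time_swap[OF tT(1) a3m a3b pj a3h]
  define a4 where "a4 k \<tau> = f \<tau> k" for k \<tau>
  have a4m: "a4 k \<in> borel_measurable (TI t)" for k unfolding a4_def by (rule fm)
  have a4b: "AE \<tau> in TI t. \<forall>k. norm (a4 k \<tau>) \<le> CS * (jb k)\<^sup>2"
    using CS(2)
  proof eventually_elim
    case (elim \<tau>)
    show ?case
    proof
      fix k
      have "norm (a4 k \<tau>) \<le> hnorm (s - \<gamma>) (f \<tau>) * (jb k)\<^sup>2"
        unfolding a4_def using elim s32 \<gamma> by (intro hs_norm_le_jb2) (auto simp: sobolev_iff f_def)
      also have "\<dots> \<le> CS * (jb k)\<^sup>2" using elim by (intro mult_right_mono) auto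
      finally show "norm (a4 k \<tau>) \<le> CS * (jb k)\<^sup>2" .
    qed
  qed
  have a4h: "AE \<tau> in TI t. complex_of_real (LINT x|torus. S \<tau> x * \<phi> x) = ?V * infsum (\<lambda>k. cnj (p k) * a4 k \<tau>) UNIV"
    using CS(2)
  proof eventually_elim
    case (elim \<tau>)
    then have "integrable torus (S \<tau>)" by (intro L2_torus_integrable) (simp add: sobolev_iff)
    from parseval(1)[OF this \<phi>i ps[unfolded p_def]] show ?case by (simp only: a4_def p_def f_def)
  qed
  note T4 = time_swap[OF tT(1) a4m a4b pj a4h]
  let ?S2 = "infsum (\<lambda>k. cnj (p k) * (LINT \<tau>|TI t. a2 k \<tau>)) UNIV"
  let ?S3 = "infsum (\<lambda>k. cnj (p k) * (LINT \<tau>|TI t. a3 k \<tau>)) UNIV"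
  let ?S4 = "infsum (\<lambda>k. cnj (p k) * (LINT \<tau>|TI t. a4 k \<tau>)) UNIV"
  let ?S1 = "infsum (\<lambda>k. cnj (p k) * (u t k - c k)) UNIV"
  note s2 = has_sum_infsum[OF abs_summable_summable[OF T2(2)]]
  note s3 = has_sum_infsum[OF abs_summable_summable[OF T3(2)]]
  note s4 = has_sum_infsum[OF abs_summable_summable[OF T4(2)]]
  have tot: "((\<lambda>k. cnj (p k) * (u t k - c k) + complex_of_real \<kappa> * (cnj (p k) * (LINT \<tau>|TI t. a2 k \<tau>))
      + - (cnj (p k) * (LINT \<tau>|TI t. a3 k \<tau>)) + - (cnj (p k) * (LINT \<tau>|TI t. a4 k \<tau>))) has_sum (?S1 + complex_of_real \<kappa> * ?S2 + - ?S3 + - ?S4)) UNIV"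
    by (intro has_sum_add has_sum_cmult_right has_sum_uminusI s1 s2 s3 s4)
  have r: "cnj (p k) * (u t k - c k) + complex_of_real \<kappa> * (cnj (p k) * (LINT \<tau>|TI t. a2 k \<tau>))
      + - (cnj (p k) * (LINT \<tau>|TI t. a3 k \<tau>)) + - (cnj (p k) * (LINT \<tau>|TI t. a4 k \<tau>)) = cnj (p k) * resid c f u t k" for k
  proof -
    have "(LINT \<tau>|TI t. a2 k \<tau>) = complex_of_real (norm (freq k) powr (2 * \<gamma>)) * (LINT \<tau>|TI t. u \<tau> k)"
      unfolding a2_def by (rule integral_mult_right_zero)
    moreover have "(LINT \<tau>|TI t. a3 k \<tau>) = - (LINT \<tau>|TI t. N (u \<tau>) (u \<tau>) k)"
      unfolding a3_def by simp
    ultimately show ?thesis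
      unfolding resid_def \<mu>_def a4_def by (simp add: algebra_simps)
  qed
  have "infsum (\<lambda>k. cnj (p k) * resid c f u t k) UNIV = ?S1 + complex_of_real \<kappa> * ?S2 + - ?S3 + - ?S4"
    using infsumI[OF tot] unfolding r .
  then show ?thesis
    unfolding p_def[symmetric] c_def[symmetric] f_def[symmetric, abs_def] u_def[symmetric, abs_def]
    by (simp only: of_real_add of_real_diff of_real_mult e1 T2(1) T3(1) T4(1)) (simp add: algebra_simps)
qed

text \<open>Real test functions see only the pair \<open>E k\<close>, \<open>E (- k)\<close>. The
  cosine yields the sum and the sine the difference of the two, so both vanish.\<close>

lemma trig_test_zero:
  assumes "\<And>\<phi>. \<phi> \<in> smooth_torus \<Longrightarrow> infsum (\<lambda>m. cnj (fourier_coeff \<phi> m) * E m) UNIV = 0"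
  shows "E k = 0"
proof -
  have *: "Complex (a/2) (b/2) * E k + Complex (a/2) (-b/2) * E (- k) = 0" for a b
  proof -
    let ?\<phi> = "\<lambda>x. a * cos (freq k \<bullet> x) + b * sin (freq k \<bullet> x)"
    have s1: "((\<lambda>m. if m = k then Complex (a/2) (b/2) * E k else 0) has_sum (Complex (a/2) (b/2) * E k)) UNIV"
      by (rule has_sum_finite_neutralI[of "{k}"]) auto
    have s2: "((\<lambda>m. if m = - k then Complex (a/2) (-b/2) * E (- k) else 0) has_sum (Complex (a/2) (-b/2) * E (- k))) UNIV"
      by (rule has_sum_finite_neutralI[of "{- k}"]) auto
    have eq: "cnj (fourier_coeff ?\<phi> m) * E m = (if m = k then Complex (a/2) (b/2) * E k else 0) + (if m = - k then Complex (a/2) (-b/2) * E (- k) else 0)" for m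
      unfolding fourier_coeff_trig complex_cnj_add distrib_right
      by (rule arg_cong2[where f = "(+)"]) (simp_all add: complex_cnj)
    have "infsum (\<lambda>m. cnj (fourier_coeff ?\<phi> m) * E m) UNIV = Complex (a/2) (b/2) * E k + Complex (a/2) (-b/2) * E (- k)"
      unfolding eq by (rule infsumI[OF has_sum_add[OF s1 s2]])
    then show ?thesis using assms[OF smooth_torus_trig, of a k b] by simp
  qed
  from *[of 1 0] *[of 0 1] show ?thesis
    by (simp add: complex_eq_iff)
qed

text \<open>The bridge between both formulations: existence goes from the modes to the weak form,
  uniqueness in the other direction.\<close>

lemma solution_iff_resid:
  assumes \<Theta>0: "\<Theta>0 \<in> sobolev s" and S: "S \<in> Linf_sobolev {0<..} (s - \<gamma>)"
  shows "mg_solution \<Omega> \<beta> \<eta> \<kappa> \<gamma> s \<Theta>0 S T \<Theta> \<longleftrightarrow> regular T \<Theta> \<and>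
    (\<forall>t\<in>{0<..<T}. \<forall>k. resid (fourier_coeff \<Theta>0) (\<lambda>t. fourier_coeff (S t)) (\<lambda>t. fourier_coeff (\<Theta> t)) t k = 0)"
proof -
  let ?W = "\<lambda>\<phi> t. (LINT x|torus. (\<Theta> t x - \<Theta>0 x) * \<phi> x)
        + \<kappa> * (LINT \<tau>|TI t. LINT x|torus. \<Theta> \<tau> x * frac_laplacian \<gamma> \<phi> x)
        - (LINT \<tau>|TI t. LINT x|torus. \<Theta> \<tau> x * (mg_velocity \<Omega> \<beta> \<eta> (\<Theta> \<tau>) x \<bullet> gradient \<phi> x))
        - (LINT \<tau>|TI t. LINT x|torus. S \<tau> x * \<phi> x)"
  let ?E = "resid (fourier_coeff \<Theta>0) (\<lambda>t. fourier_coeff (S t)) (\<lambda>t. fourier_coeff (\<Theta> t))"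
  have "mg_solution \<Omega> \<beta> \<eta> \<kappa> \<gamma> s \<Theta>0 S T \<Theta> \<longleftrightarrow> regular T \<Theta> \<and> (\<forall>\<phi>\<in>smooth_torus. \<forall>t\<in>{0<..<T}. ?W \<phi> t = 0)"
    unfolding mg_solution_def regular_def by (simp only: conj_assoc right_minus_eq)
  moreover have "(\<forall>\<phi>\<in>smooth_torus. \<forall>t\<in>{0<..<T}. ?W \<phi> t = 0) \<longleftrightarrow> (\<forall>t\<in>{0<..<T}. \<forall>k. ?E t k = 0)" if reg: "regular T \<Theta>"
  proof -
    have W: "complex_of_real (?W \<phi> t) = (2 * pi) ^ 3 * infsum (\<lambda>k. cnj (fourier_coeff \<phi> k) * ?E t k) UNIV"
      if "\<phi> \<in> smooth_torus" "t \<in> {0<..<T}" for \<phi> t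
      by (rule weak_residual[OF reg \<Theta>0 S that])
    have Z: "?W \<phi> t = 0 \<longleftrightarrow> infsum (\<lambda>k. cnj (fourier_coeff \<phi> k) * ?E t k) UNIV = 0"
      if "\<phi> \<in> smooth_torus" "t \<in> {0<..<T}" for \<phi> t
    proof -
      have "?W \<phi> t = 0 \<longleftrightarrow> complex_of_real (?W \<phi> t) = 0" by (simp only: of_real_eq_0_iff)
      then show ?thesis unfolding W[OF that] by simp
    qed
    show ?thesis
    proof
      assume L: "\<forall>\<phi>\<in>smooth_torus. \<forall>t\<in>{0<..<T}. ?W \<phi> t = 0"
      show "\<forall>t\<in>{0<..<T}. \<forall>k. ?E t k = 0"
      proof (intro ballI allI)
        fix t k assume t: "t \<in> {0<..<T}"
        show "?E t k = 0"
          by (rule trig_test_zero) (use L t Z[OF _ t] in blast)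
      qed
    next
      assume L: "\<forall>t\<in>{0<..<T}. \<forall>k. ?E t k = 0"
      show "\<forall>\<phi>\<in>smooth_torus. \<forall>t\<in>{0<..<T}. ?W \<phi> t = 0"
      proof (intro ballI)
        fix \<phi> t assume \<phi>: "\<phi> \<in> smooth_torus" and t: "t \<in> {0<..<T}"
        have "infsum (\<lambda>k. cnj (fourier_coeff \<phi> k) * ?E t k) UNIV = 0"
          using L t by simp
        then show "?W \<phi> t = 0" using Z[OF \<phi> t] by blast
      qed
    qed
  qed
  ultimately show ?thesis by blast
qed

end

section \<open>Uniqueness\<close>

context mg_params
begin

text \<open>Since r < 2 \<gamma>, the loss is a power \<theta> = r / (2 \<gamma>) < 1 of the full
  diffusive gain, hence below any small multiple of the damping at high frequencies;
  \<open>l\<close> covers the low frequencies and the undamped zero mode.\<close>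

lemma damping_dominates:
  assumes "\<delta> > 0"
  obtains l where "l > 0" "\<And>k. jb k powr r \<le> \<delta> * (\<mu> k + l)"
proof -
  define \<delta>' where "\<delta>' = \<delta> / C\<kappa>"
  have \<delta>': "\<delta>' > 0" using assms C\<kappa>_ge_1 by (simp add: \<delta>'_def)
  define \<theta> where "\<theta> = r / (2 * \<gamma>)"
  have \<theta>: "0 \<le> \<theta>" "\<theta> < 1" using r \<gamma> by (auto simp: \<theta>_def)
  \<comment> \<open>\<open>Y\<close> is the point where y^(\<theta>-1) equals
    \<open>\<delta>'\<close>: beyond it the power lies below the line \<open>\<delta>' * y\<close>,
    before it the power is at most its value at \<open>Y\<close>.\<close>
  define Y where "Y = (1 / \<delta>') powr (1 / (1 - \<theta>))"
  have split: "y powr \<theta> \<le> \<delta>' * y + Y powr \<theta>" if y: "1 \<le> y" for y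
  proof (cases "y \<le> Y")
    case True
    then have "y powr \<theta> \<le> Y powr \<theta>" using y \<theta> by (intro powr_mono2) auto
    then show ?thesis using y \<delta>' by (simp add: add_increasing)
  next
    case False
    have "Y powr (\<theta> - 1) = \<delta>'"
    proof -
      have "Y powr (\<theta> - 1) = (1 / \<delta>') powr (1 / (1 - \<theta>) * (\<theta> - 1))"
        unfolding Y_def by (simp add: powr_powr)
      also have "1 / (1 - \<theta>) * (\<theta> - 1) = - 1" using \<theta> by (simp add: field_simps)
      also have "(1 / \<delta>') powr (- 1) = \<delta>'" using \<delta>' by (simp add: powr_minus)
      finally show ?thesis .
    qed
    moreover have "y powr (\<theta> - 1) \<le> Y powr (\<theta> - 1)"
      using False \<theta> \<delta>' by (intro powr_mono2') (auto simp: Y_def)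
    ultimately have "y powr (\<theta> - 1) * y \<le> \<delta>' * y" using y by (intro mult_right_mono) auto
    moreover have "y powr (\<theta> - 1) * y = y powr \<theta>" using y by (simp add: powr_diff)
    ultimately show ?thesis by (simp add: add_increasing2)
  qed
  have dom: "jb k powr (2 * \<gamma>) \<le> C\<kappa> * (\<mu> k + 1)" for k
  proof (cases "k = 0")
    case True
    then have "jb k = 1" by (simp add: jb_def)
    then show ?thesis using C\<kappa>_ge_1 \<mu>_nonneg[of k] mult_mono[of 1 C\<kappa> 1 "\<mu> k + 1"] by simp
  next
    case False
    have "jb k powr (2 * \<gamma>) \<le> 2 * norm (freq k) powr (2 * \<gamma>)" by (rule jb_powr_le[OF False])
    also have "\<dots> = (2 / \<kappa>) * \<mu> k" using pos by (simp add: \<mu>_def)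
    also have "\<dots> \<le> C\<kappa> * (\<mu> k + 1)" using \<mu>_nonneg[of k] C\<kappa>_ge_1 by (intro mult_mono) (auto simp: C\<kappa>_def)
    finally show ?thesis .
  qed
  show thesis
  proof (rule that[of "1 + Y powr \<theta> / \<delta>"])
    show "1 + Y powr \<theta> / \<delta> > 0" using assms by (simp add: add_pos_nonneg)
    fix k
    have "jb k powr r = (jb k powr (2 * \<gamma>)) powr \<theta>" using \<gamma> by (simp add: powr_powr \<theta>_def)
    also have "\<dots> \<le> \<delta>' * jb k powr (2 * \<gamma>) + Y powr \<theta>"
      using jb_ge_1 \<gamma> by (intro split ge_one_powr_ge_zero) auto
    also have "\<dots> \<le> \<delta>' * (C\<kappa> * (\<mu> k + 1)) + Y powr \<theta>"
      using dom[of k] \<delta>' by (intro add_right_mono mult_left_mono) auto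
    also have "\<dots> = \<delta> * (\<mu> k + (1 + Y powr \<theta> / \<delta>))"
      using assms C\<kappa>_ge_1 by (simp add: \<delta>'_def field_simps)
    finally show "jb k powr r \<le> \<delta> * (\<mu> k + (1 + Y powr \<theta> / \<delta>))" .
  qed
qed

text \<open>The exponential weight turns the damping \<open>m\<close> into \<open>m + l\<close>,
  which is how a large \<open>l\<close> produces smallness on any time interval.\<close>

lemma duh_exp_weight:
  "exp (- (l * t)) *\<^sub>R duh m f t = duh (m + l) (\<lambda>\<sigma>. exp (- (l * \<sigma>)) *\<^sub>R f \<sigma>) t"
proof -
  have "exp ((m + l) * \<sigma>) *\<^sub>R exp (- (l * \<sigma>)) *\<^sub>R f \<sigma> = exp (m * \<sigma>) *\<^sub>R f \<sigma>" for \<sigma>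
    by (simp add: exp_add[symmetric] algebra_simps)
  then show ?thesis
    by (simp add: duh_eq exp_add[symmetric] algebra_simps)
qed

lemma hsum_scale: "a \<ge> 0 \<Longrightarrow> hsum q (\<lambda>k. a *\<^sub>R c k) = ennreal (a\<^sup>2) * hsum q c"
  unfolding hsum_def
  by (simp add: nn_integral_cmult[symmetric] ennreal_mult'[symmetric] power_mult_distrib mult_ac)

lemma hsum_le_hnorm: "hs q c \<Longrightarrow> hs q' d \<Longrightarrow> hnorm q c \<le> M * hnorm q' d \<Longrightarrow> M \<ge> 0 \<Longrightarrow> hsum q c \<le> ennreal (M\<^sup>2) * hsum q' d"
proof -
  assume a: "hs q c" "hs q' d" "hnorm q c \<le> M * hnorm q' d" "M \<ge> 0"
  have "(hnorm q c)\<^sup>2 \<le> (M * hnorm q' d)\<^sup>2" using a by (intro power_mono) auto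
  then show ?thesis using a by (simp add: hsum_eq ennreal_mult'[symmetric] power_mult_distrib ennreal_leI)
qed

text \<open>In the norm of \<open>L\<^sup>2(0,T;H\<^sup>s)\<close> with weight \<open>exp (- l t)\<close> the difference of two solutions is bounded by
  half of itself once \<open>l\<close> is large, because the nonlinearity loses only \<open>r < 2\<gamma>\<close> derivatives.\<close>

lemma resid_unique:
  fixes u v :: "real \<Rightarrow> int^3 \<Rightarrow> complex"
  assumes T: "0 < T"
    and um: "\<And>k. (\<lambda>t. u t k) \<in> borel_measurable (TI T)" and vm: "\<And>k. (\<lambda>t. v t k) \<in> borel_measurable (TI T)"
    and hu: "\<And>t. t \<in> {0<..<T} \<Longrightarrow> hs s (u t)" and hv: "\<And>t. t \<in> {0<..<T} \<Longrightarrow> hs s (v t)"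
    and uR: "AE t in TI T. hnorm s (u t) \<le> R" and vR: "AE t in TI T. hnorm s (v t) \<le> R" and R: "R \<ge> 0"
    and ru: "\<And>t k. t \<in> {0<..<T} \<Longrightarrow> resid c f u t k = 0" and rv: "\<And>t k. t \<in> {0<..<T} \<Longrightarrow> resid c f v t k = 0"
    and t: "t \<in> {0<..<T}"
  shows "u t k = v t k"
proof -
  interpret finite_measure "TI T" by (rule finite_measure_TI)
  define d where "d t k = u t k - v t k" for t k
  define G where "G t k = N (u t) (u t) k - N (v t) (v t) k" for t k
  have dm: "(\<lambda>t. d t k) \<in> borel_measurable (TI T)" for k unfolding d_def using um vm by measurable
  have Num: "(\<lambda>t. N (u t) (u t) k) \<in> borel_measurable (TI T)" and Nvm: "(\<lambda>t. N (v t) (v t) k) \<in> borel_measurable (TI T)" for k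
    by (intro N_measurable um vm)+
  have Gm: "(\<lambda>t. G t k) \<in> borel_measurable (TI T)" for k unfolding G_def using Num Nvm by measurable
  have hd: "hs s (d t)" "hnorm s (d t) \<le> hnorm s (u t) + hnorm s (v t)" if "t \<in> {0<..<T}" for t
    unfolding d_def[abs_def] using hs_diff[OF hu[OF that] hv[OF that]] by auto
  have uvR: "AE t in TI T. t \<in> {0<..<T} \<and> hnorm s (u t) \<le> R \<and> hnorm s (v t) \<le> R"
    using uR vR AE_space by eventually_elim auto
  have N_bd: "norm (N w w k) \<le> (KN * (R * R)) * (jb k)\<^sup>2" if "hs s w" "hnorm s w \<le> R" for w k
  proof -
    note H = hnorm_N_le[OF that(1) that(1)]
    have "norm (N w w k) \<le> hnorm (s - r) (N w w) * (jb k)\<^sup>2"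
      using H(1) s32 r2 by (intro hs_norm_le_jb2) auto
    also have "\<dots> \<le> (KN * (R * R)) * (jb k)\<^sup>2"
      using that(2) KN_nonneg R by (intro mult_right_mono order_trans[OF H(2)] mult_left_mono mult_mono) auto
    finally show ?thesis .
  qed
  have w_bd: "norm (w k) \<le> R * (jb k)\<^sup>2" if "hs s w" "hnorm s w \<le> R" for w :: "int^3 \<Rightarrow> complex" and k
    using s32 that by (intro order_trans[OF hs_norm_le_jb2[OF that(1)] mult_right_mono]) auto
  have ub: "AE t in TI T. norm (u t k) \<le> R * (jb k)\<^sup>2" for k
    using uvR by eventually_elim (blast intro: w_bd hu)
  have vb: "AE t in TI T. norm (v t k) \<le> R * (jb k)\<^sup>2" for k
    using uvR by eventually_elim (blast intro: w_bd hv)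
  have Nub: "AE t in TI T. norm (N (u t) (u t) k) \<le> (KN * (R * R)) * (jb k)\<^sup>2" for k
    using uvR by eventually_elim (blast intro: N_bd hu)
  have Nvb: "AE t in TI T. norm (N (v t) (v t) k) \<le> (KN * (R * R)) * (jb k)\<^sup>2" for k
    using uvR by eventually_elim (blast intro: N_bd hv)
  note iu = integrable_const_bound[OF ub um] and iv = integrable_const_bound[OF vb vm]
  note iNu = integrable_const_bound[OF Nub Num] and iNv = integrable_const_bound[OF Nvb Nvm]
  have iG: "integrable (TI T) (\<lambda>t. G t k)" and id: "integrable (TI T) (\<lambda>t. d t k)" for k
    unfolding G_def d_def using iu iv iNu iNv by auto
  have d_eq: "d t k = 0 + (LINT \<tau>|TI t. - G \<tau> k) - \<mu> k *\<^sub>R (LINT \<tau>|TI t. d \<tau> k)" if t: "t \<in> {0<..<T}" for t k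
  proof -
    have tT: "t \<le> T" using t by simp
    have a1: "(LINT \<tau>|TI t. - G \<tau> k) = - ((LINT \<tau>|TI t. N (u \<tau>) (u \<tau>) k) - (LINT \<tau>|TI t. N (v \<tau>) (v \<tau>) k))"
      unfolding G_def using integrable_TI[OF iNu tT] integrable_TI[OF iNv tT] by simp
    have a2: "(LINT \<tau>|TI t. d \<tau> k) = (LINT \<tau>|TI t. u \<tau> k) - (LINT \<tau>|TI t. v \<tau> k)"
      unfolding d_def using integrable_TI[OF iu tT] integrable_TI[OF iv tT] by simp
    have "resid c f u t k - resid c f v t k = 0" using ru[OF t] rv[OF t] by simp
    then have a3: "u t k - v t k = - complex_of_real (\<mu> k) * ((LINT \<tau>|TI t. u \<tau> k) - (LINT \<tau>|TI t. v \<tau> k))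
        - ((LINT \<tau>|TI t. N (u \<tau>) (u \<tau>) k) - (LINT \<tau>|TI t. N (v \<tau>) (v \<tau>) k))"
      unfolding resid_def by (simp add: algebra_simps)
    have "d t k = u t k - v t k" by (simp add: d_def)
    then show ?thesis
      unfolding a1 a2 a3 by (simp add: scaleR_conv_of_real)
  qed
  \<comment> \<open>The difference has initial value 0 and forcing \<open>- G\<close>, so each of
    its modes is a pure Duhamel integral.\<close>
  have d_duh: "d t k = duh (\<mu> k) (\<lambda>\<tau>. - G \<tau> k) t" if "t \<in> {0<..<T}" for t k
    using integral_eq_duhamel[OF integrable_minus[OF iG] id d_eq that, of k] by simp
  define M where "M = 2 * KN * R"
  have M0: "M \<ge> 0" unfolding M_def using KN_nonneg R by simp
  have G_est: "hs (s - r) (G t)" "hnorm (s - r) (G t) \<le> M * hnorm s (d t)"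
    if t: "t \<in> {0<..<T}" and b: "hnorm s (u t) \<le> R" "hnorm s (v t) \<le> R" for t
  proof -
    have G: "G t = (\<lambda>k. N (u t) (d t) k + N (d t) (v t) k)"
      unfolding G_def d_def
      by (rule ext) (rule Nl_diff[OF pos(1-3) r(1) r2 sr hu[OF t] hv[OF t] hu[OF t] hv[OF t]])
    note H1 = hnorm_N_le[OF hu[OF t] hd(1)[OF t]] and H2 = hnorm_N_le[OF hd(1)[OF t] hv[OF t]]
    show "hs (s - r) (G t)" unfolding G by (rule hs_add(1)[OF H1(1) H2(1)])
    have "hnorm (s - r) (G t) \<le> KN * (hnorm s (u t) * hnorm s (d t)) + KN * (hnorm s (d t) * hnorm s (v t))"
      unfolding G using hs_add(2)[OF H1(1) H2(1)] H1(2) H2(2) by simp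
    also have "\<dots> \<le> KN * (R * hnorm s (d t)) + KN * (hnorm s (d t) * R)"
      using b KN_nonneg by (intro add_mono mult_left_mono mult_right_mono) auto
    finally show "hnorm (s - r) (G t) \<le> M * hnorm s (d t)" by (simp add: M_def algebra_simps)
  qed
  \<comment> \<open>The choice makes \<delta> M \<le> 1/2, so that the squared weighted norm of the
    difference is at most a quarter of itself; the added 1 covers M = 0.\<close>
  define \<delta> where "\<delta> = 1 / (2 * (M + 1))"
  have \<delta>0: "\<delta> > 0" unfolding \<delta>_def using M0 by simp
  have \<delta>M: "\<delta> * M \<le> 1 / 2" unfolding \<delta>_def using M0 by (simp add: field_simps)
  obtain l where l: "l > 0" "\<And>k. jb k powr r \<le> \<delta> * (\<mu> k + l)" using damping_dominates[OF \<delta>0] by blast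
  define D where "D t k = exp (- (l * t)) *\<^sub>R d t k" for t k
  define H where "H t k = exp (- (l * t)) *\<^sub>R G t k" for t k
  have Dm: "(\<lambda>t. D t k) \<in> borel_measurable (TI T)" and Hm: "(\<lambda>t. H t k) \<in> borel_measurable (TI T)" for k
    unfolding D_def H_def using dm Gm by measurable
  have mode: "(\<integral>\<^sup>+t. ennreal ((norm (D t k))\<^sup>2) \<partial>TI T) \<le> ennreal ((1 / (\<mu> k + l))\<^sup>2) * (\<integral>\<^sup>+t. ennreal ((norm (H t k))\<^sup>2) \<partial>TI T)" for k
  proof -
    have n: "\<mu> k + l > 0" using \<mu>_nonneg[of k] l(1) by linarith
    have Gb: "AE t in TI T. norm (G t k) \<le> 2 * ((KN * (R * R)) * (jb k)\<^sup>2)"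
      using uvR
    proof eventually_elim
      case (elim t)
      then show ?case
        using norm_triangle_ineq4[of "N (u t) (u t) k" "N (v t) (v t) k"] N_bd[OF hu, of t k] N_bd[OF hv, of t k]
        by (simp add: G_def)
    qed
    have H2: "integrable (TI T) (\<lambda>t. (norm (- H t k))\<^sup>2)"
    proof (rule integrable_const_bound[where B = "(2 * ((KN * (R * R)) * (jb k)\<^sup>2))\<^sup>2"])
      show "AE t in TI T. norm ((norm (- H t k))\<^sup>2) \<le> (2 * ((KN * (R * R)) * (jb k)\<^sup>2))\<^sup>2"
        using Gb AE_space
      proof eventually_elim
        case (elim t)
        then have "exp (- (l * t)) * norm (G t k) \<le> 1 * (2 * ((KN * (R * R)) * (jb k)\<^sup>2))"
          using l(1) by (intro mult_mono) auto
        then have "(norm (- H t k))\<^sup>2 \<le> (2 * ((KN * (R * R)) * (jb k)\<^sup>2))\<^sup>2"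
          by (intro power_mono) (auto simp: H_def)
        then show ?case by simp
      qed
      show "(\<lambda>t. (norm (- H t k))\<^sup>2) \<in> borel_measurable (TI T)" using Hm by measurable
    qed
    have Dd: "D t k = duh (\<mu> k + l) (\<lambda>\<tau>. - H \<tau> k) t" if "t \<in> {0<..<T}" for t
      unfolding D_def d_duh[OF that] H_def using duh_exp_weight[of l t "\<mu> k" "\<lambda>\<tau>. - G \<tau> k"] by simp
    have Hm': "(\<lambda>t. - H t k) \<in> borel_measurable (TI T)" using Hm by measurable
    note E = duh_L2_estimate[OF Hm' H2 less_imp_le[OF n] T, of "1 / (\<mu> k + l)"]
    have "(\<integral>\<^sup>+t. ennreal ((norm (D t k))\<^sup>2) \<partial>TI T) = (\<integral>\<^sup>+t. ennreal ((norm (duh (\<mu> k + l) (\<lambda>\<tau>. - H \<tau> k) t))\<^sup>2) \<partial>TI T)"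
      by (intro nn_integral_cong) (simp add: Dd)
    also have "\<dots> = ennreal (LINT t|TI T. (norm (duh (\<mu> k + l) (\<lambda>\<tau>. - H \<tau> k) t))\<^sup>2)"
      using E(2) n by (intro nn_integral_eq_integral) auto
    also have "\<dots> \<le> ennreal ((1 / (\<mu> k + l))\<^sup>2 * (LINT t|TI T. (norm (- H t k))\<^sup>2))"
      using E(3) n by (intro ennreal_leI) auto
    also have "\<dots> = ennreal ((1 / (\<mu> k + l))\<^sup>2) * ennreal (LINT t|TI T. (norm (- H t k))\<^sup>2)"
      by (rule ennreal_mult') simp
    also have "ennreal (LINT t|TI T. (norm (- H t k))\<^sup>2) = (\<integral>\<^sup>+t. ennreal ((norm (- H t k))\<^sup>2) \<partial>TI T)"
      by (rule nn_integral_eq_integral[symmetric, OF H2]) simp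
    finally show ?thesis by simp
  qed
  define X where "X = (\<integral>\<^sup>+t. hsum s (D t) \<partial>TI T)"
  have "X = nsum (\<lambda>k. ennreal (jb k powr (2 * s)) * (\<integral>\<^sup>+t. ennreal ((norm (D t k))\<^sup>2) \<partial>TI T))"
    unfolding X_def by (rule nn_integral_hsum[OF sigma_finite_TI Dm])
  also have "\<dots> \<le> nsum (\<lambda>k. ennreal (\<delta>\<^sup>2) * (ennreal (jb k powr (2 * (s - r))) * (\<integral>\<^sup>+t. ennreal ((norm (H t k))\<^sup>2) \<partial>TI T)))"
  proof (rule nn_integral_mono)
    fix k
    have n: "\<mu> k + l > 0" using \<mu>_nonneg[of k] l(1) by linarith
    \<comment> \<open>The \<open>r\<close> derivatives lost by the nonlinearity are bought back by
      the damping here: the powers s - r and r recombine to s.\<close>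
    have "jb k powr r / (\<mu> k + l) \<le> \<delta>" using l(2)[of k] n by (simp add: pos_divide_le_eq)
    then have "(jb k powr (s - r) * (jb k powr r / (\<mu> k + l)))\<^sup>2 \<le> (jb k powr (s - r) * \<delta>)\<^sup>2"
      using n by (intro power_mono mult_left_mono) auto
    moreover have "jb k powr (s - r) * (jb k powr r / (\<mu> k + l)) = jb k powr s * (1 / (\<mu> k + l))"
      by (simp add: powr_add[symmetric])
    ultimately have w: "jb k powr (2 * s) * (1 / (\<mu> k + l))\<^sup>2 \<le> \<delta>\<^sup>2 * jb k powr (2 * (s - r))"
      by (simp only: power_mult_distrib jb_powr_sq mult.commute)
    have "ennreal (jb k powr (2 * s)) * (\<integral>\<^sup>+t. ennreal ((norm (D t k))\<^sup>2) \<partial>TI T)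
      \<le> ennreal (jb k powr (2 * s)) * (ennreal ((1 / (\<mu> k + l))\<^sup>2) * (\<integral>\<^sup>+t. ennreal ((norm (H t k))\<^sup>2) \<partial>TI T))"
      by (intro mult_left_mono mode) simp
    also have "\<dots> = ennreal (jb k powr (2 * s) * (1 / (\<mu> k + l))\<^sup>2) * (\<integral>\<^sup>+t. ennreal ((norm (H t k))\<^sup>2) \<partial>TI T)"
      by (simp only: ennreal_mult'[OF powr_ge_zero] mult.assoc)
    also have "\<dots> \<le> ennreal (\<delta>\<^sup>2 * jb k powr (2 * (s - r))) * (\<integral>\<^sup>+t. ennreal ((norm (H t k))\<^sup>2) \<partial>TI T)"
      by (intro mult_right_mono ennreal_leI w) simp
    also have "\<dots> = ennreal (\<delta>\<^sup>2) * (ennreal (jb k powr (2 * (s - r))) * (\<integral>\<^sup>+t. ennreal ((norm (H t k))\<^sup>2) \<partial>TI T))"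
      by (simp only: ennreal_mult'[OF zero_le_power2] mult.assoc)
    finally show "ennreal (jb k powr (2 * s)) * (\<integral>\<^sup>+t. ennreal ((norm (D t k))\<^sup>2) \<partial>TI T)
      \<le> ennreal (\<delta>\<^sup>2) * (ennreal (jb k powr (2 * (s - r))) * (\<integral>\<^sup>+t. ennreal ((norm (H t k))\<^sup>2) \<partial>TI T))" .
  qed
  also have "\<dots> = ennreal (\<delta>\<^sup>2) * (\<integral>\<^sup>+t. hsum (s - r) (H t) \<partial>TI T)"
    unfolding nn_integral_hsum[OF sigma_finite_TI Hm] by (rule nn_integral_cmult) simp
  also have "\<dots> \<le> ennreal (\<delta>\<^sup>2) * (\<integral>\<^sup>+t. ennreal (M\<^sup>2) * hsum s (D t) \<partial>TI T)"
  proof (intro mult_left_mono nn_integral_mono_AE)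
    show "AE t in TI T. hsum (s - r) (H t) \<le> ennreal (M\<^sup>2) * hsum s (D t)"
      using uvR
    proof eventually_elim
      case (elim t)
      have "hsum (s - r) (G t) \<le> ennreal (M\<^sup>2) * hsum s (d t)"
        using elim by (intro hsum_le_hnorm G_est hd M0) auto
      then have "ennreal ((exp (- (l * t)))\<^sup>2) * hsum (s - r) (G t) \<le> ennreal ((exp (- (l * t)))\<^sup>2) * (ennreal (M\<^sup>2) * hsum s (d t))"
        by (rule mult_left_mono) simp
      then show ?case
        unfolding H_def[abs_def] D_def[abs_def] by (simp add: hsum_scale mult_ac)
    qed
  qed simp
  also have "\<dots> = ennreal (\<delta>\<^sup>2) * (ennreal (M\<^sup>2) * X)"
    unfolding X_def by (subst nn_integral_cmult) (auto intro: borel_measurable_hsum Dm)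
  also have "\<dots> = ennreal ((\<delta> * M)\<^sup>2) * X"
    by (simp add: ennreal_mult'[symmetric] mult.assoc[symmetric] power_mult_distrib)
  also have "\<dots> \<le> ennreal (1 / 4) * X"
  proof (intro mult_right_mono ennreal_leI)
    have "(\<delta> * M)\<^sup>2 \<le> (1 / 2)\<^sup>2" using \<delta>M \<delta>0 M0 by (intro power_mono) auto
    then show "(\<delta> * M)\<^sup>2 \<le> 1 / 4" by (simp add: power2_eq_square)
  qed simp
  finally have X_le: "X \<le> ennreal (1 / 4) * X" .
  \<comment> \<open>Finiteness has to be known before X \<le> X/4 can force X = 0; the bound
    \<open>R\<close> on both solutions supplies it.\<close>
  have "X \<le> (\<integral>\<^sup>+t. ennreal ((2 * R)\<^sup>2) \<partial>TI T)"
    unfolding X_def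
  proof (rule nn_integral_mono_AE)
    show "AE t in TI T. hsum s (D t) \<le> ennreal ((2 * R)\<^sup>2)"
      using uvR
    proof eventually_elim
      case (elim t)
      have "hnorm s (d t) \<le> 2 * R" using hd(2)[of t] elim by auto
      then have "(hnorm s (d t))\<^sup>2 \<le> (2 * R)\<^sup>2" by (intro power_mono) auto
      then have h: "hsum s (d t) \<le> ennreal ((2 * R)\<^sup>2)" using hd(1)[of t] elim by (simp add: hsum_eq ennreal_leI)
      have "(exp (- (l * t)))\<^sup>2 \<le> 1" using elim l(1) by (intro power_le_one) auto
      then have "ennreal ((exp (- (l * t)))\<^sup>2) * hsum s (d t) \<le> 1 * ennreal ((2 * R)\<^sup>2)"
        by (intro mult_mono h) auto
      then show ?case unfolding D_def[abs_def] by (simp add: hsum_scale)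
    qed
  qed
  also have "\<dots> < \<infinity>" using emeasure_finite by (simp add: ennreal_mult_less_top top.not_eq_extremum[symmetric] ennreal_mult_eq_top_iff)
  finally have X_fin: "X < \<infinity>" .
  have "X = 0"
  proof -
    obtain y where y: "X = ennreal y" "y \<ge> 0" using X_fin by (cases X) auto
    have "ennreal y \<le> ennreal (1 / 4 * y)" using X_le y by (simp only: ennreal_mult'' y)
    then have "y \<le> 1 / 4 * y" using y(2) by (subst (asm) ennreal_le_iff) auto
    then show ?thesis using y by simp
  qed
  then have "AE t in TI T. hsum s (D t) = 0"
    unfolding X_def using nn_integral_0_iff_AE[OF borel_measurable_hsum[OF Dm]] by simp
  then have d0: "AE t in TI T. \<forall>k. d t k = 0"
  proof eventually_elim
    case (elim t)
    then have "AE k in count_space UNIV. ennreal (jb k powr (2 * s) * (norm (D t k))\<^sup>2) = 0"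
      unfolding hsum_def by (subst (asm) nn_integral_0_iff_AE) auto
    then have "\<forall>k. ennreal (jb k powr (2 * s) * (norm (D t k))\<^sup>2) = 0" by (simp add: AE_count_space)
    then show ?case by (auto simp: D_def ennreal_eq_0_iff mult_le_0_iff)
  qed
  have tT: "t \<le> T" using t by simp
  \<comment> \<open>From almost every time to every time: the integrated equation
    \<open>d_eq\<close> expresses the difference at \<open>t\<close> by integrals, which ignore null
    sets.\<close>
  have d0t: "AE \<tau> in TI t. \<forall>k. d \<tau> k = 0" by (rule AE_TI[OF d0 tT])
  have "(LINT \<tau>|TI t. d \<tau> k) = (LINT \<tau>|TI t. 0)"
    using d0t measurable_TI[OF dm tT] by (intro integral_cong_AE) (auto elim: eventually_mono)
  moreover have "(LINT \<tau>|TI t. - G \<tau> k) = (LINT \<tau>|TI t. 0)"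
  proof (rule integral_cong_AE)
    show "(\<lambda>\<tau>. - G \<tau> k) \<in> borel_measurable (TI t)" using measurable_TI[OF Gm tT] by measurable
    show "AE \<tau> in TI t. - G \<tau> k = 0"
      using d0t
    proof eventually_elim
      case (elim \<tau>)
      then have "u \<tau> = v \<tau>" by (simp add: d_def fun_eq_iff)
      then show ?case by (simp add: G_def)
    qed
  qed simp
  ultimately have "d t k = 0" using d_eq[OF t, of k] by simp
  then show ?thesis by (simp add: d_def)
qed

section \<open>Existence\<close>

text \<open>Since s > 3/2, the series converges absolutely at every time of the interval, so that a
  function with exactly these coefficients is available at each time and not only almost
  everywhere.\<close>

lemma regular_rser:
  assumes X: "bnd T R X" and herm: "\<And>t. t \<in> {0<..<T} \<Longrightarrow> hermitian (X t)"
  shows "regular T (\<lambda>t. rser (X t))" "t \<in> {0<..<T} \<Longrightarrow> fourier_coeff (rser (X t)) = X t"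
proof -
  have sm: "(\<lambda>k. norm (X t k)) summable_on UNIV" if "t \<in> {0<..<T}" for t
    by (rule hs_abs_summable0[OF bndD(1)[OF X that] s32])
  have L2: "rser (X t) \<in> L2_torus" if "t \<in> {0<..<T}" for t by (rule rser_L2[OF sm[OF that]])
  show co: "fourier_coeff (rser (X t)) = X t" if "t \<in> {0<..<T}" for t
    by (rule ext) (rule fourier_coeff_rser[OF sm[OF that] herm[OF that]])
  note I = integrable_hnorm_sq[OF bnd_measurable[OF X] bnd_hsum[OF X]]
  have hs_s: "AE t in TI T. hs s (X t)" using bndD(1)[OF X] by (intro AE_I2) auto
  have sm_s: "strongly_measurable {0<..<T} s (\<lambda>t. rser (X t))"
    by (rule strongly_measurableI[OF bnd_measurable[OF X] L2 co hs_s])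
  have sm_g: "strongly_measurable {0<..<T} (s + \<gamma>) (\<lambda>t. rser (X t))"
    by (rule strongly_measurableI[OF bnd_measurable[OF X] L2 co I(1)])
  have "AE t in TI T. sobolev_norm s (rser (X t)) \<le> R"
    using bndD(2)[OF X] by (intro AE_I2) (auto simp: sobolev_norm_eq co)
  moreover have "integrable (TI T) (\<lambda>t. (sobolev_norm (s + \<gamma>) (rser (X t)))\<^sup>2)"
    using I(2) by (rule Bochner_Integration.integrable_cong[THEN iffD1, rotated 2]) (auto simp: sobolev_norm_eq co)
  ultimately show "regular T (\<lambda>t. rser (X t))"
    unfolding regular_def Linf_sobolev_def L2_sobolev_def
    using sm_s sm_g L2 bndD(1)[OF X] by (auto simp: sobolev_iff co)
qed

text \<open>The fixed point equation is Duhamel's formula for each mode with forcing f - N(X,X);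
  \<open>duhamel_solves\<close> turns it into the integrated equation.\<close>

lemma fixed_point_resid:
  assumes X: "bnd T R X" and T: "0 < T"
    and fm: "\<And>k. integrable (TI T) (\<lambda>t. f t k)"
    and eq: "\<And>t k. t \<in> {0<..<T} \<Longrightarrow> X t k = Lin c f t k - Dop X X t k"
    and t: "t \<in> {0<..<T}"
  shows "resid c f X t k = 0"
proof -
  have tT: "0 < t" "t \<le> T" using t by auto
  define g where "g \<tau> = f \<tau> k + (- N (X \<tau>) (X \<tau>) k)" for \<tau>
  have iN: "integrable (TI T) (\<lambda>\<tau>. - N (X \<tau>) (X \<tau>) k)" using N_integrable[OF X X T] by simp
  have ig: "integrable (TI T) g" unfolding g_def using fm iN by (intro Bochner_Integration.integrable_add)
  have Xd: "X \<tau> k = exp (- (\<mu> k * \<tau>)) *\<^sub>R c k + duh (\<mu> k) g \<tau>" if "\<tau> \<in> {0<..<T}" for \<tau>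
  proof -
    have "duh (\<mu> k) g \<tau> = duh (\<mu> k) (\<lambda>\<tau>. f \<tau> k) \<tau> + duh (\<mu> k) (\<lambda>\<tau>. - N (X \<tau>) (X \<tau>) k) \<tau>"
      unfolding g_def[abs_def] using that by (intro duh_add[OF fm iN]) auto
    moreover have "duh (\<mu> k) (\<lambda>\<tau>. - N (X \<tau>) (X \<tau>) k) \<tau> = - Dop X X \<tau> k"
      by (simp add: Dop_def duh_def)
    ultimately show ?thesis using eq[OF that, of k] by (simp add: Lin_def)
  qed
  have "X t k = c k + (LINT \<tau>|TI t. g \<tau>) - \<mu> k *\<^sub>R (LINT \<tau>|TI t. exp (- (\<mu> k * \<tau>)) *\<^sub>R c k + duh (\<mu> k) g \<tau>)"
    using duhamel_solves[OF ig tT, of "\<mu> k" "c k"] Xd[OF t] by simp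
  also have "(LINT \<tau>|TI t. exp (- (\<mu> k * \<tau>)) *\<^sub>R c k + duh (\<mu> k) g \<tau>) = (LINT \<tau>|TI t. X \<tau> k)"
    using t by (intro Bochner_Integration.integral_cong refl) (auto simp: Xd)
  also have "(LINT \<tau>|TI t. g \<tau>) = (LINT \<tau>|TI t. f \<tau> k) - (LINT \<tau>|TI t. N (X \<tau>) (X \<tau>) k)"
    unfolding g_def using integrable_TI[OF fm tT(2)] integrable_TI[OF N_integrable[OF X X T] tT(2)] by simp
  finally show ?thesis
    unfolding resid_def by (simp add: scaleR_conv_of_real algebra_simps)
qed

theorem local_wellposedness:
  assumes \<Theta>0: "\<Theta>0 \<in> sobolev s" and S: "S \<in> Linf_sobolev {0<..} (s - \<gamma>)"
  shows "\<exists>T>0. \<exists>\<Theta>. mg_solution \<Omega> \<beta> \<eta> \<kappa> \<gamma> s \<Theta>0 S T \<Theta> \<and>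
           (\<forall>\<Psi>. mg_solution \<Omega> \<beta> \<eta> \<kappa> \<gamma> s \<Theta>0 S T \<Psi> \<longrightarrow>
              (\<forall>t\<in>{0<..<T}. AE x in torus. \<Psi> t x = \<Theta> t x))"
proof -
  define c where "c = fourier_coeff \<Theta>0"
  define f where "f t = fourier_coeff (S t)" for t
  have c: "hs s c" using \<Theta>0 by (simp add: c_def sobolev_iff)
  have fm: "(\<lambda>t. f t k) \<in> borel_measurable (TI T)" for k T unfolding f_def by (rule forcingD(1)[OF S])
  obtain CS where "AE t in TI 1. S t \<in> sobolev (s - \<gamma>) \<and> hnorm (s - \<gamma>) (f t) \<le> CS"
    using forcingD(2)[OF S, of 1] by (auto simp: f_def)
  then have fb: "AE t in TI 1. hs (s - \<gamma>) (f t) \<and> hnorm (s - \<gamma>) (f t) \<le> CS"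
    by eventually_elim (simp add: sobolev_iff f_def)
  obtain \<rho> where \<rho>: "\<And>T. 0 < T \<Longrightarrow> T \<le> 1 \<Longrightarrow> bnd T \<rho> (Lin c f)"
    using bnd_Lin[OF c fm fb] by blast
  have \<rho>0: "\<rho> \<ge> 0" using bnd_nonneg[OF \<rho>[of 1]] by simp
  \<comment> \<open>The summand 1 keeps \<open>q\<close> positive. With T^(\<epsilon>/2) = 1/q the
    smallness condition becomes (q - 1)/q \<le> 1, and q \<ge> 1 gives T \<le> 1.\<close>
  define q where "q = 8 * \<Gamma> * \<rho> + 1"
  have q: "q \<ge> 1" unfolding q_def using \<Gamma>_nonneg \<rho>0 by simp
  define T where "T = (1 / q) powr (2 / \<epsilon>)"
  have T0: "0 < T" unfolding T_def using q by simp
  have T1: "T \<le> 1" unfolding T_def using q \<epsilon>_pos by (intro powr_le1) auto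
  have "T powr (\<epsilon> / 2) = 1 / q"
    unfolding T_def using q \<epsilon>_pos by (simp add: powr_powr)
  then have "8 * (\<Gamma> * T powr (\<epsilon> / 2)) * \<rho> = (q - 1) / q"
    by (simp add: q_def mult_ac)
  also have "\<dots> \<le> 1" using q by simp
  finally have small: "8 * (\<Gamma> * T powr (\<epsilon> / 2)) * \<rho> \<le> 1" .
  have herm: "hermitian (Lin c f t)" for t
  proof -
    have "\<mu> (- k) = \<mu> k" for k by (simp add: \<mu>_def)
    moreover have "c (- k) = cnj (c k)" "f \<tau> (- k) = cnj (f \<tau> k)" for k \<tau>
      using hermitian_fourier_coeff unfolding c_def f_def hermitian_def by auto
    ultimately show ?thesis
      unfolding hermitian_def Lin_def by (simp add: duh_cnj scaleR_conv_of_real)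
  qed
  obtain X R where X: "bnd T R X" and fix_eq: "\<And>t k. t \<in> {0<..<T} \<Longrightarrow> X t k = Lin c f t k - Dop X X t k"
    and Xh: "\<And>t. t \<in> {0<..<T} \<Longrightarrow> hermitian (X t)"
    by (rule picard[OF \<rho>[OF T0 T1] T0 T1 small herm]) (rule that, assumption+)
  define \<Theta> where "\<Theta> t = rser (X t)" for t
  have reg: "regular T \<Theta>" unfolding \<Theta>_def[abs_def] by (rule regular_rser(1)[OF X Xh])
  have co: "fourier_coeff (\<Theta> t) = X t" if "t \<in> {0<..<T}" for t
    unfolding \<Theta>_def by (rule regular_rser(2)[OF X Xh that])
  have fi: "integrable (TI T) (\<lambda>t. f t k)" for k
    by (rule integrable_TI[OF L2_TI_integrable[OF fm forcing_L2(1)[OF fm fb]] T1])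
  have rX: "resid c f X t k = 0" if "t \<in> {0<..<T}" for t k
    by (rule fixed_point_resid[OF X T0 fi fix_eq that])
  have r\<Theta>: "resid c f (\<lambda>t. fourier_coeff (\<Theta> t)) t k = 0" if t: "t \<in> {0<..<T}" for t k
  proof -
    have "resid c f (\<lambda>t. fourier_coeff (\<Theta> t)) t k = resid c f X t k"
    proof -
      have "(LINT \<tau>|TI t. fourier_coeff (\<Theta> \<tau>) k) = (LINT \<tau>|TI t. X \<tau> k)"
        "(LINT \<tau>|TI t. N (fourier_coeff (\<Theta> \<tau>)) (fourier_coeff (\<Theta> \<tau>)) k) = (LINT \<tau>|TI t. N (X \<tau>) (X \<tau>) k)"
        using t by (auto intro!: Bochner_Integration.integral_cong simp: co)
      then show ?thesis unfolding resid_def using co[OF t] by simp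
    qed
    then show ?thesis using rX[OF t] by simp
  qed
  note iff = solution_iff_resid[OF \<Theta>0 S, folded c_def f_def]
  have sol: "mg_solution \<Omega> \<beta> \<eta> \<kappa> \<gamma> s \<Theta>0 S T \<Theta>"
    unfolding iff using reg r\<Theta> by blast
  have uniq: "AE x in torus. \<Psi> t x = \<Theta> t x" if \<Psi>: "mg_solution \<Omega> \<beta> \<eta> \<kappa> \<gamma> s \<Theta>0 S T \<Psi>" and t: "t \<in> {0<..<T}" for \<Psi> t
  proof -
    have reg\<Psi>: "regular T \<Psi>" and r\<Psi>: "\<And>t k. t \<in> {0<..<T} \<Longrightarrow> resid c f (\<lambda>t. fourier_coeff (\<Psi> t)) t k = 0"
      using \<Psi> unfolding iff by auto
    obtain R1 where R1: "R1 \<ge> 0" "AE t in TI T. hnorm s (fourier_coeff (\<Psi> t)) \<le> R1" using regularD(4)[OF reg\<Psi>] by blast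
    obtain R2 where R2: "R2 \<ge> 0" "AE t in TI T. hnorm s (fourier_coeff (\<Theta> t)) \<le> R2" using regularD(4)[OF reg] by blast
    have "fourier_coeff (\<Psi> t) k = fourier_coeff (\<Theta> t) k" for k
    proof (rule resid_unique[where R = "max R1 R2" and T = T and c = c and f = f])
      show "AE t in TI T. hnorm s (fourier_coeff (\<Psi> t)) \<le> max R1 R2" using R1(2) by eventually_elim simp
      show "AE t in TI T. hnorm s (fourier_coeff (\<Theta> t)) \<le> max R1 R2" using R2(2) by eventually_elim simp
    qed (use T0 t R1(1) regularD(1,3)[OF reg\<Psi>] regularD(1,3)[OF reg] r\<Psi> r\<Theta> in auto)
    then show ?thesis
      using regularD(2)[OF reg\<Psi> t] regularD(2)[OF reg t]
      by (intro AE_eq_of_fourier_coeff_eq L2_torus_integrable) (auto simp: sobolev_iff)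
  qed
  show ?thesis using T0 sol uniq by blast
qed

end

theorem theorem3p1:
  fixes \<Omega> \<beta> \<eta> \<kappa> \<gamma> s :: real
    and \<Theta>0 :: "real^3 \<Rightarrow> real"
    and S :: "real \<Rightarrow> real^3 \<Rightarrow> real"
  assumes "\<Omega> > 0" "\<beta> > 0" "\<eta> > 0" "\<kappa> > 0"
    and "1/2 < \<gamma>" "\<gamma> < 1"
    and "s > 5/2 + (1 - 2 * \<gamma>)"
    and "\<Theta>0 \<in> sobolev s"
    and "(LINT x|torus. \<Theta>0 x) = 0"
    and "S \<in> Linf_sobolev {0<..} (s - \<gamma>)"
    and "AE t in lebesgue_on {0<..}. (LINT x|torus. S t x) = 0"
  shows "\<exists>T>0. \<exists>\<Theta>. mg_solution \<Omega> \<beta> \<eta> \<kappa> \<gamma> s \<Theta>0 S T \<Theta> \<and>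
           (\<forall>\<Psi>. mg_solution \<Omega> \<beta> \<eta> \<kappa> \<gamma> s \<Theta>0 S T \<Psi> \<longrightarrow>
              (\<forall>t\<in>{0<..<T}. AE x in torus. \<Psi> t x = \<Theta> t x))"
proof -
  \<comment> \<open>\<open>m\<close> collects the lower bounds for \<open>r\<close>. It is below 2
    \<gamma> by 1/2 < \<gamma> and the hypothesis on \<open>s\<close>; the midpoint between
    \<open>m\<close> and 2 \<gamma> satisfies all bounds strictly.\<close>
  define m where "m = max 1 (7/2 - s)"
  define r where "r = (m + 2 * \<gamma>) / 2"
  have m: "m < 2 * \<gamma>" "1 \<le> m" "7/2 - s \<le> m" using assms(5,7) by (auto simp: m_def)
  have r: "1 \<le> r" "r < 2 * \<gamma>" "m < r" using m by (auto simp: r_def)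
  then have "s + r > 7/2" using m(3) by linarith
  note r = r(1,2) this
  interpret mg_params \<Omega> \<beta> \<eta> \<kappa> \<gamma> s r
    by unfold_locales (use assms r in auto)
  show ?thesis by (rule local_wellposedness) (use assms in auto)
qed

end
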